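(* Let $A$ be an associative, commutative ring with unit. For each positive integer $d$, there is a resolution (exact sequence) of graded FI-modules $$0\leftarrow\mathcal{I}_d\xleftarrow{\partial^d_0}\mathcal{F}^d_0\xleftarrow{\partial^d_1}\mathcal{F}^d_1\xleftarrow{\partial^d_2}\mathcal{F}^d_2\leftarrow\cdots\leftarrow\mathcal{F}^d_{i-1}\xleftarrow{\partial^d_i}\mathcal{F}^d_i\leftarrow\cdots$$ where the graded FI-modules $\mathcal{I}_d$, $\mathcal{F}^d_i$ and the morphisms $\partial^d_i$ are those defined in the context.
   Context: An FI-module (over $A$) is a functor from the category of finite sets and injections to $A$-modules; a graded FI-module is such a functor to graded $A$-modules; a morphism is a natural transformation; exactness is checked pointwise, i.e. on each finite set. It suffices to describe FI-modules on the sets $[n]=\{1,\ldots,n\}$, $n\geq0$, and injections $\varepsilon\colon[n]\to[m]$; $\mathcal{V}(n)$ denotes the value at $[n]$. $R_n=A[x_1,\ldots,x_n]$ has the standard grading, $\mathfrak{S}_n$ acts by permuting variables, and $I_{d,n}\subset R_n$ is the ideal generated by all squarefree monomials of degree $d$ (it is $0$ if $d>n$). An $R_n[\mathfrak{S}_n]$-module is an $R_n$-module with compatible $A$-linear $\mathfrak{S}_n$-action, $\sigma(pm)=\sigma(p)\sigma(m)$. A tableau of shape $\lambda$ with entries in $[n]$ is a filling of the Young diagram of $\lambda$ (English notation) with distinct elements of $[n]$. For $1\leq d\leq n$, $0\leq i\leq n-d$, $U^{d,n}_i:=\operatorname{Ind}^{\mathfrak{S}_n}_{\mathfrak{S}_{d+i}\times\mathfrak{S}_{n-d-i}}(S^{(d,1^i)}\otimes_A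 S^{(n-d-i)})$ ($S^\lambda$ the Specht module over $A$; $\mathfrak{S}_{d+i}\times\mathfrak{S}_{n-d-i}$ the subgroup preserving $\{1,\ldots,d+i\}$ and $\{d+i+1,\ldots,n\}$); otherwise $U^{d,n}_i:=0$. It is identified with the $A[\mathfrak{S}_n]$-module generated by classes $[T]$ of tableaux of shape $(d,1^i)$ with entries in $[n]$ (with $\sigma[T]=[\sigma T]$) modulo: (alternating columns) $[\sigma T]=\operatorname{sgn}(\sigma)[T]$ for every permutation $\sigma$ of the entries of $T$ preserving each column; (shuffling relations) $[T]=\sum[T']$, over all $T'$ obtained from $T$ by exchanging the top $k$ elements of the $(j+1)$-st column with $k$ elements in the $j$-th column, preserving the vertical order of each set of $k$ elements. (The same presentation with $n=m$ and shape any partition $\lambda$ of $m$ defines the Specht module $S^\lambda$.) Set $F^{d,n}_i:=U^{d,n}_i\otimes_A R_n(-d-i)$, and write $p[T]$ for $[T]\otimes p$. Maps $\partial^{d,n}_i$. For $1\leq i\leq n-d$ and a tableau $T$ of shape $(d,1^i)$ with first column $a_0,\ldots,a_i$ (top to bottom) and first row $a_0,b_1,\ldots,b_{d-1}$, let $T\setminus a_j$ be the tableau of shape $(d,1^{i-1})$ obtained by removing the box containing $a_j$ and sliding upward the boxes below it in the first column. Then $\partial^{d,n}_i\colon F^{d,n}_i\to F^{d,n}_{i-1}$ is the map of $R_n[\mathfrak{S}_n]$-modules with $\partial^{d,n}_i([T])=\sum_{j=0}^i(-1)^{i-j}x_{a_j}[T\setminus a_j]$. The map $\partial^{d,n}_0\colon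 F^{d,n}_0\to I_{d,n}$ is the $R_n$-linear map sending the class of the one-row tableau with entries $b_1,\ldots,b_d$ to $x_{b_1}\cdots x_{b_d}$. When the source is $0$ these maps are zero. FI-modules. $\mathcal{I}_d(n)=I_{d,n}$ and, for an injection $\varepsilon\colon[n]\to[m]$, $\mathcal{I}_d(\varepsilon)\colon I_{d,n}\to I_{d,m}$ is $p(x_1,\ldots,x_n)\mapsto p(x_{\varepsilon(1)},\ldots,x_{\varepsilon(n)})$. For $i\geq0$, $\mathcal{F}^d_i(n)=F^{d,n}_i$ and $\mathcal{F}^d_i(\varepsilon)\colon F^{d,n}_i\to F^{d,m}_i$ is $p(x_1,\ldots,x_n)[T]\mapsto p(x_{\varepsilon(1)},\ldots,x_{\varepsilon(n)})[\varepsilon(T)]$, where $\varepsilon(T)$ is obtained from $T$ by applying $\varepsilon$ to every entry. The morphisms $\partial^d_0\colon\mathcal{F}^d_0\to\mathcal{I}_d$ and $\partial^d_i\colon\mathcal{F}^d_i\to\mathcal{F}^d_{i-1}$ ($i\geq1$) are given on $[n]$ by $\partial^{d,n}_0$ and $\partial^{d,n}_i$. *)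

theory Defs
  imports "HOL-Algebra.Module" "HOL-Algebra.Ideal" "HOL-Combinatorics.Permutations"
begin

section \<open>Linear algebra over a commutative ring\<close>

text \<open>The record type of modules extends that of rings; where there is no product, the fields
  \<open>mult\<close> and \<open>one\<close> are left \<open>undefined\<close>.\<close>

definition delta :: "('a, 'r) ring_scheme \<Rightarrow> 'b \<Rightarrow> 'b \<Rightarrow> 'a" where
  "delta A b = (\<lambda>c. if c = b then \<one>\<^bsub>A\<^esub> else \<zero>\<^bsub>A\<^esub>)"

definition free_module :: "('a, 'r) ring_scheme \<Rightarrow> 'b set \<Rightarrow> ('a, 'b \<Rightarrow> 'a) module" where
  "free_module A B =
    \<lparr>carrier = {f. (\<forall>b. f b \<in> carrier A) \<and> finite {b. f b \<noteq> \<zero>\<^bsub>A\<^esub>} \<and> {b. f b \<noteq> \<zero>\<^bsub>A\<^esub>} \<subseteq> B},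
     monoid.mult = undefined, one = undefined,
     zero = (\<lambda>b. \<zero>\<^bsub>A\<^esub>), add = (\<lambda>f g b. f b \<oplus>\<^bsub>A\<^esub> g b),
     smult = (\<lambda>a f b. a \<otimes>\<^bsub>A\<^esub> f b)\<rparr>"

definition span_of ::
    "('a, 'r) ring_scheme \<Rightarrow> ('a, 'm, 's) module_scheme \<Rightarrow> 'm set \<Rightarrow> 'm set" where
  "span_of A M S = \<Inter>{N. submodule N A M \<and> S \<subseteq> N}"

text \<open>For a submodule \<open>N\<close>, a scalar multiple of a coset is not a full coset as a mere
  elementwise image, hence the summand \<open>N\<close> in \<open>smult\<close>.\<close>

definition quot_module :: "('a, 'm, 's) module_scheme \<Rightarrow> 'm set \<Rightarrow> ('a, 'm set) module" where
  "quot_module M N =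
    \<lparr>carrier = a_rcosets\<^bsub>M\<^esub> N, monoid.mult = undefined, one = undefined,
     zero = N, add = (\<lambda>X Y. X <+>\<^bsub>M\<^esub> Y),
     smult = (\<lambda>a X. N <+>\<^bsub>M\<^esub> ((\<lambda>x. a \<odot>\<^bsub>M\<^esub> x) ` X))\<rparr>"

definition lin_hom :: "('a, 'r) ring_scheme \<Rightarrow> ('a, 'm, 's) module_scheme \<Rightarrow>
    ('a, 'n, 't) module_scheme \<Rightarrow> ('m \<Rightarrow> 'n) set" where
  "lin_hom A M N = {f \<in> hom (add_monoid M) (add_monoid N).
     \<forall>a\<in>carrier A. \<forall>x\<in>carrier M. f (a \<odot>\<^bsub>M\<^esub> x) = a \<odot>\<^bsub>N\<^esub> f x}"

definition lin_comb :: "('a, 'r) ring_scheme \<Rightarrow> ('a, 'm, 's) module_scheme \<Rightarrow>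
    'b set \<Rightarrow> ('b \<Rightarrow> 'a) \<Rightarrow> ('b \<Rightarrow> 'm) \<Rightarrow> 'm" where
  "lin_comb A M B c e = (\<Oplus>\<^bsub>M\<^esub>b\<in>{b \<in> B. c b \<noteq> \<zero>\<^bsub>A\<^esub>}. c b \<odot>\<^bsub>M\<^esub> e b)"

text \<open>\<open>lin_ext A M N B e g\<close> is the \<open>A\<close>-linear map \<open>M \<rightarrow> N\<close> with \<open>e b \<mapsto> g b\<close> for \<open>b \<in> B\<close>, where
  the \<open>e b\<close> generate \<open>M\<close>. It is a total function whose value is meaningful only if that map
  is well defined; see \<open>lin_ext_eq\<close> below.\<close>

definition lin_ext :: "('a, 'r) ring_scheme \<Rightarrow> ('a, 'm, 's) module_scheme \<Rightarrow>
    ('a, 'n, 't) module_scheme \<Rightarrow> 'b set \<Rightarrow> ('b \<Rightarrow> 'm) \<Rightarrow> ('b \<Rightarrow> 'n) \<Rightarrow> 'm \<Rightarrow> 'n" where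
  "lin_ext A M N B e g m = (THE y. \<exists>c\<in>carrier (free_module A B).
     m = lin_comb A M B c e \<and> y = lin_comb A N B c g)"

lemma lin_hom_lin_comb:
  assumes M: "module A M" and N: "module A N" and f: "f \<in> lin_hom A M N"
    and e: "e \<in> B \<rightarrow> carrier M" and fe: "\<And>b. b \<in> B \<Longrightarrow> f (e b) = g b"
    and c: "c \<in> carrier (free_module A B)"
  shows "f (lin_comb A M B c e) = lin_comb A N B c g"
proof -
  interpret M: module A M by fact
  interpret N: module A N by fact
  have hom: "f \<in> hom (add_monoid M) (add_monoid N)"
    and sc: "\<And>a x. a \<in> carrier A \<Longrightarrow> x \<in> carrier M \<Longrightarrow> f (a \<odot>\<^bsub>M\<^esub> x) = a \<odot>\<^bsub>N\<^esub> f x"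
    using f by (auto simp: lin_hom_def)
  have fM: "f x \<in> carrier N" if "x \<in> carrier M" for x
    using hom that by (auto simp: hom_def)
  have fadd: "f (x \<oplus>\<^bsub>M\<^esub> y) = f x \<oplus>\<^bsub>N\<^esub> f y" if "x \<in> carrier M" "y \<in> carrier M" for x y
    using hom that by (auto simp: hom_def)
  have "f \<zero>\<^bsub>M\<^esub> \<oplus>\<^bsub>N\<^esub> f \<zero>\<^bsub>M\<^esub> = f \<zero>\<^bsub>M\<^esub>"
    using fadd[of "\<zero>\<^bsub>M\<^esub>" "\<zero>\<^bsub>M\<^esub>"] by simp
  then have f0: "f \<zero>\<^bsub>M\<^esub> = \<zero>\<^bsub>N\<^esub>"
    using fM[of "\<zero>\<^bsub>M\<^esub>"] N.add.l_cancel_one by simp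
  have cA: "\<And>b. c b \<in> carrier A"
    using c by (auto simp: free_module_def)
  have *: "f (\<Oplus>\<^bsub>M\<^esub>b\<in>S. c b \<odot>\<^bsub>M\<^esub> e b) = (\<Oplus>\<^bsub>N\<^esub>b\<in>S. c b \<odot>\<^bsub>N\<^esub> g b)"
    if "finite S" "S \<subseteq> B" for S
    using that
  proof (induction S rule: finite_induct)
    case empty
    show ?case by (simp add: f0)
  next
    case (insert b S)
    have eM: "\<And>x. x \<in> insert b S \<Longrightarrow> e x \<in> carrier M"
      using e insert.prems by auto
    have gN: "\<And>x. x \<in> insert b S \<Longrightarrow> g x \<in> carrier N"
      using fM[OF eM] fe insert.prems by (metis subsetD)
    have 1: "(\<lambda>b. c b \<odot>\<^bsub>M\<^esub> e b) \<in> S \<rightarrow> carrier M"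
      using eM cA by auto
    have 2: "(\<lambda>b. c b \<odot>\<^bsub>N\<^esub> g b) \<in> S \<rightarrow> carrier N"
      using gN cA by auto
    have 3: "(\<Oplus>\<^bsub>M\<^esub>b\<in>S. c b \<odot>\<^bsub>M\<^esub> e b) \<in> carrier M"
      using 1 by (rule M.finsum_closed)
    show ?case
      using insert 1 2 3 eM gN cA fe
      by (simp add: M.finsum_insert N.finsum_insert fadd sc)
  qed
  have "finite {b \<in> B. c b \<noteq> \<zero>\<^bsub>A\<^esub>}"
    using c by (auto simp: free_module_def elim: rev_finite_subset)
  then show ?thesis
    using * by (simp add: lin_comb_def)
qed

lemma lin_ext_eq:
  assumes "module A M" "module A N" "f \<in> lin_hom A M N" "e \<in> B \<rightarrow> carrier M"
    and "\<And>b. b \<in> B \<Longrightarrow> f (e b) = g b"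
    and m: "\<exists>c\<in>carrier (free_module A B). m = lin_comb A M B c e"
  shows "lin_ext A M N B e g m = f m"
  unfolding lin_ext_def using m lin_hom_lin_comb[OF assms(1-5)] by (intro the_equality) auto

definition tensor_rels ::
    "('a, 'r) ring_scheme \<Rightarrow> ('a, 'm, 's) module_scheme \<Rightarrow> ('a, 'n, 't) module_scheme \<Rightarrow>
      ('m \<times> 'n \<Rightarrow> 'a) set" where
  "tensor_rels A M N = (let P = free_module A (carrier M \<times> carrier N) in
      {delta A (x \<oplus>\<^bsub>M\<^esub> x', y) \<ominus>\<^bsub>P\<^esub> (delta A (x, y) \<oplus>\<^bsub>P\<^esub> delta A (x', y)) | x x' y.
          x \<in> carrier M \<and> x' \<in> carrier M \<and> y \<in> carrier N}
    \<union> {delta A (x, y \<oplus>\<^bsub>N\<^esub> y') \<ominus>\<^bsub>P\<^esub> (delta A (x, y) \<oplus>\<^bsub>P\<^esub> delta A (x, y')) | x y y'.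
          x \<in> carrier M \<and> y \<in> carrier N \<and> y' \<in> carrier N}
    \<union> {delta A (a \<odot>\<^bsub>M\<^esub> x, y) \<ominus>\<^bsub>P\<^esub> a \<odot>\<^bsub>P\<^esub> delta A (x, y) | a x y.
          a \<in> carrier A \<and> x \<in> carrier M \<and> y \<in> carrier N}
    \<union> {delta A (x, a \<odot>\<^bsub>N\<^esub> y) \<ominus>\<^bsub>P\<^esub> a \<odot>\<^bsub>P\<^esub> delta A (x, y) | a x y.
          a \<in> carrier A \<and> x \<in> carrier M \<and> y \<in> carrier N})"

definition tensor ::
    "('a, 'r) ring_scheme \<Rightarrow> ('a, 'm, 's) module_scheme \<Rightarrow> ('a, 'n, 't) module_scheme \<Rightarrow>
      ('a, ('m \<times> 'n \<Rightarrow> 'a) set) module" where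
  "tensor A M N = (let P = free_module A (carrier M \<times> carrier N)
     in quot_module P (span_of A P (tensor_rels A M N)))"

definition pure_tensor ::
    "('a, 'r) ring_scheme \<Rightarrow> ('a, 'm, 's) module_scheme \<Rightarrow> ('a, 'n, 't) module_scheme \<Rightarrow>
      'm \<Rightarrow> 'n \<Rightarrow> ('m \<times> 'n \<Rightarrow> 'a) set" where
  "pure_tensor A M N x y = (let P = free_module A (carrier M \<times> carrier N)
     in span_of A P (tensor_rels A M N) +>\<^bsub>P\<^esub> delta A (x, y))"


section \<open>Graded FI-modules\<close>

definition graded_module ::
    "('a, 'r) ring_scheme \<Rightarrow> ('a, 'm, 's) module_scheme \<Rightarrow> (int \<Rightarrow> 'm set) \<Rightarrow> bool" where
  "graded_module A M G \<longleftrightarrow> module A M \<and> (\<forall>k. submodule (G k) A M) \<and>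
     (\<forall>x\<in>carrier M. \<exists>!c. (\<forall>k. c k \<in> G k) \<and> finite {k. c k \<noteq> \<zero>\<^bsub>M\<^esub>} \<and>
        x = (\<Oplus>\<^bsub>M\<^esub>k\<in>{k. c k \<noteq> \<zero>\<^bsub>M\<^esub>}. c k))"

definition graded_hom ::
    "('a, 'r) ring_scheme \<Rightarrow> ('a, 'm, 's) module_scheme \<Rightarrow> (int \<Rightarrow> 'm set) \<Rightarrow>
      ('a, 'n, 't) module_scheme \<Rightarrow> (int \<Rightarrow> 'n set) \<Rightarrow> ('m \<Rightarrow> 'n) \<Rightarrow> bool" where
  "graded_hom A M G N H f \<longleftrightarrow> f \<in> lin_hom A M N \<and> (\<forall>k. f ` G k \<subseteq> H k)"

text \<open>Injections \<open>[m] \<rightarrow> [n]\<close>, where \<open>[n] = {1..n}\<close>.\<close>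

definition FI_inj :: "nat \<Rightarrow> nat \<Rightarrow> (nat \<Rightarrow> nat) set" where
  "FI_inj m n = {\<epsilon> \<in> {1..m} \<rightarrow>\<^sub>E {1..n}. inj_on \<epsilon> {1..m}}"

text \<open>The data of a graded FI-module on the sets \<open>[n]\<close>: the module at \<open>[n]\<close>, its graded pieces,
  and the map \<open>fi_map V m n \<epsilon>\<close> induced by an injection \<open>\<epsilon> : [m] \<rightarrow> [n]\<close>.\<close>

record ('a, 'm) fi_data =
  fi_obj :: "nat \<Rightarrow> ('a, 'm) module"
  fi_gr :: "nat \<Rightarrow> int \<Rightarrow> 'm set"
  fi_map :: "nat \<Rightarrow> nat \<Rightarrow> (nat \<Rightarrow> nat) \<Rightarrow> 'm \<Rightarrow> 'm"

definition graded_FI_module :: "('a, 'r) ring_scheme \<Rightarrow> ('a, 'm) fi_data \<Rightarrow> bool" where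
  "graded_FI_module A V \<longleftrightarrow>
     (\<forall>n. graded_module A (fi_obj V n) (fi_gr V n)) \<and>
     (\<forall>m n. \<forall>\<epsilon>\<in>FI_inj m n.
        graded_hom A (fi_obj V m) (fi_gr V m) (fi_obj V n) (fi_gr V n) (fi_map V m n \<epsilon>)) \<and>
     (\<forall>n. \<forall>x\<in>carrier (fi_obj V n). fi_map V n n (restrict id {1..n}) x = x) \<and>
     (\<forall>l m n. \<forall>\<epsilon>\<in>FI_inj l m. \<forall>\<eta>\<in>FI_inj m n. \<forall>x\<in>carrier (fi_obj V l).
        fi_map V l n (compose {1..l} \<eta> \<epsilon>) x = fi_map V m n \<eta> (fi_map V l m \<epsilon> x))"

definition graded_FI_hom ::
    "('a, 'r) ring_scheme \<Rightarrow> ('a, 'm) fi_data \<Rightarrow> ('a, 'n) fi_data \<Rightarrow> (nat \<Rightarrow> 'm \<Rightarrow> 'n) \<Rightarrow> bool" where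
  "graded_FI_hom A V W f \<longleftrightarrow>
     (\<forall>n. graded_hom A (fi_obj V n) (fi_gr V n) (fi_obj W n) (fi_gr W n) (f n)) \<and>
     (\<forall>m n. \<forall>\<epsilon>\<in>FI_inj m n. \<forall>x\<in>carrier (fi_obj V m).
        f n (fi_map V m n \<epsilon> x) = fi_map W m n \<epsilon> (f m x))"


section \<open>Polynomial rings and the ideals of squarefree monomials\<close>

text \<open>A monomial is the multiset of its variables, and a polynomial is its coefficient function
  (as in \<open>HOL-Algebra.Indexed_Polynomials\<close>). The variable \<open>x\<^sub>j\<close> is the monomial \<open>{#j#}\<close>.\<close>

type_synonym 'a mpol = "nat multiset \<Rightarrow> 'a"

definition mpol_ring :: "('a, 'r) ring_scheme \<Rightarrow> nat \<Rightarrow> ('a, 'a mpol) module" where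
  "mpol_ring A n = (free_module A {u. set_mset u \<subseteq> {1..n}})
     \<lparr>monoid.mult := (\<lambda>p q u. \<Oplus>\<^bsub>A\<^esub>v\<in>{v. v \<subseteq># u}. p v \<otimes>\<^bsub>A\<^esub> q (u - v)), one := delta A {#}\<rparr>"

definition mpol_gr :: "('a, 'r) ring_scheme \<Rightarrow> nat \<Rightarrow> int \<Rightarrow> 'a mpol set" where
  "mpol_gr A n k = {p \<in> carrier (mpol_ring A n). \<forall>u. p u \<noteq> \<zero>\<^bsub>A\<^esub> \<longrightarrow> int (size u) = k}"

text \<open>The substitution \<open>x\<^sub>j \<mapsto> x\<^bsub>\<epsilon> j\<^esub>\<close>.\<close>

definition mpol_map :: "('a, 'r) ring_scheme \<Rightarrow> (nat \<Rightarrow> nat) \<Rightarrow> 'a mpol \<Rightarrow> 'a mpol" where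
  "mpol_map A \<epsilon> p = (\<lambda>u. \<Oplus>\<^bsub>A\<^esub>v\<in>{v. p v \<noteq> \<zero>\<^bsub>A\<^esub> \<and> image_mset \<epsilon> v = u}. p v)"

definition sqfree_ideal :: "('a, 'r) ring_scheme \<Rightarrow> nat \<Rightarrow> nat \<Rightarrow> 'a mpol set" where
  "sqfree_ideal A d n =
     Idl\<^bsub>mpol_ring A n\<^esub> {delta A (mset_set S) | S. S \<subseteq> {1..n} \<and> card S = d}"

definition I_FI :: "('a, 'r) ring_scheme \<Rightarrow> nat \<Rightarrow> ('a, 'a mpol) fi_data" where
  "I_FI A d =
    \<lparr>fi_obj = (\<lambda>n. (mpol_ring A n)\<lparr>carrier := sqfree_ideal A d n\<rparr>),
     fi_gr = (\<lambda>n k. sqfree_ideal A d n \<inter> mpol_gr A n k),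
     fi_map = (\<lambda>m n \<epsilon>. mpol_map A \<epsilon>)\<rparr>"


section \<open>Tableaux and the modules they generate\<close>

text \<open>A tableau is the list of its columns, each read from top to bottom; a shape is given by
  the list of its column lengths.\<close>

type_synonym tableau = "nat list list"

definition tableaux :: "nat list \<Rightarrow> nat \<Rightarrow> tableau set" where
  "tableaux cs n = {T. map length T = cs \<and> distinct (concat T) \<and> set (concat T) \<subseteq> {1..n}}"

text \<open>\<open>exchange T j S\<close> exchanges the top \<open>card S\<close> elements of column \<open>j + 1\<close> of \<open>T\<close> with the
  elements at the positions \<open>S\<close> of column \<open>j\<close>, both in their vertical order
  (columns and positions are counted from \<open>0\<close>).\<close>

definition exchange :: "tableau \<Rightarrow> nat \<Rightarrow> nat set \<Rightarrow> tableau" where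
  "exchange T j S = T
     [j := map (\<lambda>p. if p \<in> S then T ! Suc j ! card {q \<in> S. q < p} else T ! j ! p)
             [0..<length (T ! j)],
      Suc j := map (\<lambda>l. if l < card S then T ! j ! (sorted_list_of_set S ! l) else T ! Suc j ! l)
             [0..<length (T ! Suc j)]]"

definition tableau_rels :: "('a, 'r) ring_scheme \<Rightarrow> nat list \<Rightarrow> nat \<Rightarrow> (tableau \<Rightarrow> 'a) set" where
  "tableau_rels A cs n = (let P = free_module A (tableaux cs n) in
      {delta A (map (map \<sigma>) T) \<ominus>\<^bsub>P\<^esub> [sign \<sigma>] \<cdot>\<^bsub>P\<^esub> delta A T | \<sigma> T.
          T \<in> tableaux cs n \<and> \<sigma> permutes set (concat T) \<and> (\<forall>c\<in>set T. \<sigma> ` set c = set c)}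
    \<union> {delta A T \<ominus>\<^bsub>P\<^esub>
          (\<Oplus>\<^bsub>P\<^esub>S\<in>{S. S \<subseteq> {..<length (T ! j)} \<and> card S = k}. delta A (exchange T j S)) | T j k.
          T \<in> tableaux cs n \<and> Suc j < length T \<and> 1 \<le> k \<and> k \<le> length (T ! Suc j)})"

text \<open>The set of relations is stable under the symmetric group, so its \<open>A\<close>-span is the
  \<open>A[\<SS>\<^sub>n]\<close>-submodule it generates.\<close>

definition tableau_module ::
    "('a, 'r) ring_scheme \<Rightarrow> nat list \<Rightarrow> nat \<Rightarrow> ('a, (tableau \<Rightarrow> 'a) set) module" where
  "tableau_module A cs n = (let P = free_module A (tableaux cs n)
     in quot_module P (span_of A P (tableau_rels A cs n)))"

definition tableau_class ::
    "('a, 'r) ring_scheme \<Rightarrow> nat list \<Rightarrow> nat \<Rightarrow> tableau \<Rightarrow> (tableau \<Rightarrow> 'a) set" where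
  "tableau_class A cs n T = (let P = free_module A (tableaux cs n)
     in span_of A P (tableau_rels A cs n) +>\<^bsub>P\<^esub> delta A T)"

text \<open>The hook \<open>(d, 1\<^sup>i)\<close>, for \<open>d \<ge> 1\<close>: a first column of length \<open>i + 1\<close>, then \<open>d - 1\<close> columns of
  length \<open>1\<close>. The module \<open>U_mod A d i n\<close> is the usual presentation by tableaux of the induced module
  \<open>Ind (S\<^bsup>(d,1^i)\<^esup> \<otimes> S\<^bsup>(n-d-i)\<^esup>)\<close> from \<open>\<SS>\<^bsub>d+i\<^esub> \<times> \<SS>\<^bsub>n-d-i\<^esub>\<close>. For \<open>i > n - d\<close> there are no such tableaux with entries in \<open>[n]\<close>, so
  \<open>U_mod A d i n\<close> is then the zero module.\<close>

definition hook :: "nat \<Rightarrow> nat \<Rightarrow> nat list" where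
  "hook d i = Suc i # replicate (d - 1) 1"

definition U_mod :: "('a, 'r) ring_scheme \<Rightarrow> nat \<Rightarrow> nat \<Rightarrow> nat \<Rightarrow> ('a, (tableau \<Rightarrow> 'a) set) module" where
  "U_mod A d i n = tableau_module A (hook d i) n"


section \<open>The complex\<close>

type_synonym 'a F_elem = "((tableau \<Rightarrow> 'a) set \<times> 'a mpol \<Rightarrow> 'a) set"

definition F_mod :: "('a, 'r) ring_scheme \<Rightarrow> nat \<Rightarrow> nat \<Rightarrow> nat \<Rightarrow> ('a, 'a F_elem) module" where
  "F_mod A d i n = tensor A (U_mod A d i n) (mpol_ring A n)"

text \<open>\<open>F_gen A d i n p T\<close> is \<open>p[T] = [T] \<otimes> p\<close>.\<close>

definition F_gen :: "('a, 'r) ring_scheme \<Rightarrow> nat \<Rightarrow> nat \<Rightarrow> nat \<Rightarrow> 'a mpol \<Rightarrow> tableau \<Rightarrow> 'a F_elem" where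
  "F_gen A d i n p T =
     pure_tensor A (U_mod A d i n) (mpol_ring A n) (tableau_class A (hook d i) n T) p"

text \<open>The grading of \<open>U \<otimes>\<^sub>A R\<^sub>n(-d-i)\<close>, where \<open>R\<^sub>n(-d-i)\<^sub>k = (R\<^sub>n)\<^bsub>k-d-i\<^esub>\<close> and \<open>U\<close> sits in
  degree \<open>0\<close>.\<close>

definition F_gr :: "('a, 'r) ring_scheme \<Rightarrow> nat \<Rightarrow> nat \<Rightarrow> nat \<Rightarrow> int \<Rightarrow> 'a F_elem set" where
  "F_gr A d i n k = span_of A (F_mod A d i n)
     {pure_tensor A (U_mod A d i n) (mpol_ring A n) u p | u p.
        u \<in> carrier (U_mod A d i n) \<and> p \<in> mpol_gr A n (k - int d - int i)}"

text \<open>\<open>F_mod A d i n\<close> as a module over \<open>R\<^sub>n\<close>, with \<open>q(u \<otimes> p) = u \<otimes> qp\<close>.\<close>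

definition F_mod_R :: "('a, 'r) ring_scheme \<Rightarrow> nat \<Rightarrow> nat \<Rightarrow> nat \<Rightarrow> ('a mpol, 'a F_elem) module" where
  "F_mod_R A d i n = (let F = F_mod A d i n; U = U_mod A d i n; R = mpol_ring A n in
    \<lparr>carrier = carrier F, monoid.mult = undefined, one = undefined, zero = \<zero>\<^bsub>F\<^esub>, add = add F,
     smult = (\<lambda>q. lin_ext A F F (carrier U \<times> carrier R)
        (\<lambda>(u, p). pure_tensor A U R u p) (\<lambda>(u, p). pure_tensor A U R u (q \<otimes>\<^bsub>R\<^esub> p)))\<rparr>)"

text \<open>\<open>I\<^bsub>d,n\<^esub>\<close> as a module over \<open>R\<^sub>n\<close>.\<close>

definition I_mod_R :: "('a, 'r) ring_scheme \<Rightarrow> nat \<Rightarrow> nat \<Rightarrow> ('a mpol, 'a mpol) module" where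
  "I_mod_R A d n = (let R = mpol_ring A n in
    \<lparr>carrier = sqfree_ideal A d n, monoid.mult = monoid.mult R, one = one R, zero = \<zero>\<^bsub>R\<^esub>, add = add R,
     smult = monoid.mult R\<rparr>)"

definition F_FI :: "('a, 'r) ring_scheme \<Rightarrow> nat \<Rightarrow> nat \<Rightarrow> ('a, 'a F_elem) fi_data" where
  "F_FI A d i =
    \<lparr>fi_obj = F_mod A d i,
     fi_gr = F_gr A d i,
     fi_map = (\<lambda>m n \<epsilon>. lin_ext A (F_mod A d i m) (F_mod A d i n)
        (tableaux (hook d i) m \<times> carrier (mpol_ring A m))
        (\<lambda>(T, p). F_gen A d i m p T)
        (\<lambda>(T, p). F_gen A d i n (mpol_map A \<epsilon> p) (map (map \<epsilon>) T)))\<rparr>"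

text \<open>For \<open>i = 0\<close> all columns have length \<open>1\<close>, so \<open>concat T\<close> lists the row of \<open>T\<close>.\<close>

definition diff0 :: "('a, 'r) ring_scheme \<Rightarrow> nat \<Rightarrow> nat \<Rightarrow> 'a F_elem \<Rightarrow> 'a mpol" where
  "diff0 A d n = lin_ext (mpol_ring A n) (F_mod_R A d 0 n) (I_mod_R A d n) (tableaux (hook d 0) n)
     (F_gen A d 0 n \<one>\<^bsub>mpol_ring A n\<^esub>) (\<lambda>T. delta A (mset (concat T)))"

definition remove_box :: "tableau \<Rightarrow> nat \<Rightarrow> tableau" where
  "remove_box T j = (take j (hd T) @ drop (Suc j) (hd T)) # tl T"

text \<open>Only used for \<open>i \<ge> 1\<close>.\<close>

definition diff :: "('a, 'r) ring_scheme \<Rightarrow> nat \<Rightarrow> nat \<Rightarrow> nat \<Rightarrow> 'a F_elem \<Rightarrow> 'a F_elem" where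
  "diff A d i n =
     lin_ext (mpol_ring A n) (F_mod_R A d i n) (F_mod_R A d (i - 1) n) (tableaux (hook d i) n)
     (F_gen A d i n \<one>\<^bsub>mpol_ring A n\<^esub>)
     (\<lambda>T. \<Oplus>\<^bsub>F_mod A d (i - 1) n\<^esub>j\<in>{0..i}. [((- 1 :: int) ^ (i - j))] \<cdot>\<^bsub>F_mod A d (i - 1) n\<^esub>
        F_gen A d (i - 1) n (delta A {#hd T ! j#}) (remove_box T j))"

end

theory Submission
  imports Defs
begin

text \<open>Take the free module on triples \<open>(B, C, r)\<close> of disjoint \<open>B, C \<subseteq> [n]\<close> and a monomial \<open>r\<close>, with two
  anticommuting Koszul differentials: one moves elements of the exterior part \<open>B\<close> to the row \<open>C\<close>, the other
  multiplies them into \<open>r\<close>. Sending \<open>[T] \<otimes> m\<close> to the row differential of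
  \<open>(first column, rest of first row, m)\<close> identifies \<open>F\<^sub>i\<close> with the kernel of the row differential on the
  triples with \<open>|B| = i\<close>, \<open>|C| = d\<close>, and \<open>\<partial>\<^sub>i\<close> with the monomial differential up to sign. Both
  differentials are contracted by moving the least available element into \<open>B\<close>: the row differential for \<open>C \<noteq> \<emptyset>\<close>,
  the monomial differential on the triples with \<open>supp r \<union> B \<not>\<subseteq> C\<close>. Exactness then follows by descending
  induction on \<open>|C|\<close>: a monomial primitive \<open>y\<close> of a cycle has a row differential with \<open>|C|\<close> one larger,
  which by induction has a monomial primitive killed by the row differential, hence of the form \<open>K z\<close>
  with \<open>K\<close> the row differential, and adding the monomial differential of \<open>z\<close> to \<open>y\<close> makes \<open>K y\<close> vanish.\<close>

section \<open>Linear maps, submodules and spans\<close>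

text \<open>The identification is possible because the shuffle between the first two columns says
  that the squared row differential vanishes on a wedge with one extra factor. Both contractions
  select one element instead of averaging over all of them, so no integer is inverted and every
  coefficient ring is covered. For a fixed row \<open>C\<close> the monomial differential is the
  Koszul complex on the variables outside \<open>C\<close>; its homology sits in exterior degree 0
  and is spanned by the monomials supported in \<open>C\<close>. This obstruction is met at the end
  of the resolution: among rows of one size such a monomial is determined by its product with the
  row, so a vanishing augmentation kills its coefficient. The contraction of the monomial
  differential need not preserve the kernel of the row differential, and this is why rows with more
  than \<open>d\<close> elements enter. The embedding also settles a formal point:
  \<open>diff\<close> and \<open>diff0\<close> are prescribed by values on generators of a quotient,
  and transporting maps of the free module on triples yields linear maps with those values, so the
  prescriptions are consistent.\<close>

lemma (in abelian_group) minus_eq_zero_iff: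
  assumes "x \<in> carrier G" "y \<in> carrier G"
  shows "x \<ominus> y = \<zero> \<longleftrightarrow> x = y"
  using assms by (metis a_minus_def add.inv_equality add.r_inv add.inv_closed minus_minus)

text \<open>Bundles a linear map with the module axioms at both ends, so that one interpretation
  makes its compatibility with sums, negatives and integer multiples available.\<close>

locale lin_map = M: module A M + N: module A N
  for A :: "('a, 'r) ring_scheme" and M :: "('a, 'm, 's) module_scheme"
    and N :: "('a, 'n, 't) module_scheme" +
  fixes f :: "'m \<Rightarrow> 'n"
  assumes lin_hom: "f \<in> lin_hom A M N"
begin

lemma map_closed [simp]: "x \<in> carrier M \<Longrightarrow> f x \<in> carrier N"
  using lin_hom by (auto simp: lin_hom_def hom_def)

lemma map_add: "x \<in> carrier M \<Longrightarrow> y \<in> carrier M \<Longrightarrow> f (x \<oplus>\<^bsub>M\<^esub> y) = f x \<oplus>\<^bsub>N\<^esub> f y"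
  using lin_hom by (auto simp: lin_hom_def hom_def)

lemma map_smult: "a \<in> carrier A \<Longrightarrow> x \<in> carrier M \<Longrightarrow> f (a \<odot>\<^bsub>M\<^esub> x) = a \<odot>\<^bsub>N\<^esub> f x"
  using lin_hom by (auto simp: lin_hom_def)

lemma group_hom: "group_hom (add_monoid M) (add_monoid N) f"
  using lin_hom by (intro group_hom.intro group_hom_axioms.intro M.a_group N.a_group)
    (auto simp: lin_hom_def)

lemma map_zero: "f \<zero>\<^bsub>M\<^esub> = \<zero>\<^bsub>N\<^esub>"
  using group_hom.hom_one[OF group_hom] by simp

lemma map_a_inv: "x \<in> carrier M \<Longrightarrow> f (\<ominus>\<^bsub>M\<^esub> x) = \<ominus>\<^bsub>N\<^esub> f x"
  using group_hom.hom_inv[OF group_hom] by (simp add: a_inv_def)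

lemma map_minus: "x \<in> carrier M \<Longrightarrow> y \<in> carrier M \<Longrightarrow> f (x \<ominus>\<^bsub>M\<^esub> y) = f x \<ominus>\<^bsub>N\<^esub> f y"
  by (simp add: a_minus_def map_add map_a_inv)

lemma map_int_pow: "x \<in> carrier M \<Longrightarrow> f ([(k::int)] \<cdot>\<^bsub>M\<^esub> x) = [k] \<cdot>\<^bsub>N\<^esub> f x"
  using group_hom.hom_int_pow[OF group_hom] by (simp add: add_pow_def)

lemma map_finsum:
  "F \<in> S \<rightarrow> carrier M \<Longrightarrow> f (\<Oplus>\<^bsub>M\<^esub>s\<in>S. F s) = (\<Oplus>\<^bsub>N\<^esub>s\<in>S. f (F s))"
  by (induction S rule: infinite_finite_induct)
    (auto simp: map_zero map_add M.finsum_infinite N.finsum_infinite M.finsum_insert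
      N.finsum_insert M.finsum_closed Pi_def)

end

lemma lin_mapI:
  assumes "module A M" "module A N" "f \<in> lin_hom A M N"
  shows "lin_map A M N f"
  using assms by (simp add: lin_map_def lin_map_axioms_def)

lemma lin_homI:
  assumes "\<And>x. x \<in> carrier M \<Longrightarrow> f x \<in> carrier N"
    and "\<And>x y. x \<in> carrier M \<Longrightarrow> y \<in> carrier M \<Longrightarrow> f (x \<oplus>\<^bsub>M\<^esub> y) = f x \<oplus>\<^bsub>N\<^esub> f y"
    and "\<And>a x. a \<in> carrier A \<Longrightarrow> x \<in> carrier M \<Longrightarrow> f (a \<odot>\<^bsub>M\<^esub> x) = a \<odot>\<^bsub>N\<^esub> f x"
  shows "f \<in> lin_hom A M N"
  using assms by (auto simp: lin_hom_def hom_def)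

lemma lin_hom_closed: "f \<in> lin_hom A M N \<Longrightarrow> x \<in> carrier M \<Longrightarrow> f x \<in> carrier N"
  by (auto simp: lin_hom_def hom_def)

lemma lin_hom_add: "f \<in> lin_hom A M N \<Longrightarrow> x \<in> carrier M \<Longrightarrow> y \<in> carrier M \<Longrightarrow>
    f (x \<oplus>\<^bsub>M\<^esub> y) = f x \<oplus>\<^bsub>N\<^esub> f y"
  by (auto simp: lin_hom_def hom_def)

lemma lin_hom_smult: "f \<in> lin_hom A M N \<Longrightarrow> a \<in> carrier A \<Longrightarrow> x \<in> carrier M \<Longrightarrow>
    f (a \<odot>\<^bsub>M\<^esub> x) = a \<odot>\<^bsub>N\<^esub> f x"
  by (auto simp: lin_hom_def)

lemma lin_hom_comp:
  "f \<in> lin_hom A M N \<Longrightarrow> g \<in> lin_hom A N Q \<Longrightarrow> (\<lambda>x. g (f x)) \<in> lin_hom A M Q"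
  by (rule lin_homI) (simp_all add: lin_hom_closed lin_hom_add lin_hom_smult)

lemma lin_hom_cong:
  "f \<in> lin_hom A M N \<Longrightarrow> (\<And>x. x \<in> carrier M \<Longrightarrow> f x = g x) \<Longrightarrow> module A M \<Longrightarrow> g \<in> lin_hom A M N"
proof -
  assume f: "f \<in> lin_hom A M N" and eq: "\<And>x. x \<in> carrier M \<Longrightarrow> f x = g x" and "module A M"
  then interpret M: module A M by simp
  show ?thesis
    by (rule lin_homI) (simp_all add: eq[symmetric] lin_hom_closed[OF f] lin_hom_add[OF f] lin_hom_smult[OF f])
qed

lemma lin_hom_plus:
  assumes "module A N" "f \<in> lin_hom A M N" "g \<in> lin_hom A M N"
  shows "(\<lambda>x. f x \<oplus>\<^bsub>N\<^esub> g x) \<in> lin_hom A M N"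
proof -
  interpret N: module A N by fact
  show ?thesis
    by (rule lin_homI)
      (simp_all add: lin_hom_add[OF assms(2)] lin_hom_add[OF assms(3)] lin_hom_smult[OF assms(2)]
        lin_hom_smult[OF assms(3)] N.smult_r_distr N.a_ac lin_hom_closed[OF assms(2)]
        lin_hom_closed[OF assms(3)])
qed

lemma lin_hom_int_pow:
  assumes "module A N" "f \<in> lin_hom A M N"
  shows "(\<lambda>x. [(k::int)] \<cdot>\<^bsub>N\<^esub> f x) \<in> lin_hom A M N"
proof -
  interpret N: module A N by fact
  have "a \<odot>\<^bsub>N\<^esub> ([k] \<cdot>\<^bsub>N\<^esub> y) = [k] \<cdot>\<^bsub>N\<^esub> (a \<odot>\<^bsub>N\<^esub> y)" if "a \<in> carrier A" "y \<in> carrier N" for a y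
    using that
    by (intro lin_map.map_int_pow[of A N N] lin_mapI assms(1) lin_homI)
      (simp_all add: N.smult_r_distr N.smult_assoc1[symmetric] N.R.m_comm)
  then show ?thesis
    by (intro lin_homI)
      (simp_all add: lin_hom_add[OF assms(2)] lin_hom_smult[OF assms(2)] lin_hom_closed[OF assms(2)]
       N.add.int_pow_distrib)
qed



lemma (in module) zero_lin_hom: "(\<lambda>x. \<zero>\<^bsub>M\<^esub>) \<in> lin_hom R N M"
  by (rule lin_homI) simp_all

lemma (in module) id_lin_hom: "(\<lambda>x. x) \<in> lin_hom R M M"
  by (rule lin_homI) simp_all

section \<open>Submodules, their images and preimages\<close>

lemma submodule_module: "module A M \<Longrightarrow> submodule H A M \<Longrightarrow> module A (M\<lparr>carrier := H\<rparr>)"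
  by (rule submodule.submodule_is_module)

lemma submodule_subset: "submodule H A M \<Longrightarrow> H \<subseteq> carrier M"
  using subgroup.subset[of H "add_monoid M"] by (auto simp: submodule_def)

lemma submodule_zero: "submodule H A M \<Longrightarrow> \<zero>\<^bsub>M\<^esub> \<in> H"
  using subgroup.one_closed[of H "add_monoid M"] by (auto simp: submodule_def)

lemma submodule_add: "submodule H A M \<Longrightarrow> x \<in> H \<Longrightarrow> y \<in> H \<Longrightarrow> x \<oplus>\<^bsub>M\<^esub> y \<in> H"
  using subgroup.m_closed[of H "add_monoid M"] by (auto simp: submodule_def)

lemma submodule_a_inv: "submodule H A M \<Longrightarrow> x \<in> H \<Longrightarrow> \<ominus>\<^bsub>M\<^esub> x \<in> H"
  using subgroup.m_inv_closed[of H "add_monoid M"] by (auto simp: submodule_def a_inv_def)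

lemma submodule_smult: "submodule H A M \<Longrightarrow> a \<in> carrier A \<Longrightarrow> x \<in> H \<Longrightarrow> a \<odot>\<^bsub>M\<^esub> x \<in> H"
  by (rule submodule.smult_closed)

lemma submodule_finsum:
  assumes "module A M" "submodule H A M" "F \<in> S \<rightarrow> H"
  shows "(\<Oplus>\<^bsub>M\<^esub>s\<in>S. F s) \<in> H"
proof -
  interpret M: module A M by fact
  note sub = submodule_subset[OF assms(2)]
  show ?thesis using assms(3)
  proof (induction S rule: infinite_finite_induct)
    case (insert s S)
    then show ?case using sub assms(2)
      by (subst M.finsum_insert) (auto intro: submodule_add)
  qed (use assms(2) in \<open>auto simp: M.finsum_infinite submodule_zero\<close>)
qed

lemma submodule_int_pow:
  assumes "module A M" "submodule H A M" "x \<in> H"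
  shows "[(k::int)] \<cdot>\<^bsub>M\<^esub> x \<in> H"
proof -
  interpret M: module A M by fact
  have x: "x \<in> carrier M" using assms submodule_subset by blast
  have *: "[int m] \<cdot>\<^bsub>M\<^esub> x \<in> H" for m
  proof (induction m)
    case 0
    then show ?case using submodule_zero[OF assms(2)] by (simp add: add_pow_def)
  next
    case (Suc m)
    have "[int (Suc m)] \<cdot>\<^bsub>M\<^esub> x = [int m] \<cdot>\<^bsub>M\<^esub> x \<oplus>\<^bsub>M\<^esub> x"
      using M.add.int_pow_mult[OF x, of "int m" 1] x by (simp add: add.commute)
    then show ?case using Suc assms by (simp add: submodule_add)
  qed
  show ?thesis
  proof (cases "k \<ge> 0")
    case True
    then show ?thesis using *[of "nat k"] by simp
  next
    case False
    then have "[k] \<cdot>\<^bsub>M\<^esub> x = \<ominus>\<^bsub>M\<^esub> ([int (nat (- k))] \<cdot>\<^bsub>M\<^esub> x)"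
      using M.add.int_pow_neg[OF x, of "- k"] by simp
    then show ?thesis using * submodule_a_inv[OF assms(2)] by metis
  qed
qed

lemma (in lin_map) submodule_vimage:
  "submodule H A N \<Longrightarrow> submodule {x \<in> carrier M. f x \<in> H} A M"
  by (rule M.submoduleI)
    (auto simp: map_zero map_a_inv map_add map_smult submodule_zero submodule_a_inv submodule_add
      submodule_smult)

lemma (in lin_map) submodule_image:
  assumes "submodule H A M" shows "submodule (f ` H) A N"
proof -
  note sub = submodule_subset[OF assms]
  have c: "f x \<in> carrier N" if "x \<in> H" for x using sub that by auto
  show ?thesis
  proof (rule N.submoduleI)
    show "f ` H \<subseteq> carrier N" using c by auto
    show "\<zero>\<^bsub>N\<^esub> \<in> f ` H" using map_zero submodule_zero[OF assms] by (metis imageI)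
    fix y assume y: "y \<in> f ` H"
    then obtain x where x: "x \<in> H" "y = f x" by auto
    show "\<ominus>\<^bsub>N\<^esub> y \<in> f ` H"
      using x sub submodule_a_inv[OF assms x(1)] map_a_inv[of x] by (metis image_eqI subsetD)
    show "a \<odot>\<^bsub>N\<^esub> y \<in> f ` H" if "a \<in> carrier A" for a
      using that x sub submodule_smult[OF assms that x(1)] map_smult[of a x]
      by (metis image_eqI subsetD)
    fix z assume "z \<in> f ` H"
    then obtain w where w: "w \<in> H" "z = f w" by auto
    show "y \<oplus>\<^bsub>N\<^esub> z \<in> f ` H"
      using x w sub submodule_add[OF assms x(1) w(1)] map_add[of x w] by (metis image_eqI subsetD)
  qed
qed

lemma submodule_singleton_zero: "module A M \<Longrightarrow> submodule {\<zero>\<^bsub>M\<^esub>} A M"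
proof -
  assume "module A M"
  then interpret M: module A M .
  show ?thesis by (rule M.submoduleI) auto
qed

lemma lin_hom_finsum:
  assumes "module A M" "module A N" "\<And>s. s \<in> S \<Longrightarrow> f s \<in> lin_hom A M N" "finite S"
  shows "(\<lambda>x. \<Oplus>\<^bsub>N\<^esub>s\<in>S. f s x) \<in> lin_hom A M N"
proof -
  interpret M: module A M by fact
  interpret N: module A N by fact
  show ?thesis using assms(4,3)
  proof (induction S rule: finite_induct)
    case empty
    show ?case using N.zero_lin_hom by simp
  next
    case (insert s S)
    have h: "(\<lambda>x. f s x \<oplus>\<^bsub>N\<^esub> (\<Oplus>\<^bsub>N\<^esub>s\<in>S. f s x)) \<in> lin_hom A M N"
      using insert by (intro lin_hom_plus assms(2)) auto
    have "f s x \<oplus>\<^bsub>N\<^esub> (\<Oplus>\<^bsub>N\<^esub>s\<in>S. f s x) = (\<Oplus>\<^bsub>N\<^esub>s\<in>insert s S. f s x)" if "x \<in> carrier M" for x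
      using insert that lin_hom_closed[of _ A M N x] by (intro N.finsum_insert[symmetric]) auto
    then show ?case by (rule lin_hom_cong[OF h _ assms(1)])
  qed
qed

lemma submodule_equalizer:
  assumes "module A M" "module A N" "f \<in> lin_hom A M N" "g \<in> lin_hom A M N"
  shows "submodule {x \<in> carrier M. f x = g x} A M"
proof -
  interpret f: lin_map A M N f using assms by (intro lin_mapI)
  interpret g: lin_map A M N g using assms by (intro lin_mapI)
  show ?thesis
    by (rule f.M.submoduleI)
      (auto simp: f.map_zero g.map_zero f.map_a_inv g.map_a_inv f.map_add g.map_add f.map_smult
        g.map_smult)
qed

section \<open>Spans and maps determined on generators\<close>

lemma span_of_superset: "S \<subseteq> span_of A M S"
  by (auto simp: span_of_def)

lemma span_of_least: "submodule N A M \<Longrightarrow> S \<subseteq> N \<Longrightarrow> span_of A M S \<subseteq> N"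
  by (auto simp: span_of_def)

lemma span_of_submodule:
  assumes "module A M" "S \<subseteq> carrier M" shows "submodule (span_of A M S) A M"
proof -
  interpret M: module A M by fact
  have "submodule (carrier M) A M" by (rule M.carrier_is_submodule)
  then have sub: "span_of A M S \<subseteq> carrier M" using assms(2) by (rule span_of_least)
  show ?thesis
    by (rule M.submoduleI)
      (use sub in \<open>auto simp: span_of_def intro: submodule_zero submodule_a_inv submodule_add
        submodule_smult\<close>)
qed

text \<open>The equalizer of two linear maps is a submodule containing the generators. The later
  uniqueness arguments for maps on free modules, polynomial rings and tensor products rest on
  this.\<close>

lemma lin_hom_eq_on_span:
  assumes "module A M" "module A N" "f \<in> lin_hom A M N" "g \<in> lin_hom A M N"
    and "span_of A M S = carrier M" "S \<subseteq> carrier M" "\<And>s. s \<in> S \<Longrightarrow> f s = g s" "x \<in> carrier M"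
  shows "f x = g x"
  using span_of_least[OF submodule_equalizer[OF assms(1-4)], of S] assms(5-8) by auto

text \<open>The preimage of \<open>H\<close> is a submodule containing \<open>S\<close>. With
  \<open>H\<close> the zero submodule this shows that a map kills everything generated by a set of
  relations.\<close>

lemma span_of_vimage:
  assumes "module A M" "module A N" "f \<in> lin_hom A M N" "submodule H A N"
    and "S \<subseteq> carrier M" "\<And>s. s \<in> S \<Longrightarrow> f s \<in> H" "x \<in> span_of A M S"
  shows "f x \<in> H"
proof -
  interpret f: lin_map A M N f using assms by (intro lin_mapI)
  show ?thesis
    using span_of_least[OF f.submodule_vimage[OF assms(4)], of S] assms(5-7) by auto
qed

section \<open>Free modules\<close>

lemma free_module_simps [simp]:
  "\<zero>\<^bsub>free_module A B\<^esub> = (\<lambda>b. \<zero>\<^bsub>A\<^esub>)"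
  "f \<oplus>\<^bsub>free_module A B\<^esub> g = (\<lambda>b. f b \<oplus>\<^bsub>A\<^esub> g b)"
  "a \<odot>\<^bsub>free_module A B\<^esub> f = (\<lambda>b. a \<otimes>\<^bsub>A\<^esub> f b)"
  by (simp_all add: free_module_def)

lemma mem_free_module_iff:
  "f \<in> carrier (free_module A B) \<longleftrightarrow>
    (\<forall>b. f b \<in> carrier A) \<and> finite {b. f b \<noteq> \<zero>\<^bsub>A\<^esub>} \<and> (\<forall>b. f b \<noteq> \<zero>\<^bsub>A\<^esub> \<longrightarrow> b \<in> B)"
  by (auto simp: free_module_def)

lemma free_module_app_closed: "f \<in> carrier (free_module A B) \<Longrightarrow> f b \<in> carrier A"
  by (simp add: mem_free_module_iff)

lemma free_module_finite: "f \<in> carrier (free_module A B) \<Longrightarrow> finite {b. f b \<noteq> \<zero>\<^bsub>A\<^esub>}"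
  by (simp add: mem_free_module_iff)

lemma free_module_zero_outside: "f \<in> carrier (free_module A B) \<Longrightarrow> b \<notin> B \<Longrightarrow> f b = \<zero>\<^bsub>A\<^esub>"
  by (auto simp: mem_free_module_iff)

lemma free_module_module:
  assumes "cring A" shows "module A (free_module A B)"
proof -
  interpret cring A by fact
  show ?thesis
  proof (rule moduleI)
    show "abelian_group (free_module A B)"
    proof (rule abelian_groupI)
      fix f g assume f: "f \<in> carrier (free_module A B)" and g: "g \<in> carrier (free_module A B)"
      have "{b. f b \<oplus>\<^bsub>A\<^esub> g b \<noteq> \<zero>\<^bsub>A\<^esub>} \<subseteq> {b. f b \<noteq> \<zero>\<^bsub>A\<^esub>} \<union> {b. g b \<noteq> \<zero>\<^bsub>A\<^esub>}"
        by auto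
      then show "f \<oplus>\<^bsub>free_module A B\<^esub> g \<in> carrier (free_module A B)"
        using f g by (auto simp: mem_free_module_iff intro: finite_subset)
    next
      fix f assume f: "f \<in> carrier (free_module A B)"
      have "(\<lambda>b. \<ominus>\<^bsub>A\<^esub> f b) \<in> carrier (free_module A B)"
        using f by (auto simp: mem_free_module_iff elim!: rev_finite_subset)
      moreover have "(\<lambda>b. \<ominus>\<^bsub>A\<^esub> f b) \<oplus>\<^bsub>free_module A B\<^esub> f = \<zero>\<^bsub>free_module A B\<^esub>"
        using f by (auto simp: mem_free_module_iff l_neg)
      ultimately show "\<exists>g\<in>carrier (free_module A B). g \<oplus>\<^bsub>free_module A B\<^esub> f = \<zero>\<^bsub>free_module A B\<^esub>"
        by blast
    qed (auto simp: mem_free_module_iff a_ac)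
    fix a f assume a: "a \<in> carrier A" and f: "f \<in> carrier (free_module A B)"
    have "{b. a \<otimes>\<^bsub>A\<^esub> f b \<noteq> \<zero>\<^bsub>A\<^esub>} \<subseteq> {b. f b \<noteq> \<zero>\<^bsub>A\<^esub>}"
      using a f by auto
    then show "a \<odot>\<^bsub>free_module A B\<^esub> f \<in> carrier (free_module A B)"
      using a f finite_subset[of "{b. a \<otimes>\<^bsub>A\<^esub> f b \<noteq> \<zero>\<^bsub>A\<^esub>}"]
      by (auto simp: mem_free_module_iff)
  qed (auto simp: mem_free_module_iff l_distr r_distr m_assoc cring_axioms)
qed

lemma free_module_a_inv:
  assumes "cring A" "f \<in> carrier (free_module A B)"
  shows "\<ominus>\<^bsub>free_module A B\<^esub> f = (\<lambda>b. \<ominus>\<^bsub>A\<^esub> f b)"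
proof -
  interpret cring A by fact
  interpret M: module A "free_module A B" by (rule free_module_module) fact
  have "(\<lambda>b. \<ominus>\<^bsub>A\<^esub> f b) \<in> carrier (free_module A B)"
    using assms(2) by (auto simp: mem_free_module_iff elim!: rev_finite_subset)
  moreover have "(\<lambda>b. \<ominus>\<^bsub>A\<^esub> f b) \<oplus>\<^bsub>free_module A B\<^esub> f = \<zero>\<^bsub>free_module A B\<^esub>"
    using assms(2) by (auto simp: mem_free_module_iff l_neg)
  ultimately show ?thesis using assms(2) M.minus_equality by blast
qed

lemma free_module_finsum_app:
  assumes "cring A" "F \<in> S \<rightarrow> carrier (free_module A B)" "finite S"
  shows "(\<Oplus>\<^bsub>free_module A B\<^esub>s\<in>S. F s) b = (\<Oplus>\<^bsub>A\<^esub>s\<in>S. F s b)"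
proof -
  interpret cring A by fact
  interpret M: module A "free_module A B" by (rule free_module_module) fact
  show ?thesis using assms(3,2)
  proof (induction S rule: finite_induct)
    case (insert s S)
    then show ?case
      by (subst M.finsum_insert, (auto)[4], subst finsum_insert)
        (auto simp: free_module_app_closed Pi_def)
  qed auto
qed

lemma delta_closed: "cring A \<Longrightarrow> b \<in> B \<Longrightarrow> delta A b \<in> carrier (free_module A B)"
proof -
  assume "cring A" "b \<in> B"
  interpret cring A by fact
  show ?thesis using \<open>b \<in> B\<close> by (auto simp: mem_free_module_iff delta_def)
qed

lemma free_module_mono: "B \<subseteq> C \<Longrightarrow> carrier (free_module A B) \<subseteq> carrier (free_module A C)"
  by (auto simp: free_module_def)

lemma free_module_submodule:
  assumes "cring A" "B \<subseteq> C" shows "submodule (carrier (free_module A B)) A (free_module A C)"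
proof -
  interpret C: module A "free_module A C" by (rule free_module_module) fact
  interpret B: module A "free_module A B" by (rule free_module_module) fact
  have B: "f \<in> carrier (free_module A C)" if "f \<in> carrier (free_module A B)" for f
    using free_module_mono[OF assms(2)] that by auto
  show ?thesis
  proof (rule C.submoduleI)
    show "\<ominus>\<^bsub>free_module A C\<^esub> f \<in> carrier (free_module A B)" if "f \<in> carrier (free_module A B)" for f
      using B.a_inv_closed[OF that] B[OF that] that by (simp add: free_module_a_inv assms(1))
  qed (use B B.zero_closed B.a_closed B.smult_closed in auto)
qed

lemma lin_comb_closed:
  assumes "module A M" "c \<in> carrier (free_module A B)" "g \<in> B \<rightarrow> carrier M"
  shows "lin_comb A M B c g \<in> carrier M"
proof -
  interpret M: module A M by fact
  show ?thesis unfolding lin_comb_def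
    using assms(2,3) by (intro M.finsum_closed) (auto simp: mem_free_module_iff)
qed

lemma lin_comb_eq_finsum:
  assumes "module A M" "c \<in> carrier (free_module A B)" "g \<in> B \<rightarrow> carrier M"
    and "finite S" "S \<subseteq> B" "{b. c b \<noteq> \<zero>\<^bsub>A\<^esub>} \<subseteq> S"
  shows "lin_comb A M B c g = (\<Oplus>\<^bsub>M\<^esub>b\<in>S. c b \<odot>\<^bsub>M\<^esub> g b)"
proof -
  interpret M: module A M by fact
  show ?thesis unfolding lin_comb_def
    using assms
    by (intro M.add.finprod_mono_neutral_cong_left) (auto simp: mem_free_module_iff Pi_def subset_iff)
qed

lemma lin_comb_lin_hom:
  assumes "module A M" "g \<in> B \<rightarrow> carrier M"
  shows "(\<lambda>c. lin_comb A M B c g) \<in> lin_hom A (free_module A B) M"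
proof -
  interpret M: module A M by fact
  interpret F: module A "free_module A B" by (rule free_module_module) (rule M.R.cring_axioms)
  show ?thesis
  proof (rule lin_homI)
    fix c assume c: "c \<in> carrier (free_module A B)"
    then show "lin_comb A M B c g \<in> carrier M" using lin_comb_closed assms by blast
    note cA = free_module_app_closed[OF c]
    {
      fix c' assume c': "c' \<in> carrier (free_module A B)"
      note c'A = free_module_app_closed[OF c']
      define S where "S = {b. c b \<noteq> \<zero>\<^bsub>A\<^esub>} \<union> {b. c' b \<noteq> \<zero>\<^bsub>A\<^esub>}"
      have S: "finite S" "S \<subseteq> B" using c c' by (auto simp: S_def mem_free_module_iff)
      have *: "lin_comb A M B c'' g = (\<Oplus>\<^bsub>M\<^esub>b\<in>S. c'' b \<odot>\<^bsub>M\<^esub> g b)"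
        if "c'' \<in> carrier (free_module A B)" "{b. c'' b \<noteq> \<zero>\<^bsub>A\<^esub>} \<subseteq> S" for c''
        using lin_comb_eq_finsum[OF assms(1) that(1) assms(2) S that(2)] .
      have "lin_comb A M B (c \<oplus>\<^bsub>free_module A B\<^esub> c') g
          = (\<Oplus>\<^bsub>M\<^esub>b\<in>S. (c \<oplus>\<^bsub>free_module A B\<^esub> c') b \<odot>\<^bsub>M\<^esub> g b)"
        using c c' by (intro * F.a_closed) (auto simp: S_def)
      also have "\<dots> = (\<Oplus>\<^bsub>M\<^esub>b\<in>S. c b \<odot>\<^bsub>M\<^esub> g b \<oplus>\<^bsub>M\<^esub> c' b \<odot>\<^bsub>M\<^esub> g b)"
        using S assms(2) cA c'A
        by (intro M.finsum_cong) (auto simp: Pi_def M.smult_l_distr simp_implies_def subset_iff)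
      also have "\<dots> = (\<Oplus>\<^bsub>M\<^esub>b\<in>S. c b \<odot>\<^bsub>M\<^esub> g b) \<oplus>\<^bsub>M\<^esub> (\<Oplus>\<^bsub>M\<^esub>b\<in>S. c' b \<odot>\<^bsub>M\<^esub> g b)"
        using S assms(2) cA c'A by (intro M.finsum_addf) (auto simp: Pi_def)
      also have "\<dots> = lin_comb A M B c g \<oplus>\<^bsub>M\<^esub> lin_comb A M B c' g"
        using c c' by (subst (1 2) *) (auto simp: S_def)
      finally show "lin_comb A M B (c \<oplus>\<^bsub>free_module A B\<^esub> c') g
        = lin_comb A M B c g \<oplus>\<^bsub>M\<^esub> lin_comb A M B c' g" .
    }
    fix a assume a: "a \<in> carrier A"
    define S where "S = {b. c b \<noteq> \<zero>\<^bsub>A\<^esub>}"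
    have S: "finite S" "S \<subseteq> B" using c by (auto simp: S_def mem_free_module_iff)
    have *: "lin_comb A M B c'' g = (\<Oplus>\<^bsub>M\<^esub>b\<in>S. c'' b \<odot>\<^bsub>M\<^esub> g b)"
      if "c'' \<in> carrier (free_module A B)" "{b. c'' b \<noteq> \<zero>\<^bsub>A\<^esub>} \<subseteq> S" for c''
      using lin_comb_eq_finsum[OF assms(1) that(1) assms(2) S that(2)] .
    have "lin_comb A M B (a \<odot>\<^bsub>free_module A B\<^esub> c) g = (\<Oplus>\<^bsub>M\<^esub>b\<in>S. (a \<odot>\<^bsub>free_module A B\<^esub> c) b \<odot>\<^bsub>M\<^esub> g b)"
      using c a by (intro * F.smult_closed) (auto simp: S_def)
    also have "\<dots> = (\<Oplus>\<^bsub>M\<^esub>b\<in>S. a \<odot>\<^bsub>M\<^esub> (c b \<odot>\<^bsub>M\<^esub> g b))"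
      using S a assms(2) cA
      by (intro M.finsum_cong) (auto simp: Pi_def M.smult_assoc1 simp_implies_def subset_iff)
    also have "\<dots> = a \<odot>\<^bsub>M\<^esub> (\<Oplus>\<^bsub>M\<^esub>b\<in>S. c b \<odot>\<^bsub>M\<^esub> g b)"
      using S a assms(2) cA by (intro M.finsum_smult_ldistr[symmetric]) (auto simp: Pi_def)
    also have "\<dots> = a \<odot>\<^bsub>M\<^esub> lin_comb A M B c g"
      using c by (subst *) (auto simp: S_def)
    finally show "lin_comb A M B (a \<odot>\<^bsub>free_module A B\<^esub> c) g = a \<odot>\<^bsub>M\<^esub> lin_comb A M B c g" .
  qed
qed

text \<open>Linearity in the vectors, with the coefficients fixed. It is the second half of
  bilinearity when one linear map per monomial is combined into a pairing with polynomials.\<close>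

lemma lin_comb_param_lin_hom:
  assumes "module A M" "module A N" "c \<in> carrier (free_module A B)"
    and f: "\<And>b. b \<in> B \<Longrightarrow> f b \<in> lin_hom A M N"
  shows "(\<lambda>u. lin_comb A N B c (\<lambda>b. f b u)) \<in> lin_hom A M N"
proof -
  interpret M: module A M by fact
  interpret N: module A N by fact
  define S where "S = {b \<in> B. c b \<noteq> \<zero>\<^bsub>A\<^esub>}"
  have S: "S \<subseteq> B" "finite S" using assms(3) by (auto simp: S_def mem_free_module_iff)
  note cA = free_module_app_closed[OF assms(3)]
  have fc: "f b x \<in> carrier N" if "b \<in> S" "x \<in> carrier M" for b x
    using that S by (auto intro: lin_hom_closed[OF f])
  show ?thesis
    unfolding lin_comb_def S_def[symmetric]
  proof (rule lin_homI)
    fix x assume x: "x \<in> carrier M"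
    show "(\<Oplus>\<^bsub>N\<^esub>b\<in>S. c b \<odot>\<^bsub>N\<^esub> f b x) \<in> carrier N"
      using fc x cA by (intro N.finsum_closed) auto
    show "(\<Oplus>\<^bsub>N\<^esub>b\<in>S. c b \<odot>\<^bsub>N\<^esub> f b (x \<oplus>\<^bsub>M\<^esub> y))
      = (\<Oplus>\<^bsub>N\<^esub>b\<in>S. c b \<odot>\<^bsub>N\<^esub> f b x) \<oplus>\<^bsub>N\<^esub> (\<Oplus>\<^bsub>N\<^esub>b\<in>S. c b \<odot>\<^bsub>N\<^esub> f b y)" if y: "y \<in> carrier M" for y
    proof -
      have "(\<Oplus>\<^bsub>N\<^esub>b\<in>S. c b \<odot>\<^bsub>N\<^esub> f b (x \<oplus>\<^bsub>M\<^esub> y)) = (\<Oplus>\<^bsub>N\<^esub>b\<in>S. c b \<odot>\<^bsub>N\<^esub> f b x \<oplus>\<^bsub>N\<^esub> c b \<odot>\<^bsub>N\<^esub> f b y)"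
      proof (rule N.finsum_cong')
        fix b assume b: "b \<in> S"
        then show "c b \<odot>\<^bsub>N\<^esub> f b (x \<oplus>\<^bsub>M\<^esub> y) = c b \<odot>\<^bsub>N\<^esub> f b x \<oplus>\<^bsub>N\<^esub> c b \<odot>\<^bsub>N\<^esub> f b y"
          using lin_hom_add[OF f x y, of b] S fc[OF b] x y cA by (auto simp: N.smult_r_distr)
      qed (use fc x y cA in auto)
      also have "\<dots> = (\<Oplus>\<^bsub>N\<^esub>b\<in>S. c b \<odot>\<^bsub>N\<^esub> f b x) \<oplus>\<^bsub>N\<^esub> (\<Oplus>\<^bsub>N\<^esub>b\<in>S. c b \<odot>\<^bsub>N\<^esub> f b y)"
        using fc x y cA by (intro N.finsum_addf) auto
      finally show ?thesis .
    qed
    show "(\<Oplus>\<^bsub>N\<^esub>b\<in>S. c b \<odot>\<^bsub>N\<^esub> f b (a \<odot>\<^bsub>M\<^esub> x)) = a \<odot>\<^bsub>N\<^esub> (\<Oplus>\<^bsub>N\<^esub>b\<in>S. c b \<odot>\<^bsub>N\<^esub> f b x)" if a: "a \<in> carrier A" for a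
    proof -
      have "(\<Oplus>\<^bsub>N\<^esub>b\<in>S. c b \<odot>\<^bsub>N\<^esub> f b (a \<odot>\<^bsub>M\<^esub> x)) = (\<Oplus>\<^bsub>N\<^esub>b\<in>S. a \<odot>\<^bsub>N\<^esub> (c b \<odot>\<^bsub>N\<^esub> f b x))"
      proof (rule N.finsum_cong')
        fix b assume b: "b \<in> S"
        then show "c b \<odot>\<^bsub>N\<^esub> f b (a \<odot>\<^bsub>M\<^esub> x) = a \<odot>\<^bsub>N\<^esub> (c b \<odot>\<^bsub>N\<^esub> f b x)"
          using lin_hom_smult[OF f a x, of b] S fc[OF b] x a cA
          by (auto simp: N.smult_assoc1[symmetric] M.R.m_comm)
      qed (use fc x a cA in auto)
      also have "\<dots> = a \<odot>\<^bsub>N\<^esub> (\<Oplus>\<^bsub>N\<^esub>b\<in>S. c b \<odot>\<^bsub>N\<^esub> f b x)"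
        using fc x a cA S by (intro N.finsum_smult_ldistr[symmetric]) auto
      finally show ?thesis .
    qed
  qed
qed

lemma lin_comb_delta:
  assumes "module A M" "g \<in> B \<rightarrow> carrier M" "b \<in> B"
  shows "lin_comb A M B (delta A b) g = g b"
proof -
  interpret M: module A M by fact
  have "lin_comb A M B (delta A b) g = (\<Oplus>\<^bsub>M\<^esub>c\<in>{b}. delta A b c \<odot>\<^bsub>M\<^esub> g c)"
    using assms by (intro lin_comb_eq_finsum delta_closed M.R.cring_axioms) (auto simp: delta_def)
  then show ?thesis using assms(2,3) by (auto simp: delta_def Pi_def)
qed

lemma lin_comb_free_delta:
  fixes f :: "'b \<Rightarrow> 'a"
  assumes "cring A" "f \<in> carrier (free_module A B)"
  shows "lin_comb A (free_module A B) B f (delta A) = f"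
proof
  fix x :: 'b
  interpret cring A by fact
  interpret F: module A "free_module A B" by (rule free_module_module) fact
  note fA = free_module_app_closed[OF assms(2)]
  define S where "S = {b \<in> B. f b \<noteq> \<zero>\<^bsub>A\<^esub>}"
  have S: "finite S" "S \<subseteq> B" using assms(2) by (auto simp: S_def mem_free_module_iff)
  have dA: "delta A b x \<in> carrier A" for b by (auto simp: delta_def)
  have "lin_comb A (free_module A B) B f (delta A) x
      = (\<Oplus>\<^bsub>A\<^esub>b\<in>S. (f b \<odot>\<^bsub>free_module A B\<^esub> delta A b) x)"
    unfolding lin_comb_def S_def[symmetric] using S fA
    by (intro free_module_finsum_app assms(1) Pi_I F.smult_closed delta_closed) auto
  also have "\<dots> = (\<Oplus>\<^bsub>A\<^esub>b\<in>S. if x = b then f b else \<zero>\<^bsub>A\<^esub>)"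
    using fA by (intro finsum_cong) (auto simp: delta_def Pi_def simp_implies_def)
  also have "\<dots> = f x"
  proof (cases "x \<in> S")
    case True
    then show ?thesis using S fA by (simp add: finsum_singleton Pi_def)
  next
    case False
    then have "(\<Oplus>\<^bsub>A\<^esub>b\<in>S. if x = b then f b else \<zero>\<^bsub>A\<^esub>) = (\<Oplus>\<^bsub>A\<^esub>b\<in>S. \<zero>\<^bsub>A\<^esub>)"
      by (intro finsum_cong) (auto simp: simp_implies_def)
    moreover have "f x = \<zero>\<^bsub>A\<^esub>"
      using False assms(2) by (auto simp: S_def mem_free_module_iff)
    ultimately show ?thesis by simp
  qed
  finally show "lin_comb A (free_module A B) B f (delta A) x = f x" .
qed

lemma free_module_span_delta:
  assumes "cring A" shows "span_of A (free_module A B) (delta A ` B) = carrier (free_module A B)"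
proof -
  interpret F: module A "free_module A B" by (rule free_module_module) fact
  have sub: "submodule (span_of A (free_module A B) (delta A ` B)) A (free_module A B)"
    using assms by (intro span_of_submodule F.module_axioms) (auto intro: delta_closed)
  have "f \<in> span_of A (free_module A B) (delta A ` B)" if f: "f \<in> carrier (free_module A B)" for f
  proof -
    have "lin_comb A (free_module A B) B f (delta A) \<in> span_of A (free_module A B) (delta A ` B)"
      unfolding lin_comb_def
      by (intro submodule_finsum[OF F.module_axioms sub] Pi_I submodule_smult[OF sub]
        subsetD[OF span_of_superset] free_module_app_closed[OF f]) auto
    then show ?thesis using lin_comb_free_delta[OF assms f] by simp
  qed
  then show ?thesis using submodule_subset[OF sub] by auto
qed

lemma lin_hom_free_eqI:
  assumes "module A M" "f \<in> lin_hom A (free_module A B) M" "g \<in> lin_hom A (free_module A B) M"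
    and "\<And>b. b \<in> B \<Longrightarrow> f (delta A b) = g (delta A b)" "x \<in> carrier (free_module A B)"
  shows "f x = g x"
proof -
  interpret M: module A M by fact
  have A: "cring A" by (rule M.R.cring_axioms)
  show ?thesis
    by (rule lin_hom_eq_on_span[OF free_module_module[OF A] assms(1-3) free_module_span_delta[OF A]])
      (use assms(4,5) in \<open>auto intro: delta_closed[OF A]\<close>)
qed

text \<open>The operations of \<open>free_module A B\<close> do not depend on \<open>B\<close>; a
  smaller basis only shrinks the carrier. Hence all differentials can live on one module over
  \<open>UNIV\<close>, while the supports are tracked separately by carriers of smaller free
  modules.\<close>

lemma lin_hom_free_restrict:
  "B \<subseteq> C \<Longrightarrow> f \<in> lin_hom A (free_module A C) M \<Longrightarrow> f \<in> lin_hom A (free_module A B) M"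
  using free_module_mono[of B C A]
  by (auto simp: lin_hom_def hom_def Pi_def subset_iff)

lemma lin_hom_free_corestrict:
  "f \<in> lin_hom A M (free_module A C) \<Longrightarrow> (\<And>x. x \<in> carrier M \<Longrightarrow> f x \<in> carrier (free_module A B))
    \<Longrightarrow> f \<in> lin_hom A M (free_module A B)"
  by (auto simp: lin_hom_def hom_def)

lemma lin_hom_free_eq_on:
  assumes "module A M" "f \<in> lin_hom A (free_module A C) M" "g \<in> lin_hom A (free_module A C) M"
    and "\<And>b. b \<in> B \<Longrightarrow> f (delta A b) = g (delta A b)" "x \<in> carrier (free_module A B)" "B \<subseteq> C"
  shows "f x = g x"
  using lin_hom_free_eqI[OF assms(1) lin_hom_free_restrict[OF assms(6,2)]
      lin_hom_free_restrict[OF assms(6,3)] assms(4,5)] .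

lemma lin_comb_in_submodule:
  assumes "module A M" "submodule H A M" "c \<in> carrier (free_module A B)" "B \<subseteq> B'"
    and "\<And>b. b \<in> B \<Longrightarrow> g b \<in> H"
  shows "lin_comb A M B' c g \<in> H"
  unfolding lin_comb_def
  using assms(3-5) by (intro submodule_finsum[OF assms(1,2)] Pi_I submodule_smult[OF assms(2)])
    (auto simp: mem_free_module_iff)

text \<open>The linear combinations form the image of a linear map, hence a submodule. Read from
  left to right, the equation supplies the coefficients that \<open>lin_ext_eq\<close> asks
  for.\<close>

lemma lin_comb_range:
  assumes "module A M" "g \<in> B \<rightarrow> carrier M"
  shows "span_of A M (g ` B) = (\<lambda>c. lin_comb A M B c g) ` carrier (free_module A B)"
proof -
  interpret M: module A M by fact
  have A: "cring A" by (rule M.R.cring_axioms)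
  interpret h: lin_map A "free_module A B" M "\<lambda>c. lin_comb A M B c g"
    using assms by (intro lin_mapI free_module_module A lin_comb_lin_hom)
  have sub: "submodule (span_of A M (g ` B)) A M"
    using assms by (intro span_of_submodule) auto
  show ?thesis
  proof
    show "span_of A M (g ` B) \<subseteq> (\<lambda>c. lin_comb A M B c g) ` carrier (free_module A B)"
    proof (rule span_of_least)
      show "submodule ((\<lambda>c. lin_comb A M B c g) ` carrier (free_module A B)) A M"
        by (intro h.submodule_image h.M.carrier_is_submodule)
      show "g ` B \<subseteq> (\<lambda>c. lin_comb A M B c g) ` carrier (free_module A B)"
      proof
        fix y assume "y \<in> g ` B"
        then obtain b where b: "b \<in> B" "y = g b" by auto
        then have "y = lin_comb A M B (delta A b) g" using lin_comb_delta[OF assms] by simp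
        then show "y \<in> (\<lambda>c. lin_comb A M B c g) ` carrier (free_module A B)"
          using delta_closed[OF A b(1)] by blast
      qed
    qed
    show "(\<lambda>c. lin_comb A M B c g) ` carrier (free_module A B) \<subseteq> span_of A M (g ` B)"
      using lin_comb_in_submodule[OF assms(1) sub _ order.refl] span_of_superset[of "g ` B" A M]
      by blast
  qed
qed

text \<open>The tool for evaluating \<open>lin_ext\<close>: one linear map with the prescribed
  values on generators proves that the prescription is consistent and computes it at once.\<close>

lemma lin_ext_eq_span:
  assumes "module A M" "module A N" "f \<in> lin_hom A M N" "e \<in> B \<rightarrow> carrier M"
    and "\<And>b. b \<in> B \<Longrightarrow> f (e b) = g b" "span_of A M (e ` B) = carrier M" "m \<in> carrier M"
  shows "lin_ext A M N B e g m = f m"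
  using lin_comb_range[OF assms(1,4)] assms(6,7) by (intro lin_ext_eq[OF assms(1-5)]) auto

section \<open>Quotients and tensor products\<close>

lemma submodule_abelian_subgroup:
  "module A M \<Longrightarrow> submodule N A M \<Longrightarrow> abelian_subgroup N M"
  by (auto simp: module_def submodule_def intro!: abelian_subgroupI3 additive_subgroup.intro)

lemma quot_module_carrier: "carrier (quot_module M N) = (\<lambda>x. N +>\<^bsub>M\<^esub> x) ` carrier M"
  by (auto simp: quot_module_def A_RCOSETS_def RCOSETS_def a_r_coset_def)

lemma quot_module_structure:
  assumes M: "module A M" and N: "submodule N A M"
  shows quot_module_module: "module A (quot_module M N)"
    and quot_proj_lin_hom: "(\<lambda>x. N +>\<^bsub>M\<^esub> x) \<in> lin_hom A M (quot_module M N)"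
proof -
  interpret M: module A M by fact
  interpret N: abelian_subgroup N M by (rule submodule_abelian_subgroup[OF M N])
  have add: "(N +>\<^bsub>M\<^esub> x) \<oplus>\<^bsub>quot_module M N\<^esub> (N +>\<^bsub>M\<^esub> y) = N +>\<^bsub>M\<^esub> (x \<oplus>\<^bsub>M\<^esub> y)"
    if "x \<in> carrier M" "y \<in> carrier M" for x y
    using N.a_rcos_sum[OF that] by (simp add: quot_module_def)
  have zero: "\<zero>\<^bsub>quot_module M N\<^esub> = N +>\<^bsub>M\<^esub> \<zero>\<^bsub>M\<^esub>"
    using N.a_rcos_const[OF N.zero_closed] by (simp add: quot_module_def)
  have smult: "a \<odot>\<^bsub>quot_module M N\<^esub> (N +>\<^bsub>M\<^esub> x) = N +>\<^bsub>M\<^esub> (a \<odot>\<^bsub>M\<^esub> x)"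
    if a: "a \<in> carrier A" and x: "x \<in> carrier M" for a x
  proof -
    \<comment> \<open>Adding \<open>N\<close> to the elementwise multiple restores a full coset:
      \<open>a k\<close> lies in \<open>N\<close> for \<open>k\<close> in \<open>N\<close>, and
      conversely \<open>k = 0\<close> already reaches everything.\<close>
    have "{h \<oplus>\<^bsub>M\<^esub> a \<odot>\<^bsub>M\<^esub> (k \<oplus>\<^bsub>M\<^esub> x) | h k. h \<in> N \<and> k \<in> N} = {h \<oplus>\<^bsub>M\<^esub> (a \<odot>\<^bsub>M\<^esub> x) | h. h \<in> N}"
      (is "?L = ?R")
    proof
      show "?L \<subseteq> ?R"
      proof
        fix y assume "y \<in> ?L"
        then obtain h k where hk: "h \<in> N" "k \<in> N" "y = h \<oplus>\<^bsub>M\<^esub> a \<odot>\<^bsub>M\<^esub> (k \<oplus>\<^bsub>M\<^esub> x)" by blast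
        then have "y = (h \<oplus>\<^bsub>M\<^esub> a \<odot>\<^bsub>M\<^esub> k) \<oplus>\<^bsub>M\<^esub> a \<odot>\<^bsub>M\<^esub> x"
          using a x by (simp add: M.smult_r_distr M.a_assoc)
        moreover have "h \<oplus>\<^bsub>M\<^esub> a \<odot>\<^bsub>M\<^esub> k \<in> N"
          using hk a N by (auto intro: submodule_add submodule_smult)
        ultimately show "y \<in> ?R" by blast
      qed
      show "?R \<subseteq> ?L"
      proof
        fix y assume "y \<in> ?R"
        then obtain h where "h \<in> N" "y = h \<oplus>\<^bsub>M\<^esub> (a \<odot>\<^bsub>M\<^esub> x)" by blast
        then have "y = h \<oplus>\<^bsub>M\<^esub> (a \<odot>\<^bsub>M\<^esub> (\<zero>\<^bsub>M\<^esub> \<oplus>\<^bsub>M\<^esub> x))" "h \<in> N" using x by auto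
        then show "y \<in> ?L" using N.zero_closed by blast
      qed
    qed
    moreover have coset: "N +>\<^bsub>M\<^esub> y = {h \<oplus>\<^bsub>M\<^esub> y | h. h \<in> N}" for y
      by (auto simp: a_r_coset_def')
    moreover have "a \<odot>\<^bsub>quot_module M N\<^esub> X = {h \<oplus>\<^bsub>M\<^esub> a \<odot>\<^bsub>M\<^esub> z | h z. h \<in> N \<and> z \<in> X}" for X
      by (auto simp: quot_module_def set_add_def')
    moreover have "{h \<oplus>\<^bsub>M\<^esub> a \<odot>\<^bsub>M\<^esub> z | h z. h \<in> N \<and> z \<in> N +>\<^bsub>M\<^esub> x} = ?L"
      unfolding coset by blast
    ultimately show ?thesis by simp
  qed
  have c: "N +>\<^bsub>M\<^esub> x \<in> carrier (quot_module M N)" if "x \<in> carrier M" for x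
    using that by (auto simp: quot_module_carrier)
  show "module A (quot_module M N)"
  proof (rule moduleI)
    show "abelian_group (quot_module M N)"
    proof (rule abelian_groupI)
      fix X assume "X \<in> carrier (quot_module M N)"
      then obtain x where x: "x \<in> carrier M" "X = N +>\<^bsub>M\<^esub> x" by (auto simp: quot_module_carrier)
      then have "(N +>\<^bsub>M\<^esub> (\<ominus>\<^bsub>M\<^esub> x)) \<oplus>\<^bsub>quot_module M N\<^esub> X = \<zero>\<^bsub>quot_module M N\<^esub>"
        by (simp add: add zero M.l_neg)
      then show "\<exists>Y\<in>carrier (quot_module M N). Y \<oplus>\<^bsub>quot_module M N\<^esub> X = \<zero>\<^bsub>quot_module M N\<^esub>"
        using c x by blast
    qed (auto simp: quot_module_carrier add zero M.a_ac)
  qed (auto simp: quot_module_carrier add zero smult M.smult_l_distr M.smult_r_distr M.smult_assoc1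
      M.R.cring_axioms)
  show "(\<lambda>x. N +>\<^bsub>M\<^esub> x) \<in> lin_hom A M (quot_module M N)"
    by (rule lin_homI) (simp_all add: add zero smult c)
qed

lemma quot_proj_eq_zero:
  assumes M: "module A M" and N: "submodule N A M" and "x \<in> N"
  shows "N +>\<^bsub>M\<^esub> x = \<zero>\<^bsub>quot_module M N\<^esub>"
  using abelian_subgroup.a_rcos_const[OF submodule_abelian_subgroup[OF M N] assms(3)]
  by (simp add: quot_module_def)

lemma quot_module_lift:
  assumes M: "module A M" and Q: "module A Q" and N: "submodule N A M" and g: "g \<in> lin_hom A M Q"
    and gN: "\<And>x. x \<in> N \<Longrightarrow> g x = \<zero>\<^bsub>Q\<^esub>"
  obtains h where "h \<in> lin_hom A (quot_module M N) Q"
    and "\<And>x. x \<in> carrier M \<Longrightarrow> h (N +>\<^bsub>M\<^esub> x) = g x"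
proof -
  interpret M: module A M by fact
  interpret N: abelian_subgroup N M by (rule submodule_abelian_subgroup[OF M N])
  interpret g: lin_map A M Q g using M Q g by (rule lin_mapI)
  interpret p: lin_map A M "quot_module M N" "\<lambda>x. N +>\<^bsub>M\<^esub> x"
    using M N by (intro lin_mapI quot_module_structure)
  have eq: "g x = g y" if "x \<in> carrier M" "y \<in> carrier M" "N +>\<^bsub>M\<^esub> x = N +>\<^bsub>M\<^esub> y" for x y
  proof -
    have "y \<in> N +>\<^bsub>M\<^esub> x" using that N.a_repr_independenceD by blast
    then have "y \<oplus>\<^bsub>M\<^esub> \<ominus>\<^bsub>M\<^esub> x \<in> N" using that N.a_rcos_module_imp by blast
    then have "g y \<ominus>\<^bsub>Q\<^esub> g x = \<zero>\<^bsub>Q\<^esub>"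
      using gN that g.map_minus[of y x] by (simp add: a_minus_def)
    then show ?thesis using that by (metis g.N.minus_eq_zero_iff g.map_closed)
  qed
  \<comment> \<open>A representative of the coset is chosen; by \<open>eq\<close> the value of
    \<open>g\<close> does not depend on it.\<close>
  define h where "h X = g (SOME x. x \<in> carrier M \<and> X = N +>\<^bsub>M\<^esub> x)" for X
  have h: "h (N +>\<^bsub>M\<^esub> x) = g x" if "x \<in> carrier M" for x
  proof -
    have "\<exists>y. y \<in> carrier M \<and> N +>\<^bsub>M\<^esub> x = N +>\<^bsub>M\<^esub> y" using that by blast
    from someI_ex[OF this] show ?thesis unfolding h_def using eq that by metis
  qed
  have "h \<in> lin_hom A (quot_module M N) Q"
    by (rule lin_homI)
      (auto simp: quot_module_carrier h p.map_add[symmetric] p.map_smult[symmetric] g.map_add g.map_smult)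
  then show ?thesis using that h by blast
qed

lemma quot_module_span:
  assumes M: "module A M" and N: "submodule N A M" and "S \<subseteq> carrier M" "span_of A M S = carrier M"
  shows "span_of A (quot_module M N) ((\<lambda>x. N +>\<^bsub>M\<^esub> x) ` S) = carrier (quot_module M N)"
proof -
  interpret p: lin_map A M "quot_module M N" "\<lambda>x. N +>\<^bsub>M\<^esub> x"
    using M N by (intro lin_mapI quot_module_structure)
  have sub: "submodule (span_of A (quot_module M N) ((\<lambda>x. N +>\<^bsub>M\<^esub> x) ` S)) A (quot_module M N)"
    using assms(3) by (intro span_of_submodule p.N.module_axioms) auto
  have "N +>\<^bsub>M\<^esub> x \<in> span_of A (quot_module M N) ((\<lambda>x. N +>\<^bsub>M\<^esub> x) ` S)" if "x \<in> carrier M" for x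
  proof (rule span_of_vimage[OF M p.N.module_axioms p.lin_hom sub assms(3)])
    show "N +>\<^bsub>M\<^esub> s \<in> span_of A (quot_module M N) ((\<lambda>x. N +>\<^bsub>M\<^esub> x) ` S)" if "s \<in> S" for s
      using that by (intro subsetD[OF span_of_superset] imageI)
  qed (use assms(4) that in simp)
  then show ?thesis using submodule_subset[OF sub] by (auto simp: quot_module_carrier)
qed

section \<open>Tensor products: bilinearity, universal property, generators\<close>

lemma tensor_rels_subset:
  assumes M: "module A M" and N: "module A N"
  shows "tensor_rels A M N \<subseteq> carrier (free_module A (carrier M \<times> carrier N))"
proof -
  interpret M: module A M by fact
  interpret N: module A N by fact
  note A = M.R.cring_axioms
  interpret P: module A "free_module A (carrier M \<times> carrier N)"
    by (rule free_module_module[OF A])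
  show ?thesis
    unfolding tensor_rels_def Let_def
    by (auto simp del: free_module_simps intro!: P.minus_closed P.a_closed P.smult_closed delta_closed[OF A])
qed

lemma tensor_structure:
  assumes M: "module A M" and N: "module A N"
  shows tensor_module: "module A (tensor A M N)"
    and pure_tensor_closed: "x \<in> carrier M \<Longrightarrow> y \<in> carrier N \<Longrightarrow> pure_tensor A M N x y \<in> carrier (tensor A M N)"
    and pure_tensor_lin_hom1: "y \<in> carrier N \<Longrightarrow> (\<lambda>x. pure_tensor A M N x y) \<in> lin_hom A M (tensor A M N)"
    and pure_tensor_lin_hom2: "x \<in> carrier M \<Longrightarrow> pure_tensor A M N x \<in> lin_hom A N (tensor A M N)"
    and tensor_span: "span_of A (tensor A M N) ((\<lambda>(x, y). pure_tensor A M N x y) ` (carrier M \<times> carrier N))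
      = carrier (tensor A M N)"
proof -
  interpret M: module A M by fact
  interpret N: module A N by fact
  note A = M.R.cring_axioms
  let ?P = "free_module A (carrier M \<times> carrier N)"
  let ?S = "span_of A ?P (tensor_rels A M N)"
  interpret P: module A ?P by (rule free_module_module[OF A])
  have S: "submodule ?S A ?P"
    by (intro span_of_submodule P.module_axioms tensor_rels_subset M N)
  have T: "tensor A M N = quot_module ?P ?S" by (simp add: tensor_def Let_def)
  have pt: "pure_tensor A M N x y = ?S +>\<^bsub>?P\<^esub> delta A (x, y)" for x y
    by (simp add: pure_tensor_def Let_def)
  interpret p: lin_map A ?P "tensor A M N" "\<lambda>x. ?S +>\<^bsub>?P\<^esub> x"
    unfolding T using S by (intro lin_mapI quot_module_structure P.module_axioms)
  show "module A (tensor A M N)" by (rule p.N.module_axioms)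
  show cl: "x \<in> carrier M \<Longrightarrow> y \<in> carrier N \<Longrightarrow> pure_tensor A M N x y \<in> carrier (tensor A M N)" for x y
    unfolding pt by (intro p.map_closed delta_closed[OF A]) auto
  have rel: "?S +>\<^bsub>?P\<^esub> x = ?S +>\<^bsub>?P\<^esub> y"
    if "x \<ominus>\<^bsub>?P\<^esub> y \<in> tensor_rels A M N" "x \<in> carrier ?P" "y \<in> carrier ?P" for x y
  proof -
    have "?S +>\<^bsub>?P\<^esub> (x \<ominus>\<^bsub>?P\<^esub> y) = \<zero>\<^bsub>tensor A M N\<^esub>"
      unfolding T by (intro quot_proj_eq_zero[OF P.module_axioms S] subsetD[OF span_of_superset] that)
    then show ?thesis using that(2,3) by (simp add: p.map_minus p.N.minus_eq_zero_iff)
  qed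
  note d = delta_closed[OF A, of _ "carrier M \<times> carrier N"]
  show "(\<lambda>x. pure_tensor A M N x y) \<in> lin_hom A M (tensor A M N)" if y: "y \<in> carrier N"
  proof (rule lin_homI)
    fix x x' assume x: "x \<in> carrier M" "x' \<in> carrier M"
    have "?S +>\<^bsub>?P\<^esub> delta A (x \<oplus>\<^bsub>M\<^esub> x', y) = ?S +>\<^bsub>?P\<^esub> (delta A (x, y) \<oplus>\<^bsub>?P\<^esub> delta A (x', y))"
      by (intro rel d P.a_closed) (use x y in \<open>simp_all del: free_module_simps add: tensor_rels_def Let_def, blast?\<close>)
    also have "\<dots> = pure_tensor A M N x y \<oplus>\<^bsub>tensor A M N\<^esub> pure_tensor A M N x' y"
      unfolding pt by (intro p.map_add d) (use x y in auto)
    finally show "pure_tensor A M N (x \<oplus>\<^bsub>M\<^esub> x') y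
      = pure_tensor A M N x y \<oplus>\<^bsub>tensor A M N\<^esub> pure_tensor A M N x' y" by (simp add: pt)
  next
    fix a x assume x: "a \<in> carrier A" "x \<in> carrier M"
    have "?S +>\<^bsub>?P\<^esub> delta A (a \<odot>\<^bsub>M\<^esub> x, y) = ?S +>\<^bsub>?P\<^esub> (a \<odot>\<^bsub>?P\<^esub> delta A (x, y))"
      by (intro rel d P.smult_closed) (use x y in \<open>simp_all del: free_module_simps add: tensor_rels_def Let_def, blast?\<close>)
    also have "\<dots> = a \<odot>\<^bsub>tensor A M N\<^esub> pure_tensor A M N x y"
      unfolding pt by (intro p.map_smult d) (use x y in auto)
    finally show "pure_tensor A M N (a \<odot>\<^bsub>M\<^esub> x) y = a \<odot>\<^bsub>tensor A M N\<^esub> pure_tensor A M N x y" by (simp add: pt)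
  qed (use cl y in auto)
  show "pure_tensor A M N x \<in> lin_hom A N (tensor A M N)" if x: "x \<in> carrier M"
  proof (rule lin_homI)
    fix y y' assume y: "y \<in> carrier N" "y' \<in> carrier N"
    have "?S +>\<^bsub>?P\<^esub> delta A (x, y \<oplus>\<^bsub>N\<^esub> y') = ?S +>\<^bsub>?P\<^esub> (delta A (x, y) \<oplus>\<^bsub>?P\<^esub> delta A (x, y'))"
      by (intro rel d P.a_closed) (use x y in \<open>simp_all del: free_module_simps add: tensor_rels_def Let_def, blast?\<close>)
    also have "\<dots> = pure_tensor A M N x y \<oplus>\<^bsub>tensor A M N\<^esub> pure_tensor A M N x y'"
      unfolding pt by (intro p.map_add d) (use x y in auto)
    finally show "pure_tensor A M N x (y \<oplus>\<^bsub>N\<^esub> y')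
      = pure_tensor A M N x y \<oplus>\<^bsub>tensor A M N\<^esub> pure_tensor A M N x y'" by (simp add: pt)
  next
    fix a y assume y: "a \<in> carrier A" "y \<in> carrier N"
    have "?S +>\<^bsub>?P\<^esub> delta A (x, a \<odot>\<^bsub>N\<^esub> y) = ?S +>\<^bsub>?P\<^esub> (a \<odot>\<^bsub>?P\<^esub> delta A (x, y))"
      by (intro rel d P.smult_closed) (use x y in \<open>simp_all del: free_module_simps add: tensor_rels_def Let_def, blast?\<close>)
    also have "\<dots> = a \<odot>\<^bsub>tensor A M N\<^esub> pure_tensor A M N x y"
      unfolding pt by (intro p.map_smult d) (use x y in auto)
    finally show "pure_tensor A M N x (a \<odot>\<^bsub>N\<^esub> y) = a \<odot>\<^bsub>tensor A M N\<^esub> pure_tensor A M N x y" by (simp add: pt)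
  qed (use cl x in auto)
  have "(\<lambda>(x, y). pure_tensor A M N x y) ` (carrier M \<times> carrier N)
    = (\<lambda>x. ?S +>\<^bsub>?P\<^esub> x) ` delta A ` (carrier M \<times> carrier N)"
    by (auto simp: pt image_image)
  moreover have "span_of A (quot_module ?P ?S) ((\<lambda>x. ?S +>\<^bsub>?P\<^esub> x) ` delta A ` (carrier M \<times> carrier N)) = carrier (quot_module ?P ?S)"
    using d by (intro quot_module_span[OF P.module_axioms S] free_module_span_delta[OF A]) auto
  ultimately show "span_of A (tensor A M N) ((\<lambda>(x, y). pure_tensor A M N x y) ` (carrier M \<times> carrier N))
      = carrier (tensor A M N)" by (simp add: T)
qed

text \<open>The linear extension of \<open>b\<close> to the free module on all pairs kills the four
  families of relations, since each of them is additivity or homogeneity in one slot; it therefore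
  descends to the quotient.\<close>

lemma tensor_lift:
  assumes M: "module A M" and N: "module A N" and Q: "module A Q"
    and b1: "\<And>y. y \<in> carrier N \<Longrightarrow> (\<lambda>x. b x y) \<in> lin_hom A M Q"
    and b2: "\<And>x. x \<in> carrier M \<Longrightarrow> b x \<in> lin_hom A N Q"
  obtains h where "h \<in> lin_hom A (tensor A M N) Q"
    and "\<And>x y. x \<in> carrier M \<Longrightarrow> y \<in> carrier N \<Longrightarrow> h (pure_tensor A M N x y) = b x y"
proof -
  interpret M: module A M by fact
  interpret N: module A N by fact
  interpret Q: module A Q by fact
  note A = M.R.cring_axioms
  let ?P = "free_module A (carrier M \<times> carrier N)"
  let ?S = "span_of A ?P (tensor_rels A M N)"
  interpret P: module A ?P by (rule free_module_module[OF A])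
  have S: "submodule ?S A ?P"
    by (intro span_of_submodule P.module_axioms tensor_rels_subset M N)
  define G where "G = (\<lambda>(x, y). b x y)"
  have G: "G \<in> carrier M \<times> carrier N \<rightarrow> carrier Q"
    using b2 by (auto simp: G_def intro: lin_hom_closed)
  define g where "g c = lin_comb A Q (carrier M \<times> carrier N) c G" for c
  interpret g: lin_map A ?P Q g
    unfolding g_def using G by (intro lin_mapI P.module_axioms Q lin_comb_lin_hom)
  note d = delta_closed[OF A, of _ "carrier M \<times> carrier N"]
  have gd: "g (delta A (x, y)) = b x y" if "x \<in> carrier M" "y \<in> carrier N" for x y
    unfolding g_def using that by (subst lin_comb_delta[OF Q G]) (auto simp: G_def)
  have "g x \<in> {\<zero>\<^bsub>Q\<^esub>}" if "x \<in> ?S" for x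
  proof (rule span_of_vimage[OF P.module_axioms Q g.lin_hom submodule_singleton_zero[OF Q] tensor_rels_subset[OF M N] _ that])
    fix s assume s: "s \<in> tensor_rels A M N"
    have bc: "b x y \<in> carrier Q" if "x \<in> carrier M" "y \<in> carrier N" for x y
      using b2 that by (auto intro: lin_hom_closed)
    have zero: "z \<ominus>\<^bsub>Q\<^esub> z = \<zero>\<^bsub>Q\<^esub>" if "z \<in> carrier Q" for z using that by (simp add: Q.minus_eq_zero_iff)
    show "g s \<in> {\<zero>\<^bsub>Q\<^esub>}"
      using s unfolding tensor_rels_def Let_def
      by (auto simp del: free_module_simps simp: g.map_minus g.map_add g.map_smult d P.a_closed gd bc zero
          lin_hom_add[OF b1] lin_hom_add[OF b2] lin_hom_smult[OF b1] lin_hom_smult[OF b2])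
  qed
  then obtain h where "h \<in> lin_hom A (quot_module ?P ?S) Q"
    and "\<And>x. x \<in> carrier ?P \<Longrightarrow> h (?S +>\<^bsub>?P\<^esub> x) = g x"
    using quot_module_lift[OF P.module_axioms Q S g.lin_hom] by blast
  then show ?thesis using that[of h] by (simp add: tensor_def pure_tensor_def Let_def gd d)
qed

text \<open>The factors are treated one after the other: with a generator fixed on the left, the
  right factor runs through a preimage of the span, and then the roles are exchanged.\<close>

lemma tensor_span_generators:
  assumes M: "module A M" and N: "module A N"
    and S: "S \<subseteq> carrier M" "span_of A M S = carrier M" and T: "T \<subseteq> carrier N" "span_of A N T = carrier N"
  shows "span_of A (tensor A M N) ((\<lambda>(x, y). pure_tensor A M N x y) ` (S \<times> T)) = carrier (tensor A M N)"
proof -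
  note tm = tensor_module[OF M N]
  let ?G = "(\<lambda>(x, y). pure_tensor A M N x y) ` (S \<times> T)"
  have G: "?G \<subseteq> carrier (tensor A M N)"
    using S(1) T(1) pure_tensor_closed[OF M N] by auto
  have sub: "submodule (span_of A (tensor A M N) ?G) A (tensor A M N)"
    by (rule span_of_submodule[OF tm G])
  have 1: "pure_tensor A M N x y \<in> span_of A (tensor A M N) ?G" if "x \<in> S" "y \<in> carrier N" for x y
  proof (rule span_of_vimage[OF N tm pure_tensor_lin_hom2[OF M N] sub T(1)])
    show "pure_tensor A M N x t \<in> span_of A (tensor A M N) ?G" if "t \<in> T" for t
      using that \<open>x \<in> S\<close> by (intro subsetD[OF span_of_superset]) auto
  qed (use S T that in auto)
  have 2: "pure_tensor A M N x y \<in> span_of A (tensor A M N) ?G" if "x \<in> carrier M" "y \<in> carrier N" for x y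
    using S that 1 by (auto intro: span_of_vimage[OF M tm pure_tensor_lin_hom1[OF M N] sub S(1)])
  have "carrier (tensor A M N) \<subseteq> span_of A (tensor A M N) ?G"
    unfolding tensor_span[OF M N, symmetric] using 2 by (intro span_of_least sub) auto
  then show ?thesis using submodule_subset[OF sub] by auto
qed

section \<open>Signs\<close>

text \<open>The sign of moving \<open>a\<close> to the front of the increasing wedge of
  \<open>B\<close>; whether \<open>a\<close> itself belongs to \<open>B\<close> does not affect
  it.\<close>

definition pos_sign :: "nat \<Rightarrow> nat set \<Rightarrow> int" where
  "pos_sign a B = (- 1) ^ card {b \<in> B. b < a}"

lemma pos_sign_insert_self [simp]: "pos_sign a (insert a B) = pos_sign a B"
proof -
  have "{b \<in> insert a B. b < a} = {b \<in> B. b < a}" by auto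
  then show ?thesis by (simp add: pos_sign_def)
qed

lemma pos_sign_remove_self [simp]: "pos_sign a (B - {a}) = pos_sign a B"
proof -
  have "{b \<in> B - {a}. b < a} = {b \<in> B. b < a}" by auto
  then show ?thesis by (simp add: pos_sign_def)
qed

lemma pos_sign_remove_greater: "a < b \<Longrightarrow> pos_sign a (B - {b}) = pos_sign a B"
proof -
  assume "a < b"
  then have "{x \<in> B - {b}. x < a} = {x \<in> B. x < a}" by auto
  then show ?thesis by (simp add: pos_sign_def)
qed

lemma pos_sign_remove_less:
  assumes "finite B" "a \<in> B" "a < b" shows "pos_sign b (B - {a}) = - pos_sign b B"
proof -
  have "{x \<in> B. x < b} = insert a {x \<in> B - {a}. x < b}" using assms by auto
  moreover have "finite {x \<in> B - {a}. x < b}" using assms by auto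
  ultimately show ?thesis by (simp add: pos_sign_def)
qed

text \<open>Deleting the larger of two elements leaves the position of the smaller unchanged,
  whereas deleting the smaller shifts the larger by one. This single sign is the source of all
  squares that vanish and of all differentials that anticommute.\<close>

lemma pos_sign_swap:
  assumes "finite B" "a \<in> B" "b \<in> B" "a \<noteq> b"
  shows "pos_sign a B * pos_sign b (B - {a}) = - (pos_sign b B * pos_sign a (B - {b}))"
  using assms
  by (cases a b rule: linorder_cases) (simp_all add: pos_sign_remove_greater pos_sign_remove_less)

lemma pos_sign_least: "(\<And>b. b \<in> B \<Longrightarrow> a \<le> b) \<Longrightarrow> pos_sign a B = 1"
proof -
  assume "\<And>b. b \<in> B \<Longrightarrow> a \<le> b"
  then have "{b \<in> B. b < a} = {}" by force
  then show ?thesis unfolding pos_sign_def by (simp only: card.empty power_0)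
qed

text \<open>For a distinct list this is \<open>-1\<close> to the number of inversions, that is, the
  sign of the permutation sorting it. The recursion peels off the head because the head contributes
  exactly its position in the underlying set.\<close>

fun list_sign :: "nat list \<Rightarrow> int" where
  "list_sign [] = 1"
| "list_sign (a # L) = pos_sign a (set L) * list_sign L"

lemma list_sign_swap_Cons:
  assumes "a \<noteq> b" "a \<notin> set L" "b \<notin> set L"
  shows "list_sign (a # b # L) = - list_sign (b # a # L)"
proof -
  let ?B = "insert a (insert b (set L))"
  have "?B - {a} = insert b (set L)" "?B - {b} = insert a (set L)" using assms by auto
  then have "pos_sign a ?B * pos_sign b (insert b (set L))
    = - (pos_sign b ?B * pos_sign a (insert a (set L)))"
    using pos_sign_swap[of ?B a b] assms by auto
  moreover have "pos_sign b ?B = pos_sign b (insert a (set L))"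
    by (simp add: insert_commute[of a b])
  ultimately show ?thesis by (simp add: algebra_simps)
qed

text \<open>Each step of \<open>a\<close> past a neighbour on its way to the front flips the sign
  once.\<close>

lemma list_sign_move:
  "distinct (P @ a # Q) \<Longrightarrow> list_sign (P @ a # Q) = (- 1) ^ length P * list_sign (a # P @ Q)"
proof (induction P)
  case (Cons p P)
  have "list_sign ((p # P) @ a # Q) = (- 1) ^ length P * list_sign (p # a # P @ Q)"
    using Cons by simp
  also have "list_sign (p # a # P @ Q) = - list_sign (a # p # P @ Q)"
    using Cons by (intro list_sign_swap_Cons) auto
  finally show ?case by simp
qed simp

lemma list_sign_sorted: "sorted L \<Longrightarrow> list_sign L = 1"
  by (induction L) (auto intro: pos_sign_least)

lemma list_sign_transpose:
  assumes "distinct L" "a \<in> set L" "b \<in> set L" "a \<noteq> b"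
  shows "list_sign (map (Transposition.transpose a b) L) = - list_sign L"
proof -
  have *: "list_sign (P @ b # Q @ a # R) = - list_sign (P @ a # Q @ b # R)"
    if "distinct (P @ a # Q @ b # R)" for P Q R a b
  proof -
    \<comment> \<open>Both entries are brought to the front, where
      \<open>list_sign_swap_Cons\<close> exchanges them. The power of \<open>-1\<close> spent on the
      way is the same for both orders and cancels.\<close>
    have "list_sign (P @ a # Q @ b # R)
        = (- 1) ^ length P * ((- 1) ^ (Suc (length P + length Q)) * list_sign (b # a # P @ Q @ R))"
      if "distinct (P @ a # Q @ b # R)" for a b
      using list_sign_move[of P a "Q @ b # R"] list_sign_move[of "a # P @ Q" b R] that by auto
    from this[of a b] this[of b a] show ?thesis
      using that list_sign_swap_Cons[of a b "P @ Q @ R"] by auto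
  qed
  have **: "map (Transposition.transpose a b) (P @ a # Q @ b # R) = P @ b # Q @ a # R"
    if "distinct (P @ a # Q @ b # R)" for P Q R a b
  proof -
    have "map (Transposition.transpose a b) X = X" if "a \<notin> set X" "b \<notin> set X" for X
      using that by (induction X) auto
    then show ?thesis using that by auto
  qed
  obtain P Q where PQ: "L = P @ a # Q" using assms(2) by (auto dest: split_list)
  show ?thesis
  proof (cases "b \<in> set Q")
    case True
    then obtain Q' R where "Q = Q' @ b # R" by (auto dest: split_list)
    then have L: "L = P @ a # Q' @ b # R" using PQ by simp
    have d: "distinct (P @ a # Q' @ b # R)" using assms(1) unfolding L .
    show ?thesis unfolding L **[OF d] using *[OF d] .
  next
    case False
    then obtain P' R where "P = P' @ b # R" using assms PQ by (auto dest: split_list)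
    then have L: "L = P' @ b # R @ a # Q" using PQ by simp
    have d: "distinct (P' @ b # R @ a # Q)" using assms(1) unfolding L .
    show ?thesis
      unfolding L transpose_commute[of a b] **[OF d] using *[OF d] .
  qed
qed

text \<open>Every permutation of a finite set is built from transpositions, and each of these flips
  both signs. This links the sign of a column as a list to the sign in the alternating
  relation.\<close>

lemma list_sign_map_permutes:
  assumes "\<sigma> permutes set L" "distinct L"
  shows "list_sign (map \<sigma> L) = sign \<sigma> * list_sign L"
  using assms(1) finite_set
proof (induction rule: permutes_induct)
  case (swap a b p)
  have "set (map p L) = set L" "distinct (map p L)"
    using swap assms(2) by (auto simp: permutes_image distinct_map permutes_inj_on)
  moreover have "sign (Transposition.transpose a b \<circ> p) = sign (Transposition.transpose a b) * sign p"
    using swap by (intro sign_compose permutation_swap_id) (auto simp: permutation_permutes)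
  ultimately show ?case
    using swap list_sign_transpose[of "map p L" a b]
    by (simp only: map_map[symmetric] sign_swap_id) simp
qed simp_all

section \<open>Koszul differentials\<close>

text \<open>The ordered pairs \<open>(a, b)\<close> and \<open>(b, a)\<close> cancel. The diagonal
  is left out of the sum, and the induction adds a row and a column at a time, so halving is avoided
  and 2 may be a zero divisor.\<close>

lemma (in abelian_group) finsum_antisymmetric:
  assumes "finite B" "\<And>a b. a \<in> B \<Longrightarrow> b \<in> B \<Longrightarrow> a \<noteq> b \<Longrightarrow> g a b \<in> carrier G"
    and "\<And>a b. a \<in> B \<Longrightarrow> b \<in> B \<Longrightarrow> a \<noteq> b \<Longrightarrow> g a b = \<ominus> g b a"
  shows "(\<Oplus>a\<in>B. \<Oplus>b\<in>B - {a}. g a b) = \<zero>"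
  using assms
proof (induction B rule: finite_induct)
  case (insert x B)
  have c: "g a b \<in> carrier G" if "a \<in> insert x B" "b \<in> insert x B" "a \<noteq> b" for a b
    using insert.prems(1) that by blast
  have c': "(\<lambda>b. g x b) \<in> B \<rightarrow> carrier G" "(\<lambda>a. g a x) \<in> B \<rightarrow> carrier G"
    "\<And>a. a \<in> B \<Longrightarrow> (\<lambda>b. g a b) \<in> B - {a} \<rightarrow> carrier G"
    using c insert.hyps(2) by (auto intro!: c)
  have c'': "(\<Oplus>b\<in>B - {a}. g a b) \<in> carrier G" if "a \<in> B" for a
    using c'(3)[OF that] by (rule finsum_closed)
  have "(\<Oplus>b\<in>insert x B - {a}. g a b) = g a x \<oplus> (\<Oplus>b\<in>B - {a}. g a b)" if "a \<in> B" for a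
  proof -
    have "insert x B - {a} = insert x (B - {a})" using that insert.hyps by auto
    moreover have "g a x \<in> carrier G" using that insert.hyps by (intro c) auto
    ultimately show ?thesis
      using that insert.hyps c'(3)[OF that] finsum_insert[of "B - {a}" x "g a"] by simp
  qed
  then have "(\<Oplus>a\<in>B. \<Oplus>b\<in>insert x B - {a}. g a b) = (\<Oplus>a\<in>B. g a x \<oplus> (\<Oplus>b\<in>B - {a}. g a b))"
    using c' c'' by (intro finsum_cong) (auto simp: simp_implies_def intro!: a_closed)
  also have "\<dots> = (\<Oplus>a\<in>B. g a x) \<oplus> (\<Oplus>a\<in>B. \<Oplus>b\<in>B - {a}. g a b)"
    using c' c'' by (intro finsum_addf) auto
  also have "(\<Oplus>a\<in>B. \<Oplus>b\<in>B - {a}. g a b) = \<zero>"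
    using insert by blast
  finally have 1: "(\<Oplus>a\<in>B. \<Oplus>b\<in>insert x B - {a}. g a b) = (\<Oplus>a\<in>B. g a x)"
    using c' by (simp add: finsum_closed)
  have e1: "(\<Oplus>b\<in>insert x B - {x}. g x b) = (\<Oplus>b\<in>B. g x b)"
    using insert.hyps(2) by (simp add: insert_Diff_if)
  \<comment> \<open>The new row and the new column cancel term by term.\<close>
  have "(\<Oplus>a\<in>B. g a x \<oplus> g x a) = (\<Oplus>a\<in>B. \<zero>)"
  proof (intro finsum_cong')
    fix a assume a: "a \<in> B"
    then have "g a x = \<ominus> g x a" "g x a \<in> carrier G"
      using insert.prems(2)[of a x] insert.hyps(2) c'(1) by auto
    then show "g a x \<oplus> g x a = \<zero>" by (simp add: l_neg)
  qed auto
  then have e2: "(\<Oplus>a\<in>B. g a x) \<oplus> (\<Oplus>a\<in>B. g x a) = \<zero>"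
    using c' by (simp add: finsum_addf)
  have e3: "(\<Oplus>a\<in>insert x B. \<Oplus>b\<in>insert x B - {a}. g a b)
    = (\<Oplus>b\<in>insert x B - {x}. g x b) \<oplus> (\<Oplus>a\<in>B. \<Oplus>b\<in>insert x B - {a}. g a b)"
  proof (rule finsum_insert[OF insert.hyps])
    have "g a b \<in> carrier G" if "a \<in> insert x B" "b \<in> insert x B - {a}" for a b
      using that by (intro c) auto
    then have "(\<Oplus>b\<in>insert x B - {a}. g a b) \<in> carrier G" if "a \<in> insert x B" for a
      using that by (intro finsum_closed funcsetI)
    from this this[of x] show "(\<lambda>a. \<Oplus>b\<in>insert x B - {a}. g a b) \<in> B \<rightarrow> carrier G"
      "(\<Oplus>b\<in>insert x B - {x}. g x b) \<in> carrier G" by blast+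
  qed
  have e4: "(\<Oplus>b\<in>B. g x b) \<oplus> (\<Oplus>a\<in>B. g a x) = (\<Oplus>a\<in>B. g a x) \<oplus> (\<Oplus>b\<in>B. g x b)"
    by (intro a_comm finsum_closed c')
  show ?case unfolding e3 e1 1 e4 by (rule e2)
next
  case empty
  show ?case by simp
qed

text \<open>The Koszul differential on \<open>\<Lambda> \<otimes> Z\<close>, where \<open>\<Lambda>\<close> is the exterior algebra on the natural
  numbers and \<open>Z\<close> is free on a set on which each number \<open>a\<close> acts by \<open>\<tau> a\<close>. The basis vector
  \<open>(B, z)\<close> stands for the wedge of the elements of \<open>B\<close> in increasing order, tensored with \<open>z\<close>.\<close>

abbreviation exterior_module :: "('a, 'r) ring_scheme \<Rightarrow> ('a, nat set \<times> 'z \<Rightarrow> 'a) module" where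
  "exterior_module A \<equiv> free_module A UNIV"

definition koszul :: "('a, 'r) ring_scheme \<Rightarrow> (nat \<Rightarrow> 'z \<Rightarrow> 'z) \<Rightarrow>
    (nat set \<times> 'z \<Rightarrow> 'a) \<Rightarrow> nat set \<times> 'z \<Rightarrow> 'a" where
  "koszul A \<tau> f = lin_comb A (exterior_module A) UNIV f (\<lambda>(B, z).
     \<Oplus>\<^bsub>exterior_module A\<^esub>a\<in>B. [pos_sign a B] \<cdot>\<^bsub>exterior_module A\<^esub> delta A (B - {a}, \<tau> a z))"

text \<open>The wedge of the entries in the order of \<open>L\<close>, rewritten in the basis of
  increasing wedges. This reading requires \<open>L\<close> to be distinct.\<close>

definition wedge :: "('a, 'r) ring_scheme \<Rightarrow> nat list \<Rightarrow> 'z \<Rightarrow> nat set \<times> 'z \<Rightarrow> 'a" where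
  "wedge A L z = [list_sign L] \<cdot>\<^bsub>exterior_module A\<^esub> delta A (set L, z)"

text \<open>Wedging with the chosen element from the left. The value is zero when that element
  already occurs in \<open>B\<close>, and there is no sign because the element is going to be the
  least one, hence the first factor.\<close>

definition koszul_htpy :: "('a, 'r) ring_scheme \<Rightarrow> (nat set \<Rightarrow> 'z \<Rightarrow> nat) \<Rightarrow> (nat \<Rightarrow> 'z \<Rightarrow> 'z) \<Rightarrow>
    (nat set \<times> 'z \<Rightarrow> 'a) \<Rightarrow> nat set \<times> 'z \<Rightarrow> 'a" where
  "koszul_htpy A w \<sigma> f = lin_comb A (exterior_module A) UNIV f (\<lambda>(B, z).
     if w B z \<in> B then \<zero>\<^bsub>exterior_module A\<^esub> else delta A (insert (w B z) B, \<sigma> (w B z) z))"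

section \<open>Squares, anticommutation and list form of Koszul differentials\<close>

context
  fixes A :: "('a, 'r) ring_scheme"
  assumes A: "cring A"
begin

interpretation P: module A "exterior_module A :: ('a, nat set \<times> 'z \<Rightarrow> 'a) module"
  by (rule free_module_module[OF A])

lemma delta_UNIV_closed: "delta A b \<in> carrier (free_module A UNIV)"
  by (rule delta_closed[OF A UNIV_I])

lemma koszul_lin_hom: "koszul A \<tau> \<in> lin_hom A (exterior_module A) (exterior_module A)"
  unfolding koszul_def
  by (intro lin_comb_lin_hom P.module_axioms) (auto intro!: P.finsum_closed P.add.int_pow_closed delta_UNIV_closed)

lemma koszul_delta: "koszul A \<tau> (delta A (B, z))
    = (\<Oplus>\<^bsub>exterior_module A\<^esub>a\<in>B. [pos_sign a B] \<cdot>\<^bsub>exterior_module A\<^esub> delta A (B - {a}, \<tau> a z))"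
  unfolding koszul_def
  by (subst lin_comb_delta[OF P.module_axioms])
    (auto intro!: P.finsum_closed P.add.int_pow_closed delta_UNIV_closed)

interpretation K: lin_map A "exterior_module A" "exterior_module A" "koszul A \<tau>"
  by (intro lin_mapI P.module_axioms koszul_lin_hom)

text \<open>Two possibly different differentials are allowed, so that the same expansion serves both
  for squares and for mixed composites.\<close>

lemma koszul_koszul_delta:
  assumes "finite B"
  shows "koszul A \<tau>' (koszul A \<tau> (delta A (B, z))) = (\<Oplus>\<^bsub>exterior_module A\<^esub>a\<in>B. \<Oplus>\<^bsub>exterior_module A\<^esub>b\<in>B - {a}.
    [(pos_sign a B * pos_sign b (B - {a}))] \<cdot>\<^bsub>exterior_module A\<^esub> delta A (B - {a} - {b}, \<tau>' b (\<tau> a z)))"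
proof -
  have "koszul A \<tau>' ([pos_sign a B] \<cdot>\<^bsub>exterior_module A\<^esub> delta A (B - {a}, \<tau> a z))
    = (\<Oplus>\<^bsub>exterior_module A\<^esub>b\<in>B - {a}.
    [(pos_sign a B * pos_sign b (B - {a}))] \<cdot>\<^bsub>exterior_module A\<^esub> delta A (B - {a} - {b}, \<tau>' b (\<tau> a z)))" for a
  proof -
    have pow: "(\<lambda>x. [pos_sign a B] \<cdot>\<^bsub>exterior_module A\<^esub> x) \<in> lin_hom A (exterior_module A) (exterior_module A)"
      by (intro lin_hom_int_pow P.module_axioms lin_homI) auto
    interpret pow: lin_map A "exterior_module A" "exterior_module A" "\<lambda>x. [pos_sign a B] \<cdot>\<^bsub>exterior_module A\<^esub> x"
      by (intro lin_mapI P.module_axioms pow)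
    show ?thesis
      by (simp only: K.map_int_pow delta_UNIV_closed koszul_delta)
        (subst pow.map_finsum, auto simp: P.add.int_pow_pow delta_UNIV_closed mult.commute intro!: P.add.int_pow_closed)
  qed
  then show ?thesis
    by (subst koszul_delta, subst K.map_finsum)
      (auto intro!: P.add.int_pow_closed delta_UNIV_closed)
qed

text \<open>Exchanging the two removed elements keeps the basis vector, as the actions commute, and
  flips the sign by \<open>pos_sign_swap\<close>.\<close>

lemma koszul_square:
  assumes "\<And>a b z. \<tau> a (\<tau> b z) = \<tau> b (\<tau> a z)" "x \<in> carrier (free_module A {(B, z). finite B})"
  shows "koszul A \<tau> (koszul A \<tau> x) = \<zero>\<^bsub>exterior_module A\<^esub>"
proof -
  have sub: "submodule (carrier (free_module A {(B, z). finite B})) A (exterior_module A)"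
    by (intro free_module_submodule A) auto
  have *: "koszul A \<tau> (koszul A \<tau> (delta A (B, z))) = \<zero>\<^bsub>exterior_module A\<^esub>" if "finite B" for B z
    unfolding koszul_koszul_delta[OF that]
  proof (rule P.finsum_antisymmetric[OF that])
    fix a b assume ab: "a \<in> B" "b \<in> B" "a \<noteq> b"
    have 1: "B - {b} - {a} = B - {a} - {b}" by auto
    show "[(pos_sign a B * pos_sign b (B - {a}))] \<cdot>\<^bsub>exterior_module A\<^esub> delta A (B - {a} - {b}, \<tau> b (\<tau> a z))
      = \<ominus>\<^bsub>exterior_module A\<^esub> ([(pos_sign b B * pos_sign a (B - {b}))]
        \<cdot>\<^bsub>exterior_module A\<^esub> delta A (B - {b} - {a}, \<tau> a (\<tau> b z)))"
      unfolding 1 assms(1)[of a b] pos_sign_swap[OF that ab] by (rule P.add.int_pow_neg) (rule delta_UNIV_closed)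
  qed (intro P.add.int_pow_closed delta_UNIV_closed)
  show ?thesis
    by (rule lin_hom_free_eq_on[where f = "\<lambda>x. koszul A \<tau> (koszul A \<tau> x)"
          and g = "\<lambda>x. \<zero>\<^bsub>exterior_module A\<^esub>", OF P.module_axioms _ P.zero_lin_hom _ assms(2)])
      (auto simp del: free_module_simps simp: * intro!: lin_hom_comp[OF koszul_lin_hom koszul_lin_hom])
qed

text \<open>A single mixed composite is not antisymmetric in the two removed elements, because the
  actions \<open>\<tau>\<close> and \<open>\<tau>'\<close> trade places. Only the sum of both
  composites is, so the summands are merged before cancellation.\<close>

lemma koszul_anticommute:
  assumes "\<And>a b z. \<tau> a (\<tau>' b z) = \<tau>' b (\<tau> a z)" "x \<in> carrier (free_module A {(B, z). finite B})"
  shows "koszul A \<tau> (koszul A \<tau>' x) = \<ominus>\<^bsub>exterior_module A\<^esub> koszul A \<tau>' (koszul A \<tau> x)"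
proof -
  note d = delta_UNIV_closed P.add.int_pow_closed
  have *: "koszul A \<tau> (koszul A \<tau>' (delta A (B, z))) \<oplus>\<^bsub>exterior_module A\<^esub> koszul A \<tau>' (koszul A \<tau> (delta A (B, z)))
     = \<zero>\<^bsub>exterior_module A\<^esub>" if "finite B" for B z
  proof -
    have eq: "koszul A \<tau> (koszul A \<tau>' (delta A (B, z))) \<oplus>\<^bsub>exterior_module A\<^esub> koszul A \<tau>' (koszul A \<tau> (delta A (B, z)))
      = (\<Oplus>\<^bsub>exterior_module A\<^esub>a\<in>B. \<Oplus>\<^bsub>exterior_module A\<^esub>b\<in>B - {a}.
          [(pos_sign a B * pos_sign b (B - {a}))] \<cdot>\<^bsub>exterior_module A\<^esub> (delta A (B - {a} - {b}, \<tau> b (\<tau>' a z))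
          \<oplus>\<^bsub>exterior_module A\<^esub> delta A (B - {a} - {b}, \<tau>' b (\<tau> a z))))"
      unfolding koszul_koszul_delta[OF that]
      apply (subst P.finsum_addf[symmetric])
        apply (auto intro!: P.finsum_closed d)[2]
      apply (rule P.finsum_cong')
        apply (auto intro!: P.finsum_closed d P.a_closed simp del: free_module_simps)[2]
      apply (subst P.finsum_addf[symmetric])
        apply (auto intro!: P.finsum_closed d)[2]
      apply (rule P.finsum_cong')
        apply (auto intro!: P.finsum_closed d P.a_closed simp del: free_module_simps)[2]
      apply (rule P.add.int_pow_distrib[symmetric])
      apply (rule d)+
      done
    show ?thesis unfolding eq
    proof (rule P.finsum_antisymmetric[OF that])
      fix a b assume ab: "a \<in> B" "b \<in> B" "a \<noteq> b"
      have 1: "B - {b} - {a} = B - {a} - {b}" by auto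
      show "[(pos_sign a B * pos_sign b (B - {a}))] \<cdot>\<^bsub>exterior_module A\<^esub> (delta A (B - {a} - {b}, \<tau> b (\<tau>' a z))
          \<oplus>\<^bsub>exterior_module A\<^esub> delta A (B - {a} - {b}, \<tau>' b (\<tau> a z)))
        = \<ominus>\<^bsub>exterior_module A\<^esub> ([(pos_sign b B * pos_sign a (B - {b}))] \<cdot>\<^bsub>exterior_module A\<^esub> (delta A (B - {b} - {a}, \<tau> a (\<tau>' b z))
          \<oplus>\<^bsub>exterior_module A\<^esub> delta A (B - {b} - {a}, \<tau>' a (\<tau> b z))))"
        unfolding 1 assms(1) pos_sign_swap[OF that ab]
        by (subst P.a_comm, (rule d)+) (intro P.add.int_pow_neg P.a_closed d)
    qed (intro d P.a_closed)
  qed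
  have "koszul A \<tau> (koszul A \<tau>' x) \<oplus>\<^bsub>exterior_module A\<^esub> koszul A \<tau>' (koszul A \<tau> x) = \<zero>\<^bsub>exterior_module A\<^esub>"
    by (rule lin_hom_free_eq_on[where g = "\<lambda>x. \<zero>\<^bsub>exterior_module A\<^esub>"
          and f = "\<lambda>x. koszul A \<tau> (koszul A \<tau>' x) \<oplus>\<^bsub>exterior_module A\<^esub> koszul A \<tau>' (koszul A \<tau> x)",
        OF P.module_axioms _ P.zero_lin_hom _ assms(2)])
      (auto simp del: free_module_simps simp: *
        intro!: lin_hom_comp[OF koszul_lin_hom koszul_lin_hom] lin_hom_plus[OF P.module_axioms])
  moreover have "x \<in> carrier (exterior_module A)"
    using assms(2) free_module_mono[of "{(B, z). finite B}" UNIV A] by auto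
  ultimately show ?thesis
    by (simp del: free_module_simps add: P.minus_equality[symmetric])
qed

lemma koszul_closed:
  assumes "\<And>B z a. (B, z) \<in> Y \<Longrightarrow> a \<in> B \<Longrightarrow> (B - {a}, \<tau> a z) \<in> Y'" "x \<in> carrier (free_module A Y)"
  shows "koszul A \<tau> x \<in> carrier (free_module A Y')"
proof -
  have sub: "submodule (carrier (free_module A Y')) A (exterior_module A)"
    by (intro free_module_submodule A) auto
  show ?thesis unfolding koszul_def
  proof (rule lin_comb_in_submodule[OF P.module_axioms sub assms(2)])
    fix b assume "b \<in> Y"
    then show "(case b of (B, z) \<Rightarrow> \<Oplus>\<^bsub>exterior_module A\<^esub>a\<in>B.
        [pos_sign a B] \<cdot>\<^bsub>exterior_module A\<^esub> delta A (B - {a}, \<tau> a z)) \<in> carrier (free_module A Y')"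
      using assms(1)
      by (cases b) (auto intro!: submodule_finsum[OF P.module_axioms sub]
        submodule_int_pow[OF P.module_axioms sub] delta_closed[OF A])
  qed auto
qed

lemma wedge_closed: "(set L, z) \<in> Y \<Longrightarrow> wedge A L z \<in> carrier (free_module A Y)"
  unfolding wedge_def
  by (intro submodule_int_pow[OF P.module_axioms] free_module_submodule A delta_closed) auto

text \<open>The usual alternating formula for factors in arbitrary order. Sorting after the removal
  of the factor at position \<open>j\<close> differs from sorting before it by \<open>(-1)^j\<close>
  times the position sign of that factor, and this position sign occurs twice.\<close>

lemma koszul_wedge:
  assumes "distinct L"
  shows "koszul A \<tau> (wedge A L z) = (\<Oplus>\<^bsub>exterior_module A\<^esub>j\<in>{..<length L}.
    [((- 1 :: int) ^ j)] \<cdot>\<^bsub>exterior_module A\<^esub> wedge A (take j L @ drop (Suc j) L) (\<tau> (L ! j) z))"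
proof -
  note d = delta_UNIV_closed P.add.int_pow_closed
  have pow: "(\<lambda>x. [list_sign L] \<cdot>\<^bsub>exterior_module A\<^esub> x) \<in> lin_hom A (exterior_module A) (exterior_module A)"
    by (intro lin_hom_int_pow P.module_axioms lin_homI) auto
  interpret pow: lin_map A "exterior_module A" "exterior_module A" "\<lambda>x. [list_sign L] \<cdot>\<^bsub>exterior_module A\<^esub> x"
    by (intro lin_mapI P.module_axioms pow)
  have inj: "inj_on ((!) L) {..<length L}" using assms by (auto simp: inj_on_def nth_eq_iff_index_eq)
  have img: "(!) L ` {..<length L} = set L" by (auto simp: set_conv_nth)
  have summand: "[list_sign L] \<cdot>\<^bsub>exterior_module A\<^esub> ([pos_sign (L ! j) (set L)] \<cdot>\<^bsub>exterior_module A\<^esub>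
      delta A (set L - {L ! j}, \<tau> (L ! j) z))
    = [((- 1 :: int) ^ j)] \<cdot>\<^bsub>exterior_module A\<^esub> wedge A (take j L @ drop (Suc j) L) (\<tau> (L ! j) z)" if "j < length L" for j
  proof -
    let ?L = "take j L @ drop (Suc j) L"
    have L: "L = take j L @ L ! j # drop (Suc j) L" using that by (rule id_take_nth_drop)
    have s: "distinct (take j L @ L ! j # drop (Suc j) L)"
      using assms L by metis
    have "set L = set (take j L @ L ! j # drop (Suc j) L)" using L by metis
    then have s': "set ?L = set L - {L ! j}" using s by auto
    have "list_sign L = (- 1) ^ j * list_sign (L ! j # ?L)"
      using list_sign_move[OF s] that L by simp
    then have "list_sign L = (- 1) ^ j * (pos_sign (L ! j) (set L) * list_sign ?L)"
      unfolding list_sign.simps s' by simp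
    moreover have "pos_sign (L ! j) (set L) * pos_sign (L ! j) (set L) = 1"
      by (simp add: pos_sign_def flip: power_add mult_2)
    ultimately have "pos_sign (L ! j) (set L) * list_sign L = (- 1) ^ j * list_sign ?L" by simp
    then show ?thesis
      unfolding wedge_def s' P.add.int_pow_pow[OF d(1)] by (simp add: mult.commute)
  qed
  have "koszul A \<tau> (wedge A L z) = (\<Oplus>\<^bsub>exterior_module A\<^esub>a\<in>set L.
      [list_sign L] \<cdot>\<^bsub>exterior_module A\<^esub> ([pos_sign a (set L)] \<cdot>\<^bsub>exterior_module A\<^esub> delta A (set L - {a}, \<tau> a z)))"
    unfolding wedge_def
    by (subst K.map_int_pow, rule d, subst koszul_delta, subst pow.map_finsum) (auto intro!: d)
  also have "\<dots> = (\<Oplus>\<^bsub>exterior_module A\<^esub>j\<in>{..<length L}.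
      [list_sign L] \<cdot>\<^bsub>exterior_module A\<^esub> ([pos_sign (L ! j) (set L)] \<cdot>\<^bsub>exterior_module A\<^esub> delta A (set L - {L ! j}, \<tau> (L ! j) z)))"
    unfolding img[symmetric] by (subst P.finsum_reindex[OF _ inj]) (auto intro!: d)
  also have "\<dots> = (\<Oplus>\<^bsub>exterior_module A\<^esub>j\<in>{..<length L}.
    [((- 1 :: int) ^ j)] \<cdot>\<^bsub>exterior_module A\<^esub> wedge A (take j L @ drop (Suc j) L) (\<tau> (L ! j) z))"
    using summand by (intro P.finsum_cong') (auto intro!: d wedge_closed)
  finally show ?thesis .
qed

section \<open>Contracting homotopies of Koszul differentials\<close>

lemma koszul_htpy_lin_hom: "koszul_htpy A w \<sigma> \<in> lin_hom A (exterior_module A) (exterior_module A)"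
  unfolding koszul_htpy_def
  by (intro lin_comb_lin_hom P.module_axioms) (auto intro!: delta_UNIV_closed simp del: free_module_simps)

lemma koszul_htpy_delta: "koszul_htpy A w \<sigma> (delta A (B, z)) =
    (if w B z \<in> B then \<zero>\<^bsub>exterior_module A\<^esub> else delta A (insert (w B z) B, \<sigma> (w B z) z))"
  unfolding koszul_htpy_def
  by (subst lin_comb_delta[OF P.module_axioms]) (auto intro!: delta_UNIV_closed simp del: free_module_simps)

lemma koszul_htpy_closed:
  assumes "\<And>B z. (B, z) \<in> Y \<Longrightarrow> w B z \<notin> B \<Longrightarrow> (insert (w B z) B, \<sigma> (w B z) z) \<in> Y'"
    and "x \<in> carrier (free_module A Y)"
  shows "koszul_htpy A w \<sigma> x \<in> carrier (free_module A Y')"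
proof -
  have sub: "submodule (carrier (free_module A Y')) A (exterior_module A)"
    by (intro free_module_submodule A) auto
  show ?thesis unfolding koszul_htpy_def
  proof (rule lin_comb_in_submodule[OF P.module_axioms sub assms(2)])
    fix b assume "b \<in> Y"
    then show "(case b of (B, z) \<Rightarrow> if w B z \<in> B then \<zero>\<^bsub>exterior_module A\<^esub>
        else delta A (insert (w B z) B, \<sigma> (w B z) z)) \<in> carrier (free_module A Y')"
      using assms(1)
      by (cases b) (auto simp del: free_module_simps intro!: delta_closed[OF A] submodule_zero[OF sub])
  qed auto
qed

text \<open>By \<open>stable\<close> the chosen element \<open>w\<close> is the same before and
  after the differential. If \<open>w\<close> lies in \<open>B\<close>, the homotopy of the vector
  is zero, and in its differential only the term that removes \<open>w\<close> survives reinsertion,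
  with sign 1 because \<open>w\<close> is least. If \<open>w\<close> is missing, inserting it shifts
  every other element by one place, so all terms cancel except the one that takes \<open>w\<close>
  out again.\<close>

lemma koszul_homotopy:
  assumes Y: "\<And>B z. (B, z) \<in> Y \<Longrightarrow> finite B"
    and least: "\<And>B z b. (B, z) \<in> Y \<Longrightarrow> b \<in> B \<Longrightarrow> w B z \<le> b"
    and stable: "\<And>B z a. (B, z) \<in> Y \<Longrightarrow> a \<in> B \<Longrightarrow> w (B - {a}) (\<tau> a z) = w B z"
    and inverse: "\<And>B z. (B, z) \<in> Y \<Longrightarrow> w B z \<in> B \<Longrightarrow> \<sigma> (w B z) (\<tau> (w B z) z) = z"
      "\<And>B z. (B, z) \<in> Y \<Longrightarrow> w B z \<notin> B \<Longrightarrow> \<tau> (w B z) (\<sigma> (w B z) z) = z"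
    and commute: "\<And>B z a. (B, z) \<in> Y \<Longrightarrow> w B z \<notin> B \<Longrightarrow> a \<in> B \<Longrightarrow> \<tau> a (\<sigma> (w B z) z) = \<sigma> (w B z) (\<tau> a z)"
    and x: "x \<in> carrier (free_module A Y)"
  shows "koszul A \<tau> (koszul_htpy A w \<sigma> x) \<oplus>\<^bsub>exterior_module A\<^esub> koszul_htpy A w \<sigma> (koszul A \<tau> x) = x"
proof -
  note d = delta_UNIV_closed P.add.int_pow_closed
  interpret H: lin_map A "exterior_module A" "exterior_module A" "koszul_htpy A w \<sigma>"
    by (intro lin_mapI P.module_axioms koszul_htpy_lin_hom)
  have "koszul A \<tau> (koszul_htpy A w \<sigma> (delta A (B, z))) \<oplus>\<^bsub>exterior_module A\<^esub>
      koszul_htpy A w \<sigma> (koszul A \<tau> (delta A (B, z))) = delta A (B, z)" if Bz: "(B, z) \<in> Y" for B z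
  proof -
    define v where "v = w B z"
    note fin = Y[OF Bz]
    have hk: "koszul_htpy A w \<sigma> (koszul A \<tau> (delta A (B, z))) = (\<Oplus>\<^bsub>exterior_module A\<^esub>a\<in>B.
      [pos_sign a B] \<cdot>\<^bsub>exterior_module A\<^esub> (if v \<in> B - {a} then \<zero>\<^bsub>exterior_module A\<^esub>
        else delta A (insert v (B - {a}), \<sigma> v (\<tau> a z))))"
    proof -
      have "koszul_htpy A w \<sigma> (koszul A \<tau> (delta A (B, z))) = (\<Oplus>\<^bsub>exterior_module A\<^esub>a\<in>B.
        koszul_htpy A w \<sigma> ([pos_sign a B] \<cdot>\<^bsub>exterior_module A\<^esub> delta A (B - {a}, \<tau> a z)))"
        by (subst koszul_delta, subst H.map_finsum) (auto intro!: d)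
      also have "\<dots> = (\<Oplus>\<^bsub>exterior_module A\<^esub>a\<in>B.
        [pos_sign a B] \<cdot>\<^bsub>exterior_module A\<^esub> (if v \<in> B - {a} then \<zero>\<^bsub>exterior_module A\<^esub>
        else delta A (insert v (B - {a}), \<sigma> v (\<tau> a z))))"
        by (intro P.finsum_cong')
          (auto simp del: free_module_simps simp: H.map_int_pow d koszul_htpy_delta stable[OF Bz] v_def intro!: d)
      finally show ?thesis .
    qed
    show ?thesis
    proof (cases "v \<in> B")
      case True
      have "(\<Oplus>\<^bsub>exterior_module A\<^esub>a\<in>B.
        [pos_sign a B] \<cdot>\<^bsub>exterior_module A\<^esub> (if v \<in> B - {a} then \<zero>\<^bsub>exterior_module A\<^esub>
          else delta A (insert v (B - {a}), \<sigma> v (\<tau> a z))))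
        = (\<Oplus>\<^bsub>exterior_module A\<^esub>a\<in>B. if v = a then delta A (B, z) else \<zero>\<^bsub>exterior_module A\<^esub>)"
      proof (intro P.finsum_cong')
        fix a assume a: "a \<in> B"
        have "pos_sign v B = 1" using least[OF Bz] by (intro pos_sign_least) (auto simp: v_def)
        then show "[pos_sign a B] \<cdot>\<^bsub>exterior_module A\<^esub> (if v \<in> B - {a} then \<zero>\<^bsub>exterior_module A\<^esub>
            else delta A (insert v (B - {a}), \<sigma> v (\<tau> a z)))
          = (if v = a then delta A (B, z) else \<zero>\<^bsub>exterior_module A\<^esub>)"
          using True a inverse(1)[OF Bz] by (auto simp del: free_module_simps simp: v_def insert_absorb d P.add.int_pow_one)
      qed (auto simp del: free_module_simps intro!: d)
      also have "\<dots> = delta A (B, z)"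
        by (rule P.finsum_singleton[OF True fin]) (auto intro!: d)
      finally show ?thesis
        using True by (simp del: free_module_simps add: hk koszul_htpy_delta v_def[symmetric] K.map_zero d)
    next
      case False
      have less: "v < b" if "b \<in> B" for b using least[OF Bz that] that False by (auto simp: v_def order_le_less)
      have neg: "pos_sign a (insert v B) = - pos_sign a B" if "a \<in> B" for a
        using pos_sign_remove_less[of "insert v B" v a] fin less[OF that] False by simp
      have ins: "insert v B - {a} = insert v (B - {a})" if "a \<in> B" for a
        using that False by auto
      have "koszul A \<tau> (koszul_htpy A w \<sigma> (delta A (B, z))) = (\<Oplus>\<^bsub>exterior_module A\<^esub>a\<in>insert v B.
          [pos_sign a (insert v B)] \<cdot>\<^bsub>exterior_module A\<^esub> delta A (insert v B - {a}, \<tau> a (\<sigma> v z)))"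
        using False by (simp del: free_module_simps add: koszul_htpy_delta v_def[symmetric] koszul_delta)
      also have "\<dots> = [pos_sign v (insert v B)] \<cdot>\<^bsub>exterior_module A\<^esub> delta A (insert v B - {v}, \<tau> v (\<sigma> v z))
        \<oplus>\<^bsub>exterior_module A\<^esub> (\<Oplus>\<^bsub>exterior_module A\<^esub>a\<in>B.
          [pos_sign a (insert v B)] \<cdot>\<^bsub>exterior_module A\<^esub> delta A (insert v B - {a}, \<tau> a (\<sigma> v z)))"
        using fin False by (intro P.finsum_insert) (auto intro!: d)
      also have "[pos_sign v (insert v B)] \<cdot>\<^bsub>exterior_module A\<^esub> delta A (insert v B - {v}, \<tau> v (\<sigma> v z)) = delta A (B, z)"
        using less False inverse(2)[OF Bz]
        by (subst pos_sign_least) (auto simp: v_def d P.add.int_pow_one intro: less_imp_le)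
      also have "(\<Oplus>\<^bsub>exterior_module A\<^esub>a\<in>B.
          [pos_sign a (insert v B)] \<cdot>\<^bsub>exterior_module A\<^esub> delta A (insert v B - {a}, \<tau> a (\<sigma> v z)))
        = (\<Oplus>\<^bsub>exterior_module A\<^esub>a\<in>B.
          [(- pos_sign a B)] \<cdot>\<^bsub>exterior_module A\<^esub> delta A (insert v (B - {a}), \<sigma> v (\<tau> a z)))"
        using False commute[OF Bz]
        by (intro P.finsum_cong') (auto simp: neg ins v_def[symmetric] intro!: d)
      finally have kh: "koszul A \<tau> (koszul_htpy A w \<sigma> (delta A (B, z))) = delta A (B, z) \<oplus>\<^bsub>exterior_module A\<^esub>
        (\<Oplus>\<^bsub>exterior_module A\<^esub>a\<in>B.
          [(- pos_sign a B)] \<cdot>\<^bsub>exterior_module A\<^esub> delta A (insert v (B - {a}), \<sigma> v (\<tau> a z)))" .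
      have hk': "koszul_htpy A w \<sigma> (koszul A \<tau> (delta A (B, z))) = (\<Oplus>\<^bsub>exterior_module A\<^esub>a\<in>B.
          [pos_sign a B] \<cdot>\<^bsub>exterior_module A\<^esub> delta A (insert v (B - {a}), \<sigma> v (\<tau> a z)))"
        unfolding hk using False by (intro P.finsum_cong') (auto intro!: d)
      have "(\<Oplus>\<^bsub>exterior_module A\<^esub>a\<in>B.
          [(- pos_sign a B)] \<cdot>\<^bsub>exterior_module A\<^esub> delta A (insert v (B - {a}), \<sigma> v (\<tau> a z)))
        \<oplus>\<^bsub>exterior_module A\<^esub> (\<Oplus>\<^bsub>exterior_module A\<^esub>a\<in>B.
          [pos_sign a B] \<cdot>\<^bsub>exterior_module A\<^esub> delta A (insert v (B - {a}), \<sigma> v (\<tau> a z)))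
        = (\<Oplus>\<^bsub>exterior_module A\<^esub>a\<in>B. [(- pos_sign a B)] \<cdot>\<^bsub>exterior_module A\<^esub> delta A (insert v (B - {a}), \<sigma> v (\<tau> a z))
          \<oplus>\<^bsub>exterior_module A\<^esub> [pos_sign a B] \<cdot>\<^bsub>exterior_module A\<^esub> delta A (insert v (B - {a}), \<sigma> v (\<tau> a z)))"
        by (rule P.finsum_addf[symmetric]) (auto intro!: d)
      also have "\<dots> = (\<Oplus>\<^bsub>exterior_module A\<^esub>a\<in>B. \<zero>\<^bsub>exterior_module A\<^esub>)"
        by (intro P.finsum_cong') (auto simp del: free_module_simps simp: P.add.int_pow_neg d intro!: P.l_neg d)
      also have "\<dots> = \<zero>\<^bsub>exterior_module A\<^esub>" by (rule P.finsum_zero)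
      finally have cancel: "(\<Oplus>\<^bsub>exterior_module A\<^esub>a\<in>B.
          [(- pos_sign a B)] \<cdot>\<^bsub>exterior_module A\<^esub> delta A (insert v (B - {a}), \<sigma> v (\<tau> a z)))
        \<oplus>\<^bsub>exterior_module A\<^esub> (\<Oplus>\<^bsub>exterior_module A\<^esub>a\<in>B.
          [pos_sign a B] \<cdot>\<^bsub>exterior_module A\<^esub> delta A (insert v (B - {a}), \<sigma> v (\<tau> a z)))
        = \<zero>\<^bsub>exterior_module A\<^esub>" .
      have c: "(\<Oplus>\<^bsub>exterior_module A\<^esub>a\<in>B. [(k a :: int)] \<cdot>\<^bsub>exterior_module A\<^esub>
          delta A (insert v (B - {a}), \<sigma> v (\<tau> a z))) \<in> carrier (exterior_module A)" for k
        by (intro P.finsum_closed funcsetI d)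
      show ?thesis
        unfolding kh hk' P.a_assoc[OF d(1) c c] cancel by (rule P.r_zero[OF d(1)])
    qed
  qed
  note on_delta = this
  show ?thesis
  proof (rule lin_hom_free_eq_on[where g = "\<lambda>x. x" and f = "\<lambda>x. koszul A \<tau> (koszul_htpy A w \<sigma> x)
          \<oplus>\<^bsub>exterior_module A\<^esub> koszul_htpy A w \<sigma> (koszul A \<tau> x)", OF P.module_axioms _ P.id_lin_hom _ x])
    show "(\<lambda>x. koszul A \<tau> (koszul_htpy A w \<sigma> x) \<oplus>\<^bsub>exterior_module A\<^esub> koszul_htpy A w \<sigma> (koszul A \<tau> x))
        \<in> lin_hom A (exterior_module A) (exterior_module A)"
      by (rule lin_hom_plus[OF P.module_axioms lin_hom_comp[OF koszul_htpy_lin_hom koszul_lin_hom]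
            lin_hom_comp[OF koszul_lin_hom koszul_htpy_lin_hom]])
    show "koszul A \<tau> (koszul_htpy A w \<sigma> (delta A b)) \<oplus>\<^bsub>exterior_module A\<^esub>
      koszul_htpy A w \<sigma> (koszul A \<tau> (delta A b)) = delta A b" if "b \<in> Y" for b
      using on_delta that by (cases b) blast
  qed simp
qed

end

declare free_module_simps [simp del]

section \<open>The double complex\<close>

text \<open>Basis elements are triples \<open>(B, C, r)\<close>: an exterior part, a row and a monomial. An element
  leaving \<open>B\<close> goes to the row under \<^term>\<open>koszul A to_row\<close> and to the monomial under
  \<^term>\<open>koszul A to_mono\<close>.\<close>

definition cells :: "nat \<Rightarrow> nat \<Rightarrow> nat \<Rightarrow> (nat set \<times> nat set \<times> nat multiset) set" where
  "cells n i q = {(B, C, r). B \<subseteq> {1..n} \<and> C \<subseteq> {1..n} \<and> B \<inter> C = {} \<and> card B = i \<and> card C = q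
     \<and> set_mset r \<subseteq> {1..n}}"

definition to_row :: "nat \<Rightarrow> nat set \<times> nat multiset \<Rightarrow> nat set \<times> nat multiset" where
  "to_row a = (\<lambda>(C, r). (insert a C, r))"

definition from_row :: "nat \<Rightarrow> nat set \<times> nat multiset \<Rightarrow> nat set \<times> nat multiset" where
  "from_row a = (\<lambda>(C, r). (C - {a}, r))"

definition to_mono :: "nat \<Rightarrow> nat set \<times> nat multiset \<Rightarrow> nat set \<times> nat multiset" where
  "to_mono a = (\<lambda>(C, r). (C, add_mset a r))"

definition from_mono :: "nat \<Rightarrow> nat set \<times> nat multiset \<Rightarrow> nat set \<times> nat multiset" where
  "from_mono a = (\<lambda>(C, r). (C, r - {#a#}))"

text \<open>Each homotopy moves into \<open>B\<close> the least element that either end of its differential can hold; that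
  element is the same before and after applying the differential.\<close>

definition row_htpy :: "('a, 'r) ring_scheme \<Rightarrow> (nat set \<times> nat set \<times> nat multiset \<Rightarrow> 'a) \<Rightarrow>
    nat set \<times> nat set \<times> nat multiset \<Rightarrow> 'a" where
  "row_htpy A = koszul_htpy A (\<lambda>B (C, r). Min (B \<union> C)) from_row"

text \<open>The \<open>Min\<close> is meaningless when \<open>supp r \<union> B \<subseteq> C\<close>; those triples have no exterior part and are handled
  by the augmentation.\<close>

definition mono_htpy :: "('a, 'r) ring_scheme \<Rightarrow> (nat set \<times> nat set \<times> nat multiset \<Rightarrow> 'a) \<Rightarrow>
    nat set \<times> nat set \<times> nat multiset \<Rightarrow> 'a" where
  "mono_htpy A = koszul_htpy A (\<lambda>B (C, r). Min ((set_mset r \<union> B) - C)) from_mono"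

text \<open>The product of the monomial \<open>r\<close> with the squarefree monomial of the row
  \<open>C\<close>; on triples with empty exterior part this models the map onto the ideal.\<close>

definition augmentation :: "('a, 'r) ring_scheme \<Rightarrow> (nat set \<times> nat set \<times> nat multiset \<Rightarrow> 'a) \<Rightarrow>
    nat multiset \<Rightarrow> 'a" where
  "augmentation A x =
     lin_comb A (free_module A UNIV) UNIV x (\<lambda>(B, C, r). delta A (r + mset_set C))"

lemma cells_finite:
  "(B, C, r) \<in> cells n i q \<Longrightarrow> finite B" "(B, C, r) \<in> cells n i q \<Longrightarrow> finite C"
  by (auto simp: cells_def intro: finite_subset)

text \<open>Base of the descending induction on the row size.\<close>

lemma cells_empty: "n < q \<Longrightarrow> cells n i q = {}"
  by (auto simp: cells_def dest!: card_mono[rotated])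

lemma free_module_empty: "x \<in> carrier (free_module A {}) \<Longrightarrow> x = \<zero>\<^bsub>free_module A C\<^esub>"
  by (auto simp: mem_free_module_iff free_module_simps)

context
  fixes A :: "('a, 'r) ring_scheme"
  assumes A: "cring A"
begin

interpretation P: module A "exterior_module A :: ('a, nat set \<times> 'z \<Rightarrow> 'a) module"
  by (rule free_module_module[OF A])

interpretation Q: module A "free_module A UNIV :: ('a, nat multiset \<Rightarrow> 'a) module"
  by (rule free_module_module[OF A])

interpretation K: lin_map A "exterior_module A" "exterior_module A" "koszul A \<tau>"
  by (intro lin_mapI P.module_axioms koszul_lin_hom A)

lemma cells_UNIV: "x \<in> carrier (free_module A (cells n i q)) \<Longrightarrow> x \<in> carrier (free_module A UNIV)"
  using free_module_mono[of "cells n i q" UNIV A] by auto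

lemma cells_fin_ext: "x \<in> carrier (free_module A (cells n i q)) \<Longrightarrow> x \<in> carrier (free_module A {(B, z). finite B})"
  by (erule subsetD[OF free_module_mono, rotated]) (auto dest: cells_finite(1))

lemma row_closed:
  "x \<in> carrier (free_module A (cells n (Suc i) q)) \<Longrightarrow>
    koszul A to_row x \<in> carrier (free_module A (cells n i (Suc q)))"
  by (erule koszul_closed[OF A, rotated])
    (auto simp: cells_def to_row_def card_insert_if finite_subset[of _ "{Suc 0..n}"])

lemma mono_closed:
  "x \<in> carrier (free_module A (cells n (Suc i) q)) \<Longrightarrow>
    koszul A to_mono x \<in> carrier (free_module A (cells n i q))"
  by (erule koszul_closed[OF A, rotated]) (auto simp: cells_def to_mono_def subset_iff)

lemma koszul_cells_0:
  assumes "x \<in> carrier (free_module A (cells n 0 q))"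
  shows "koszul A \<tau> x = \<zero>\<^bsub>exterior_module A\<^esub>"
proof (rule lin_hom_free_eq_on[where g = "\<lambda>x. \<zero>\<^bsub>exterior_module A\<^esub>" and f = "koszul A \<tau>",
      OF P.module_axioms koszul_lin_hom[OF A] P.zero_lin_hom _ assms])
  fix b assume b: "b \<in> cells n 0 q"
  obtain B C r where BC: "b = (B, C, r)" by (cases b)
  have "finite B" by (rule cells_finite(1)[OF b[unfolded BC]])
  moreover have "card B = 0" using b unfolding BC by (simp add: cells_def)
  ultimately have "b = ({}, C, r)" using BC by simp
  then show "koszul A \<tau> (delta A b) = \<zero>\<^bsub>exterior_module A\<^esub>"
    by (simp add: koszul_delta[OF A])
qed simp

lemma row_row: "x \<in> carrier (free_module A (cells n i q)) \<Longrightarrow>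
    koszul A to_row (koszul A to_row x) = \<zero>\<^bsub>exterior_module A\<^esub>"
  by (rule koszul_square[OF A _ cells_fin_ext]) (auto simp: to_row_def)

lemma mono_mono: "x \<in> carrier (free_module A (cells n i q)) \<Longrightarrow>
    koszul A to_mono (koszul A to_mono x) = \<zero>\<^bsub>exterior_module A\<^esub>"
  by (rule koszul_square[OF A _ cells_fin_ext]) (auto simp: to_mono_def add_mset_commute)

lemma row_mono: "x \<in> carrier (free_module A (cells n i q)) \<Longrightarrow>
    koszul A to_row (koszul A to_mono x) = \<ominus>\<^bsub>exterior_module A\<^esub> koszul A to_mono (koszul A to_row x)"
  by (rule koszul_anticommute[OF A _ cells_fin_ext]) (auto simp: to_mono_def to_row_def)

section \<open>The two contractions on triples\<close>

lemma row_htpy_closed: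
  assumes "x \<in> carrier (free_module A (cells n i (Suc q)))"
  shows "row_htpy A x \<in> carrier (free_module A (cells n (Suc i) q))"
  unfolding row_htpy_def
proof (rule koszul_htpy_closed[OF A _ assms])
  fix B z assume z: "(B, z) \<in> cells n i (Suc q)" "(case z of (C, r) \<Rightarrow> Min (B \<union> C)) \<notin> B"
  obtain C r where Cr: "z = (C, r)" by (cases z)
  note fin = cells_finite[OF z(1)[unfolded Cr]]
  have "Min (B \<union> C) \<in> B \<union> C" using z Cr fin by (intro Min_in) (auto simp: cells_def)
  then show "(insert (case z of (C, r) \<Rightarrow> Min (B \<union> C)) B, from_row (case z of (C, r) \<Rightarrow> Min (B \<union> C)) z)
      \<in> cells n (Suc i) q"
    using z Cr fin by (auto simp: cells_def from_row_def)
qed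

lemma row_homotopy:
  assumes "x \<in> carrier (free_module A (cells n i (Suc q)))"
  shows "koszul A to_row (row_htpy A x) \<oplus>\<^bsub>exterior_module A\<^esub> row_htpy A (koszul A to_row x) = x"
  unfolding row_htpy_def
proof (rule koszul_homotopy[OF A _ _ _ _ _ _ assms])
  fix B and z :: "nat set \<times> nat multiset" assume z: "(B, z) \<in> cells n i (Suc q)"
  obtain C r where Cr: "z = (C, r)" by (cases z)
  note fin = cells_finite[OF z(1)[unfolded Cr]]
  show "finite B" by fact
  \<comment> \<open>The union is nonempty because the row has size \<open>Suc q\<close>.
    Disjointness makes inserting into and deleting from the row inverse to each other.\<close>
  have ne: "B \<union> C \<noteq> {}" "B \<inter> C = {}" using z Cr by (auto simp: cells_def)
  define w where "w = Min (B \<union> C)"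
  have w: "(case z of (C, r) \<Rightarrow> Min (B \<union> C)) = w" by (simp add: Cr w_def)
  have wi: "w \<in> B \<union> C" unfolding w_def using fin ne by (intro Min_in) auto
  show "(case z of (C, r) \<Rightarrow> Min (B \<union> C)) \<le> b" if "b \<in> B" for b
    using that fin by (auto simp: Cr)
  show "(case to_row a z of (C, r) \<Rightarrow> Min (B - {a} \<union> C)) = (case z of (C, r) \<Rightarrow> Min (B \<union> C))" if "a \<in> B" for a
  proof -
    have "B - {a} \<union> insert a C = B \<union> C" using that by auto
    then show ?thesis by (simp add: to_row_def Cr)
  qed
  show "from_row (case z of (C, r) \<Rightarrow> Min (B \<union> C)) (to_row (case z of (C, r) \<Rightarrow> Min (B \<union> C)) z) = z"
    if "(case z of (C, r) \<Rightarrow> Min (B \<union> C)) \<in> B"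
    using that ne unfolding w by (auto simp: to_row_def from_row_def Cr)
  assume nB: "(case z of (C, r) \<Rightarrow> Min (B \<union> C)) \<notin> B"
  show "to_row (case z of (C, r) \<Rightarrow> Min (B \<union> C)) (from_row (case z of (C, r) \<Rightarrow> Min (B \<union> C)) z) = z"
    using nB wi unfolding w by (auto simp: to_row_def from_row_def Cr)
  show "to_row a (from_row (case z of (C, r) \<Rightarrow> Min (B \<union> C)) z) = from_row (case z of (C, r) \<Rightarrow> Min (B \<union> C)) (to_row a z)"
    if "a \<in> B" for a
    using nB that unfolding w by (auto simp: to_row_def from_row_def Cr)
qed

lemma mono_htpy_closed:
  assumes "x \<in> carrier (free_module A {(B, C, r) \<in> cells n i q. \<not> set_mset r \<union> B \<subseteq> C})"
  shows "mono_htpy A x \<in> carrier (free_module A (cells n (Suc i) q))"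
  unfolding mono_htpy_def
proof (rule koszul_htpy_closed[OF A _ assms])
  fix B z assume z: "(B, z) \<in> {(B, C, r) \<in> cells n i q. \<not> set_mset r \<union> B \<subseteq> C}"
    "(case z of (C, r) \<Rightarrow> Min ((set_mset r \<union> B) - C)) \<notin> B"
  obtain C r where Cr: "z = (C, r)" by (cases z)
  have fin: "finite B" "finite C" using z(1) Cr cells_finite by auto
  have "Min ((set_mset r \<union> B) - C) \<in> (set_mset r \<union> B) - C" using z Cr fin by (intro Min_in) (auto simp: cells_def)
  then show "(insert (case z of (C, r) \<Rightarrow> Min ((set_mset r \<union> B) - C)) B, from_mono (case z of (C, r) \<Rightarrow> Min ((set_mset r \<union> B) - C)) z)
      \<in> cells n (Suc i) q"
    using z Cr fin by (auto simp: cells_def from_mono_def dest: in_diffD)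
qed

text \<open>The set of which the minimum is taken is invariant: an element leaving \<open>B\<close>
  enters the support of \<open>r\<close>, and \<open>C\<close> does not change. Elements of
  \<open>C\<close> are excluded because moving one of them into \<open>B\<close> would destroy
  disjointness.\<close>

lemma mono_homotopy:
  assumes "x \<in> carrier (free_module A {(B, C, r) \<in> cells n i q. \<not> set_mset r \<union> B \<subseteq> C})"
  shows "koszul A to_mono (mono_htpy A x) \<oplus>\<^bsub>exterior_module A\<^esub> mono_htpy A (koszul A to_mono x) = x"
  unfolding mono_htpy_def
proof (rule koszul_homotopy[OF A _ _ _ _ _ _ assms])
  fix B and z :: "nat set \<times> nat multiset"
  assume z: "(B, z) \<in> {(B, C, r) \<in> cells n i q. \<not> set_mset r \<union> B \<subseteq> C}"
  obtain C r where Cr: "z = (C, r)" by (cases z)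
  have fin: "finite B" "finite C" using z(1) Cr cells_finite by auto
  show "finite B" by fact
  have ne: "(set_mset r \<union> B) - C \<noteq> {}" "B \<inter> C = {}" using z Cr by (auto simp: cells_def)
  define w where "w = Min ((set_mset r \<union> B) - C)"
  have w: "(case z of (C, r) \<Rightarrow> Min ((set_mset r \<union> B) - C)) = w" by (simp add: Cr w_def)
  have wi: "w \<in> (set_mset r \<union> B) - C" unfolding w_def using fin ne by (intro Min_in) auto
  show "(case z of (C, r) \<Rightarrow> Min ((set_mset r \<union> B) - C)) \<le> b" if "b \<in> B" for b
    using that fin ne by (auto simp: Cr intro!: Min_le)
  show "(case to_mono a z of (C, r) \<Rightarrow> Min ((set_mset r \<union> (B - {a})) - C))
      = (case z of (C, r) \<Rightarrow> Min ((set_mset r \<union> B) - C))" if "a \<in> B" for a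
  proof -
    have "(set_mset (add_mset a r) \<union> (B - {a})) - C = (set_mset r \<union> B) - C" using that by auto
    then show ?thesis by (simp add: to_mono_def Cr)
  qed
  show "from_mono (case z of (C, r) \<Rightarrow> Min ((set_mset r \<union> B) - C)) (to_mono (case z of (C, r) \<Rightarrow> Min ((set_mset r \<union> B) - C)) z) = z"
    by (auto simp: to_mono_def from_mono_def Cr)
  assume nB: "(case z of (C, r) \<Rightarrow> Min ((set_mset r \<union> B) - C)) \<notin> B"
  show "to_mono (case z of (C, r) \<Rightarrow> Min ((set_mset r \<union> B) - C)) (from_mono (case z of (C, r) \<Rightarrow> Min ((set_mset r \<union> B) - C)) z) = z"
    using nB wi unfolding w by (auto simp: to_mono_def from_mono_def Cr)
  show "to_mono a (from_mono (case z of (C, r) \<Rightarrow> Min ((set_mset r \<union> B) - C)) z)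
      = from_mono (case z of (C, r) \<Rightarrow> Min ((set_mset r \<union> B) - C)) (to_mono a z)" if "a \<in> B" for a
    using nB wi that unfolding w by (auto simp: to_mono_def from_mono_def Cr)
qed

section \<open>The augmentation on triples\<close>

lemma augmentation_lin_hom: "augmentation A \<in> lin_hom A (free_module A UNIV) (free_module A UNIV)"
  unfolding augmentation_def
  by (intro lin_comb_lin_hom Q.module_axioms) (auto intro!: delta_UNIV_closed[OF A])

lemma augmentation_delta: "augmentation A (delta A (B, C, r)) = delta A (r + mset_set C)"
  unfolding augmentation_def
  by (subst lin_comb_delta[OF Q.module_axioms]) (auto intro!: delta_UNIV_closed[OF A])

text \<open>A single exterior element \<open>b\<close> is not in the row, so putting it into the row
  or into the monomial yields the same product. Hence the augmentation kills monomial boundaries of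
  row cycles, and its vanishing passes from one row size to the next.\<close>

lemma augmentation_row_mono:
  assumes "x \<in> carrier (free_module A (cells n (Suc 0) q))"
  shows "augmentation A (koszul A to_mono x) = augmentation A (koszul A to_row x)"
proof (rule lin_hom_free_eq_on[where f = "\<lambda>x. augmentation A (koszul A to_mono x)"
    and g = "\<lambda>x. augmentation A (koszul A to_row x)", OF Q.module_axioms
      lin_hom_comp[OF koszul_lin_hom[OF A] augmentation_lin_hom]
      lin_hom_comp[OF koszul_lin_hom[OF A] augmentation_lin_hom] _ assms])
  fix x assume x: "x \<in> cells n (Suc 0) q"
  obtain B C r where BC: "x = (B, C, r)" by (cases x)
  then have "card B = Suc 0" using x by (simp add: cells_def)
  then obtain b where "B = {b}" unfolding One_nat_def[symmetric] by (rule card_1_singletonE)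
  then have bC: "x = ({b}, C, r)" using BC by simp
  have "b \<notin> C" using x unfolding bC by (simp add: cells_def)
  moreover have "finite C" using x unfolding bC by (rule cells_finite)
  moreover have "koszul A \<tau> (delta A ({b}, z)) = delta A ({}, \<tau> b z)" for \<tau> and z :: "nat set \<times> nat multiset"
  proof -
    have "koszul A \<tau> (delta A ({b}, z)) = [pos_sign b {b}] \<cdot>\<^bsub>exterior_module A\<^esub> delta A ({b} - {b}, \<tau> b z)
        \<oplus>\<^bsub>exterior_module A\<^esub> \<zero>\<^bsub>exterior_module A\<^esub>"
      unfolding koszul_delta[OF A]
      by (subst P.finsum_insert) (auto intro!: P.add.int_pow_closed delta_UNIV_closed[OF A])
    moreover have "pos_sign b {b} = 1" by (rule pos_sign_least) simp
    ultimately show ?thesis by (simp del: pos_sign_insert_self add: delta_UNIV_closed[OF A])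
  qed
  ultimately show "augmentation A (koszul A to_mono (delta A x)) = augmentation A (koszul A to_row (delta A x))"
    by (simp add: bC to_mono_def to_row_def augmentation_delta)
qed simp

text \<open>A triple with the monomial supported in \<open>C\<close> is the only one of its row size
  with the product \<open>r + mset_set C\<close>: another row \<open>C'\<close> with that product
  lies in the support, which is \<open>C\<close>, and has as many elements. The coefficient of this
  product in the augmentation is therefore a single coefficient of \<open>x\<close>, so it vanishes,
  and the monomial contraction applies to all of \<open>x\<close>.\<close>

lemma augmentation_zero_support:
  assumes x: "x \<in> carrier (free_module A (cells n 0 q))"
    and zero: "augmentation A x = \<zero>\<^bsub>free_module A UNIV\<^esub>"
  shows "x \<in> carrier (free_module A {(B, C, r) \<in> cells n 0 q. \<not> set_mset r \<union> B \<subseteq> C})"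
proof -
  have "x (B, C, r) = \<zero>\<^bsub>A\<^esub>" if c: "(B, C, r) \<in> cells n 0 q" and sub: "set_mset r \<union> B \<subseteq> C" for B C r
  proof (rule ccontr)
    assume nz: "x (B, C, r) \<noteq> \<zero>\<^bsub>A\<^esub>"
    note xA = free_module_app_closed[OF x]
    define S where "S = {t. x t \<noteq> \<zero>\<^bsub>A\<^esub>}"
    have S: "finite S" "S \<subseteq> cells n 0 q" using x by (auto simp: S_def mem_free_module_iff)
    let ?u = "r + mset_set C"
    have "\<zero>\<^bsub>A\<^esub> = augmentation A x ?u" by (simp add: zero free_module_simps)
    also have "augmentation A x = (\<Oplus>\<^bsub>free_module A UNIV\<^esub>t\<in>S. x t \<odot>\<^bsub>free_module A UNIV\<^esub>
        (case t of (B, C, r) \<Rightarrow> delta A (r + mset_set C)))"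
      by (simp add: augmentation_def lin_comb_def S_def)
    also have "\<dots> ?u = (\<Oplus>\<^bsub>A\<^esub>t\<in>S. (x t \<odot>\<^bsub>free_module A UNIV\<^esub>
        (case t of (B, C, r) \<Rightarrow> delta A (r + mset_set C))) ?u)"
      using xA by (intro free_module_finsum_app A S) (auto intro!: Q.smult_closed delta_UNIV_closed[OF A])
    also have "\<dots> = (\<Oplus>\<^bsub>A\<^esub>t\<in>S. if (B, C, r) = t then x t else \<zero>\<^bsub>A\<^esub>)"
    proof (intro P.R.finsum_cong')
      fix t assume "t \<in> S"
      then have t: "t \<in> cells n 0 q" using S by auto
      obtain B' C' r' where t': "t = (B', C', r')" by (cases t)
      have fin: "finite B" "finite C" "finite B'" "finite C'" using c t t' cells_finite by auto
      have B: "B = {}" "B' = {}" using c t t' fin by (auto simp: cells_def)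
      have "r' = r \<and> C' = C" if eq: "r' + mset_set C' = ?u"
      proof -
        have "set_mset (r' + mset_set C') = set_mset ?u" using eq by simp
        then have "C' \<subseteq> C" using sub fin by auto
        then have "C' = C" using c t t' fin by (intro card_subset_eq) (auto simp: cells_def)
        then show ?thesis using eq by simp
      qed
      then show "(x t \<odot>\<^bsub>free_module A UNIV\<^esub> (case t of (B, C, r) \<Rightarrow> delta A (r + mset_set C))) ?u
        = (if (B, C, r) = t then x t else \<zero>\<^bsub>A\<^esub>)"
        using xA B by (auto simp: t' free_module_simps delta_def)
    qed (use xA in auto)
    also have "\<dots> = x (B, C, r)"
      using S xA nz by (intro P.R.finsum_singleton) (auto simp: S_def)
    finally show False using nz by simp
  qed
  note vanish = this
  have "t \<in> {(B, C, r) \<in> cells n 0 q. \<not> set_mset r \<union> B \<subseteq> C}" if t: "x t \<noteq> \<zero>\<^bsub>A\<^esub>" for t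
  proof -
    obtain B C r where "t = (B, C, r)" by (cases t)
    moreover have "t \<in> cells n 0 q" using x t unfolding mem_free_module_iff by blast
    ultimately show ?thesis using vanish[of B C r] t by blast
  qed
  then show ?thesis using x unfolding mem_free_module_iff by blast
qed

section \<open>Exactness on the kernel of the row differential\<close>

lemma exact_step:
  assumes y0: "y0 \<in> carrier (free_module A (cells n (Suc i) q))"
    and y1: "y1 \<in> carrier (free_module A (cells n (Suc i) (Suc q)))" "koszul A to_mono y1 = koszul A to_row y0"
      "koszul A to_row y1 = \<zero>\<^bsub>exterior_module A\<^esub>"
  shows "\<exists>y\<in>carrier (free_module A (cells n (Suc i) q)).
    koszul A to_mono y = koszul A to_mono y0 \<and> koszul A to_row y = \<zero>\<^bsub>exterior_module A\<^esub>"
proof -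
  have ht: "row_htpy A \<zero>\<^bsub>exterior_module A\<^esub> = \<zero>\<^bsub>exterior_module A\<^esub>"
    unfolding row_htpy_def
    by (rule lin_map.map_zero[OF lin_mapI[OF P.module_axioms P.module_axioms koszul_htpy_lin_hom[OF A]]])
  define z where "z = row_htpy A y1"
  have z: "z \<in> carrier (free_module A (cells n (Suc (Suc i)) q))"
    unfolding z_def by (rule row_htpy_closed[OF y1(1)])
  note zP = cells_UNIV[OF z] and y0P = cells_UNIV[OF y0]
  \<comment> \<open>As \<open>y1\<close> is a row cycle, the homotopy identity loses its second
    term.\<close>
  have kz: "koszul A to_row z = y1"
    using row_homotopy[OF y1(1)] unfolding y1(3) ht z_def[symmetric] by (simp add: zP)
  interpret E: module A "free_module A (cells n (Suc i) q)" by (rule free_module_module[OF A])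
  have add: "y0 \<oplus>\<^bsub>exterior_module A\<^esub> koszul A to_mono z
    = y0 \<oplus>\<^bsub>free_module A (cells n (Suc i) q)\<^esub> koszul A to_mono z"
    by (simp add: free_module_simps)
  have "koszul A to_mono (y0 \<oplus>\<^bsub>exterior_module A\<^esub> koszul A to_mono z) = koszul A to_mono y0"
    by (simp add: K.map_add y0P zP mono_mono[OF z])
  \<comment> \<open>With \<open>K\<close> and \<open>D\<close> for the row and the monomial
    differential: \<open>K (D z) = - D (K z) = - D y1 = - K y0\<close>. Anticommutation is what
    makes the correcting term enter with a plus sign.\<close>
  moreover have "koszul A to_row (y0 \<oplus>\<^bsub>exterior_module A\<^esub> koszul A to_mono z) = \<zero>\<^bsub>exterior_module A\<^esub>"
    by (simp add: K.map_add y0P zP row_mono[OF z] kz y1(2) P.r_neg)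
  moreover have "y0 \<oplus>\<^bsub>exterior_module A\<^esub> koszul A to_mono z \<in> carrier (free_module A (cells n (Suc i) q))"
    unfolding add by (intro E.a_closed y0 mono_closed z)
  ultimately show ?thesis by blast
qed

lemma mono_htpy_zero: "mono_htpy A \<zero>\<^bsub>exterior_module A\<^esub> = \<zero>\<^bsub>exterior_module A\<^esub>"
  unfolding mono_htpy_def
  by (rule lin_map.map_zero[OF lin_mapI[OF P.module_axioms P.module_axioms koszul_htpy_lin_hom[OF A]]])

lemma zero_cells: "\<zero>\<^bsub>exterior_module A\<^esub> \<in> carrier (free_module A (cells n i q))"
  by (rule submodule_zero[OF free_module_submodule[OF A subset_UNIV]])

text \<open>The induction runs on \<open>Suc n - q\<close>, so that its base is a row size larger
  than \<open>n\<close>, where there are no triples and \<open>x\<close> is zero.\<close>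

lemma exact_Suc:
  assumes "x \<in> carrier (free_module A (cells n (Suc i) q))"
    and "koszul A to_row x = \<zero>\<^bsub>exterior_module A\<^esub>" "koszul A to_mono x = \<zero>\<^bsub>exterior_module A\<^esub>"
  shows "\<exists>y\<in>carrier (free_module A (cells n (Suc (Suc i)) q)).
    koszul A to_mono y = x \<and> koszul A to_row y = \<zero>\<^bsub>exterior_module A\<^esub>"
  using assms
proof (induction "Suc n - q" arbitrary: q x)
  case 0
  then have "x = \<zero>\<^bsub>exterior_module A\<^esub>"
    using cells_empty[of n q] by (auto intro: free_module_empty)
  then show ?case by (intro bexI[of _ "\<zero>\<^bsub>exterior_module A\<^esub>"]) (simp_all add: K.map_zero zero_cells)
next
  case (Suc k)
  \<comment> \<open>In positive exterior degree \<open>B\<close> is nonempty and disjoint from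
    \<open>C\<close>, so the monomial contraction covers every triple.\<close>
  have "cells n (Suc i) q \<subseteq> {(B, C, r) \<in> cells n (Suc i) q. \<not> set_mset r \<union> B \<subseteq> C}"
  proof -
    have "\<not> B \<subseteq> C" if "B \<inter> C = {}" "card B = Suc i" for B C :: "nat set"
      using that by (cases "B = {}") auto
    then show ?thesis by (force simp: cells_def)
  qed
  then have x: "x \<in> carrier (free_module A {(B, C, r) \<in> cells n (Suc i) q. \<not> set_mset r \<union> B \<subseteq> C})"
    using Suc.prems(1) free_module_mono by blast
  define y where "y = mono_htpy A x"
  have y: "y \<in> carrier (free_module A (cells n (Suc (Suc i)) q))"
    unfolding y_def by (rule mono_htpy_closed[OF x])
  note yP = cells_UNIV[OF y]
  have my: "koszul A to_mono y = x"
    using mono_homotopy[OF x] unfolding Suc.prems(3) mono_htpy_zero y_def[symmetric] by (simp add: yP)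
  \<comment> \<open>Since \<open>x\<close> is a row cycle, the row differential of the primitive
    \<open>y\<close> is a monomial cycle. It is a row cycle as well, so the induction hypothesis for
    rows of size \<open>Suc q\<close> applies to it.\<close>
  have "\<ominus>\<^bsub>exterior_module A\<^esub> koszul A to_mono (koszul A to_row y) = \<zero>\<^bsub>exterior_module A\<^esub>"
    using row_mono[OF y] Suc.prems(2) by (simp add: my)
  then have "koszul A to_mono (koszul A to_row y) = \<zero>\<^bsub>exterior_module A\<^esub>"
    by (simp add: P.add.inv_eq_1_iff yP)
  from Suc.hyps(1)[of "Suc q", OF _ row_closed[OF y] row_row[OF y] this] Suc.hyps(2)
  obtain y1 where y1: "y1 \<in> carrier (free_module A (cells n (Suc (Suc i)) (Suc q)))"
    "koszul A to_mono y1 = koszul A to_row y" "koszul A to_row y1 = \<zero>\<^bsub>exterior_module A\<^esub>"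
    by fastforce
  show ?case using exact_step[OF y y1] unfolding my .
qed

text \<open>The same induction with the augmentation in the role of the monomial differential: its
  vanishing on \<open>x\<close> both makes the contraction applicable and, by
  \<open>augmentation_row_mono\<close>, carries over to the row differential of the
  primitive.\<close>

lemma exact_0:
  assumes "x \<in> carrier (free_module A (cells n 0 q))" "augmentation A x = \<zero>\<^bsub>free_module A UNIV\<^esub>"
  shows "\<exists>y\<in>carrier (free_module A (cells n (Suc 0) q)).
    koszul A to_mono y = x \<and> koszul A to_row y = \<zero>\<^bsub>exterior_module A\<^esub>"
  using assms
proof (induction "Suc n - q" arbitrary: q x)
  case 0
  then have "x = \<zero>\<^bsub>exterior_module A\<^esub>"
    using cells_empty[of n q] by (auto intro: free_module_empty)
  then show ?case by (intro bexI[of _ "\<zero>\<^bsub>exterior_module A\<^esub>"]) (simp_all add: K.map_zero zero_cells)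
next
  case (Suc k)
  note x = augmentation_zero_support[OF Suc.prems]
  define y where "y = mono_htpy A x"
  have y: "y \<in> carrier (free_module A (cells n (Suc 0) q))"
    unfolding y_def by (rule mono_htpy_closed[OF x])
  note yP = cells_UNIV[OF y]
  have my: "koszul A to_mono y = x"
    using mono_homotopy[OF x] unfolding koszul_cells_0[OF Suc.prems(1)] mono_htpy_zero y_def[symmetric]
    by (simp add: yP)
  have "augmentation A (koszul A to_row y) = \<zero>\<^bsub>free_module A UNIV\<^esub>"
    using augmentation_row_mono[OF y] Suc.prems(2) by (simp add: my)
  from Suc.hyps(1)[of "Suc q", OF _ row_closed[OF y] this] Suc.hyps(2)
  obtain y1 where y1: "y1 \<in> carrier (free_module A (cells n (Suc 0) (Suc q)))"
    "koszul A to_mono y1 = koszul A to_row y" "koszul A to_row y1 = \<zero>\<^bsub>exterior_module A\<^esub>"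
    by fastforce
  show ?case using exact_step[OF y y1] unfolding my .
qed

end

section \<open>Polynomial rings\<close>

lemma finite_submultisets: "finite {v. v \<subseteq># u}"
proof (induction u)
  case (add a u)
  have "v \<in> {v. v \<subseteq># u} \<union> add_mset a ` {v. v \<subseteq># u}" if v: "v \<subseteq># add_mset a u" for v
  proof (cases "a \<in># v")
    case True
    then have "v = add_mset a (v - {#a#})" by simp
    moreover have "v - {#a#} \<subseteq># u" using v by (simp add: subset_eq_diff_conv)
    ultimately show ?thesis by blast
  next
    case False
    then show ?thesis using v by (metis Un_iff diff_single_trivial mem_Collect_eq subset_eq_diff_conv add_mset_add_single)
  qed
  then have "{v. v \<subseteq># add_mset a u} \<subseteq> {v. v \<subseteq># u} \<union> add_mset a ` {v. v \<subseteq># u}" by blast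
  then show ?case using add.IH finite_subset by blast
qed simp

text \<open>The module axioms do not look at the multiplicative fields, so the polynomial ring is a
  module simply as a free module on monomials.\<close>

lemma module_update_mult:
  assumes "module A M" shows "module A (M\<lparr>monoid.mult := t, one := e\<rparr>)"
proof -
  interpret M: module A M by fact
  show ?thesis
    by (rule moduleI)
      (auto intro!: M.R.cring_axioms abelian_groupI M.a_assoc M.a_comm bexI[of _ "\<ominus>\<^bsub>M\<^esub> _"] M.l_neg
        simp: M.smult_l_distr M.smult_r_distr M.smult_assoc1)
qed

definition monoms :: "nat \<Rightarrow> nat multiset set" where
  "monoms n = {u. set_mset u \<subseteq> {1..n}}"

text \<open>The monomials divisible by some squarefree monomial of degree \<open>d\<close>: at least
  \<open>d\<close> distinct variables have to occur.\<close>

definition sq_monoms :: "nat \<Rightarrow> nat \<Rightarrow> nat multiset set" where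
  "sq_monoms d n = {u. set_mset u \<subseteq> {1..n} \<and> d \<le> card (set_mset u)}"

lemma sq_monoms_subset: "sq_monoms d n \<subseteq> monoms n"
  by (auto simp: sq_monoms_def monoms_def)

lemma mpol_ring_eq: "mpol_ring A n = (free_module A (monoms n))
     \<lparr>monoid.mult := (\<lambda>p q u. \<Oplus>\<^bsub>A\<^esub>v\<in>{v. v \<subseteq># u}. p v \<otimes>\<^bsub>A\<^esub> q (u - v)), one := delta A {#}\<rparr>"
  by (simp add: mpol_ring_def monoms_def)

lemma mpol_ring_simps:
  "carrier (mpol_ring A n) = carrier (free_module A (monoms n))"
  "\<zero>\<^bsub>mpol_ring A n\<^esub> = \<zero>\<^bsub>free_module A (monoms n)\<^esub>"
  "p \<oplus>\<^bsub>mpol_ring A n\<^esub> q = p \<oplus>\<^bsub>free_module A (monoms n)\<^esub> q"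
  "a \<odot>\<^bsub>mpol_ring A n\<^esub> p = a \<odot>\<^bsub>free_module A (monoms n)\<^esub> p"
  "\<one>\<^bsub>mpol_ring A n\<^esub> = delta A {#}"
  by (simp_all add: mpol_ring_eq)

lemma mpol_mult: "(p \<otimes>\<^bsub>mpol_ring A n\<^esub> q) u = (\<Oplus>\<^bsub>A\<^esub>v\<in>{v. v \<subseteq># u}. p v \<otimes>\<^bsub>A\<^esub> q (u - v))"
  by (simp add: mpol_ring_eq)

lemma mpol_lin_hom:
  "lin_hom A (mpol_ring A n) N = lin_hom A (free_module A (monoms n)) N"
  "lin_hom A N (mpol_ring A n) = lin_hom A N (free_module A (monoms n))"
  by (auto simp: lin_hom_def hom_def mpol_ring_simps)

context
  fixes A :: "('a, 'r) ring_scheme"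
  assumes A: "cring A"
begin

interpretation A: cring A by (rule A)

interpretation R: module A "free_module A (monoms n)"
  by (rule free_module_module[OF A])

lemma mpol_module: "module A (mpol_ring A n)"
  unfolding mpol_ring_eq by (rule module_update_mult) (rule R.module_axioms)

lemma mpol_mult_closed:
  assumes p: "p \<in> carrier (mpol_ring A n)" and q: "q \<in> carrier (mpol_ring A n)"
  shows "p \<otimes>\<^bsub>mpol_ring A n\<^esub> q \<in> carrier (mpol_ring A n)"
proof -
  note p' = p[unfolded mpol_ring_simps] and q' = q[unfolded mpol_ring_simps]
  note pA = free_module_app_closed[OF p'] and qA = free_module_app_closed[OF q']
  have "\<exists>v w. u = v + w \<and> p v \<noteq> \<zero>\<^bsub>A\<^esub> \<and> q w \<noteq> \<zero>\<^bsub>A\<^esub>" if u: "(p \<otimes>\<^bsub>mpol_ring A n\<^esub> q) u \<noteq> \<zero>\<^bsub>A\<^esub>" for u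
  proof (rule ccontr)
    assume *: "\<not> ?thesis"
    have "(\<Oplus>\<^bsub>A\<^esub>v\<in>{v. v \<subseteq># u}. p v \<otimes>\<^bsub>A\<^esub> q (u - v)) = (\<Oplus>\<^bsub>A\<^esub>v\<in>{v. v \<subseteq># u}. \<zero>\<^bsub>A\<^esub>)"
    proof (rule A.finsum_cong')
      fix v assume "v \<in> {v. v \<subseteq># u}"
      then have "u = v + (u - v)" by simp
      then have "p v = \<zero>\<^bsub>A\<^esub> \<or> q (u - v) = \<zero>\<^bsub>A\<^esub>" using * by blast
      then show "p v \<otimes>\<^bsub>A\<^esub> q (u - v) = \<zero>\<^bsub>A\<^esub>" using pA qA by auto
    qed auto
    then show False using u by (simp add: mpol_mult)
  qed
  note ex = this
  have "{u. (p \<otimes>\<^bsub>mpol_ring A n\<^esub> q) u \<noteq> \<zero>\<^bsub>A\<^esub>}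
      \<subseteq> (\<lambda>(v, w). v + w) ` ({v. p v \<noteq> \<zero>\<^bsub>A\<^esub>} \<times> {w. q w \<noteq> \<zero>\<^bsub>A\<^esub>})"
    using ex by force
  then have "finite {u. (p \<otimes>\<^bsub>mpol_ring A n\<^esub> q) u \<noteq> \<zero>\<^bsub>A\<^esub>}"
    using free_module_finite[OF p'] free_module_finite[OF q'] by (meson finite_SigmaI finite_imageI finite_subset)
  moreover have "u \<in> monoms n" if nz: "(p \<otimes>\<^bsub>mpol_ring A n\<^esub> q) u \<noteq> \<zero>\<^bsub>A\<^esub>" for u
  proof -
    obtain v w where "u = v + w" "p v \<noteq> \<zero>\<^bsub>A\<^esub>" "q w \<noteq> \<zero>\<^bsub>A\<^esub>" using ex[OF nz] by blast
    moreover from this have "v \<in> monoms n" "w \<in> monoms n"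
      using p' q' unfolding mem_free_module_iff by blast+
    ultimately show ?thesis by (simp add: monoms_def)
  qed
  moreover have "(p \<otimes>\<^bsub>mpol_ring A n\<^esub> q) u \<in> carrier A" for u
    unfolding mpol_mult using pA qA by (intro A.finsum_closed) auto
  ultimately show ?thesis unfolding mpol_ring_simps mem_free_module_iff by blast
qed

lemma mpol_mult_lin1:
  assumes q: "q \<in> carrier (mpol_ring A n)"
  shows "(\<lambda>p. p \<otimes>\<^bsub>mpol_ring A n\<^esub> q) \<in> lin_hom A (mpol_ring A n) (mpol_ring A n)"
proof (rule lin_homI)
  note qA = free_module_app_closed[OF q[unfolded mpol_ring_simps]]
  fix p assume p: "p \<in> carrier (mpol_ring A n)"
  note pA = free_module_app_closed[OF p[unfolded mpol_ring_simps]]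
  show "p \<otimes>\<^bsub>mpol_ring A n\<^esub> q \<in> carrier (mpol_ring A n)" by (rule mpol_mult_closed[OF p q])
  {
    fix p' assume p': "p' \<in> carrier (mpol_ring A n)"
    note pA' = free_module_app_closed[OF p'[unfolded mpol_ring_simps]]
    show "(p \<oplus>\<^bsub>mpol_ring A n\<^esub> p') \<otimes>\<^bsub>mpol_ring A n\<^esub> q
      = p \<otimes>\<^bsub>mpol_ring A n\<^esub> q \<oplus>\<^bsub>mpol_ring A n\<^esub> p' \<otimes>\<^bsub>mpol_ring A n\<^esub> q"
    proof
      fix u
      have "(\<Oplus>\<^bsub>A\<^esub>v\<in>{v. v \<subseteq># u}. (p v \<oplus>\<^bsub>A\<^esub> p' v) \<otimes>\<^bsub>A\<^esub> q (u - v))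
        = (\<Oplus>\<^bsub>A\<^esub>v\<in>{v. v \<subseteq># u}. p v \<otimes>\<^bsub>A\<^esub> q (u - v) \<oplus>\<^bsub>A\<^esub> p' v \<otimes>\<^bsub>A\<^esub> q (u - v))"
        using pA pA' qA by (intro A.finsum_cong') (auto simp: A.l_distr)
      also have "\<dots> = (\<Oplus>\<^bsub>A\<^esub>v\<in>{v. v \<subseteq># u}. p v \<otimes>\<^bsub>A\<^esub> q (u - v)) \<oplus>\<^bsub>A\<^esub> (\<Oplus>\<^bsub>A\<^esub>v\<in>{v. v \<subseteq># u}. p' v \<otimes>\<^bsub>A\<^esub> q (u - v))"
        using pA pA' qA by (intro A.finsum_addf) auto
      finally show "((p \<oplus>\<^bsub>mpol_ring A n\<^esub> p') \<otimes>\<^bsub>mpol_ring A n\<^esub> q) u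
        = (p \<otimes>\<^bsub>mpol_ring A n\<^esub> q \<oplus>\<^bsub>mpol_ring A n\<^esub> p' \<otimes>\<^bsub>mpol_ring A n\<^esub> q) u"
        by (simp add: mpol_ring_simps free_module_simps mpol_mult)
    qed
  }
  fix a assume a: "a \<in> carrier A"
  show "(a \<odot>\<^bsub>mpol_ring A n\<^esub> p) \<otimes>\<^bsub>mpol_ring A n\<^esub> q = a \<odot>\<^bsub>mpol_ring A n\<^esub> (p \<otimes>\<^bsub>mpol_ring A n\<^esub> q)"
  proof
    fix u
    have "(\<Oplus>\<^bsub>A\<^esub>v\<in>{v. v \<subseteq># u}. (a \<otimes>\<^bsub>A\<^esub> p v) \<otimes>\<^bsub>A\<^esub> q (u - v))
      = (\<Oplus>\<^bsub>A\<^esub>v\<in>{v. v \<subseteq># u}. a \<otimes>\<^bsub>A\<^esub> (p v \<otimes>\<^bsub>A\<^esub> q (u - v)))"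
      using a pA qA by (intro A.finsum_cong') (auto simp: A.m_assoc)
    also have "\<dots> = a \<otimes>\<^bsub>A\<^esub> (\<Oplus>\<^bsub>A\<^esub>v\<in>{v. v \<subseteq># u}. p v \<otimes>\<^bsub>A\<^esub> q (u - v))"
      using a pA qA by (intro A.finsum_rdistr[symmetric] finite_submultisets) auto
    finally show "((a \<odot>\<^bsub>mpol_ring A n\<^esub> p) \<otimes>\<^bsub>mpol_ring A n\<^esub> q) u
      = (a \<odot>\<^bsub>mpol_ring A n\<^esub> (p \<otimes>\<^bsub>mpol_ring A n\<^esub> q)) u"
      by (simp add: mpol_ring_simps free_module_simps mpol_mult)
  qed
qed

text \<open>Complementation \<open>v \<mapsto> u - v\<close> is an involution on the divisors of
  \<open>u\<close> and exchanges the two factors of the convolution.\<close>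

lemma mpol_mult_comm:
  assumes p: "p \<in> carrier (mpol_ring A n)" and q: "q \<in> carrier (mpol_ring A n)"
  shows "p \<otimes>\<^bsub>mpol_ring A n\<^esub> q = q \<otimes>\<^bsub>mpol_ring A n\<^esub> p"
proof
  fix u :: "nat multiset"
  note pA = free_module_app_closed[OF p[unfolded mpol_ring_simps]]
  note qA = free_module_app_closed[OF q[unfolded mpol_ring_simps]]
  have inj: "inj_on (\<lambda>v. u - v) {v. v \<subseteq># u}"
    by (rule inj_on_inverseI[of _ "\<lambda>v. u - v"]) (simp add: multiset_eq_iff subseteq_mset_def)
  have img: "(\<lambda>v. u - v) ` {v. v \<subseteq># u} = {v. v \<subseteq># u}"
  proof -
    have "v \<in> (\<lambda>v. u - v) ` {v. v \<subseteq># u}" if "v \<subseteq># u" for v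
      using that by (intro image_eqI[of _ _ "u - v"]) (auto simp: multiset_eq_iff subseteq_mset_def)
    then show ?thesis by auto
  qed
  have "(\<Oplus>\<^bsub>A\<^esub>v\<in>(\<lambda>v. u - v) ` {v. v \<subseteq># u}. p v \<otimes>\<^bsub>A\<^esub> q (u - v))
      = (\<Oplus>\<^bsub>A\<^esub>v\<in>{v. v \<subseteq># u}. p (u - v) \<otimes>\<^bsub>A\<^esub> q (u - (u - v)))"
    using pA qA by (intro A.finsum_reindex inj) auto
  also have "\<dots> = (\<Oplus>\<^bsub>A\<^esub>v\<in>{v. v \<subseteq># u}. q v \<otimes>\<^bsub>A\<^esub> p (u - v))"
  proof (rule A.finsum_cong')
    fix v assume "v \<in> {v. v \<subseteq># u}"
    then have "u - (u - v) = v" by (auto simp: multiset_eq_iff subseteq_mset_def)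
    then show "p (u - v) \<otimes>\<^bsub>A\<^esub> q (u - (u - v)) = q v \<otimes>\<^bsub>A\<^esub> p (u - v)"
      using pA qA by (simp add: A.m_comm)
  qed (use pA qA in auto)
  finally show "(p \<otimes>\<^bsub>mpol_ring A n\<^esub> q) u = (q \<otimes>\<^bsub>mpol_ring A n\<^esub> p) u"
    by (simp add: mpol_mult img)
qed

lemma mpol_mult_lin2:
  assumes p: "p \<in> carrier (mpol_ring A n)"
  shows "(\<lambda>q. p \<otimes>\<^bsub>mpol_ring A n\<^esub> q) \<in> lin_hom A (mpol_ring A n) (mpol_ring A n)"
  by (rule lin_hom_cong[OF mpol_mult_lin1[OF p] _ mpol_module]) (rule mpol_mult_comm[OF _ p])

lemma mpol_delta_closed: "u \<in> monoms n \<Longrightarrow> delta A u \<in> carrier (mpol_ring A n)"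
  unfolding mpol_ring_simps by (rule delta_closed[OF A])

lemma mpol_mult_delta: "delta A u \<otimes>\<^bsub>mpol_ring A n\<^esub> delta A v = delta A (u + v)"
proof
  fix x
  have "(\<Oplus>\<^bsub>A\<^esub>w\<in>{w. w \<subseteq># x}. delta A u w \<otimes>\<^bsub>A\<^esub> delta A v (x - w))
    = (\<Oplus>\<^bsub>A\<^esub>w\<in>{w. w \<subseteq># x}. if u = w then delta A (u + v) x else \<zero>\<^bsub>A\<^esub>)"
  proof (rule A.finsum_cong')
    fix w assume "w \<in> {w. w \<subseteq># x}"
    then have "x - w = v \<longleftrightarrow> x = w + v" by (metis add_diff_cancel_left' mem_Collect_eq subset_mset.add_diff_inverse)
    then show "delta A u w \<otimes>\<^bsub>A\<^esub> delta A v (x - w) = (if u = w then delta A (u + v) x else \<zero>\<^bsub>A\<^esub>)"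
      by (auto simp: delta_def)
  qed (auto simp: delta_def)
  also have "\<dots> = delta A (u + v) x"
  proof (cases "u \<subseteq># x")
    case True
    then show ?thesis
      by (intro A.finsum_singleton finite_submultisets) (auto simp: delta_def)
  next
    case False
    then have "x \<noteq> u + v" by auto
    then have "(\<Oplus>\<^bsub>A\<^esub>w\<in>{w. w \<subseteq># x}. if u = w then delta A (u + v) x else \<zero>\<^bsub>A\<^esub>)
        = (\<Oplus>\<^bsub>A\<^esub>w\<in>{w. w \<subseteq># x}. \<zero>\<^bsub>A\<^esub>)"
      by (intro A.finsum_cong') (auto simp: delta_def)
    then show ?thesis using \<open>x \<noteq> u + v\<close> by (simp add: delta_def)
  qed
  finally show "(delta A u \<otimes>\<^bsub>mpol_ring A n\<^esub> delta A v) x = delta A (u + v) x" by (simp add: mpol_mult)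
qed

lemma mpol_lin_hom_eqI:
  assumes "module A M" "f \<in> lin_hom A (mpol_ring A n) M" "g \<in> lin_hom A (mpol_ring A n) M"
    and "\<And>u. u \<in> monoms n \<Longrightarrow> f (delta A u) = g (delta A u)" "x \<in> carrier (mpol_ring A n)"
  shows "f x = g x"
  using lin_hom_free_eqI[OF assms(1) assms(2,3)[unfolded mpol_lin_hom] assms(4)] assms(5)
  by (simp add: mpol_ring_simps)

text \<open>Linearity in each factor in turn reduces the claim to monomials, where it is
  associativity of addition of multisets; a triple convolution sum never appears.\<close>

lemma mpol_mult_assoc:
  assumes p: "p \<in> carrier (mpol_ring A n)" and q: "q \<in> carrier (mpol_ring A n)"
    and r: "r \<in> carrier (mpol_ring A n)"
  shows "p \<otimes>\<^bsub>mpol_ring A n\<^esub> q \<otimes>\<^bsub>mpol_ring A n\<^esub> r = p \<otimes>\<^bsub>mpol_ring A n\<^esub> (q \<otimes>\<^bsub>mpol_ring A n\<^esub> r)"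
proof (rule mpol_lin_hom_eqI[OF mpol_module lin_hom_comp[OF mpol_mult_lin1[OF q] mpol_mult_lin1[OF r]]
      mpol_mult_lin1[OF mpol_mult_closed[OF q r]] _ p])
  fix u assume u: "u \<in> monoms n"
  note du = mpol_delta_closed[OF u]
  show "delta A u \<otimes>\<^bsub>mpol_ring A n\<^esub> q \<otimes>\<^bsub>mpol_ring A n\<^esub> r = delta A u \<otimes>\<^bsub>mpol_ring A n\<^esub> (q \<otimes>\<^bsub>mpol_ring A n\<^esub> r)"
  proof (rule mpol_lin_hom_eqI[OF mpol_module lin_hom_comp[OF mpol_mult_lin2[OF du] mpol_mult_lin1[OF r]]
        lin_hom_comp[OF mpol_mult_lin1[OF r] mpol_mult_lin2[OF du]] _ q])
    fix v assume v: "v \<in> monoms n"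
    note dv = mpol_delta_closed[OF v]
    show "delta A u \<otimes>\<^bsub>mpol_ring A n\<^esub> delta A v \<otimes>\<^bsub>mpol_ring A n\<^esub> r
        = delta A u \<otimes>\<^bsub>mpol_ring A n\<^esub> (delta A v \<otimes>\<^bsub>mpol_ring A n\<^esub> r)"
      by (rule mpol_lin_hom_eqI[OF mpol_module mpol_mult_lin2[OF mpol_mult_closed[OF du dv]]
            lin_hom_comp[OF mpol_mult_lin2[OF dv] mpol_mult_lin2[OF du]] _ r])
        (simp add: mpol_mult_delta add.assoc)
  qed
qed

lemma mpol_one_mult:
  assumes p: "p \<in> carrier (mpol_ring A n)"
  shows "\<one>\<^bsub>mpol_ring A n\<^esub> \<otimes>\<^bsub>mpol_ring A n\<^esub> p = p"
proof -
  interpret M: module A "mpol_ring A n" by (rule mpol_module)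
  have "\<one>\<^bsub>mpol_ring A n\<^esub> \<in> carrier (mpol_ring A n)"
    by (simp add: mpol_ring_simps(5) mpol_delta_closed monoms_def)
  then show ?thesis
    by (rule mpol_lin_hom_eqI[OF mpol_module mpol_mult_lin2 M.id_lin_hom _ p])
      (simp add: mpol_ring_simps(5) mpol_mult_delta)
qed

lemma mpol_cring: "cring (mpol_ring A n)"
proof -
  interpret M: module A "mpol_ring A n" by (rule mpol_module)
  have one: "\<one>\<^bsub>mpol_ring A n\<^esub> \<in> carrier (mpol_ring A n)"
    by (simp add: mpol_ring_simps(5) mpol_delta_closed monoms_def)
  show ?thesis
  proof (rule cringI)
    show "abelian_group (mpol_ring A n)" by (rule M.abelian_group_axioms)
    show "comm_monoid (mpol_ring A n)"
      by (rule comm_monoidI; rule mpol_mult_closed one mpol_mult_assoc mpol_one_mult mpol_mult_comm; assumption)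
  qed (simp add: lin_hom_add[OF mpol_mult_lin1])
qed

text \<open>Scalars act as constant polynomials, so closure under multiplication by polynomials
  implies closure under scalars.\<close>

lemma mpol_smult_eq:
  assumes "a \<in> carrier A" "p \<in> carrier (mpol_ring A n)"
  shows "a \<odot>\<^bsub>mpol_ring A n\<^esub> p = (a \<odot>\<^bsub>mpol_ring A n\<^esub> \<one>\<^bsub>mpol_ring A n\<^esub>) \<otimes>\<^bsub>mpol_ring A n\<^esub> p"
proof -
  interpret M: cring "mpol_ring A n" by (rule mpol_cring)
  show ?thesis
    using lin_hom_smult[OF mpol_mult_lin1[OF assms(2)] assms(1) M.one_closed] assms(2) by simp
qed

lemma mpol_span: "span_of A (mpol_ring A n) (delta A ` monoms n) = carrier (mpol_ring A n)"
proof -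
  have "submodule N A (mpol_ring A n) \<longleftrightarrow> submodule N A (free_module A (monoms n))" for N
  proof -
    have "add_monoid (mpol_ring A n) = add_monoid (free_module A (monoms n))"
      by (simp add: mpol_ring_eq)
    then show ?thesis
      by (simp add: submodule_def submodule_axioms_def mpol_ring_simps)
  qed
  then show ?thesis
    using free_module_span_delta[OF A, of "monoms n"] by (simp add: span_of_def mpol_ring_simps)
qed

text \<open>Turns the ideal into a free module with an explicit basis. Divisors of a monomial with
  fewer than \<open>d\<close> variables have fewer than \<open>d\<close> variables too, so
  polynomials supported on \<open>sq_monoms d n\<close> form an ideal. Conversely, any
  \<open>d\<close> variables occurring in such a monomial give a generator dividing it.\<close>

lemma sqfree_ideal_structure:
  shows sqfree_ideal_ideal: "ideal (sqfree_ideal A d n) (mpol_ring A n)"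
    and sqfree_ideal_eq: "sqfree_ideal A d n = carrier (free_module A (sq_monoms d n))"
proof -
  interpret R: cring "mpol_ring A n" by (rule mpol_cring)
  interpret M: module A "mpol_ring A n" by (rule mpol_module)
  let ?G = "{delta A (mset_set S) | S. S \<subseteq> {1..n} \<and> card S = d}"
  let ?I = "carrier (free_module A (sq_monoms d n))"
  have sub: "sq_monoms d n \<subseteq> monoms n" by (auto simp: sq_monoms_def monoms_def)
  have subm: "submodule ?I A (free_module A (monoms n))" by (rule free_module_submodule[OF A sub])
  have subc: "?I \<subseteq> carrier (mpol_ring A n)"
    unfolding mpol_ring_simps by (rule free_module_mono[OF sub])
  have addm: "add_monoid (mpol_ring A n) = add_monoid (free_module A (monoms n))"
    by (simp add: mpol_ring_eq)
  have G: "?G \<subseteq> carrier (mpol_ring A n)"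
    by (auto intro!: mpol_delta_closed simp: monoms_def finite_subset[of _ "{Suc 0..n}"] subset_iff)
  have I_closed: "p \<otimes>\<^bsub>mpol_ring A n\<^esub> a \<in> ?I" if p: "p \<in> carrier (mpol_ring A n)" and a: "a \<in> ?I" for p a
  proof -
    have pa: "p \<otimes>\<^bsub>mpol_ring A n\<^esub> a \<in> carrier (mpol_ring A n)"
      using a subc by (intro mpol_mult_closed p) auto
    have "u \<in> sq_monoms d n" if u: "(p \<otimes>\<^bsub>mpol_ring A n\<^esub> a) u \<noteq> \<zero>\<^bsub>A\<^esub>" for u
    proof (rule ccontr)
      assume nu: "u \<notin> sq_monoms d n"
      have um: "u \<in> monoms n"
        using pa u unfolding mpol_ring_simps mem_free_module_iff by blast
      have "(\<Oplus>\<^bsub>A\<^esub>v\<in>{v. v \<subseteq># u}. p v \<otimes>\<^bsub>A\<^esub> a (u - v)) = (\<Oplus>\<^bsub>A\<^esub>v\<in>{v. v \<subseteq># u}. \<zero>\<^bsub>A\<^esub>)"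
      proof (rule A.finsum_cong')
        fix v assume "v \<in> {v. v \<subseteq># u}"
        have "set_mset (u - v) \<subseteq> set_mset u" by (auto dest: in_diffD)
        then have "card (set_mset (u - v)) \<le> card (set_mset u)" by (intro card_mono) auto
        then have "u - v \<notin> sq_monoms d n" using nu um by (auto simp: sq_monoms_def monoms_def)
        then have "a (u - v) = \<zero>\<^bsub>A\<^esub>" by (rule free_module_zero_outside[OF a])
        then show "p v \<otimes>\<^bsub>A\<^esub> a (u - v) = \<zero>\<^bsub>A\<^esub>"
          using free_module_app_closed[OF p[unfolded mpol_ring_simps]] by simp
      qed auto
      then show False using u by (simp add: mpol_mult)
    qed
    then show ?thesis
      using pa unfolding mpol_ring_simps mem_free_module_iff by blast
  qed
  have ideal: "ideal ?I (mpol_ring A n)"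
  proof (rule idealI[OF R.ring_axioms])
    show "subgroup ?I (add_monoid (mpol_ring A n))"
      unfolding addm using subm by (simp add: submodule_def)
    show "x \<otimes>\<^bsub>mpol_ring A n\<^esub> a \<in> ?I" "a \<otimes>\<^bsub>mpol_ring A n\<^esub> x \<in> ?I"
      if "a \<in> ?I" "x \<in> carrier (mpol_ring A n)" for a x
      using that I_closed R.m_comm[of a x] subc by auto
  qed
  have GI: "?G \<subseteq> ?I"
    by (auto intro!: delta_closed[OF A] simp: sq_monoms_def finite_subset[of _ "{Suc 0..n}"] subset_iff)
  interpret J: ideal "sqfree_ideal A d n" "mpol_ring A n"
    unfolding sqfree_ideal_def by (rule R.genideal_ideal[OF G])
  show "ideal (sqfree_ideal A d n) (mpol_ring A n)" by (rule J.ideal_axioms)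
  have Jsub: "submodule (sqfree_ideal A d n) A (free_module A (monoms n))"
  proof -
    have "a \<odot>\<^bsub>mpol_ring A n\<^esub> x \<in> sqfree_ideal A d n" if a: "a \<in> carrier A" and x: "x \<in> sqfree_ideal A d n" for a x
      using J.I_l_closed[OF x, of "a \<odot>\<^bsub>mpol_ring A n\<^esub> \<one>\<^bsub>mpol_ring A n\<^esub>"] mpol_smult_eq[OF a J.a_Hcarr[OF x]] a
      by simp
    then show ?thesis
      using J.a_subgroup unfolding addm by (simp add: submodule_def submodule_axioms_def mpol_ring_simps)
  qed
  have dJ: "delta A u \<in> sqfree_ideal A d n" if u: "u \<in> sq_monoms d n" for u
  proof -
    obtain S where S: "S \<subseteq> set_mset u" "card S = d" "finite S"
      using u obtain_subset_with_card_n[of d "set_mset u"] by (auto simp: sq_monoms_def)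
    have "mset_set S \<subseteq># u"
      using S(1,3) by (auto simp: subseteq_mset_def count_mset_set' Suc_le_eq)
    then have eq: "delta A u = delta A (u - mset_set S) \<otimes>\<^bsub>mpol_ring A n\<^esub> delta A (mset_set S)"
      by (simp add: mpol_mult_delta)
    have "u - mset_set S \<in> monoms n" using u by (auto simp: sq_monoms_def monoms_def dest!: in_diffD)
    then have "delta A (u - mset_set S) \<in> carrier (mpol_ring A n)" by (rule mpol_delta_closed)
    moreover have "delta A (mset_set S) \<in> sqfree_ideal A d n"
      unfolding sqfree_ideal_def using u S by (intro subsetD[OF R.genideal_self[OF G]]) (auto simp: sq_monoms_def)
    ultimately show ?thesis unfolding eq by (rule J.I_l_closed[rotated])
  qed
  show "sqfree_ideal A d n = ?I"
  proof
    show "sqfree_ideal A d n \<subseteq> ?I"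
      unfolding sqfree_ideal_def by (rule R.genideal_minimal[OF ideal GI])
    show "?I \<subseteq> sqfree_ideal A d n"
    proof
      fix p assume p: "p \<in> ?I"
      have "lin_comb A (free_module A (monoms n)) (monoms n) p (delta A) \<in> sqfree_ideal A d n"
        by (rule lin_comb_in_submodule[OF R.module_axioms Jsub p sub dJ])
      moreover have "lin_comb A (free_module A (monoms n)) (monoms n) p (delta A) = p"
        using p subc by (intro lin_comb_free_delta A) (auto simp: mpol_ring_simps)
      ultimately show "p \<in> sqfree_ideal A d n" by simp
    qed
  qed
qed

end

section \<open>Hook tableaux\<close>

text \<open>The list \<open>row\<close> excludes the corner box, which is the head of
  \<open>col\<close>.\<close>

definition hook_tableau :: "nat list \<Rightarrow> nat list \<Rightarrow> tableau" where
  "hook_tableau col row = col # map (\<lambda>x. [x]) row"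

lemma hook_tableau_simps [simp]:
  "hd (hook_tableau col row) = col" "tl (hook_tableau col row) = map (\<lambda>x. [x]) row"
  "concat (hook_tableau col row) = col @ row"
  by (simp_all add: hook_tableau_def)

lemma map_hook_tableau: "map (map f) (hook_tableau col row) = hook_tableau (map f col) (map f row)"
  by (simp add: hook_tableau_def)

lemma hook_tableau_in_tableaux: "hook_tableau col row \<in> tableaux (hook d i) n \<longleftrightarrow>
    length col = Suc i \<and> length row = d - 1 \<and> distinct (col @ row) \<and> set (col @ row) \<subseteq> {1..n}"
proof -
  have "map length (hook_tableau col row) = hook d i \<longleftrightarrow> length col = Suc i \<and> length row = d - 1"
    by (auto simp: hook_tableau_def hook_def comp_def map_replicate_const)
  then show ?thesis unfolding tableaux_def mem_Collect_eq hook_tableau_simps by blast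
qed

lemma tableaux_hookE:
  assumes "T \<in> tableaux (hook d i) n"
  obtains col row where "T = hook_tableau col row" "length col = Suc i" "length row = d - 1"
    "distinct (col @ row)" "set (col @ row) \<subseteq> {1..n}"
proof -
  have "map length T = Suc i # replicate (d - 1) 1"
    using assms by (simp add: tableaux_def hook_def)
  then obtain col Ts where T: "T = col # Ts" and Ts: "map length Ts = replicate (d - 1) 1"
    by (cases T) auto
  have "\<forall>c\<in>set Ts. length c = 1"
    using arg_cong[OF Ts, of set] by (auto simp: image_iff set_replicate_conv_if split: if_splits)
  then have "Ts = map (\<lambda>x. [x]) (map hd Ts)"
    by (induction Ts) (auto simp: length_Suc_conv)
  then have "T = hook_tableau col (map hd Ts)" by (simp add: T hook_tableau_def)
  with assms show ?thesis using that[of col "map hd Ts"] by (simp add: hook_tableau_in_tableaux)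
qed

lemma exchange_column:
  assumes "p < length col"
  shows "exchange (hook_tableau col (x # row)) 0 {p} = hook_tableau (col[p := x]) (col ! p # row)"
proof -
  have "{q \<in> {p}. q < p} = {}" by auto
  then have "map (\<lambda>q. if q \<in> {p} then [x] ! card {r \<in> {p}. r < q} else col ! q) [0..<length col] = col[p := x]"
    by (intro nth_equalityI) (auto simp del: Collect_empty_eq simp: nth_list_update)
  then show ?thesis unfolding exchange_def hook_tableau_def \<open>{q \<in> {p}. q < p} = {}\<close>
    using \<open>{q \<in> {p}. q < p} = {}\<close>
    by (simp del: Collect_empty_eq cong: if_cong)
qed

text \<open>Index 0 belongs to the long column, so the row entry at position \<open>length P\<close>
  sits in the column with index \<open>Suc (length P)\<close>.\<close>

lemma exchange_row:
  "exchange (hook_tableau col (P @ a # b # Q)) (Suc (length P)) {0} = hook_tableau col (P @ b # a # Q)"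
proof -
  have "{q. q = 0 \<and> q < (0::nat)} = {}" by auto
  then show ?thesis
    by (simp add: exchange_def hook_tableau_def nth_append list_update_append)
qed

text \<open>All columns of a hook but the first have height one, so only the shuffles of a single box survive:
  between the first two columns, and between neighbours in the rest of the row.\<close>

definition hook_rels :: "('a, 'r) ring_scheme \<Rightarrow> nat \<Rightarrow> nat \<Rightarrow> nat \<Rightarrow> (tableau \<Rightarrow> 'a) set" where
  "hook_rels A d i n = (let P = free_module A (tableaux (hook d i) n) in
      {delta A (hook_tableau (map \<sigma> col) row) \<ominus>\<^bsub>P\<^esub> [sign \<sigma>] \<cdot>\<^bsub>P\<^esub> delta A (hook_tableau col row) | \<sigma> col row.
          hook_tableau col row \<in> tableaux (hook d i) n \<and> \<sigma> permutes set col}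
    \<union> {delta A (hook_tableau col (x # row)) \<ominus>\<^bsub>P\<^esub>
          (\<Oplus>\<^bsub>P\<^esub>p\<in>{..<length col}. delta A (hook_tableau (col[p := x]) (col ! p # row))) | col x row.
          hook_tableau col (x # row) \<in> tableaux (hook d i) n}
    \<union> {delta A (hook_tableau col (R @ a # b # Q)) \<ominus>\<^bsub>P\<^esub> delta A (hook_tableau col (R @ b # a # Q)) | col R a b Q.
          hook_tableau col (R @ a # b # Q) \<in> tableaux (hook d i) n})"

lemma subsets_card_1: "{S. S \<subseteq> {..<m} \<and> card S = Suc 0} = (\<lambda>p. {p}) ` {..<m}"
  by (auto simp: card_Suc_eq)

section \<open>Signs of columns and order of rows\<close>

lemma list_sign_update:
  assumes "distinct L" "p < length L" "x \<notin> set L - {L ! p}"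
  shows "list_sign (L[p := x]) = (- 1) ^ p * list_sign (x # take p L @ drop (Suc p) L)"
    and "set (L[p := x]) = insert x (set L - {L ! p})" "distinct (L[p := x])"
    and "set (take p L @ drop (Suc p) L) = set L - {L ! p}" "distinct (take p L @ drop (Suc p) L)"
proof -
  have u: "L[p := x] = take p L @ x # drop (Suc p) L" using assms(2) by (rule upd_conv_take_nth_drop)
  have L: "L = take p L @ L ! p # drop (Suc p) L" using assms(2) by (rule id_take_nth_drop)
  have d: "distinct (take p L @ L ! p # drop (Suc p) L)" using assms(1) L by metis
  have "set L = set (take p L @ L ! p # drop (Suc p) L)" using L by metis
  then show s: "set (take p L @ drop (Suc p) L) = set L - {L ! p}" using d by auto
  then show "set (L[p := x]) = insert x (set L - {L ! p})" unfolding u by auto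
  show "distinct (take p L @ drop (Suc p) L)" using d by auto
  have "x \<notin> set (take p L @ drop (Suc p) L)" unfolding s by (rule assms(3))
  then have d': "distinct (take p L @ x # drop (Suc p) L)" using d by auto
  then show "distinct (L[p := x])" unfolding u .
  show "list_sign (L[p := x]) = (- 1) ^ p * list_sign (x # take p L @ drop (Suc p) L)"
    unfolding u using list_sign_move[OF d'] assms(2) by simp
qed

text \<open>An entry smaller than all others contributes no inversion once it is moved to the front.
  What remains is \<open>L\<close> with its entry at \<open>p\<close> deleted, and moving that entry
  to the front of \<open>L\<close> costs the same \<open>(-1)^p\<close> and then its position
  sign.\<close>

lemma list_sign_update_least:
  assumes "distinct L" "p < length L" "\<And>y. y \<in> set L \<Longrightarrow> x < y"
  shows "list_sign (L[p := x]) = list_sign L * pos_sign (L ! p) (set L)"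
proof -
  have x: "x \<notin> set L - {L ! p}" using assms(3) by auto
  note u = list_sign_update[OF assms(1,2) x]
  have nth: "L ! p \<notin> set L - {L ! p}" by simp
  have L: "L[p := L ! p] = L" using assms(2) by simp
  have "list_sign (L[p := x]) = (- 1) ^ p * list_sign (take p L @ drop (Suc p) L)"
    unfolding u(1) list_sign.simps u(4) using assms(3)
    by (subst pos_sign_least) (auto intro: less_imp_le)
  moreover have "list_sign L = (- 1) ^ p * (pos_sign (L ! p) (set L) * list_sign (take p L @ drop (Suc p) L))"
    using list_sign_update(1)[OF assms(1,2) nth] unfolding L list_sign.simps u(4) by simp
  moreover have "pos_sign (L ! p) (set L) * pos_sign (L ! p) (set L) = 1"
    by (simp add: pos_sign_def flip: power_add mult_2)
  ultimately show ?thesis by (simp add: mult.assoc mult.left_commute[of _ "pos_sign (L ! p) (set L)"])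
qed

text \<open>The alternating relation permutes the entries, not the positions, so the reordering of a
  sorted column has to be realised by a permutation of values.\<close>

lemma sorted_map_permutes:
  assumes "distinct L"
  obtains \<sigma> where "\<sigma> permutes set L" "map \<sigma> (sorted_list_of_set (set L)) = L" "sign \<sigma> = list_sign L"
proof -
  have "mset L = mset (sorted_list_of_set (set L))"
    using assms by (intro set_eq_iff_mset_eq_distinct[THEN iffD1]) auto
  then obtain \<sigma> where \<sigma>: "\<sigma> permutes {..<length (sorted_list_of_set (set L))}"
    "permute_list \<sigma> (sorted_list_of_set (set L)) = L"
    by (rule mset_eq_permutation)
  let ?S = "sorted_list_of_set (set L)"
  \<comment> \<open>The map takes each value of the sorted list to the entry of \<open>L\<close> at
    the same position and fixes everything else.\<close>
  define \<tau> where "\<tau> x = (if x \<in> set L then (THE y. \<exists>p<length L. ?S ! p = x \<and> y = L ! p) else x)" for x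
  have len: "length ?S = length L" using assms by (simp add: distinct_card)
  have \<tau>: "\<tau> (?S ! p) = L ! p" if p: "p < length L" for p
  proof -
    have "?S ! p \<in> set L" using p len nth_mem[of p ?S] by simp
    moreover have "(THE y. \<exists>q<length L. ?S ! q = ?S ! p \<and> y = L ! q) = L ! p"
      using p len nth_eq_iff_index_eq[of ?S] by (intro the_equality) auto
    ultimately show ?thesis by (simp add: \<tau>_def)
  qed
  have map: "map \<tau> ?S = L" using len \<tau> by (intro nth_equalityI) auto
  have "\<tau> ` set L = set L" using arg_cong[OF map, of set] by simp
  then have "bij_betw \<tau> (set L) (set L)"
    by (simp add: bij_betw_def finite_surj_inj)
  then have perm: "\<tau> permutes set L" by (rule bij_imp_permutes) (simp add: \<tau>_def)
  have "list_sign (map \<tau> ?S) = sign \<tau> * list_sign ?S"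
    using perm by (intro list_sign_map_permutes) auto
  then have "sign \<tau> = list_sign L" by (simp add: map list_sign_sorted)
  with perm map show ?thesis by (rule that)
qed

text \<open>Bubble sort: the row shuffles only exchange neighbours, and together they make the order
  of the row irrelevant. The premise is restricted to lists with multiset \<open>M\<close> because
  the relation is available for genuine tableaux only.\<close>

lemma adjacent_swap_mset_eq:
  assumes "\<And>P a b Q. mset (P @ a # b # Q) = M \<Longrightarrow> f (P @ a # b # Q) = f (P @ b # a # Q)"
    and "mset xs = M" "mset ys = M"
  shows "f xs = f ys"
proof -
  have move: "f (P @ Q @ a # R) = f (P @ a # Q @ R)" if "mset (P @ Q @ a # R) = M" for P Q a R
    using that
  proof (induction Q arbitrary: R rule: rev_induct)
    case (snoc q Q)
    have "f (P @ (Q @ [q]) @ a # R) = f ((P @ Q) @ q # a # R)" by simp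
    also have "\<dots> = f ((P @ Q) @ a # q # R)" using snoc.prems by (intro assms(1)) simp
    also have "\<dots> = f (P @ a # Q @ q # R)"
      using snoc.IH[of "q # R"] snoc.prems by (simp add: add_mset_commute)
    finally show ?case by simp
  qed simp
  have "f (P @ xs) = f (P @ ys)" if "mset xs = mset ys" "mset (P @ xs) = M" for P
    using that
  proof (induction xs arbitrary: P ys)
    case (Cons x xs)
    then have "x \<in> set ys" by (metis list.set_intros(1) mset_eq_setD)
    then obtain Y Z where ys: "ys = Y @ x # Z" by (auto dest: split_list)
    have "f (P @ ys) = f (P @ x # Y @ Z)"
      unfolding ys using Cons.prems ys by (intro move) simp
    moreover have "f ((P @ [x]) @ xs) = f ((P @ [x]) @ Y @ Z)"
      using Cons.prems ys by (intro Cons.IH) auto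
    ultimately show ?case by simp
  qed simp
  from this[of "[]"] show ?thesis using assms(2,3) by simp
qed

context
  fixes A :: "('a, 'r) ring_scheme"
  assumes A: "cring A"
begin

interpretation T: module A "free_module A (tableaux cs n)"
  by (rule free_module_module[OF A])

interpretation P: module A "exterior_module A :: ('a, nat set \<times> 'z \<Rightarrow> 'a) module"
  by (rule free_module_module[OF A])

text \<open>The form in which a vanishing square becomes a shuffling relation. Moving
  \<open>x\<close> from the front into the slot vacated by the removed factor absorbs the
  alternating signs and leaves one common minus.\<close>

lemma koszul_wedge_Cons:
  assumes "distinct (x # L)"
  shows "koszul A \<tau> (wedge A (x # L) z) = wedge A L (\<tau> x z) \<ominus>\<^bsub>exterior_module A\<^esub>
    (\<Oplus>\<^bsub>exterior_module A\<^esub>p\<in>{..<length L}. wedge A (L[p := x]) (\<tau> (L ! p) z))"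
proof -
  note w = wedge_closed[OF A UNIV_I]
  note c = P.add.int_pow_closed[OF w]
  have neg: "(\<lambda>x. [(- 1 :: int)] \<cdot>\<^bsub>exterior_module A\<^esub> x) \<in> lin_hom A (exterior_module A) (exterior_module A)"
    by (rule lin_hom_int_pow[OF P.module_axioms P.id_lin_hom])
  interpret neg: lin_map A "exterior_module A" "exterior_module A" "\<lambda>x. [(- 1 :: int)] \<cdot>\<^bsub>exterior_module A\<^esub> x"
    by (intro lin_mapI P.module_axioms neg)
  have S: "{..<length (x # L)} = insert 0 (Suc ` {..<length L})"
    by (simp add: lessThan_Suc_eq_insert_0)
  have "koszul A \<tau> (wedge A (x # L) z) = (\<Oplus>\<^bsub>exterior_module A\<^esub>j\<in>insert 0 (Suc ` {..<length L}).
    [((- 1 :: int) ^ j)] \<cdot>\<^bsub>exterior_module A\<^esub> wedge A (take j (x # L) @ drop (Suc j) (x # L)) (\<tau> ((x # L) ! j) z))"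
    unfolding S[symmetric] by (rule koszul_wedge[OF A assms])
  also have "\<dots> = [((- 1 :: int) ^ 0)] \<cdot>\<^bsub>exterior_module A\<^esub> wedge A (take 0 (x # L) @ drop (Suc 0) (x # L)) (\<tau> ((x # L) ! 0) z)
    \<oplus>\<^bsub>exterior_module A\<^esub> (\<Oplus>\<^bsub>exterior_module A\<^esub>j\<in>Suc ` {..<length L}.
    [((- 1 :: int) ^ j)] \<cdot>\<^bsub>exterior_module A\<^esub> wedge A (take j (x # L) @ drop (Suc j) (x # L)) (\<tau> ((x # L) ! j) z))"
    by (rule P.finsum_insert) (auto intro!: c)
  also have "[((- 1 :: int) ^ 0)] \<cdot>\<^bsub>exterior_module A\<^esub> wedge A (take 0 (x # L) @ drop (Suc 0) (x # L)) (\<tau> ((x # L) ! 0) z)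
    = wedge A L (\<tau> x z)"
    by (simp add: w)
  also have "(\<Oplus>\<^bsub>exterior_module A\<^esub>j\<in>Suc ` {..<length L}.
    [((- 1 :: int) ^ j)] \<cdot>\<^bsub>exterior_module A\<^esub> wedge A (take j (x # L) @ drop (Suc j) (x # L)) (\<tau> ((x # L) ! j) z))
    = (\<Oplus>\<^bsub>exterior_module A\<^esub>p\<in>{..<length L}.
    [((- 1 :: int) ^ Suc p)] \<cdot>\<^bsub>exterior_module A\<^esub> wedge A (take (Suc p) (x # L) @ drop (Suc (Suc p)) (x # L)) (\<tau> ((x # L) ! Suc p) z))"
    by (rule P.finsum_reindex) (auto intro!: c)
  also have "\<dots> = (\<Oplus>\<^bsub>exterior_module A\<^esub>p\<in>{..<length L}.
    [(- 1 :: int)] \<cdot>\<^bsub>exterior_module A\<^esub> wedge A (L[p := x]) (\<tau> (L ! p) z))"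
  proof (rule P.finsum_cong')
    fix p assume p: "p \<in> {..<length L}"
    have x: "x \<notin> set L - {L ! p}" using assms by auto
    have d: "distinct L" "p < length L" using assms p by auto
    note u = list_sign_update[OF d x]
    have s: "set (x # take p L @ drop (Suc p) L) = set (L[p := x])" unfolding u(2) list.set(2) u(4) ..
    have "list_sign (x # take p L @ drop (Suc p) L) * ((- 1 :: int) ^ Suc p) = list_sign (L[p := x]) * (- 1)"
      unfolding u(1) by simp
    then show "[((- 1 :: int) ^ Suc p)] \<cdot>\<^bsub>exterior_module A\<^esub> wedge A (take (Suc p) (x # L) @ drop (Suc (Suc p)) (x # L)) (\<tau> ((x # L) ! Suc p) z)
      = [(- 1 :: int)] \<cdot>\<^bsub>exterior_module A\<^esub> wedge A (L[p := x]) (\<tau> (L ! p) z)"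
      unfolding take_Suc_Cons drop_Suc_Cons nth_Cons_Suc append_Cons wedge_def s
        P.add.int_pow_pow[OF delta_UNIV_closed[OF A]] by simp
  qed (auto intro!: c)
  also have "\<dots> = [(- 1 :: int)] \<cdot>\<^bsub>exterior_module A\<^esub> (\<Oplus>\<^bsub>exterior_module A\<^esub>p\<in>{..<length L}.
      wedge A (L[p := x]) (\<tau> (L ! p) z))"
    by (rule neg.map_finsum[symmetric]) (auto intro!: w)
  also have "\<dots> = \<ominus>\<^bsub>exterior_module A\<^esub> (\<Oplus>\<^bsub>exterior_module A\<^esub>p\<in>{..<length L}.
      wedge A (L[p := x]) (\<tau> (L ! p) z))"
    by (simp add: P.add.int_pow_neg w P.finsum_closed)
  finally show ?thesis by (simp add: a_minus_def)
qed

lemma tableau_rels_hook: "tableau_rels A (hook d i) n = hook_rels A d i n" (is "?L = ?R")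
proof -
  let ?P = "free_module A (tableaux (hook d i) n)"
  note dc = delta_closed[OF A, of _ "tableaux (hook d i) n"]
  have col_sum: "(\<Oplus>\<^bsub>?P\<^esub>S\<in>{S. S \<subseteq> {..<length col} \<and> card S = Suc 0}. delta A (exchange (hook_tableau col (x # row)) 0 S))
      = (\<Oplus>\<^bsub>?P\<^esub>p\<in>{..<length col}. delta A (hook_tableau (col[p := x]) (col ! p # row)))"
    if T: "hook_tableau col (x # row) \<in> tableaux (hook d i) n" for col x row
  proof -
    have c: "hook_tableau (col[p := x]) (col ! p # row) \<in> tableaux (hook d i) n" if p: "p < length col" for p
    proof -
      have x: "x \<notin> set col - {col ! p}" and "distinct col" using T by (auto simp: hook_tableau_in_tableaux)
      note u = list_sign_update(2,3)[OF this(2) p this(1)]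
      have "col ! p \<in> set col" using p by simp
      then show ?thesis using T u unfolding hook_tableau_in_tableaux by (auto simp: subset_iff)
    qed
    have "(\<Oplus>\<^bsub>?P\<^esub>S\<in>(\<lambda>p. {p}) ` {..<length col}. delta A (exchange (hook_tableau col (x # row)) 0 S))
      = (\<Oplus>\<^bsub>?P\<^esub>p\<in>{..<length col}. delta A (exchange (hook_tableau col (x # row)) 0 {p}))"
      by (rule T.finsum_reindex) (auto intro!: dc simp: exchange_column c)
    also have "\<dots> = (\<Oplus>\<^bsub>?P\<^esub>p\<in>{..<length col}. delta A (hook_tableau (col[p := x]) (col ! p # row)))"
      by (rule T.finsum_cong') (auto intro!: dc simp: exchange_column c)
    finally show ?thesis by (simp add: subsets_card_1)
  qed
  have row_swap: "(\<Oplus>\<^bsub>?P\<^esub>S\<in>{S. S \<subseteq> {..<Suc 0} \<and> card S = Suc 0}. delta A (exchange (hook_tableau col (R @ a # b # Q)) (Suc (length R)) S))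
      = delta A (hook_tableau col (R @ b # a # Q))"
    if T: "hook_tableau col (R @ a # b # Q) \<in> tableaux (hook d i) n" for col R a b Q
  proof -
    have c: "hook_tableau col (R @ b # a # Q) \<in> tableaux (hook d i) n"
      using T by (auto simp: hook_tableau_in_tableaux)
    have "{S. S \<subseteq> {..<Suc 0} \<and> card S = Suc 0} = {{0}}" unfolding subsets_card_1 by (simp add: lessThan_Suc)
    then show ?thesis using dc[OF c] by (simp add: exchange_row T.finsum_insert)
  qed
  have perm: "map (map \<sigma>) (hook_tableau col row) = hook_tableau (map \<sigma> col) row"
    if "\<And>x. x \<in> set row \<Longrightarrow> \<sigma> x = x" for \<sigma> col row
    using that by (simp add: map_hook_tableau map_idI)
  show ?thesis
  proof
    show "?L \<subseteq> ?R"
    proof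
      fix z assume "z \<in> ?L"
      then consider (alt) \<sigma> T where "T \<in> tableaux (hook d i) n" "\<sigma> permutes set (concat T)"
        "\<forall>c\<in>set T. \<sigma> ` set c = set c" "z = delta A (map (map \<sigma>) T) \<ominus>\<^bsub>?P\<^esub> [sign \<sigma>] \<cdot>\<^bsub>?P\<^esub> delta A T"
      | (sh) T j k where "T \<in> tableaux (hook d i) n" "Suc j < length T" "1 \<le> k" "k \<le> length (T ! Suc j)"
        "z = delta A T \<ominus>\<^bsub>?P\<^esub> (\<Oplus>\<^bsub>?P\<^esub>S\<in>{S. S \<subseteq> {..<length (T ! j)} \<and> card S = k}. delta A (exchange T j S))"
        unfolding tableau_rels_def Let_def by blast
      then show "z \<in> ?R"
      proof cases
        case alt
        obtain col row where T: "T = hook_tableau col row" by (rule tableaux_hookE[OF alt(1)])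
        \<comment> \<open>The remaining columns are singletons, so preserving them as sets means
          fixing their entries; the permutation moves only the first column.\<close>
        have fix_row: "\<sigma> x = x" if "x \<in> set row" for x
          using alt(3) that by (auto simp: T hook_tableau_def)
        have "\<sigma> permutes set col"
          using alt(2)[unfolded T] by (rule permutes_superset) (use fix_row in auto)
        moreover have "map (map \<sigma>) T = hook_tableau (map \<sigma> col) row"
          unfolding T by (rule perm) (rule fix_row)
        ultimately show ?thesis
          using alt(1,4) unfolding hook_rels_def Let_def
          by (intro UnI1 CollectI exI[of _ \<sigma>] exI[of _ col] exI[of _ row]) (simp add: T)
      next
        case sh
        obtain col row where T: "T = hook_tableau col row" by (rule tableaux_hookE[OF sh(1)])
        have j: "j < length row" using sh(2) by (simp add: T hook_tableau_def)
        have k: "k = Suc 0" using sh(3,4) j by (simp add: T hook_tableau_def)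
        show ?thesis
        proof (cases j)
          case 0
          then obtain x row' where row': "row = x # row'" using j by (cases row) auto
          have "T ! 0 = col" by (simp add: T hook_tableau_def)
          then have "z = delta A (hook_tableau col (x # row')) \<ominus>\<^bsub>?P\<^esub>
            (\<Oplus>\<^bsub>?P\<^esub>p\<in>{..<length col}. delta A (hook_tableau (col[p := x]) (col ! p # row')))"
            using sh(5) col_sum[of col x row'] sh(1) by (simp add: 0 k T row')
          then show ?thesis using sh(1) unfolding T row' hook_rels_def Let_def by blast
        next
          \<comment> \<open>The columns with indices \<open>Suc m\<close> and
            \<open>Suc (Suc m)\<close> hold the row entries at positions \<open>m\<close> and
            \<open>Suc m\<close>, as index 0 is the long column.\<close>
          case (Suc m)
          define R where "R = take m row"
          define Q where "Q = drop (Suc (Suc m)) row"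
          have "row = R @ row ! m # row ! Suc m # Q"
            using j unfolding R_def Q_def Suc by (metis Cons_nth_drop_Suc Suc_lessD id_take_nth_drop)
          then obtain a b where row': "row = R @ a # b # Q" by blast
          have m: "m = length R" using j by (simp add: R_def Suc)
          have "T ! Suc m = [a]" by (simp add: T hook_tableau_def row' m nth_append)
          then have "z = delta A (hook_tableau col (R @ a # b # Q)) \<ominus>\<^bsub>?P\<^esub> delta A (hook_tableau col (R @ b # a # Q))"
            using sh(5) row_swap[of col R a b Q] sh(1) by (simp add: Suc k T row' m)
          then show ?thesis using sh(1) unfolding T row' hook_rels_def Let_def by blast
        qed
      qed
    qed
    show "?R \<subseteq> ?L"
    proof
      fix z assume "z \<in> ?R"
      then consider (alt) \<sigma> col row where "hook_tableau col row \<in> tableaux (hook d i) n" "\<sigma> permutes set col"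
        "z = delta A (hook_tableau (map \<sigma> col) row) \<ominus>\<^bsub>?P\<^esub> [sign \<sigma>] \<cdot>\<^bsub>?P\<^esub> delta A (hook_tableau col row)"
      | (col) col x row where "hook_tableau col (x # row) \<in> tableaux (hook d i) n"
        "z = delta A (hook_tableau col (x # row)) \<ominus>\<^bsub>?P\<^esub>
          (\<Oplus>\<^bsub>?P\<^esub>p\<in>{..<length col}. delta A (hook_tableau (col[p := x]) (col ! p # row)))"
      | (row) col R a b Q where "hook_tableau col (R @ a # b # Q) \<in> tableaux (hook d i) n"
        "z = delta A (hook_tableau col (R @ a # b # Q)) \<ominus>\<^bsub>?P\<^esub> delta A (hook_tableau col (R @ b # a # Q))"
        unfolding hook_rels_def Let_def by blast
      then show "z \<in> ?L"
      proof cases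
        case alt
        have fix_row: "\<sigma> x = x" if "x \<in> set row" for x
          using alt(1,2) that by (intro permutes_not_in) (auto simp: hook_tableau_in_tableaux)
        have "\<sigma> permutes set (concat (hook_tableau col row))"
          using alt(2) by (rule permutes_subset) simp
        moreover have "\<forall>c\<in>set (hook_tableau col row). \<sigma> ` set c = set c"
          using fix_row permutes_image[OF alt(2)] by (auto simp: hook_tableau_def)
        ultimately show ?thesis
          using alt(1,3) perm[OF fix_row, where col = col]
          unfolding tableau_rels_def Let_def by (intro UnI1 CollectI exI[of _ \<sigma>] exI[of _ "hook_tableau col row"]) simp
      next
        case (col col x row)
        have "z = delta A (hook_tableau col (x # row)) \<ominus>\<^bsub>?P\<^esub>
          (\<Oplus>\<^bsub>?P\<^esub>S\<in>{S. S \<subseteq> {..<length (hook_tableau col (x # row) ! 0)} \<and> card S = Suc 0}. delta A (exchange (hook_tableau col (x # row)) 0 S))"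
          using col(2) col_sum[OF col(1)] by (simp add: hook_tableau_def)
        then show ?thesis
          using col(1) unfolding tableau_rels_def Let_def
          by (intro UnI2 CollectI exI[of _ "hook_tableau col (x # row)"] exI[of _ 0] exI[of _ "Suc 0"])
            (simp add: hook_tableau_def)
      next
        case (row col R a b Q)
        have nth: "hook_tableau col (R @ a # b # Q) ! Suc (length R) = [a]"
          "hook_tableau col (R @ a # b # Q) ! Suc (Suc (length R)) = [b]"
          by (simp_all add: hook_tableau_def nth_append)
        have "z = delta A (hook_tableau col (R @ a # b # Q)) \<ominus>\<^bsub>?P\<^esub>
          (\<Oplus>\<^bsub>?P\<^esub>S\<in>{S. S \<subseteq> {..<length (hook_tableau col (R @ a # b # Q) ! Suc (length R))} \<and> card S = Suc 0}.
            delta A (exchange (hook_tableau col (R @ a # b # Q)) (Suc (length R)) S))"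
          using row(2) row_swap[OF row(1)] by (simp add: nth)
        then show ?thesis
          using row(1) unfolding tableau_rels_def Let_def
          by (intro UnI2 CollectI exI[of _ "hook_tableau col (R @ a # b # Q)"] exI[of _ "Suc (length R)"] exI[of _ "Suc 0"])
            (simp add: nth, simp add: hook_tableau_def)
      qed
    qed
  qed
qed

end

lemma hook_permute: "hook_tableau col row \<in> tableaux (hook d i) n \<Longrightarrow> \<sigma> permutes set col \<Longrightarrow>
    hook_tableau (map \<sigma> col) row \<in> tableaux (hook d i) n"
  by (auto simp: hook_tableau_in_tableaux distinct_map permutes_inj_on permutes_image)

lemma hook_shuffle: "hook_tableau col (x # row) \<in> tableaux (hook d i) n \<Longrightarrow> p < length col \<Longrightarrow>
    hook_tableau (col[p := x]) (col ! p # row) \<in> tableaux (hook d i) n"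
proof -
  assume T: "hook_tableau col (x # row) \<in> tableaux (hook d i) n" and p: "p < length col"
  have x: "x \<notin> set col - {col ! p}" and "distinct col" using T by (auto simp: hook_tableau_in_tableaux)
  note u = list_sign_update(2,3)[OF this(2) p this(1)]
  have "col ! p \<in> set col" using p by simp
  then show ?thesis using T u unfolding hook_tableau_in_tableaux by (auto simp: subset_iff)
qed

lemma hook_swap: "hook_tableau col (P @ a # b # Q) \<in> tableaux (hook d i) n \<Longrightarrow>
    hook_tableau col (P @ b # a # Q) \<in> tableaux (hook d i) n"
  by (auto simp: hook_tableau_in_tableaux)

section \<open>The modules generated by hook tableaux\<close>

lemma U_mod_eq: "U_mod A d i n = quot_module (free_module A (tableaux (hook d i) n))
    (span_of A (free_module A (tableaux (hook d i) n)) (tableau_rels A (hook d i) n))"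
  by (simp add: U_mod_def tableau_module_def Let_def)

lemma tableau_class_eq: "tableau_class A (hook d i) n T =
    span_of A (free_module A (tableaux (hook d i) n)) (tableau_rels A (hook d i) n)
      +>\<^bsub>free_module A (tableaux (hook d i) n)\<^esub> delta A T"
  by (simp add: tableau_class_def Let_def)

context
  fixes A :: "('a, 'r) ring_scheme"
  assumes A: "cring A"
begin

interpretation T: module A "free_module A (tableaux cs n)"
  by (rule free_module_module[OF A])

interpretation P: module A "exterior_module A :: ('a, nat set \<times> 'z \<Rightarrow> 'a) module"
  by (rule free_module_module[OF A])

lemma tableau_rels_subset:
  "tableau_rels A (hook d i) n \<subseteq> carrier (free_module A (tableaux (hook d i) n))"
  unfolding tableau_rels_hook[OF A] hook_rels_def Let_def
  by (auto intro!: T.minus_closed T.add.int_pow_closed T.finsum_closed delta_closed[OF A]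
      hook_permute hook_shuffle hook_swap)

lemma tableau_span_submodule:
  "submodule (span_of A (free_module A (tableaux (hook d i) n)) (tableau_rels A (hook d i) n)) A
    (free_module A (tableaux (hook d i) n))"
  by (rule span_of_submodule[OF T.module_axioms tableau_rels_subset])

lemma U_module: "module A (U_mod A d i n)"
  unfolding U_mod_eq by (rule quot_module_module[OF T.module_axioms tableau_span_submodule])

lemma U_proj: "lin_map A (free_module A (tableaux (hook d i) n)) (U_mod A d i n)
  (\<lambda>x. span_of A (free_module A (tableaux (hook d i) n)) (tableau_rels A (hook d i) n)
      +>\<^bsub>free_module A (tableaux (hook d i) n)\<^esub> x)"
  unfolding U_mod_eq
  by (intro lin_mapI T.module_axioms quot_module_structure[OF T.module_axioms tableau_span_submodule])

interpretation U: module A "U_mod A d i n" by (rule U_module)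

lemma tableau_class_closed: "T \<in> tableaux (hook d i) n \<Longrightarrow> tableau_class A (hook d i) n T \<in> carrier (U_mod A d i n)"
  unfolding tableau_class_eq by (rule lin_map.map_closed[OF U_proj]) (rule delta_closed[OF A])

lemma U_span: "span_of A (U_mod A d i n) (tableau_class A (hook d i) n ` tableaux (hook d i) n)
    = carrier (U_mod A d i n)"
proof -
  have "tableau_class A (hook d i) n ` tableaux (hook d i) n =
    (\<lambda>x. span_of A (free_module A (tableaux (hook d i) n)) (tableau_rels A (hook d i) n)
      +>\<^bsub>free_module A (tableaux (hook d i) n)\<^esub> x) ` delta A ` tableaux (hook d i) n"
    by (simp add: image_image tableau_class_eq)
  then show ?thesis
    unfolding U_mod_eq
    using quot_module_span[OF T.module_axioms tableau_span_submodule _ free_module_span_delta[OF A]]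
      delta_closed[OF A] by (metis image_subsetI)
qed

lemma tableau_class_relation:
  assumes "x \<ominus>\<^bsub>free_module A (tableaux (hook d i) n)\<^esub> y \<in> hook_rels A d i n"
    and "x \<in> carrier (free_module A (tableaux (hook d i) n))" "y \<in> carrier (free_module A (tableaux (hook d i) n))"
  shows "span_of A (free_module A (tableaux (hook d i) n)) (tableau_rels A (hook d i) n)
      +>\<^bsub>free_module A (tableaux (hook d i) n)\<^esub> x =
    span_of A (free_module A (tableaux (hook d i) n)) (tableau_rels A (hook d i) n)
      +>\<^bsub>free_module A (tableaux (hook d i) n)\<^esub> y"
proof -
  interpret p: lin_map A "free_module A (tableaux (hook d i) n)" "U_mod A d i n"
    "\<lambda>x. span_of A (free_module A (tableaux (hook d i) n)) (tableau_rels A (hook d i) n)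
      +>\<^bsub>free_module A (tableaux (hook d i) n)\<^esub> x"
    by (rule U_proj)
  have "span_of A (free_module A (tableaux (hook d i) n)) (tableau_rels A (hook d i) n)
      +>\<^bsub>free_module A (tableaux (hook d i) n)\<^esub> (x \<ominus>\<^bsub>free_module A (tableaux (hook d i) n)\<^esub> y) = \<zero>\<^bsub>U_mod A d i n\<^esub>"
    unfolding U_mod_eq
    by (rule quot_proj_eq_zero[OF T.module_axioms tableau_span_submodule])
      (rule subsetD[OF span_of_superset assms(1)[folded tableau_rels_hook[OF A]]])
  then show ?thesis
    using assms(2,3) by (simp add: p.map_minus U.minus_eq_zero_iff)
qed

lemma tableau_class_permute:
  assumes T: "hook_tableau col row \<in> tableaux (hook d i) n" and \<sigma>: "\<sigma> permutes set col"
  shows "tableau_class A (hook d i) n (hook_tableau (map \<sigma> col) row)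
    = [sign \<sigma>] \<cdot>\<^bsub>U_mod A d i n\<^esub> tableau_class A (hook d i) n (hook_tableau col row)"
proof -
  note dc = delta_closed[OF A]
  have "span_of A (free_module A (tableaux (hook d i) n)) (tableau_rels A (hook d i) n)
      +>\<^bsub>free_module A (tableaux (hook d i) n)\<^esub> delta A (hook_tableau (map \<sigma> col) row) =
    span_of A (free_module A (tableaux (hook d i) n)) (tableau_rels A (hook d i) n)
      +>\<^bsub>free_module A (tableaux (hook d i) n)\<^esub> ([sign \<sigma>] \<cdot>\<^bsub>free_module A (tableaux (hook d i) n)\<^esub> delta A (hook_tableau col row))"
    by (rule tableau_class_relation)
      (use T \<sigma> in \<open>auto simp: hook_rels_def Let_def intro!: dc T.add.int_pow_closed hook_permute\<close>)
  then show ?thesis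
    unfolding tableau_class_eq lin_map.map_int_pow[OF U_proj dc[OF T]] .
qed

lemma tableau_class_shuffle:
  assumes T: "hook_tableau col (x # row) \<in> tableaux (hook d i) n"
  shows "tableau_class A (hook d i) n (hook_tableau col (x # row))
    = (\<Oplus>\<^bsub>U_mod A d i n\<^esub>p\<in>{..<length col}. tableau_class A (hook d i) n (hook_tableau (col[p := x]) (col ! p # row)))"
proof -
  note dc = delta_closed[OF A]
  have c: "(\<lambda>p. delta A (hook_tableau (col[p := x]) (col ! p # row))) \<in> {..<length col}
      \<rightarrow> carrier (free_module A (tableaux (hook d i) n))"
    using T by (auto intro!: dc hook_shuffle)
  have "span_of A (free_module A (tableaux (hook d i) n)) (tableau_rels A (hook d i) n)
      +>\<^bsub>free_module A (tableaux (hook d i) n)\<^esub> delta A (hook_tableau col (x # row)) =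
    span_of A (free_module A (tableaux (hook d i) n)) (tableau_rels A (hook d i) n)
      +>\<^bsub>free_module A (tableaux (hook d i) n)\<^esub>
      (\<Oplus>\<^bsub>free_module A (tableaux (hook d i) n)\<^esub>p\<in>{..<length col}. delta A (hook_tableau (col[p := x]) (col ! p # row)))"
    by (rule tableau_class_relation)
      (use T c in \<open>auto simp: hook_rels_def Let_def intro!: dc T.finsum_closed\<close>)
  then show ?thesis
    unfolding tableau_class_eq lin_map.map_finsum[OF U_proj c] .
qed

lemma tableau_class_swap:
  assumes T: "hook_tableau col (P @ a # b # Q) \<in> tableaux (hook d i) n"
  shows "tableau_class A (hook d i) n (hook_tableau col (P @ a # b # Q))
    = tableau_class A (hook d i) n (hook_tableau col (P @ b # a # Q))"
  unfolding tableau_class_eq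
  by (rule tableau_class_relation)
    (use T in \<open>auto simp: hook_rels_def Let_def intro!: delta_closed[OF A] hook_swap\<close>)

text \<open>The universal property in the form used later: after \<open>tableau_rels_hook\<close>
  only alternation of the long column, the single-box shuffle with it, and swaps of neighbours in
  the row have to be respected.\<close>

lemma U_lift:
  assumes Q: "module A Q" and g: "g \<in> tableaux (hook d i) n \<rightarrow> carrier Q"
    and g1: "\<And>\<sigma> col row. hook_tableau col row \<in> tableaux (hook d i) n \<Longrightarrow> \<sigma> permutes set col \<Longrightarrow>
      g (hook_tableau (map \<sigma> col) row) = [sign \<sigma>] \<cdot>\<^bsub>Q\<^esub> g (hook_tableau col row)"
    and g2: "\<And>col x row. hook_tableau col (x # row) \<in> tableaux (hook d i) n \<Longrightarrow>
      g (hook_tableau col (x # row)) = (\<Oplus>\<^bsub>Q\<^esub>p\<in>{..<length col}. g (hook_tableau (col[p := x]) (col ! p # row)))"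
    and g3: "\<And>col P a b R. hook_tableau col (P @ a # b # R) \<in> tableaux (hook d i) n \<Longrightarrow>
      g (hook_tableau col (P @ a # b # R)) = g (hook_tableau col (P @ b # a # R))"
  shows "\<exists>h\<in>lin_hom A (U_mod A d i n) Q. \<forall>T\<in>tableaux (hook d i) n. h (tableau_class A (hook d i) n T) = g T"
proof -
  interpret Q: module A Q by fact
  let ?P = "free_module A (tableaux (hook d i) n)"
  note dc = delta_closed[OF A, of _ "tableaux (hook d i) n"]
  define G where "G c = lin_comb A Q (tableaux (hook d i) n) c g" for c
  interpret G: lin_map A ?P Q G
    unfolding G_def by (intro lin_mapI T.module_axioms Q lin_comb_lin_hom g)
  have Gd: "G (delta A T) = g T" if "T \<in> tableaux (hook d i) n" for T
    unfolding G_def using that by (rule lin_comb_delta[OF Q g])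
  have gc: "g T \<in> carrier Q" if "T \<in> tableaux (hook d i) n" for T using g that by auto
  have "G x \<in> {\<zero>\<^bsub>Q\<^esub>}" if "x \<in> span_of A ?P (tableau_rels A (hook d i) n)" for x
  proof (rule span_of_vimage[OF T.module_axioms Q G.lin_hom submodule_singleton_zero[OF Q] tableau_rels_subset _ that])
    fix s assume "s \<in> tableau_rels A (hook d i) n"
    then consider (alt) \<sigma> col row where "hook_tableau col row \<in> tableaux (hook d i) n" "\<sigma> permutes set col"
        "s = delta A (hook_tableau (map \<sigma> col) row) \<ominus>\<^bsub>?P\<^esub> [sign \<sigma>] \<cdot>\<^bsub>?P\<^esub> delta A (hook_tableau col row)"
      | (col) col x row where "hook_tableau col (x # row) \<in> tableaux (hook d i) n"
        "s = delta A (hook_tableau col (x # row)) \<ominus>\<^bsub>?P\<^esub>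
          (\<Oplus>\<^bsub>?P\<^esub>p\<in>{..<length col}. delta A (hook_tableau (col[p := x]) (col ! p # row)))"
      | (row) col R a b S where "hook_tableau col (R @ a # b # S) \<in> tableaux (hook d i) n"
        "s = delta A (hook_tableau col (R @ a # b # S)) \<ominus>\<^bsub>?P\<^esub> delta A (hook_tableau col (R @ b # a # S))"
      unfolding tableau_rels_hook[OF A] hook_rels_def Let_def by blast
    then have "G s = \<zero>\<^bsub>Q\<^esub>"
    proof cases
      case alt
      have "G s = g (hook_tableau (map \<sigma> col) row) \<ominus>\<^bsub>Q\<^esub> [sign \<sigma>] \<cdot>\<^bsub>Q\<^esub> g (hook_tableau col row)"
        using alt by (simp add: G.map_minus G.map_int_pow dc Gd hook_permute)
      then show ?thesis
        using g1[OF alt(1,2)] gc[OF hook_permute[OF alt(1,2)]] by (simp add: Q.minus_eq_zero_iff gc alt(1))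
    next
      case col
      have c: "(\<lambda>p. delta A (hook_tableau (col[p := x]) (col ! p # row))) \<in> {..<length col} \<rightarrow> carrier ?P"
        using col(1) by (auto intro!: dc hook_shuffle)
      have "G s = g (hook_tableau col (x # row)) \<ominus>\<^bsub>Q\<^esub>
          (\<Oplus>\<^bsub>Q\<^esub>p\<in>{..<length col}. G (delta A (hook_tableau (col[p := x]) (col ! p # row))))"
        unfolding col(2) using col(1) c by (simp add: G.map_minus T.finsum_closed dc Gd G.map_finsum)
      also have "(\<Oplus>\<^bsub>Q\<^esub>p\<in>{..<length col}. G (delta A (hook_tableau (col[p := x]) (col ! p # row))))
        = (\<Oplus>\<^bsub>Q\<^esub>p\<in>{..<length col}. g (hook_tableau (col[p := x]) (col ! p # row)))"
        using col(1) by (intro Q.finsum_cong') (auto intro!: gc Gd hook_shuffle)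
      finally show ?thesis
        using g2[OF col(1)] gc[OF col(1)] by (simp add: Q.minus_eq_zero_iff)
    next
      case row
      have "G s = g (hook_tableau col (R @ a # b # S)) \<ominus>\<^bsub>Q\<^esub> g (hook_tableau col (R @ b # a # S))"
        using row by (simp add: G.map_minus dc Gd hook_swap)
      then show ?thesis
        using g3[OF row(1)] gc[OF hook_swap[OF row(1)]] by (simp add: Q.minus_eq_zero_iff)
    qed
    then show "G s \<in> {\<zero>\<^bsub>Q\<^esub>}" by simp
  qed
  then obtain h where "h \<in> lin_hom A (U_mod A d i n) Q"
    and "\<And>x. x \<in> carrier ?P \<Longrightarrow> h (span_of A ?P (tableau_rels A (hook d i) n) +>\<^bsub>?P\<^esub> x) = G x"
    using quot_module_lift[OF T.module_axioms Q tableau_span_submodule G.lin_hom] unfolding U_mod_eq by blast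
  then show ?thesis by (intro bexI[of _ h]) (auto simp: tableau_class_eq dc Gd)
qed

section \<open>The modules \<open>F\<close>\<close>

lemma F_module: "module A (F_mod A d i n)"
  unfolding F_mod_def by (rule tensor_module[OF U_module mpol_module[OF A]])

interpretation F: module A "F_mod A d i n" by (rule F_module)

lemma F_gen_lin_hom:
  "T \<in> tableaux (hook d i) n \<Longrightarrow> (\<lambda>p. F_gen A d i n p T) \<in> lin_hom A (mpol_ring A n) (F_mod A d i n)"
  unfolding F_mod_def F_gen_def
  by (rule pure_tensor_lin_hom2[OF U_module mpol_module[OF A] tableau_class_closed])

lemma F_gen_closed: "T \<in> tableaux (hook d i) n \<Longrightarrow> p \<in> carrier (mpol_ring A n) \<Longrightarrow>
    F_gen A d i n p T \<in> carrier (F_mod A d i n)"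
  by (rule lin_hom_closed[OF F_gen_lin_hom])

lemma F_gen_map: "p \<in> carrier (mpol_ring A n) \<Longrightarrow>
    lin_map A (U_mod A d i n) (F_mod A d i n) (\<lambda>u. pure_tensor A (U_mod A d i n) (mpol_ring A n) u p)"
  by (intro lin_mapI U_module F_module)
    (simp add: F_mod_def pure_tensor_lin_hom1[OF U_module mpol_module[OF A]])

lemma F_gen_permute:
  assumes "hook_tableau col row \<in> tableaux (hook d i) n" "\<sigma> permutes set col" "p \<in> carrier (mpol_ring A n)"
  shows "F_gen A d i n p (hook_tableau (map \<sigma> col) row)
    = [sign \<sigma>] \<cdot>\<^bsub>F_mod A d i n\<^esub> F_gen A d i n p (hook_tableau col row)"
  unfolding F_gen_def tableau_class_permute[OF assms(1,2)]
  by (rule lin_map.map_int_pow[OF F_gen_map[OF assms(3)] tableau_class_closed[OF assms(1)]])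

lemma F_gen_shuffle:
  assumes "hook_tableau col (x # row) \<in> tableaux (hook d i) n" "p \<in> carrier (mpol_ring A n)"
  shows "F_gen A d i n p (hook_tableau col (x # row))
    = (\<Oplus>\<^bsub>F_mod A d i n\<^esub>j\<in>{..<length col}. F_gen A d i n p (hook_tableau (col[j := x]) (col ! j # row)))"
  unfolding F_gen_def tableau_class_shuffle[OF assms(1)]
  by (rule lin_map.map_finsum[OF F_gen_map[OF assms(2)]])
    (use assms(1) in \<open>auto intro!: tableau_class_closed hook_shuffle\<close>)

lemma F_gen_swap:
  assumes "hook_tableau col (P @ a # b # Q) \<in> tableaux (hook d i) n"
  shows "F_gen A d i n p (hook_tableau col (P @ a # b # Q)) = F_gen A d i n p (hook_tableau col (P @ b # a # Q))"
  unfolding F_gen_def tableau_class_swap[OF assms] ..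

lemma F_gen_row_mset:
  assumes "hook_tableau col row \<in> tableaux (hook d i) n" "mset row = mset row'"
  shows "F_gen A d i n p (hook_tableau col row) = F_gen A d i n p (hook_tableau col row')"
proof (rule adjacent_swap_mset_eq[where f = "\<lambda>row. F_gen A d i n p (hook_tableau col row)"])
  fix P a b Q assume m: "mset (P @ a # b # Q) = mset row"
  have "length (P @ a # b # Q) = length row" "set (P @ a # b # Q) = set row"
    "distinct (P @ a # b # Q) = distinct row"
    using m by (rule mset_eq_length, rule mset_eq_setD) (use m in \<open>rule mset_eq_imp_distinct_iff\<close>)
  then have "hook_tableau col (P @ a # b # Q) \<in> tableaux (hook d i) n"
    using assms(1) unfolding hook_tableau_in_tableaux set_append distinct_append by simp
  then show "F_gen A d i n p (hook_tableau col (P @ a # b # Q)) = F_gen A d i n p (hook_tableau col (P @ b # a # Q))"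
    by (rule F_gen_swap)
qed (use assms(2) in auto)

text \<open>Normal form of a generator: reordering the row is free, reordering the column costs its
  sign. The values of \<open>hook_retract\<close> are already of this kind, which makes them
  comparable with arbitrary generators.\<close>

lemma F_gen_standard:
  assumes "hook_tableau col row \<in> tableaux (hook d i) n" "p \<in> carrier (mpol_ring A n)"
  shows "F_gen A d i n p (hook_tableau col row) = [list_sign col] \<cdot>\<^bsub>F_mod A d i n\<^esub>
    F_gen A d i n p (hook_tableau (sorted_list_of_set (set col)) (sorted_list_of_set (set row)))"
proof -
  have d: "distinct col" "distinct row" using assms(1) by (auto simp: hook_tableau_in_tableaux)
  obtain \<sigma> where \<sigma>: "\<sigma> permutes set col" "map \<sigma> (sorted_list_of_set (set col)) = col" "sign \<sigma> = list_sign col"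
    by (rule sorted_map_permutes[OF d(1)])
  have T: "hook_tableau (sorted_list_of_set (set col)) row \<in> tableaux (hook d i) n"
    using assms(1) by (auto simp: hook_tableau_in_tableaux distinct_card)
  have "F_gen A d i n p (hook_tableau (map \<sigma> (sorted_list_of_set (set col))) row)
    = [sign \<sigma>] \<cdot>\<^bsub>F_mod A d i n\<^esub> F_gen A d i n p (hook_tableau (sorted_list_of_set (set col)) row)"
    using \<sigma>(1) by (intro F_gen_permute[OF T _ assms(2)]) simp
  moreover have "mset row = mset (sorted_list_of_set (set row))"
    using d(2) by (intro set_eq_iff_mset_eq_distinct[THEN iffD1]) auto
  ultimately show ?thesis
    unfolding \<sigma>(2,3) using F_gen_row_mset[OF T] by simp
qed

text \<open>Arbitrary polynomials in the second factor match the generators in the definition of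
  \<open>F_FI\<close>; the variant \<open>F_span\<close> with monomials is the one on which maps are
  computed.\<close>

lemma F_span_pure: "span_of A (F_mod A d i n)
    ((\<lambda>(T, p). F_gen A d i n p T) ` (tableaux (hook d i) n \<times> carrier (mpol_ring A n))) = carrier (F_mod A d i n)"
proof -
  interpret R: module A "mpol_ring A n" by (rule mpol_module[OF A])
  have "span_of A (mpol_ring A n) (carrier (mpol_ring A n)) = carrier (mpol_ring A n)"
    using span_of_superset[of "carrier (mpol_ring A n)" A "mpol_ring A n"]
      span_of_least[OF R.carrier_is_submodule order.refl] by blast
  then have "span_of A (F_mod A d i n) ((\<lambda>(x, y). pure_tensor A (U_mod A d i n) (mpol_ring A n) x y) `
      (tableau_class A (hook d i) n ` tableaux (hook d i) n \<times> carrier (mpol_ring A n))) = carrier (F_mod A d i n)"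
    unfolding F_mod_def
    by (rule tensor_span_generators[OF U_module mpol_module[OF A] _ U_span order.refl, rotated])
      (auto intro: tableau_class_closed)
  moreover have "(\<lambda>(x, y). pure_tensor A (U_mod A d i n) (mpol_ring A n) x y) `
      (tableau_class A (hook d i) n ` tableaux (hook d i) n \<times> carrier (mpol_ring A n))
    = (\<lambda>(T, p). F_gen A d i n p T) ` (tableaux (hook d i) n \<times> carrier (mpol_ring A n))"
    by (force simp: F_gen_def)
  ultimately show ?thesis by simp
qed

lemma F_span: "span_of A (F_mod A d i n)
    ((\<lambda>(T, m). F_gen A d i n (delta A m) T) ` (tableaux (hook d i) n \<times> monoms n)) = carrier (F_mod A d i n)"
proof -
  have "span_of A (F_mod A d i n) ((\<lambda>(x, y). pure_tensor A (U_mod A d i n) (mpol_ring A n) x y) `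
      (tableau_class A (hook d i) n ` tableaux (hook d i) n \<times> delta A ` monoms n)) = carrier (F_mod A d i n)"
    unfolding F_mod_def
    by (rule tensor_span_generators[OF U_module mpol_module[OF A] _ U_span _ mpol_span[OF A]])
      (auto intro: tableau_class_closed mpol_delta_closed[OF A])
  moreover have "(\<lambda>(x, y). pure_tensor A (U_mod A d i n) (mpol_ring A n) x y) `
      (tableau_class A (hook d i) n ` tableaux (hook d i) n \<times> delta A ` monoms n)
    = (\<lambda>(T, m). F_gen A d i n (delta A m) T) ` (tableaux (hook d i) n \<times> monoms n)"
    by (force simp: F_gen_def)
  ultimately show ?thesis by simp
qed

lemma F_hom_eqI:
  assumes "module A Q" "f \<in> lin_hom A (F_mod A d i n) Q" "g \<in> lin_hom A (F_mod A d i n) Q"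
    and "\<And>col row m. hook_tableau col row \<in> tableaux (hook d i) n \<Longrightarrow> m \<in> monoms n \<Longrightarrow>
      f (F_gen A d i n (delta A m) (hook_tableau col row)) = g (F_gen A d i n (delta A m) (hook_tableau col row))"
    and "x \<in> carrier (F_mod A d i n)"
  shows "f x = g x"
proof (rule lin_hom_eq_on_span[OF F_module assms(1-3) F_span _ _ assms(5)])
  show "(\<lambda>(T, m). F_gen A d i n (delta A m) T) ` (tableaux (hook d i) n \<times> monoms n) \<subseteq> carrier (F_mod A d i n)"
    by (auto intro!: F_gen_closed mpol_delta_closed[OF A])
  fix s assume "s \<in> (\<lambda>(T, m). F_gen A d i n (delta A m) T) ` (tableaux (hook d i) n \<times> monoms n)"
  then obtain T m where "T \<in> tableaux (hook d i) n" "m \<in> monoms n" "s = F_gen A d i n (delta A m) T" by auto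
  then show "f s = g s" using assms(4) by (metis tableaux_hookE)
qed

text \<open>Each monomial gives one linear map on \<open>U_mod\<close>. Their linear combination
  with the coefficients of a polynomial is bilinear and so defines a map on the tensor
  product.\<close>

lemma F_lift:
  assumes Q: "module A Q" and g: "\<And>m. m \<in> monoms n \<Longrightarrow> g m \<in> tableaux (hook d i) n \<rightarrow> carrier Q"
    and g1: "\<And>m \<sigma> col row. m \<in> monoms n \<Longrightarrow> hook_tableau col row \<in> tableaux (hook d i) n \<Longrightarrow> \<sigma> permutes set col \<Longrightarrow>
      g m (hook_tableau (map \<sigma> col) row) = [sign \<sigma>] \<cdot>\<^bsub>Q\<^esub> g m (hook_tableau col row)"
    and g2: "\<And>m col x row. m \<in> monoms n \<Longrightarrow> hook_tableau col (x # row) \<in> tableaux (hook d i) n \<Longrightarrow>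
      g m (hook_tableau col (x # row)) = (\<Oplus>\<^bsub>Q\<^esub>p\<in>{..<length col}. g m (hook_tableau (col[p := x]) (col ! p # row)))"
    and g3: "\<And>m col P a b R. m \<in> monoms n \<Longrightarrow> hook_tableau col (P @ a # b # R) \<in> tableaux (hook d i) n \<Longrightarrow>
      g m (hook_tableau col (P @ a # b # R)) = g m (hook_tableau col (P @ b # a # R))"
  shows "\<exists>h\<in>lin_hom A (F_mod A d i n) Q. \<forall>T\<in>tableaux (hook d i) n. \<forall>m\<in>monoms n.
    h (F_gen A d i n (delta A m) T) = g m T"
proof -
  have "\<forall>m\<in>monoms n. \<exists>h. h \<in> lin_hom A (U_mod A d i n) Q \<and>
      (\<forall>T\<in>tableaux (hook d i) n. h (tableau_class A (hook d i) n T) = g m T)"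
    using U_lift[OF Q g g1 g2 g3] by blast
  then obtain h where h: "\<And>m. m \<in> monoms n \<Longrightarrow> h m \<in> lin_hom A (U_mod A d i n) Q"
    "\<And>m T. m \<in> monoms n \<Longrightarrow> T \<in> tableaux (hook d i) n \<Longrightarrow> h m (tableau_class A (hook d i) n T) = g m T"
    using bchoice[of "monoms n"] by metis
  have hc: "(\<lambda>m. h m u) \<in> monoms n \<rightarrow> carrier Q" if "u \<in> carrier (U_mod A d i n)" for u
    using that lin_hom_closed[OF h(1)] by blast
  have b1: "(\<lambda>u. lin_comb A Q (monoms n) p (\<lambda>m. h m u)) \<in> lin_hom A (U_mod A d i n) Q"
    if "p \<in> carrier (mpol_ring A n)" for p
    using that unfolding mpol_ring_simps by (intro lin_comb_param_lin_hom U_module Q h)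
  have b2: "(\<lambda>p. lin_comb A Q (monoms n) p (\<lambda>m. h m u)) \<in> lin_hom A (mpol_ring A n) Q"
    if "u \<in> carrier (U_mod A d i n)" for u
    unfolding mpol_lin_hom by (rule lin_comb_lin_hom[OF Q hc[OF that]])
  obtain H where "H \<in> lin_hom A (F_mod A d i n) Q" and H: "\<And>u p. u \<in> carrier (U_mod A d i n) \<Longrightarrow> p \<in> carrier (mpol_ring A n) \<Longrightarrow>
      H (pure_tensor A (U_mod A d i n) (mpol_ring A n) u p) = lin_comb A Q (monoms n) p (\<lambda>m. h m u)"
    using tensor_lift[where b = "\<lambda>u p. lin_comb A Q (monoms n) p (\<lambda>m. h m u)",
        OF U_module mpol_module[OF A] Q b1 b2] unfolding F_mod_def by blast
  then show ?thesis
    by (intro bexI[of _ H]) (auto simp: F_gen_def H tableau_class_closed mpol_delta_closed[OF A] lin_comb_delta[OF Q hc] h(2))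
qed

end

section \<open>The embedding into the double complex\<close>

text \<open>The domain is a quotient, so a formula on generators needs a compatibility proof; the
  map is chosen here, and its existence is established in \<open>hook_embed_spec\<close>.\<close>

definition hook_embed :: "('a, 'r) ring_scheme \<Rightarrow> nat \<Rightarrow> nat \<Rightarrow> nat \<Rightarrow> 'a F_elem \<Rightarrow>
    nat set \<times> nat set \<times> nat multiset \<Rightarrow> 'a" where
  "hook_embed A d i n = (SOME h. h \<in> lin_hom A (F_mod A d i n) (exterior_module A) \<and>
     (\<forall>T\<in>tableaux (hook d i) n. \<forall>m\<in>monoms n. h (F_gen A d i n (delta A m) T)
       = koszul A to_row (wedge A (hd T) (set (concat (tl T)), m))))"

text \<open>Modelled on \<open>row_htpy\<close>: if the least element of \<open>B \<union> C\<close>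
  lies in the row, it becomes the corner above the sorted column \<open>B\<close>; if it lies in
  \<open>B\<close>, the triple goes to zero, as it does under the contraction.\<close>

definition hook_retract :: "('a, 'r) ring_scheme \<Rightarrow> nat \<Rightarrow> nat \<Rightarrow> nat \<Rightarrow>
    (nat set \<times> nat set \<times> nat multiset \<Rightarrow> 'a) \<Rightarrow> 'a F_elem" where
  "hook_retract A d i n f = lin_comb A (F_mod A d i n) UNIV f (\<lambda>(B, C, r).
     if (B, C, r) \<in> cells n i d \<and> Min (B \<union> C) \<in> C
     then F_gen A d i n (delta A r)
       (hook_tableau (Min (B \<union> C) # sorted_list_of_set B) (sorted_list_of_set (C - {Min (B \<union> C)})))
     else \<zero>\<^bsub>F_mod A d i n\<^esub>)"

lemma retract_tableau:
  assumes "(B, C, r) \<in> cells n i d" "Min (B \<union> C) \<in> C"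
  shows "hook_tableau (Min (B \<union> C) # sorted_list_of_set B) (sorted_list_of_set (C - {Min (B \<union> C)}))
    \<in> tableaux (hook d i) n" "r \<in> monoms n"
proof -
  note fin = cells_finite[OF assms(1)]
  have "finite B" "finite C" by (fact fin)+
  then show "hook_tableau (Min (B \<union> C) # sorted_list_of_set B) (sorted_list_of_set (C - {Min (B \<union> C)}))
    \<in> tableaux (hook d i) n"
    using assms by (auto simp: hook_tableau_in_tableaux cells_def)
  show "r \<in> monoms n" using assms(1) by (simp add: cells_def monoms_def)
qed

context
  fixes A :: "('a, 'r) ring_scheme"
  assumes A: "cring A"
begin

interpretation P: module A "exterior_module A :: ('a, nat set \<times> 'z \<Rightarrow> 'a) module"
  by (rule free_module_module[OF A])

interpretation K: lin_map A "exterior_module A" "exterior_module A" "koszul A \<tau>"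
  by (intro lin_mapI P.module_axioms koszul_lin_hom A)

interpretation F: module A "F_mod A d i n" by (rule F_module[OF A])

lemma wedge_map_permutes:
  assumes "\<sigma> permutes set L" "distinct L"
  shows "wedge A (map \<sigma> L) z = [sign \<sigma>] \<cdot>\<^bsub>exterior_module A\<^esub> wedge A L z"
  using list_sign_map_permutes[OF assms] permutes_image[OF assms(1)]
  by (simp add: wedge_def P.add.int_pow_pow[OF delta_UNIV_closed[OF A]] mult.commute)

lemma tableau_cells:
  assumes "hook_tableau col row \<in> tableaux (hook d i) n" "m \<in> monoms n"
  shows "(set col, set row, m) \<in> cells n (Suc i) (d - 1)"
  using assms by (auto simp: hook_tableau_in_tableaux cells_def monoms_def distinct_card)

text \<open>Alternation holds because wedges alternate, and row swaps because the row enters as a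
  set. The shuffle of \<open>x\<close> with the column is the squared row differential of the wedge
  with \<open>x\<close> in front, expanded by \<open>koszul_wedge_Cons\<close>.\<close>

lemma hook_embed_spec:
  shows hook_embed_lin_hom: "hook_embed A d i n \<in> lin_hom A (F_mod A d i n) (exterior_module A)"
    and hook_embed_gen: "hook_tableau col row \<in> tableaux (hook d i) n \<Longrightarrow> m \<in> monoms n \<Longrightarrow>
      hook_embed A d i n (F_gen A d i n (delta A m) (hook_tableau col row))
        = koszul A to_row (wedge A col (set row, m))"
proof -
  define g where "g m T = koszul A to_row (wedge A (hd T) (set (concat (tl T)), m))" for m and T :: tableau
  note w = wedge_closed[OF A UNIV_I]
  have g: "g m (hook_tableau col row) = koszul A to_row (wedge A col (set row, m))" for m col row
    by (simp add: g_def)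
  have gc: "g m T \<in> carrier (exterior_module A)" for m T
    unfolding g_def by (intro K.map_closed w)
  have "\<exists>h\<in>lin_hom A (F_mod A d i n) (exterior_module A). \<forall>T\<in>tableaux (hook d i) n. \<forall>m\<in>monoms n.
    h (F_gen A d i n (delta A m) T) = g m T"
  proof (rule F_lift[OF A P.module_axioms])
    show "g m \<in> tableaux (hook d i) n \<rightarrow> carrier (exterior_module A)" for m using gc by blast
    show "g m (hook_tableau (map \<sigma> col) row) = [sign \<sigma>] \<cdot>\<^bsub>exterior_module A\<^esub> g m (hook_tableau col row)"
      if "hook_tableau col row \<in> tableaux (hook d i) n" "\<sigma> permutes set col" for m \<sigma> col row
    proof -
      have d: "distinct col" using that(1) by (simp add: hook_tableau_in_tableaux)
      show ?thesis unfolding g wedge_map_permutes[OF that(2) d] K.map_int_pow[OF w] ..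
    qed
    show "g m (hook_tableau col (P @ a # b # R)) = g m (hook_tableau col (P @ b # a # R))" for m col P a b R
      unfolding g by (simp add: insert_commute)
    show "g m (hook_tableau col (x # row))
        = (\<Oplus>\<^bsub>exterior_module A\<^esub>p\<in>{..<length col}. g m (hook_tableau (col[p := x]) (col ! p # row)))"
      if m: "m \<in> monoms n" and T: "hook_tableau col (x # row) \<in> tableaux (hook d i) n" for m col x row
    proof -
      have d: "distinct (x # col)" using T by (auto simp: hook_tableau_in_tableaux)
      have "(set (x # col), set row, m) \<in> cells n (Suc (Suc i)) (length row)"
        using T m d by (auto simp: hook_tableau_in_tableaux cells_def monoms_def distinct_card)
      then have "wedge A (x # col) (set row, m) \<in> carrier (free_module A (cells n (Suc (Suc i)) (length row)))"
        by (rule wedge_closed[OF A])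
      from row_row[OF A this] have "koszul A to_row (wedge A col (to_row x (set row, m)) \<ominus>\<^bsub>exterior_module A\<^esub>
        (\<Oplus>\<^bsub>exterior_module A\<^esub>p\<in>{..<length col}. wedge A (col[p := x]) (to_row (col ! p) (set row, m))))
        = \<zero>\<^bsub>exterior_module A\<^esub>"
        unfolding koszul_wedge_Cons[OF A d] .
      then have "koszul A to_row (wedge A col (to_row x (set row, m))) \<ominus>\<^bsub>exterior_module A\<^esub>
        (\<Oplus>\<^bsub>exterior_module A\<^esub>p\<in>{..<length col}. koszul A to_row (wedge A (col[p := x]) (to_row (col ! p) (set row, m))))
        = \<zero>\<^bsub>exterior_module A\<^esub>"
        by (simp add: K.map_minus K.map_finsum w P.finsum_closed)
      then have "koszul A to_row (wedge A col (to_row x (set row, m))) =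
        (\<Oplus>\<^bsub>exterior_module A\<^esub>p\<in>{..<length col}. koszul A to_row (wedge A (col[p := x]) (to_row (col ! p) (set row, m))))"
        by (simp add: P.minus_eq_zero_iff w P.finsum_closed)
      then show ?thesis by (simp add: g to_row_def)
    qed
  qed
  then have "\<exists>h. h \<in> lin_hom A (F_mod A d i n) (exterior_module A) \<and>
     (\<forall>T\<in>tableaux (hook d i) n. \<forall>m\<in>monoms n. h (F_gen A d i n (delta A m) T)
       = koszul A to_row (wedge A (hd T) (set (concat (tl T)), m)))"
    unfolding g_def by blast
  from someI_ex[OF this] have *: "hook_embed A d i n \<in> lin_hom A (F_mod A d i n) (exterior_module A)"
    "\<And>T m. T\<in>tableaux (hook d i) n \<Longrightarrow> m\<in>monoms n \<Longrightarrow> hook_embed A d i n (F_gen A d i n (delta A m) T)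
       = koszul A to_row (wedge A (hd T) (set (concat (tl T)), m))"
    unfolding hook_embed_def[symmetric] by blast+
  show "hook_embed A d i n \<in> lin_hom A (F_mod A d i n) (exterior_module A)" by (rule *(1))
  show "hook_tableau col row \<in> tableaux (hook d i) n \<Longrightarrow> m \<in> monoms n \<Longrightarrow>
      hook_embed A d i n (F_gen A d i n (delta A m) (hook_tableau col row))
        = koszul A to_row (wedge A col (set row, m))"
    using *(2) by simp
qed

interpretation E: lin_map A "F_mod A d i n" "exterior_module A" "hook_embed A d i n"
  by (intro lin_mapI F_module A P.module_axioms hook_embed_lin_hom)

section \<open>The retraction and the identification with row cycles\<close>

lemma hook_retract_closed':
  "(\<lambda>(B, C, r). if (B, C, r) \<in> cells n i d \<and> Min (B \<union> C) \<in> C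
     then F_gen A d i n (delta A r)
       (hook_tableau (Min (B \<union> C) # sorted_list_of_set B) (sorted_list_of_set (C - {Min (B \<union> C)})))
     else \<zero>\<^bsub>F_mod A d i n\<^esub>) \<in> UNIV \<rightarrow> carrier (F_mod A d i n)"
  using retract_tableau by (auto intro!: F_gen_closed[OF A] mpol_delta_closed[OF A])

lemma hook_retract_lin_hom: "hook_retract A d i n \<in> lin_hom A (exterior_module A) (F_mod A d i n)"
  unfolding hook_retract_def by (rule lin_comb_lin_hom[OF F.module_axioms hook_retract_closed'])

lemma hook_retract_delta: "hook_retract A d i n (delta A (B, C, r)) =
    (if (B, C, r) \<in> cells n i d \<and> Min (B \<union> C) \<in> C
     then F_gen A d i n (delta A r)
       (hook_tableau (Min (B \<union> C) # sorted_list_of_set B) (sorted_list_of_set (C - {Min (B \<union> C)})))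
     else \<zero>\<^bsub>F_mod A d i n\<^esub>)"
  unfolding hook_retract_def by (subst lin_comb_delta[OF F.module_axioms hook_retract_closed']) simp_all

interpretation R: lin_map A "exterior_module A" "F_mod A d i n" "hook_retract A d i n"
  by (intro lin_mapI F_module A P.module_axioms hook_retract_lin_hom)

context
  fixes d :: nat
  assumes d: "1 \<le> d"
begin

text \<open>Generators go to row boundaries, hence to row cycles. One column entry joins the
  \<open>d - 1\<close> entries of the row, which gives row size \<open>d\<close> because
  \<open>1 \<le> d\<close>.\<close>

lemma hook_embed_cells:
  assumes "x \<in> carrier (F_mod A d i n)"
  shows "hook_embed A d i n x \<in> carrier (free_module A (cells n i d))"
    and "koszul A to_row (hook_embed A d i n x) = \<zero>\<^bsub>exterior_module A\<^esub>"
proof -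
  let ?S = "(\<lambda>(T, m). F_gen A d i n (delta A m) T) ` (tableaux (hook d i) n \<times> monoms n)"
  have sub: "?S \<subseteq> carrier (F_mod A d i n)"
    by (auto intro!: F_gen_closed[OF A] mpol_delta_closed[OF A])
  have x: "x \<in> span_of A (F_mod A d i n) ?S" using assms F_span[OF A] by blast
  have wc: "wedge A col (set row, m) \<in> carrier (free_module A (cells n (Suc i) (d - 1)))"
    if "hook_tableau col row \<in> tableaux (hook d i) n" "m \<in> monoms n" for col row m
    by (rule wedge_closed[OF A tableau_cells[OF that]])
  show "hook_embed A d i n x \<in> carrier (free_module A (cells n i d))"
  proof (rule span_of_vimage[OF F.module_axioms P.module_axioms E.lin_hom
        free_module_submodule[OF A subset_UNIV] sub _ x])
    fix s assume "s \<in> ?S"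
    then obtain T m where T: "T \<in> tableaux (hook d i) n" "m \<in> monoms n" "s = F_gen A d i n (delta A m) T" by auto
    obtain col row where Tcr: "T = hook_tableau col row" by (rule tableaux_hookE[OF T(1)])
    have "koszul A to_row (wedge A col (set row, m)) \<in> carrier (free_module A (cells n i (Suc (d - 1))))"
      by (rule row_closed[OF A wc]) (use T Tcr in auto)
    then show "hook_embed A d i n s \<in> carrier (free_module A (cells n i d))"
      using T d by (simp add: Tcr hook_embed_gen)
  qed
  show "koszul A to_row (hook_embed A d i n x) = \<zero>\<^bsub>exterior_module A\<^esub>"
    using assms
  proof (rule F_hom_eqI[OF A P.module_axioms lin_hom_comp[OF E.lin_hom K.lin_hom] P.zero_lin_hom, rotated])
    show "koszul A to_row (hook_embed A d i n (F_gen A d i n (delta A m) (hook_tableau col row))) = \<zero>\<^bsub>exterior_module A\<^esub>"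
      if "hook_tableau col row \<in> tableaux (hook d i) n" "m \<in> monoms n" for col row m
      unfolding hook_embed_gen[OF that] by (rule row_row[OF A wc[OF that]])
  qed
qed

text \<open>Let \<open>w\<close> be the least entry of the tableau. If \<open>w\<close> is in the
  column, only the summand that moves \<open>w\<close> to the row survives the retraction, and it
  returns the normal form of the tableau. If \<open>w\<close> is in the row, every summand survives,
  and together they are the right-hand side of the shuffle of \<open>w\<close> with the
  column.\<close>

lemma retract_embed:
  assumes "x \<in> carrier (F_mod A d i n)"
  shows "hook_retract A d i n (hook_embed A d i n x) = x"
proof (rule F_hom_eqI[OF A F.module_axioms lin_hom_comp[OF E.lin_hom R.lin_hom] F.id_lin_hom _ assms])
  fix col row m assume T: "hook_tableau col row \<in> tableaux (hook d i) n" and m: "m \<in> monoms n"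
  note mc = mpol_delta_closed[OF A m]
  let ?g = "F_gen A d i n (delta A m)"
  have dist: "distinct col" "distinct row" "set col \<inter> set row = {}"
    using T by (auto simp: hook_tableau_in_tableaux)
  have cell: "(set col - {a}, insert a (set row), m) \<in> cells n i d" if "a \<in> set col" for a
    using T m that d by (auto simp: hook_tableau_in_tableaux cells_def monoms_def distinct_card card_insert_if)
  define w where "w = Min (set col \<union> set row)"
  have ne: "set col \<noteq> {}" using T by (auto simp: hook_tableau_in_tableaux)
  have w: "w \<in> set col \<union> set row" unfolding w_def using ne by (intro Min_in) auto
  have least: "w \<le> a" if "a \<in> set col \<union> set row" for a unfolding w_def using that by (intro Min_le) auto
  have W: "Min ((set col - {a}) \<union> insert a (set row)) = w" if "a \<in> set col" for a
  proof -
    have "(set col - {a}) \<union> insert a (set row) = set col \<union> set row" using that by auto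
    then show ?thesis by (simp add: w_def)
  qed
  define h where "h a = (if w \<in> insert a (set row) then ?g (hook_tableau (w # sorted_list_of_set (set col - {a}))
      (sorted_list_of_set (insert a (set row) - {w}))) else \<zero>\<^bsub>F_mod A d i n\<^esub>)" for a
  have rd: "hook_retract A d i n (delta A (set col - {a}, to_row a (set row, m))) = h a" if "a \<in> set col" for a
    using cell[OF that] W[OF that] by (simp add: to_row_def hook_retract_delta h_def)
  have hc: "h a \<in> carrier (F_mod A d i n)" if "a \<in> set col" for a
    unfolding rd[OF that, symmetric] by (rule R.map_closed[OF delta_UNIV_closed[OF A]])
  have pow: "lin_map A (F_mod A d i n) (F_mod A d i n) (\<lambda>x. [k] \<cdot>\<^bsub>F_mod A d i n\<^esub> x)" for k :: int
    by (intro lin_mapI F.module_axioms lin_hom_int_pow F.id_lin_hom)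
  have "hook_retract A d i n (hook_embed A d i n (?g (hook_tableau col row)))
    = [list_sign col] \<cdot>\<^bsub>F_mod A d i n\<^esub> (\<Oplus>\<^bsub>F_mod A d i n\<^esub>a\<in>set col. [pos_sign a (set col)] \<cdot>\<^bsub>F_mod A d i n\<^esub> h a)"
  proof -
    have "hook_retract A d i n (\<Oplus>\<^bsub>exterior_module A\<^esub>a\<in>set col. [pos_sign a (set col)] \<cdot>\<^bsub>exterior_module A\<^esub>
        delta A (set col - {a}, to_row a (set row, m)))
      = (\<Oplus>\<^bsub>F_mod A d i n\<^esub>a\<in>set col. hook_retract A d i n ([pos_sign a (set col)] \<cdot>\<^bsub>exterior_module A\<^esub>
        delta A (set col - {a}, to_row a (set row, m))))"
      by (rule R.map_finsum) (auto intro!: P.add.int_pow_closed delta_UNIV_closed[OF A])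
    also have "\<dots> = (\<Oplus>\<^bsub>F_mod A d i n\<^esub>a\<in>set col. [pos_sign a (set col)] \<cdot>\<^bsub>F_mod A d i n\<^esub> h a)"
      by (rule F.finsum_cong') (auto simp: R.map_int_pow delta_UNIV_closed[OF A] rd hc)
    finally show ?thesis
      by (simp add: hook_embed_gen[OF T m] wedge_def K.map_int_pow R.map_int_pow delta_UNIV_closed[OF A]
          koszul_delta[OF A] P.finsum_closed)
  qed
  also have "\<dots> = ?g (hook_tableau col row)"
  proof (cases "w \<in> set col")
    case True
    then have wr: "w \<notin> set row" using dist by auto
    have "(\<Oplus>\<^bsub>F_mod A d i n\<^esub>a\<in>set col. [pos_sign a (set col)] \<cdot>\<^bsub>F_mod A d i n\<^esub> h a)
      = (\<Oplus>\<^bsub>F_mod A d i n\<^esub>a\<in>set col. if w = a then h w else \<zero>\<^bsub>F_mod A d i n\<^esub>)"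
    proof (rule F.finsum_cong')
      fix a assume a: "a \<in> set col"
      show "[pos_sign a (set col)] \<cdot>\<^bsub>F_mod A d i n\<^esub> h a = (if w = a then h w else \<zero>\<^bsub>F_mod A d i n\<^esub>)"
      proof (cases "w = a")
        case True
        have "pos_sign a (set col) = 1" using least True by (intro pos_sign_least) auto
        then show ?thesis using True hc[OF a] by simp
      next
        case False
        then have "h a = \<zero>\<^bsub>F_mod A d i n\<^esub>" using wr by (simp add: h_def)
        then show ?thesis using False by simp
      qed
    qed (use hc True in auto)
    also have "\<dots> = h w" using True hc by (intro F.finsum_singleton) auto
    also have "h w = ?g (hook_tableau (sorted_list_of_set (set col)) (sorted_list_of_set (set row)))"
    proof -
      have "Min (set col) = w" using True least by (intro Min_eqI) auto
      then have "sorted_list_of_set (set col) = w # sorted_list_of_set (set col - {w})"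
        using sorted_list_of_set_nonempty[of "set col"] ne by simp
      moreover have "insert w (set row) - {w} = set row" using wr by auto
      ultimately show ?thesis by (simp add: h_def)
    qed
    finally show ?thesis using F_gen_standard[OF A T mc] by simp
  next
    case False
    then have wr: "w \<in> set row" using w by auto
    \<comment> \<open>The shuffling relation involves the first entry after the corner, so
      \<open>w\<close> is brought there first.\<close>
    define row' where "row' = remove1 w row"
    have row': "mset row = mset (w # row')" "set row' = set row - {w}" "distinct row'"
      using wr dist(2) by (simp_all add: row'_def)
    have T': "hook_tableau col (w # row') \<in> tableaux (hook d i) n"
    proof -
      have "length (w # row') = length row" using row'(1) by (metis size_mset)
      then show ?thesis
        using T row'(2,3) wr False unfolding hook_tableau_in_tableaux by auto
    qed
    have inj: "inj_on ((!) col) {..<length col}" using dist(1) by (auto simp: inj_on_def nth_eq_iff_index_eq)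
    have img: "(!) col ` {..<length col} = set col" by (auto simp: set_conv_nth)
    have gT: "?g (hook_tableau (col[j := w]) (col ! j # row'))
        = [list_sign col] \<cdot>\<^bsub>F_mod A d i n\<^esub> ([pos_sign (col ! j) (set col)] \<cdot>\<^bsub>F_mod A d i n\<^esub> h (col ! j))"
      if j: "j < length col" for j
    proof -
      have lt: "w < y" if "y \<in> set col" for y using least[of y] that False by (auto simp: order_le_less)
      have x: "w \<notin> set col - {col ! j}" using False by auto
      note u = list_sign_update[OF dist(1) j x]
      have a: "col ! j \<in> set col" using j by simp
      have "Min (insert w (set col - {col ! j})) = w" using lt by (intro Min_eqI) (auto intro: less_imp_le)
      then have s1: "sorted_list_of_set (set (col[j := w])) = w # sorted_list_of_set (set col - {col ! j})"
        unfolding u(2) using sorted_list_of_set_nonempty[of "insert w (set col - {col ! j})"] x by simp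
      have "set (col ! j # row') = insert (col ! j) (set row) - {w}"
        using row'(2) a False by auto
      then have hg: "?g (hook_tableau (sorted_list_of_set (set (col[j := w]))) (sorted_list_of_set (set (col ! j # row')))) = h (col ! j)"
        unfolding s1 using wr by (simp add: h_def)
      have "?g (hook_tableau (col[j := w]) (col ! j # row')) = [list_sign (col[j := w])] \<cdot>\<^bsub>F_mod A d i n\<^esub> h (col ! j)"
        using F_gen_standard[OF A hook_shuffle[OF T' j] mc] unfolding hg .
      also have "list_sign (col[j := w]) = pos_sign (col ! j) (set col) * list_sign col"
        using list_sign_update_least[OF dist(1) j lt] by (simp add: mult.commute)
      finally show ?thesis by (simp add: F.add.int_pow_pow hc a)
    qed
    have "?g (hook_tableau col row) = ?g (hook_tableau col (w # row'))"
      by (rule F_gen_row_mset[OF A T row'(1)])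
    also have "\<dots> = (\<Oplus>\<^bsub>F_mod A d i n\<^esub>j\<in>{..<length col}. ?g (hook_tableau (col[j := w]) (col ! j # row')))"
      by (rule F_gen_shuffle[OF A T' mc])
    also have "\<dots> = (\<Oplus>\<^bsub>F_mod A d i n\<^esub>j\<in>{..<length col}.
        [list_sign col] \<cdot>\<^bsub>F_mod A d i n\<^esub> ([pos_sign (col ! j) (set col)] \<cdot>\<^bsub>F_mod A d i n\<^esub> h (col ! j)))"
      by (rule F.finsum_cong') (auto simp: gT hc)
    also have "\<dots> = (\<Oplus>\<^bsub>F_mod A d i n\<^esub>a\<in>(!) col ` {..<length col}.
        [list_sign col] \<cdot>\<^bsub>F_mod A d i n\<^esub> ([pos_sign a (set col)] \<cdot>\<^bsub>F_mod A d i n\<^esub> h a))"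
      by (rule F.finsum_reindex[symmetric, OF _ inj]) (auto simp: img hc)
    also have "\<dots> = [list_sign col] \<cdot>\<^bsub>F_mod A d i n\<^esub> (\<Oplus>\<^bsub>F_mod A d i n\<^esub>a\<in>set col. [pos_sign a (set col)] \<cdot>\<^bsub>F_mod A d i n\<^esub> h a)"
      unfolding img by (rule lin_map.map_finsum[OF pow, symmetric]) (auto simp: hc)
    finally show ?thesis ..
  qed
  finally show "hook_retract A d i n (hook_embed A d i n (?g (hook_tableau col row))) = ?g (hook_tableau col row)" .
qed

text \<open>On basis vectors the composite equals the row differential after
  \<open>row_htpy\<close>, and on row cycles the homotopy identity turns this into the identity.
  Together with \<open>retract_embed\<close> it makes the embedding an isomorphism onto the row
  cycles.\<close>

lemma embed_retract:
  assumes f: "f \<in> carrier (free_module A (cells n i d))" and k: "koszul A to_row f = \<zero>\<^bsub>exterior_module A\<^esub>"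
  shows "hook_embed A d i n (hook_retract A d i n f) = f"
proof -
  obtain q where q: "d = Suc q" using d by (cases d) auto
  have rh: "row_htpy A \<in> lin_hom A (exterior_module A) (exterior_module A)"
    unfolding row_htpy_def by (rule koszul_htpy_lin_hom[OF A])
  have "hook_embed A d i n (hook_retract A d i n f) = koszul A to_row (row_htpy A f)"
  proof (rule lin_hom_free_eq_on[where f = "\<lambda>f. hook_embed A d i n (hook_retract A d i n f)"
      and g = "\<lambda>f. koszul A to_row (row_htpy A f)", OF P.module_axioms lin_hom_comp[OF R.lin_hom E.lin_hom]
        lin_hom_comp[OF rh K.lin_hom] _ f subset_UNIV])
    fix b assume b: "b \<in> cells n i d"
    obtain B C r where BC: "b = (B, C, r)" by (cases b)
    note b' = b[unfolded BC]
    note fin = cells_finite[OF b']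
    have disj: "B \<inter> C = {}" and "C \<noteq> {}" using b' by (auto simp: cells_def q)
    then have mem: "Min (B \<union> C) \<in> B \<union> C" using fin by (intro Min_in) auto
    show "hook_embed A d i n (hook_retract A d i n (delta A b)) = koszul A to_row (row_htpy A (delta A b))"
    proof (cases "Min (B \<union> C) \<in> C")
      case True
      then have nB: "Min (B \<union> C) \<notin> B" using disj by auto
      have "sorted (Min (B \<union> C) # sorted_list_of_set B)" using fin by auto
      then have "list_sign (Min (B \<union> C) # sorted_list_of_set B) = 1" by (rule list_sign_sorted)
      then show ?thesis
        using True nB b' fin retract_tableau[OF b' True]
        by (simp add: BC hook_retract_delta hook_embed_gen row_htpy_def koszul_htpy_delta[OF A] wedge_def
            from_row_def delta_UNIV_closed[OF A] del: list_sign.simps)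
    next
      case False
      then show ?thesis using mem
        by (simp add: BC hook_retract_delta row_htpy_def koszul_htpy_delta[OF A] E.map_zero K.map_zero)
    qed
  qed
  also have "\<dots> = f"
  proof -
    have "row_htpy A \<zero>\<^bsub>exterior_module A\<^esub> = \<zero>\<^bsub>exterior_module A\<^esub>"
      by (rule lin_map.map_zero[OF lin_mapI[OF P.module_axioms P.module_axioms rh]])
    then show ?thesis
      using row_homotopy[OF A f[unfolded q]] k row_htpy_closed[OF A f[unfolded q]]
      by (simp add: cells_UNIV[OF A])
  qed
  finally show ?thesis .
qed

lemma hook_embed_inj:
  assumes "x \<in> carrier (F_mod A d i n)" "y \<in> carrier (F_mod A d i n)" "hook_embed A d i n x = hook_embed A d i n y"
  shows "x = y"
  using assms retract_embed by metis

end

end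

text \<open>The sign has two sources: the summands of the differential carry
  \<open>(-1)^(i - j)\<close> where the Koszul formula has \<open>(-1)^j\<close>, and interchanging
  the two Koszul differentials costs another \<open>-1\<close>.\<close>

definition hook_diff :: "('a, 'r) ring_scheme \<Rightarrow> nat \<Rightarrow> nat \<Rightarrow> nat \<Rightarrow> 'a F_elem \<Rightarrow> 'a F_elem" where
  "hook_diff A d i n x = hook_retract A d (i - 1) n
     ([((- 1 :: int) ^ Suc i)] \<cdot>\<^bsub>exterior_module A\<^esub> koszul A to_mono (hook_embed A d i n x))"

definition hook_aug :: "('a, 'r) ring_scheme \<Rightarrow> nat \<Rightarrow> nat \<Rightarrow> 'a F_elem \<Rightarrow> 'a mpol" where
  "hook_aug A d n x = augmentation A (hook_embed A d 0 n x)"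

lemma F_mod_R_simps:
  "carrier (F_mod_R A d i n) = carrier (F_mod A d i n)"
  "\<zero>\<^bsub>F_mod_R A d i n\<^esub> = \<zero>\<^bsub>F_mod A d i n\<^esub>"
  "x \<oplus>\<^bsub>F_mod_R A d i n\<^esub> y = x \<oplus>\<^bsub>F_mod A d i n\<^esub> y"
  by (simp_all add: F_mod_R_def Let_def)

lemma I_mod_R_simps:
  "carrier (I_mod_R A d n) = sqfree_ideal A d n" "\<zero>\<^bsub>I_mod_R A d n\<^esub> = \<zero>\<^bsub>mpol_ring A n\<^esub>"
  "x \<oplus>\<^bsub>I_mod_R A d n\<^esub> y = x \<oplus>\<^bsub>mpol_ring A n\<^esub> y" "x \<odot>\<^bsub>I_mod_R A d n\<^esub> y = x \<otimes>\<^bsub>mpol_ring A n\<^esub> y"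
  by (simp_all add: I_mod_R_def Let_def)

lemma remove_box_hook: "remove_box (hook_tableau col row) j = hook_tableau (take j col @ drop (Suc j) col) row"
  by (simp add: remove_box_def hook_tableau_def)

lemma remove_box_in_tableaux:
  assumes "hook_tableau col row \<in> tableaux (hook d (Suc i)) n" "j \<le> Suc i"
  shows "hook_tableau (take j col @ drop (Suc j) col) row \<in> tableaux (hook d i) n"
proof -
  have j: "j < length col" and dc: "distinct col" using assms by (auto simp: hook_tableau_in_tableaux)
  have x: "col ! j \<notin> set col - {col ! j}" by simp
  note u = list_sign_update(4,5)[OF dc j x]
  show ?thesis using assms(1) u j unfolding hook_tableau_in_tableaux set_append[of "take j col @ _"] distinct_append[of "take j col @ _"] u
    by (auto simp: u)
qed

context
  fixes A :: "('a, 'r) ring_scheme"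
  assumes A: "cring A"
begin

interpretation P: module A "exterior_module A :: ('a, nat set \<times> 'z \<Rightarrow> 'a) module"
  by (rule free_module_module[OF A])

interpretation K: lin_map A "exterior_module A" "exterior_module A" "koszul A \<tau>"
  by (intro lin_mapI P.module_axioms koszul_lin_hom A)

interpretation F: module A "F_mod A d i n" by (rule F_module[OF A])

interpretation E: lin_map A "F_mod A d i n" "exterior_module A" "hook_embed A d i n"
  by (intro lin_mapI F.module_axioms P.module_axioms hook_embed_lin_hom A)

interpretation R: lin_map A "exterior_module A" "F_mod A d i n" "hook_retract A d i n"
  by (intro lin_mapI F.module_axioms P.module_axioms hook_retract_lin_hom A)

interpretation S: cring "mpol_ring A n" by (rule mpol_cring[OF A])

interpretation SM: module A "mpol_ring A n" by (rule mpol_module[OF A])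

section \<open>The module structure over the polynomial ring\<close>

lemma F_gen_add: "T \<in> tableaux (hook d i) n \<Longrightarrow> p \<in> carrier (mpol_ring A n) \<Longrightarrow> q \<in> carrier (mpol_ring A n) \<Longrightarrow>
    F_gen A d i n (p \<oplus>\<^bsub>mpol_ring A n\<^esub> q) T = F_gen A d i n p T \<oplus>\<^bsub>F_mod A d i n\<^esub> F_gen A d i n q T"
  by (rule lin_hom_add[OF F_gen_lin_hom[OF A]])

text \<open>The scalar multiplication is given by \<open>lin_ext\<close>. Multiplying the second
  tensor factor by \<open>q\<close> is bilinear, hence supplies the linear map that evaluates
  it.\<close>

lemma F_mod_R_smult:
  assumes q: "q \<in> carrier (mpol_ring A n)"
  shows F_mod_R_smult_lin_hom: "(\<lambda>x. q \<odot>\<^bsub>F_mod_R A d i n\<^esub> x) \<in> lin_hom A (F_mod A d i n) (F_mod A d i n)"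
    and F_mod_R_smult_gen: "T \<in> tableaux (hook d i) n \<Longrightarrow> p \<in> carrier (mpol_ring A n) \<Longrightarrow>
      q \<odot>\<^bsub>F_mod_R A d i n\<^esub> F_gen A d i n p T = F_gen A d i n (q \<otimes>\<^bsub>mpol_ring A n\<^esub> p) T"
proof -
  let ?U = "U_mod A d i n" and ?S = "mpol_ring A n"
  note U = U_module[OF A] and SM = SM.module_axioms
  have b1: "(\<lambda>u. pure_tensor A ?U ?S u (q \<otimes>\<^bsub>?S\<^esub> p)) \<in> lin_hom A ?U (F_mod A d i n)" if "p \<in> carrier ?S" for p
    unfolding F_mod_def by (rule pure_tensor_lin_hom1[OF U SM]) (use q that in simp)
  have b2: "(\<lambda>p. pure_tensor A ?U ?S u (q \<otimes>\<^bsub>?S\<^esub> p)) \<in> lin_hom A ?S (F_mod A d i n)" if "u \<in> carrier ?U" for u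
    unfolding F_mod_def
    by (rule lin_hom_comp[OF mpol_mult_lin2[OF A q] pure_tensor_lin_hom2[OF U SM that]])
  obtain s where s: "s \<in> lin_hom A (F_mod A d i n) (F_mod A d i n)"
    "\<And>u p. u \<in> carrier ?U \<Longrightarrow> p \<in> carrier ?S \<Longrightarrow> s (pure_tensor A ?U ?S u p) = pure_tensor A ?U ?S u (q \<otimes>\<^bsub>?S\<^esub> p)"
    using tensor_lift[where b = "\<lambda>u p. pure_tensor A ?U ?S u (q \<otimes>\<^bsub>?S\<^esub> p)", OF U SM F.module_axioms b1 b2]
    unfolding F_mod_def by blast
  have eq: "q \<odot>\<^bsub>F_mod_R A d i n\<^esub> x = s x" if x: "x \<in> carrier (F_mod A d i n)" for x
  proof -
    have "lin_ext A (F_mod A d i n) (F_mod A d i n) (carrier ?U \<times> carrier ?S)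
        (\<lambda>(u, p). pure_tensor A ?U ?S u p) (\<lambda>(u, p). pure_tensor A ?U ?S u (q \<otimes>\<^bsub>?S\<^esub> p)) x = s x"
      by (rule lin_ext_eq_span[OF F.module_axioms F.module_axioms s(1)])
        (use x s(2) tensor_span[OF U SM] pure_tensor_closed[OF U SM] in \<open>auto simp: F_mod_def\<close>)
    then show ?thesis by (simp add: F_mod_R_def Let_def)
  qed
  show "(\<lambda>x. q \<odot>\<^bsub>F_mod_R A d i n\<^esub> x) \<in> lin_hom A (F_mod A d i n) (F_mod A d i n)"
    by (rule lin_hom_cong[OF s(1) _ F.module_axioms]) (simp add: eq)
  show "q \<odot>\<^bsub>F_mod_R A d i n\<^esub> F_gen A d i n p T = F_gen A d i n (q \<otimes>\<^bsub>?S\<^esub> p) T"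
    if T: "T \<in> tableaux (hook d i) n" and p: "p \<in> carrier ?S"
    unfolding eq[OF F_gen_closed[OF A T p]] unfolding F_gen_def using tableau_class_closed[OF A T] p by (rule s(2))
qed

lemma F_hom_pure_eqI:
  assumes "module A Q" "f \<in> lin_hom A (F_mod A d i n) Q" "g \<in> lin_hom A (F_mod A d i n) Q"
    and "\<And>T p. T \<in> tableaux (hook d i) n \<Longrightarrow> p \<in> carrier (mpol_ring A n) \<Longrightarrow>
      f (F_gen A d i n p T) = g (F_gen A d i n p T)"
    and "x \<in> carrier (F_mod A d i n)"
  shows "f x = g x"
  by (rule lin_hom_eq_on_span[OF F.module_axioms assms(1-3) F_span_pure[OF A] _ _ assms(5)])
    (use assms(4) in \<open>auto intro!: F_gen_closed[OF A]\<close>)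

lemma F_mod_R_module: "module (mpol_ring A n) (F_mod_R A d i n)"
proof (rule moduleI)
  let ?F = "F_mod A d i n" and ?S = "mpol_ring A n"
  show "cring ?S" by (rule S.cring_axioms)
  show "abelian_group (F_mod_R A d i n)"
    by (rule abelian_groupI)
      (auto simp: F_mod_R_simps F.a_ac intro!: bexI[of _ "\<ominus>\<^bsub>?F\<^esub> _"] F.r_neg)
  fix a x assume a: "a \<in> carrier ?S" and x': "x \<in> carrier (F_mod_R A d i n)"
  note x = x'[unfolded F_mod_R_simps]
  note L = F_mod_R_smult_lin_hom
  show "a \<odot>\<^bsub>F_mod_R A d i n\<^esub> x \<in> carrier (F_mod_R A d i n)"
    unfolding F_mod_R_simps by (rule lin_hom_closed[OF L[OF a] x])
  show "a \<odot>\<^bsub>F_mod_R A d i n\<^esub> (x \<oplus>\<^bsub>F_mod_R A d i n\<^esub> y)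
      = a \<odot>\<^bsub>F_mod_R A d i n\<^esub> x \<oplus>\<^bsub>F_mod_R A d i n\<^esub> a \<odot>\<^bsub>F_mod_R A d i n\<^esub> y"
    if y: "y \<in> carrier (F_mod_R A d i n)" for y
    unfolding F_mod_R_simps by (rule lin_hom_add[OF L[OF a] x y[unfolded F_mod_R_simps]])
  {
    fix b assume b: "b \<in> carrier ?S"
    show "(a \<oplus>\<^bsub>?S\<^esub> b) \<odot>\<^bsub>F_mod_R A d i n\<^esub> x = a \<odot>\<^bsub>F_mod_R A d i n\<^esub> x \<oplus>\<^bsub>F_mod_R A d i n\<^esub> b \<odot>\<^bsub>F_mod_R A d i n\<^esub> x"
      unfolding F_mod_R_simps
    proof (rule F_hom_pure_eqI[OF F.module_axioms L[OF S.a_closed[OF a b]] lin_hom_plus[OF F.module_axioms L[OF a] L[OF b]] _ x])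
      fix T p assume T: "T \<in> tableaux (hook d i) n" and p: "p \<in> carrier ?S"
      then show "(a \<oplus>\<^bsub>?S\<^esub> b) \<odot>\<^bsub>F_mod_R A d i n\<^esub> F_gen A d i n p T
        = a \<odot>\<^bsub>F_mod_R A d i n\<^esub> F_gen A d i n p T \<oplus>\<^bsub>?F\<^esub> b \<odot>\<^bsub>F_mod_R A d i n\<^esub> F_gen A d i n p T"
        using a b by (simp add: F_mod_R_smult_gen S.l_distr F_gen_add)
    qed
    show "(a \<otimes>\<^bsub>?S\<^esub> b) \<odot>\<^bsub>F_mod_R A d i n\<^esub> x = a \<odot>\<^bsub>F_mod_R A d i n\<^esub> (b \<odot>\<^bsub>F_mod_R A d i n\<^esub> x)"
    proof (rule F_hom_pure_eqI[OF F.module_axioms L[OF S.m_closed[OF a b]] lin_hom_comp[OF L[OF b] L[OF a]] _ x])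
      fix T p assume T: "T \<in> tableaux (hook d i) n" and p: "p \<in> carrier ?S"
      then show "(a \<otimes>\<^bsub>?S\<^esub> b) \<odot>\<^bsub>F_mod_R A d i n\<^esub> F_gen A d i n p T
        = a \<odot>\<^bsub>F_mod_R A d i n\<^esub> (b \<odot>\<^bsub>F_mod_R A d i n\<^esub> F_gen A d i n p T)"
        using a b by (simp add: F_mod_R_smult_gen S.m_assoc)
    qed
  }
next
  fix x assume "x \<in> carrier (F_mod_R A d i n)"
  then have x: "x \<in> carrier (F_mod A d i n)" by (simp add: F_mod_R_simps)
  show "\<one>\<^bsub>mpol_ring A n\<^esub> \<odot>\<^bsub>F_mod_R A d i n\<^esub> x = x"
    by (rule F_hom_pure_eqI[OF F.module_axioms F_mod_R_smult_lin_hom[OF S.one_closed] F.id_lin_hom _ x])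
      (simp add: F_mod_R_smult_gen)
qed

interpretation FR: module "mpol_ring A n" "F_mod_R A d i n" by (rule F_mod_R_module)

lemma F_smult_eq:
  assumes a: "a \<in> carrier A" and x: "x \<in> carrier (F_mod A d i n)"
  shows "a \<odot>\<^bsub>F_mod A d i n\<^esub> x = (a \<odot>\<^bsub>mpol_ring A n\<^esub> \<one>\<^bsub>mpol_ring A n\<^esub>) \<odot>\<^bsub>F_mod_R A d i n\<^esub> x"
proof (rule F_hom_pure_eqI[where f = "\<lambda>x. a \<odot>\<^bsub>F_mod A d i n\<^esub> x", OF F.module_axioms _ F_mod_R_smult_lin_hom _ x])
  show "(\<lambda>x. a \<odot>\<^bsub>F_mod A d i n\<^esub> x) \<in> lin_hom A (F_mod A d i n) (F_mod A d i n)"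
    by (rule lin_homI) (use a in \<open>simp_all add: F.smult_r_distr F.smult_assoc1[symmetric] P.R.m_comm\<close>)
  show "a \<odot>\<^bsub>mpol_ring A n\<^esub> \<one>\<^bsub>mpol_ring A n\<^esub> \<in> carrier (mpol_ring A n)" using a by simp
  fix T p assume T: "T \<in> tableaux (hook d i) n" and p: "p \<in> carrier (mpol_ring A n)"
  show "a \<odot>\<^bsub>F_mod A d i n\<^esub> F_gen A d i n p T
    = (a \<odot>\<^bsub>mpol_ring A n\<^esub> \<one>\<^bsub>mpol_ring A n\<^esub>) \<odot>\<^bsub>F_mod_R A d i n\<^esub> F_gen A d i n p T"
    using a T p lin_hom_smult[OF F_gen_lin_hom[OF A T] a p]
    by (simp add: F_mod_R_smult_gen mpol_smult_eq[OF A a p])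
qed

text \<open>Over the polynomial ring the elements \<open>1[T]\<close> suffice, because
  \<open>p[T]\<close> is \<open>p\<close> times \<open>1[T]\<close>; constant polynomials make the
  span closed under scalars from \<open>A\<close>. This matches the generators in the definitions of
  \<open>diff\<close> and \<open>diff0\<close>.\<close>

lemma F_mod_R_span: "span_of (mpol_ring A n) (F_mod_R A d i n)
    (F_gen A d i n \<one>\<^bsub>mpol_ring A n\<^esub> ` tableaux (hook d i) n) = carrier (F_mod_R A d i n)"
proof -
  let ?G = "F_gen A d i n \<one>\<^bsub>mpol_ring A n\<^esub> ` tableaux (hook d i) n"
  let ?N = "span_of (mpol_ring A n) (F_mod_R A d i n) ?G"
  have G: "?G \<subseteq> carrier (F_mod_R A d i n)"
    unfolding F_mod_R_simps by (auto intro!: F_gen_closed[OF A])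
  have N: "submodule ?N (mpol_ring A n) (F_mod_R A d i n)"
    by (rule span_of_submodule[OF FR.module_axioms G])
  have NF: "?N \<subseteq> carrier (F_mod A d i n)" using submodule_subset[OF N] by (simp add: F_mod_R_simps)
  have sm: "a \<odot>\<^bsub>F_mod A d i n\<^esub> x \<in> ?N" if "a \<in> carrier A" "x \<in> ?N" for a x
  proof -
    have x: "x \<in> carrier (F_mod A d i n)" using that NF by blast
    show ?thesis unfolding F_smult_eq[OF that(1) x]
      by (rule submodule_smult[OF N _ that(2)]) (use that(1) in simp)
  qed
  have "submodule ?N A (F_mod A d i n)"
  proof (rule F.submoduleI[OF NF])
    show "\<zero>\<^bsub>F_mod A d i n\<^esub> \<in> ?N" using submodule_zero[OF N] by (simp add: F_mod_R_simps)
    show "x \<oplus>\<^bsub>F_mod A d i n\<^esub> y \<in> ?N" if "x \<in> ?N" "y \<in> ?N" for x y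
      using submodule_add[OF N that] by (simp add: F_mod_R_simps)
    \<comment> \<open>The negative belongs to the structure over \<open>A\<close> and is reached as
      the multiple by the scalar \<open>-1\<close>.\<close>
    show "\<ominus>\<^bsub>F_mod A d i n\<^esub> x \<in> ?N" if "x \<in> ?N" for x
      using sm[of "\<ominus>\<^bsub>A\<^esub> \<one>\<^bsub>A\<^esub>" x] that NF F.smult_l_minus[of "\<one>\<^bsub>A\<^esub>" x] by (simp add: subset_iff)
  qed (rule sm)
  moreover have "(\<lambda>(T, p). F_gen A d i n p T) ` (tableaux (hook d i) n \<times> carrier (mpol_ring A n)) \<subseteq> ?N"
  proof clarify
    fix T p assume T: "T \<in> tableaux (hook d i) n" and p: "p \<in> carrier (mpol_ring A n)"
    have "p \<odot>\<^bsub>F_mod_R A d i n\<^esub> F_gen A d i n \<one>\<^bsub>mpol_ring A n\<^esub> T \<in> ?N"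
      by (rule submodule_smult[OF N p]) (rule subsetD[OF span_of_superset imageI[OF T]])
    then show "F_gen A d i n p T \<in> ?N" using T p by (simp add: F_mod_R_smult_gen)
  qed
  ultimately have "carrier (F_mod A d i n) \<subseteq> ?N"
    unfolding F_span_pure[OF A, symmetric] by (rule span_of_least)
  then show ?thesis using NF by (simp add: F_mod_R_simps)
qed

lemma I_mod_R_module: "module (mpol_ring A n) (I_mod_R A d n)"
proof -
  interpret J: ideal "sqfree_ideal A d n" "mpol_ring A n" by (rule sqfree_ideal_ideal[OF A])
  show ?thesis
  proof (rule moduleI)
    show "cring (mpol_ring A n)" by (rule S.cring_axioms)
    show "abelian_group (I_mod_R A d n)"
      by (rule abelian_groupI)
        (auto simp: I_mod_R_simps S.a_ac J.a_Hcarr intro!: bexI[of _ "\<ominus>\<^bsub>mpol_ring A n\<^esub> _"] S.r_neg)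
  qed (auto simp: I_mod_R_simps J.a_Hcarr S.l_distr S.r_distr S.m_assoc J.I_l_closed)
qed

section \<open>The differentials\<close>


lemma hook_diff_lin_hom: "hook_diff A d i n \<in> lin_hom A (F_mod A d i n) (F_mod A d (i - 1) n)"
proof -
  have "(\<lambda>x. hook_retract A d (i - 1) n ([((- 1 :: int) ^ Suc i)] \<cdot>\<^bsub>exterior_module A\<^esub>
      koszul A to_mono (hook_embed A d i n x))) \<in> lin_hom A (F_mod A d i n) (F_mod A d (i - 1) n)"
    by (rule lin_hom_comp[OF lin_hom_int_pow[OF P.module_axioms lin_hom_comp[OF E.lin_hom K.lin_hom]] R.lin_hom])
  then show ?thesis by (simp add: hook_diff_def[abs_def])
qed

context
  fixes d :: nat
  assumes d: "1 \<le> d"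
begin

text \<open>Anticommutation keeps the monomial differential of a row cycle a row cycle, so the
  retraction is undone by the embedding. Exactness can then be tested on triples.\<close>

lemma hook_embed_diff:
  assumes x: "x \<in> carrier (F_mod A d (Suc i) n)"
  shows "hook_embed A d i n (hook_diff A d (Suc i) n x)
    = [((- 1 :: int) ^ i)] \<cdot>\<^bsub>exterior_module A\<^esub> koszul A to_mono (hook_embed A d (Suc i) n x)"
proof -
  note e = hook_embed_cells[OF A d x]
  have sub: "submodule (carrier (free_module A (cells n i d))) A (exterior_module A)"
    by (rule free_module_submodule[OF A subset_UNIV])
  have "koszul A to_row (koszul A to_mono (hook_embed A d (Suc i) n x)) = \<zero>\<^bsub>exterior_module A\<^esub>"
    using row_mono[OF A e(1)] e(2) by (simp add: K.map_zero)
  then have "koszul A to_row ([((- 1 :: int) ^ i)] \<cdot>\<^bsub>exterior_module A\<^esub> koszul A to_mono (hook_embed A d (Suc i) n x)) = \<zero>\<^bsub>exterior_module A\<^esub>"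
    using x by (simp add: K.map_int_pow)
  moreover have "[((- 1 :: int) ^ i)] \<cdot>\<^bsub>exterior_module A\<^esub> koszul A to_mono (hook_embed A d (Suc i) n x) \<in> carrier (free_module A (cells n i d))"
    by (rule submodule_int_pow[OF P.module_axioms sub mono_closed[OF A e(1)]])
  ultimately show ?thesis
    unfolding hook_diff_def diff_Suc_1 using embed_retract[OF A d] by simp
qed

text \<open>By linearity \<open>p\<close> may be a monomial, and by injectivity of the embedding
  both sides may be compared on triples, where each is a signed composite of the two differentials
  applied to the wedge of the first column.\<close>

lemma hook_diff_gen:
  assumes T: "T \<in> tableaux (hook d (Suc i)) n" and p: "p \<in> carrier (mpol_ring A n)"
  shows "hook_diff A d (Suc i) n (F_gen A d (Suc i) n p T) = (\<Oplus>\<^bsub>F_mod A d i n\<^esub>j\<in>{0..Suc i}.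
    [((- 1 :: int) ^ (Suc i - j))] \<cdot>\<^bsub>F_mod A d i n\<^esub>
      F_gen A d i n (delta A {#hd T ! j#} \<otimes>\<^bsub>mpol_ring A n\<^esub> p) (remove_box T j))"
proof -
  obtain col row where Tcr: "T = hook_tableau col row" by (rule tableaux_hookE[OF T])
  note T' = T[unfolded Tcr]
  have len: "length col = Suc (Suc i)" and dist: "distinct col" and sub: "set col \<subseteq> {1..n}"
    using T' by (auto simp: hook_tableau_in_tableaux)
  have Tj: "hook_tableau (take j col @ drop (Suc j) col) row \<in> tableaux (hook d i) n" if "j \<le> Suc i" for j
    by (rule remove_box_in_tableaux[OF T' that])
  have xm: "{#col ! j#} \<in> monoms n" if "j \<le> Suc i" for j
  proof -
    have "col ! j \<in> set col" using that len by simp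
    then show ?thesis using sub by (auto simp: monoms_def)
  qed
  note xc = mpol_delta_closed[OF A xm]
  have lin: "(\<lambda>p. \<Oplus>\<^bsub>F_mod A d i n\<^esub>j\<in>{0..Suc i}. [((- 1 :: int) ^ (Suc i - j))] \<cdot>\<^bsub>F_mod A d i n\<^esub>
      F_gen A d i n (delta A {#col ! j#} \<otimes>\<^bsub>mpol_ring A n\<^esub> p) (hook_tableau (take j col @ drop (Suc j) col) row))
    \<in> lin_hom A (mpol_ring A n) (F_mod A d i n)"
  proof (rule lin_hom_finsum[OF SM.module_axioms F.module_axioms])
    fix j assume "j \<in> {0..Suc i}"
    then have j: "j \<le> Suc i" by simp
    show "(\<lambda>p. [((- 1 :: int) ^ (Suc i - j))] \<cdot>\<^bsub>F_mod A d i n\<^esub>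
      F_gen A d i n (delta A {#col ! j#} \<otimes>\<^bsub>mpol_ring A n\<^esub> p) (hook_tableau (take j col @ drop (Suc j) col) row))
      \<in> lin_hom A (mpol_ring A n) (F_mod A d i n)"
      by (rule lin_hom_int_pow[OF F.module_axioms lin_hom_comp[OF mpol_mult_lin2[OF A xc[OF j]] F_gen_lin_hom[OF A Tj[OF j]]]])
  qed simp
  have "hook_diff A d (Suc i) n (F_gen A d (Suc i) n p T) = (\<Oplus>\<^bsub>F_mod A d i n\<^esub>j\<in>{0..Suc i}. [((- 1 :: int) ^ (Suc i - j))] \<cdot>\<^bsub>F_mod A d i n\<^esub>
      F_gen A d i n (delta A {#col ! j#} \<otimes>\<^bsub>mpol_ring A n\<^esub> p) (hook_tableau (take j col @ drop (Suc j) col) row))"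
  proof (rule mpol_lin_hom_eqI[OF A F.module_axioms lin_hom_comp[OF F_gen_lin_hom[OF A T] hook_diff_lin_hom, unfolded diff_Suc_1] lin _ p])
    fix m assume m: "m \<in> monoms n"
    note w = wedge_closed[OF A UNIV_I]
    let ?w = "wedge A col (set row, m)"
    have wc: "?w \<in> carrier (free_module A (cells n (Suc (Suc i)) (d - 1)))"
      by (rule wedge_closed[OF A tableau_cells[OF A T' m]])
    have pow: "lin_map A (exterior_module A) (exterior_module A) (\<lambda>x. [k] \<cdot>\<^bsub>exterior_module A\<^esub> x)" for k :: int
      by (intro lin_mapI P.module_axioms lin_hom_int_pow P.id_lin_hom)
    have gc: "F_gen A d i n (delta A {#col ! j#} \<otimes>\<^bsub>mpol_ring A n\<^esub> delta A m) (hook_tableau (take j col @ drop (Suc j) col) row)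
        \<in> carrier (F_mod A d i n)" if "j \<le> Suc i" for j
      by (intro F_gen_closed[OF A] Tj[OF that] mpol_mult_closed[OF A] xc[OF that] mpol_delta_closed[OF A m])
    show "hook_diff A d (Suc i) n (F_gen A d (Suc i) n (delta A m) T) = (\<Oplus>\<^bsub>F_mod A d i n\<^esub>j\<in>{0..Suc i}. [((- 1 :: int) ^ (Suc i - j))] \<cdot>\<^bsub>F_mod A d i n\<^esub>
      F_gen A d i n (delta A {#col ! j#} \<otimes>\<^bsub>mpol_ring A n\<^esub> delta A m) (hook_tableau (take j col @ drop (Suc j) col) row))"
      (is "?l = ?r")
    proof (rule hook_embed_inj[OF A d])
      show "?l \<in> carrier (F_mod A d i n)"
        using lin_hom_closed[OF hook_diff_lin_hom[of d "Suc i" n] F_gen_closed[OF A T mpol_delta_closed[OF A m]]] by simp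
      show "?r \<in> carrier (F_mod A d i n)"
        by (intro F.finsum_closed) (auto intro!: F.add.int_pow_closed gc)
      have "hook_embed A d i n ?r = (\<Oplus>\<^bsub>exterior_module A\<^esub>j\<in>{0..Suc i}. hook_embed A d i n ([((- 1 :: int) ^ (Suc i - j))] \<cdot>\<^bsub>F_mod A d i n\<^esub>
        F_gen A d i n (delta A {#col ! j#} \<otimes>\<^bsub>mpol_ring A n\<^esub> delta A m) (hook_tableau (take j col @ drop (Suc j) col) row)))"
        by (rule E.map_finsum) (auto intro!: F.add.int_pow_closed gc)
      also have "\<dots> = (\<Oplus>\<^bsub>exterior_module A\<^esub>j\<in>{0..Suc i}. [((- 1 :: int) ^ Suc i)] \<cdot>\<^bsub>exterior_module A\<^esub>
        (koszul A to_row ([((- 1 :: int) ^ j)] \<cdot>\<^bsub>exterior_module A\<^esub> wedge A (take j col @ drop (Suc j) col) (to_mono (col ! j) (set row, m)))))"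
      proof (rule P.finsum_cong')
        fix j assume "j \<in> {0..Suc i}"
        then have j: "j \<le> Suc i" by simp
        have mm: "{#col ! j#} + m \<in> monoms n" using xm[OF j] m by (simp add: monoms_def)
        \<comment> \<open>The factor depending on \<open>j\<close> is the sign of the Koszul
          formula; the other factor is common to all summands and can be pulled out.\<close>
        have "(- 1 :: int) ^ (Suc i - j) = (- 1) ^ j * (- 1) ^ Suc i"
        proof -
          have "(- 1 :: int) ^ Suc i = (- 1) ^ (Suc i - j) * (- 1) ^ j" using j by (simp flip: power_add)
          moreover have "(- 1 :: int) ^ j * (- 1) ^ j = 1" by (simp flip: power_add mult_2)
          ultimately show ?thesis by simp
        qed
        then show "hook_embed A d i n ([((- 1 :: int) ^ (Suc i - j))] \<cdot>\<^bsub>F_mod A d i n\<^esub>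
          F_gen A d i n (delta A {#col ! j#} \<otimes>\<^bsub>mpol_ring A n\<^esub> delta A m) (hook_tableau (take j col @ drop (Suc j) col) row))
          = [((- 1 :: int) ^ Suc i)] \<cdot>\<^bsub>exterior_module A\<^esub>
        (koszul A to_row ([((- 1 :: int) ^ j)] \<cdot>\<^bsub>exterior_module A\<^esub> wedge A (take j col @ drop (Suc j) col) (to_mono (col ! j) (set row, m))))"
          using hook_embed_gen[OF A Tj[OF j] mm] gc[OF j]
          by (simp only: E.map_int_pow mpol_mult_delta[OF A] K.map_int_pow w P.add.int_pow_pow K.map_closed to_mono_def prod.case add_mset_add_single[of _ m] add.commute[of m])
      qed (auto intro!: P.add.int_pow_closed K.map_closed w)
      also have "\<dots> = [((- 1 :: int) ^ Suc i)] \<cdot>\<^bsub>exterior_module A\<^esub> koszul A to_row (\<Oplus>\<^bsub>exterior_module A\<^esub>j\<in>{0..Suc i}.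
        [((- 1 :: int) ^ j)] \<cdot>\<^bsub>exterior_module A\<^esub> wedge A (take j col @ drop (Suc j) col) (to_mono (col ! j) (set row, m)))"
        by (subst K.map_finsum, (auto intro!: P.add.int_pow_closed w)[1])
          (rule lin_map.map_finsum[OF pow, symmetric], auto intro!: P.add.int_pow_closed K.map_closed w)
      also have "(\<Oplus>\<^bsub>exterior_module A\<^esub>j\<in>{0..Suc i}.
        [((- 1 :: int) ^ j)] \<cdot>\<^bsub>exterior_module A\<^esub> wedge A (take j col @ drop (Suc j) col) (to_mono (col ! j) (set row, m)))
        = koszul A to_mono ?w"
      proof -
        have "{0..Suc i} = {..<length col}" using len by auto
        then show ?thesis using koszul_wedge[OF A dist, of to_mono "(set row, m)"] by simp
      qed
      \<comment> \<open>The minus from interchanging the differentials turns the common sign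
        \<open>(-1)^(Suc i)\<close> into the \<open>(-1)^i\<close> of
        \<open>hook_embed_diff\<close>.\<close>
      also have "koszul A to_row (koszul A to_mono ?w) = \<ominus>\<^bsub>exterior_module A\<^esub> koszul A to_mono (koszul A to_row ?w)"
        by (rule row_mono[OF A wc])
      also have "[((- 1 :: int) ^ Suc i)] \<cdot>\<^bsub>exterior_module A\<^esub> (\<ominus>\<^bsub>exterior_module A\<^esub> koszul A to_mono (koszul A to_row ?w))
        = [((- 1 :: int) ^ i)] \<cdot>\<^bsub>exterior_module A\<^esub> koszul A to_mono (koszul A to_row ?w)"
        by (simp add: P.add.int_pow_neg P.add.int_pow_inv w)
      also have "\<dots> = hook_embed A d i n ?l"
        using hook_embed_diff[OF F_gen_closed[OF A T mpol_delta_closed[OF A m]]] hook_embed_gen[OF A T' m] by (simp add: Tcr)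
      finally show "hook_embed A d i n ?l = hook_embed A d i n ?r" ..
    qed
  qed
  then show ?thesis by (simp add: Tcr remove_box_hook)
qed

text \<open>The triples are used only as a module over \<open>A\<close>. Linearity over polynomials
  is read off from \<open>hook_diff_gen\<close>, which holds for arbitrary \<open>p\<close>, and
  amounts to moving \<open>q\<close> past a variable.\<close>

lemma hook_diff_R_lin_hom:
  "hook_diff A d (Suc i) n \<in> lin_hom (mpol_ring A n) (F_mod_R A d (Suc i) n) (F_mod_R A d i n)"
proof (rule lin_homI)
  note L = hook_diff_lin_hom[of d "Suc i" n, unfolded diff_Suc_1]
  fix x assume x': "x \<in> carrier (F_mod_R A d (Suc i) n)"
  note x = x'[unfolded F_mod_R_simps]
  show "hook_diff A d (Suc i) n x \<in> carrier (F_mod_R A d i n)"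
    unfolding F_mod_R_simps by (rule lin_hom_closed[OF L x])
  show "hook_diff A d (Suc i) n (x \<oplus>\<^bsub>F_mod_R A d (Suc i) n\<^esub> y) = hook_diff A d (Suc i) n x \<oplus>\<^bsub>F_mod_R A d i n\<^esub> hook_diff A d (Suc i) n y"
    if "y \<in> carrier (F_mod_R A d (Suc i) n)" for y
    unfolding F_mod_R_simps by (rule lin_hom_add[OF L x]) (use that in \<open>simp add: F_mod_R_simps\<close>)
  fix q assume q: "q \<in> carrier (mpol_ring A n)"
  show "hook_diff A d (Suc i) n (q \<odot>\<^bsub>F_mod_R A d (Suc i) n\<^esub> x) = q \<odot>\<^bsub>F_mod_R A d i n\<^esub> hook_diff A d (Suc i) n x"
  proof (rule F_hom_pure_eqI[OF F.module_axioms lin_hom_comp[OF F_mod_R_smult_lin_hom[OF q] L]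
        lin_hom_comp[OF L F_mod_R_smult_lin_hom[OF q]] _ x])
    fix T p assume T: "T \<in> tableaux (hook d (Suc i)) n" and p: "p \<in> carrier (mpol_ring A n)"
    obtain col row where Tcr: "T = hook_tableau col row" by (rule tableaux_hookE[OF T])
    have Tj: "remove_box T j \<in> tableaux (hook d i) n" if "j \<le> Suc i" for j
      unfolding Tcr remove_box_hook by (rule remove_box_in_tableaux[OF T[unfolded Tcr] that])
    have xc: "delta A {#hd T ! j#} \<in> carrier (mpol_ring A n)" if "j \<le> Suc i" for j
    proof -
      have "hd T ! j \<in> set (hd T)" "set (hd T) \<subseteq> {1..n}" using that T by (auto simp: Tcr hook_tableau_in_tableaux)
      then show ?thesis by (intro mpol_delta_closed[OF A]) (auto simp: monoms_def)
    qed
    interpret q: lin_map A "F_mod A d i n" "F_mod A d i n" "\<lambda>x. q \<odot>\<^bsub>F_mod_R A d i n\<^esub> x"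
      by (intro lin_mapI F.module_axioms F_mod_R_smult_lin_hom q)
    have gc: "F_gen A d i n (delta A {#hd T ! j#} \<otimes>\<^bsub>mpol_ring A n\<^esub> p) (remove_box T j) \<in> carrier (F_mod A d i n)" if "j \<le> Suc i" for j
      by (intro F_gen_closed[OF A] Tj[OF that] S.m_closed xc[OF that] p)
    have "q \<odot>\<^bsub>F_mod_R A d i n\<^esub> hook_diff A d (Suc i) n (F_gen A d (Suc i) n p T)
      = (\<Oplus>\<^bsub>F_mod A d i n\<^esub>j\<in>{0..Suc i}. q \<odot>\<^bsub>F_mod_R A d i n\<^esub> ([((- 1 :: int) ^ (Suc i - j))] \<cdot>\<^bsub>F_mod A d i n\<^esub>
        F_gen A d i n (delta A {#hd T ! j#} \<otimes>\<^bsub>mpol_ring A n\<^esub> p) (remove_box T j)))"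
      unfolding hook_diff_gen[OF T p] by (rule q.map_finsum) (auto intro!: F.add.int_pow_closed gc)
    also have "\<dots> = (\<Oplus>\<^bsub>F_mod A d i n\<^esub>j\<in>{0..Suc i}. [((- 1 :: int) ^ (Suc i - j))] \<cdot>\<^bsub>F_mod A d i n\<^esub>
        F_gen A d i n (delta A {#hd T ! j#} \<otimes>\<^bsub>mpol_ring A n\<^esub> (q \<otimes>\<^bsub>mpol_ring A n\<^esub> p)) (remove_box T j))"
    proof (rule F.finsum_cong')
      fix j assume "j \<in> {0..Suc i}"
      then have j: "j \<le> Suc i" by simp
      have "q \<otimes>\<^bsub>mpol_ring A n\<^esub> (delta A {#hd T ! j#} \<otimes>\<^bsub>mpol_ring A n\<^esub> p)
        = delta A {#hd T ! j#} \<otimes>\<^bsub>mpol_ring A n\<^esub> (q \<otimes>\<^bsub>mpol_ring A n\<^esub> p)"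
        using q p xc[OF j] by (simp add: S.m_lcomm)
      then show "q \<odot>\<^bsub>F_mod_R A d i n\<^esub> ([((- 1 :: int) ^ (Suc i - j))] \<cdot>\<^bsub>F_mod A d i n\<^esub>
          F_gen A d i n (delta A {#hd T ! j#} \<otimes>\<^bsub>mpol_ring A n\<^esub> p) (remove_box T j))
        = [((- 1 :: int) ^ (Suc i - j))] \<cdot>\<^bsub>F_mod A d i n\<^esub>
          F_gen A d i n (delta A {#hd T ! j#} \<otimes>\<^bsub>mpol_ring A n\<^esub> (q \<otimes>\<^bsub>mpol_ring A n\<^esub> p)) (remove_box T j)"
        using F_mod_R_smult_gen[OF q Tj[OF j] S.m_closed[OF xc[OF j] p]] by (simp add: q.map_int_pow gc[OF j])
    qed (auto intro!: F.add.int_pow_closed F_gen_closed[OF A] Tj S.m_closed xc q p)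
    also have "\<dots> = hook_diff A d (Suc i) n (q \<odot>\<^bsub>F_mod_R A d (Suc i) n\<^esub> F_gen A d (Suc i) n p T)"
      using q p by (simp add: F_mod_R_smult_gen[OF q T p] hook_diff_gen[OF T])
    finally show "hook_diff A d (Suc i) n (q \<odot>\<^bsub>F_mod_R A d (Suc i) n\<^esub> F_gen A d (Suc i) n p T)
      = q \<odot>\<^bsub>F_mod_R A d i n\<^esub> hook_diff A d (Suc i) n (F_gen A d (Suc i) n p T)" ..
  qed
qed

text \<open>\<open>hook_diff\<close> is linear over the polynomial ring and has the prescribed
  values on \<open>1[T]\<close>, so it is the map that \<open>lin_ext\<close> describes.\<close>

lemma diff_eq:
  assumes x: "x \<in> carrier (F_mod A d (Suc i) n)"
  shows "diff A d (Suc i) n x = hook_diff A d (Suc i) n x"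
  unfolding diff_def diff_Suc_1
proof (rule lin_ext_eq_span[OF F_mod_R_module F_mod_R_module hook_diff_R_lin_hom _ _ F_mod_R_span])
  show "F_gen A d (Suc i) n \<one>\<^bsub>mpol_ring A n\<^esub> \<in> tableaux (hook d (Suc i)) n \<rightarrow> carrier (F_mod_R A d (Suc i) n)"
    unfolding F_mod_R_simps by (auto intro!: F_gen_closed[OF A])
  show "x \<in> carrier (F_mod_R A d (Suc i) n)" using x by (simp add: F_mod_R_simps)
  fix T assume T: "T \<in> tableaux (hook d (Suc i)) n"
  have xc: "delta A {#hd T ! j#} \<in> carrier (mpol_ring A n)" if "j \<le> Suc i" for j
  proof -
    obtain col row where Tcr: "T = hook_tableau col row" by (rule tableaux_hookE[OF T])
    have "hd T ! j \<in> set (hd T)" "set (hd T) \<subseteq> {1..n}" using that T by (auto simp: Tcr hook_tableau_in_tableaux)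
    then show ?thesis by (intro mpol_delta_closed[OF A]) (auto simp: monoms_def)
  qed
  have Tj: "remove_box T j \<in> tableaux (hook d i) n" if "j \<le> Suc i" for j
  proof -
    obtain col row where Tcr: "T = hook_tableau col row" by (rule tableaux_hookE[OF T])
    show ?thesis unfolding Tcr remove_box_hook by (rule remove_box_in_tableaux[OF T[unfolded Tcr] that])
  qed
  show "hook_diff A d (Suc i) n (F_gen A d (Suc i) n \<one>\<^bsub>mpol_ring A n\<^esub> T) = (\<Oplus>\<^bsub>F_mod A d i n\<^esub>j\<in>{0..Suc i}.
      [((- 1 :: int) ^ (Suc i - j))] \<cdot>\<^bsub>F_mod A d i n\<^esub> F_gen A d i n (delta A {#hd T ! j#}) (remove_box T j))"
    unfolding hook_diff_gen[OF T S.one_closed]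
    by (rule F.finsum_cong') (auto simp: xc intro!: F.add.int_pow_closed F_gen_closed[OF A] Tj)
qed

end

end

section \<open>Gradings\<close>

text \<open>A retract of a free module with graded basis inherits the grading. Components arise by
  cutting \<open>\<Phi> x\<close> into its homogeneous parts and mapping these back. They are unique
  because \<open>\<Phi>\<close> is injective and puts the elements of \<open>G k\<close> in degree
  \<open>k\<close>, so the coefficients of each component are coefficients of
  \<open>\<Phi> x\<close>.\<close>

lemma graded_module_transport:
  fixes deg :: "'b \<Rightarrow> int"
  assumes M: "module A M" and \<Phi>: "\<Phi> \<in> lin_hom A M (free_module A X)" and \<Theta>: "\<Theta> \<in> lin_hom A (free_module A X) M"
    and inv: "\<And>x. x \<in> carrier M \<Longrightarrow> \<Theta> (\<Phi> x) = x"
    and G: "\<And>k. submodule (G k) A M"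
    and \<Phi>G: "\<And>k x b. x \<in> G k \<Longrightarrow> \<Phi> x b \<noteq> \<zero>\<^bsub>A\<^esub> \<Longrightarrow> deg b = k"
    and \<Theta>G: "\<And>b. b \<in> X \<Longrightarrow> \<Theta> (delta A b) \<in> G (deg b)"
  shows "graded_module A M G"
  unfolding graded_module_def
proof (intro conjI allI ballI M G)
  interpret M: module A M by fact
  have A: "cring A" by (rule M.R.cring_axioms)
  interpret P: module A "free_module A X" by (rule free_module_module[OF A])
  interpret \<Phi>: lin_map A M "free_module A X" \<Phi> by (intro lin_mapI M P.module_axioms \<Phi>)
  interpret \<Theta>: lin_map A "free_module A X" M \<Theta> by (intro lin_mapI M P.module_axioms \<Theta>)
  fix x assume x: "x \<in> carrier M"
  note \<Phi>x = \<Phi>.map_closed[OF x]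
  \<comment> \<open>The homogeneous part of degree \<open>k\<close>. Its image under
    \<open>\<Phi> \<circ> \<Theta>\<close> is not under control, which is why uniqueness below
    compares \<open>\<Phi> (c' k)\<close> with \<open>f k\<close> and only then applies
    \<open>\<Theta>\<close>.\<close>
  define f where "f k b = (if deg b = k then \<Phi> x b else \<zero>\<^bsub>A\<^esub>)" for k b
  have fB: "f k \<in> carrier (free_module A {b \<in> X. deg b = k})" for k
    using \<Phi>x unfolding mem_free_module_iff f_def
    by (auto simp: f_def elim!: rev_finite_subset)
  have fc: "f k \<in> carrier (free_module A X)" for k
    using fB free_module_mono[of "{b \<in> X. deg b = k}" X A] by blast
  define c where "c k = \<Theta> (f k)" for k
  have cG: "c k \<in> G k" for k
  proof -
    let ?B = "{b \<in> X. deg b = k}"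
    interpret B: module A "free_module A ?B" by (rule free_module_module[OF A])
    have "\<Theta> \<in> lin_hom A (free_module A ?B) M" by (rule lin_hom_free_restrict[OF _ \<Theta>]) auto
    moreover have "delta A ` ?B \<subseteq> carrier (free_module A ?B)" by (auto intro: delta_closed[OF A])
    moreover have "\<Theta> s \<in> G k" if "s \<in> delta A ` ?B" for s using that \<Theta>G by auto
    moreover have "f k \<in> span_of A (free_module A ?B) (delta A ` ?B)"
      unfolding free_module_span_delta[OF A] by (rule fB)
    ultimately show ?thesis unfolding c_def by (rule span_of_vimage[OF B.module_axioms M _ G])
  qed
  have cM: "c k \<in> carrier M" for k unfolding c_def by (rule \<Theta>.map_closed[OF fc])
  define D where "D = deg ` {b. \<Phi> x b \<noteq> \<zero>\<^bsub>A\<^esub>}"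
  have D: "finite D" unfolding D_def using free_module_finite[OF \<Phi>x] by simp
  have cD: "c k = \<zero>\<^bsub>M\<^esub>" if "k \<notin> D" for k
  proof -
    have "f k b = \<zero>\<^bsub>A\<^esub>" for b using that by (auto simp: f_def D_def)
    then have "f k = \<zero>\<^bsub>free_module A X\<^esub>" by (auto simp: free_module_simps)
    then show ?thesis by (simp add: c_def \<Theta>.map_zero)
  qed
  show "\<exists>!c. (\<forall>k. c k \<in> G k) \<and> finite {k. c k \<noteq> \<zero>\<^bsub>M\<^esub>} \<and> x = (\<Oplus>\<^bsub>M\<^esub>k\<in>{k. c k \<noteq> \<zero>\<^bsub>M\<^esub>}. c k)"
  proof (rule ex1I[of _ c], intro conjI allI cG)
    show "finite {k. c k \<noteq> \<zero>\<^bsub>M\<^esub>}" using cD by (intro finite_subset[OF _ D]) auto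
    have "(\<Oplus>\<^bsub>free_module A X\<^esub>k\<in>D. f k) = \<Phi> x"
    proof
      fix b
      have "(\<Oplus>\<^bsub>free_module A X\<^esub>k\<in>D. f k) b = (\<Oplus>\<^bsub>A\<^esub>k\<in>D. f k b)"
        using fc by (intro free_module_finsum_app[OF A _ D]) auto
      also have "\<dots> = (\<Oplus>\<^bsub>A\<^esub>k\<in>D. if deg b = k then \<Phi> x b else \<zero>\<^bsub>A\<^esub>)" by (simp add: f_def)
      also have "\<dots> = \<Phi> x b"
      proof (cases "deg b \<in> D")
        case True
        then show ?thesis
          using free_module_app_closed[OF \<Phi>x] by (intro M.R.finsum_singleton D) auto
      next
        case False
        then have "\<Phi> x b = \<zero>\<^bsub>A\<^esub>" by (auto simp: D_def)
        then show ?thesis by (simp cong: if_cong)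
      qed
      finally show "(\<Oplus>\<^bsub>free_module A X\<^esub>k\<in>D. f k) b = \<Phi> x b" .
    qed
    then have "x = \<Theta> (\<Oplus>\<^bsub>free_module A X\<^esub>k\<in>D. f k)" using inv[OF x] by simp
    also have "\<dots> = (\<Oplus>\<^bsub>M\<^esub>k\<in>D. c k)" unfolding c_def using fc by (intro \<Theta>.map_finsum) auto
    also have "\<dots> = (\<Oplus>\<^bsub>M\<^esub>k\<in>{k. c k \<noteq> \<zero>\<^bsub>M\<^esub>}. c k)"
      using cD cM D by (intro M.add.finprod_mono_neutral_cong_right) auto
    finally show "x = (\<Oplus>\<^bsub>M\<^esub>k\<in>{k. c k \<noteq> \<zero>\<^bsub>M\<^esub>}. c k)" .
  next
    fix c' assume c': "(\<forall>k. c' k \<in> G k) \<and> finite {k. c' k \<noteq> \<zero>\<^bsub>M\<^esub>} \<and> x = (\<Oplus>\<^bsub>M\<^esub>k\<in>{k. c' k \<noteq> \<zero>\<^bsub>M\<^esub>}. c' k)"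
    define S where "S = {k. c' k \<noteq> \<zero>\<^bsub>M\<^esub>}"
    have cM': "c' k \<in> carrier M" for k using c' submodule_subset[OF G[of k]] by blast
    have S: "finite S" "x = (\<Oplus>\<^bsub>M\<^esub>k\<in>S. c' k)" using c' by (auto simp: S_def)
    show "c' = c"
    proof
      fix k
      have "\<Phi> (c' k) b = f k b" for b
      proof (cases "deg b = k")
        case True
        have "\<Phi> x b = (\<Oplus>\<^bsub>free_module A X\<^esub>k\<in>S. \<Phi> (c' k)) b"
          unfolding S(2) using cM' by (subst \<Phi>.map_finsum) auto
        also have "\<dots> = (\<Oplus>\<^bsub>A\<^esub>k\<in>S. \<Phi> (c' k) b)"
          using cM' by (intro free_module_finsum_app[OF A _ S(1)]) auto
        also have "\<dots> = (\<Oplus>\<^bsub>A\<^esub>j\<in>S. if k = j then \<Phi> (c' j) b else \<zero>\<^bsub>A\<^esub>)"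
          using \<Phi>G[of "c' _" _ b] c' True cM'
          by (intro M.R.finsum_cong') (auto intro!: free_module_app_closed[OF \<Phi>.map_closed])
        also have "\<dots> = \<Phi> (c' k) b"
        proof (cases "k \<in> S")
          case True
          then show ?thesis
            using cM' by (intro M.R.finsum_singleton S(1)) (auto intro!: free_module_app_closed[OF \<Phi>.map_closed])
        next
          case False
          then have "\<Phi> (c' k) b = \<zero>\<^bsub>A\<^esub>" by (simp add: S_def \<Phi>.map_zero free_module_simps)
          moreover have "(\<Oplus>\<^bsub>A\<^esub>j\<in>S. if k = j then \<Phi> (c' j) b else \<zero>\<^bsub>A\<^esub>) = (\<Oplus>\<^bsub>A\<^esub>j\<in>S. \<zero>\<^bsub>A\<^esub>)"
            using False by (intro M.R.finsum_cong') auto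
          ultimately show ?thesis by simp
        qed
        finally show ?thesis using True by (simp add: f_def)
      next
        case False
        then show ?thesis using \<Phi>G[of "c' k" k b] c' by (auto simp: f_def)
      qed
      then have "\<Phi> (c' k) = f k" by blast
      then show "c' k = c k" using inv[OF cM'[of k]] by (simp add: c_def)
    qed
  qed
qed

section \<open>Injections acting on monomials and tableaux\<close>

lemma FI_injD:
  assumes "\<epsilon> \<in> FI_inj m n"
  shows "j \<in> {1..m} \<Longrightarrow> \<epsilon> j \<in> {1..n}" "inj_on \<epsilon> {1..m}"
  using assms by (auto simp: FI_inj_def)

lemma image_mset_monoms: "\<epsilon> \<in> FI_inj m n \<Longrightarrow> v \<in> monoms m \<Longrightarrow> image_mset \<epsilon> v \<in> monoms n"
  using FI_injD(1)[of \<epsilon> m n] by (auto simp: monoms_def subset_iff)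

lemma map_tableaux:
  assumes "\<epsilon> \<in> FI_inj m n" "hook_tableau col row \<in> tableaux (hook d i) m"
  shows "hook_tableau (map \<epsilon> col) (map \<epsilon> row) \<in> tableaux (hook d i) n"
proof -
  have sub: "set (col @ row) \<subseteq> {1..m}" using assms(2) unfolding hook_tableau_in_tableaux by blast
  have "distinct (map \<epsilon> (col @ row))"
    using assms(2) inj_on_subset[OF FI_injD(2)[OF assms(1)] sub]
    unfolding distinct_map hook_tableau_in_tableaux by blast
  moreover have "set (map \<epsilon> (col @ row)) \<subseteq> {1..n}"
    using sub FI_injD(1)[OF assms(1)] by (auto simp: subset_iff)
  ultimately show ?thesis
    using assms(2) unfolding hook_tableau_in_tableaux map_append[symmetric] by simp
qed

lemma map_tableaux': "\<epsilon> \<in> FI_inj m n \<Longrightarrow> T \<in> tableaux (hook d i) m \<Longrightarrow> map (map \<epsilon>) T \<in> tableaux (hook d i) n"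
  by (metis tableaux_hookE map_hook_tableau map_tableaux)

context
  fixes A :: "('a, 'r) ring_scheme"
  assumes A: "cring A"
begin

interpretation A: cring A by (rule A)

interpretation P: module A "exterior_module A :: ('a, nat set \<times> 'z \<Rightarrow> 'a) module"
  by (rule free_module_module[OF A])

interpretation Q: module A "free_module A UNIV :: ('a, nat multiset \<Rightarrow> 'a) module"
  by (rule free_module_module[OF A])

interpretation K: lin_map A "exterior_module A" "exterior_module A" "koszul A \<tau>"
  by (intro lin_mapI P.module_axioms koszul_lin_hom A)

interpretation F: module A "F_mod A d i n" by (rule F_module[OF A])

interpretation E: lin_map A "F_mod A d i n" "exterior_module A" "hook_embed A d i n"
  by (intro lin_mapI F.module_axioms P.module_axioms hook_embed_lin_hom A)

interpretation R: lin_map A "exterior_module A" "F_mod A d i n" "hook_retract A d i n"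
  by (intro lin_mapI F.module_axioms P.module_axioms hook_retract_lin_hom A)

interpretation S: cring "mpol_ring A n" by (rule mpol_cring[OF A])

interpretation SM: module A "mpol_ring A n" by (rule mpol_module[OF A])

interpretation Aug: lin_map A "free_module A UNIV" "free_module A UNIV" "augmentation A"
  by (intro lin_mapI P.module_axioms Q.module_axioms augmentation_lin_hom A)

interpretation M: module A "free_module A (monoms n)" by (rule free_module_module[OF A])

section \<open>The maps induced by injections\<close>

text \<open>Collecting coefficients over fibres of \<open>image_mset \<epsilon>\<close> is the
  linear extension of the substitution on monomials, from which linearity and the values on
  monomials follow.\<close>

lemma mpol_map_eq:
  assumes \<epsilon>: "\<epsilon> \<in> FI_inj m n" and p: "p \<in> carrier (mpol_ring A m)"
  shows "mpol_map A \<epsilon> p = lin_comb A (free_module A (monoms n)) (monoms m) p (\<lambda>v. delta A (image_mset \<epsilon> v))"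
proof
  fix u
  note p' = p[unfolded mpol_ring_simps]
  note pA = free_module_app_closed[OF p']
  define S where "S = {v \<in> monoms m. p v \<noteq> \<zero>\<^bsub>A\<^esub>}"
  have S: "finite S" "S \<subseteq> monoms m" "\<And>v. p v \<noteq> \<zero>\<^bsub>A\<^esub> \<Longrightarrow> v \<in> S"
    using p' by (auto simp: S_def mem_free_module_iff)
  have "lin_comb A (free_module A (monoms n)) (monoms m) p (\<lambda>v. delta A (image_mset \<epsilon> v)) u
      = (\<Oplus>\<^bsub>A\<^esub>v\<in>S. (p v \<odot>\<^bsub>free_module A (monoms n)\<^esub> delta A (image_mset \<epsilon> v)) u)"
    unfolding lin_comb_def S_def[symmetric]
    using S pA image_mset_monoms[OF \<epsilon>]
    by (intro free_module_finsum_app[OF A _ S(1)] Pi_I M.smult_closed delta_closed[OF A]) auto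
  also have "\<dots> = (\<Oplus>\<^bsub>A\<^esub>v\<in>S. if image_mset \<epsilon> v = u then p v else \<zero>\<^bsub>A\<^esub>)"
    using pA by (intro A.finsum_cong') (auto simp: free_module_simps delta_def)
  also have "\<dots> = (\<Oplus>\<^bsub>A\<^esub>v\<in>{v. p v \<noteq> \<zero>\<^bsub>A\<^esub> \<and> image_mset \<epsilon> v = u}. p v)"
    using pA S by (intro A.add.finprod_mono_neutral_cong_right) auto
  finally show "mpol_map A \<epsilon> p u = lin_comb A (free_module A (monoms n)) (monoms m) p (\<lambda>v. delta A (image_mset \<epsilon> v)) u"
    by (simp add: mpol_map_def)
qed

lemma mpol_map_in:
  assumes \<epsilon>: "\<epsilon> \<in> FI_inj m n" and p: "p \<in> carrier (free_module A B)"
    and B: "B \<subseteq> monoms m" "\<And>v. v \<in> B \<Longrightarrow> image_mset \<epsilon> v \<in> Z" "Z \<subseteq> monoms n"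
  shows "mpol_map A \<epsilon> p \<in> carrier (free_module A Z)"
proof -
  have pm: "p \<in> carrier (mpol_ring A m)" using p free_module_mono[OF B(1)] unfolding mpol_ring_simps by blast
  show ?thesis
    unfolding mpol_map_eq[OF \<epsilon> pm]
    by (rule lin_comb_in_submodule[OF M.module_axioms free_module_submodule[OF A B(3)] p B(1) delta_closed[OF A B(2)]])
qed

lemma mpol_map_lin_hom:
  assumes \<epsilon>: "\<epsilon> \<in> FI_inj m n" shows "mpol_map A \<epsilon> \<in> lin_hom A (mpol_ring A m) (mpol_ring A n)"
proof -
  have c: "(\<lambda>v. delta A (image_mset \<epsilon> v)) \<in> monoms m \<rightarrow> carrier (free_module A (monoms n))"
    using image_mset_monoms[OF \<epsilon>] by (auto intro!: delta_closed[OF A])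
  have "(\<lambda>p. lin_comb A (free_module A (monoms n)) (monoms m) p (\<lambda>v. delta A (image_mset \<epsilon> v)))
      \<in> lin_hom A (mpol_ring A m) (mpol_ring A n)"
    unfolding mpol_lin_hom by (rule lin_comb_lin_hom[OF M.module_axioms c])
  then show ?thesis
    by (rule lin_hom_cong[OF _ _ SM.module_axioms]) (simp add: mpol_map_eq[OF \<epsilon>])
qed

lemma mpol_map_delta:
  assumes \<epsilon>: "\<epsilon> \<in> FI_inj m n" and v: "v \<in> monoms m"
  shows "mpol_map A \<epsilon> (delta A v) = delta A (image_mset \<epsilon> v)"
proof -
  have c: "(\<lambda>v. delta A (image_mset \<epsilon> v)) \<in> monoms m \<rightarrow> carrier (free_module A (monoms n))"
    using image_mset_monoms[OF \<epsilon>] by (auto intro!: delta_closed[OF A])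
  show ?thesis
    unfolding mpol_map_eq[OF \<epsilon> mpol_delta_closed[OF A v]] by (rule lin_comb_delta[OF M.module_axioms c v])
qed

lemma F_map_ex:
  assumes \<epsilon>: "\<epsilon> \<in> FI_inj m n"
  shows "\<exists>h\<in>lin_hom A (F_mod A d i m) (F_mod A d i n). \<forall>T\<in>tableaux (hook d i) m. \<forall>v\<in>monoms m.
    h (F_gen A d i m (delta A v) T) = F_gen A d i n (delta A (image_mset \<epsilon> v)) (map (map \<epsilon>) T)"
proof (rule F_lift[OF A F.module_axioms])
  fix v assume v: "v \<in> monoms m"
  note dc = mpol_delta_closed[OF A image_mset_monoms[OF \<epsilon> v]]
  show "(\<lambda>T. F_gen A d i n (delta A (image_mset \<epsilon> v)) (map (map \<epsilon>) T)) \<in> tableaux (hook d i) m \<rightarrow> carrier (F_mod A d i n)"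
    using map_tableaux'[OF \<epsilon>] by (auto intro!: F_gen_closed[OF A _ dc])
  show "F_gen A d i n (delta A (image_mset \<epsilon> v)) (map (map \<epsilon>) (hook_tableau (map \<sigma> col) row))
      = [sign \<sigma>] \<cdot>\<^bsub>F_mod A d i n\<^esub> F_gen A d i n (delta A (image_mset \<epsilon> v)) (map (map \<epsilon>) (hook_tableau col row))"
    if T: "hook_tableau col row \<in> tableaux (hook d i) m" and \<sigma>: "\<sigma> permutes set col" for \<sigma> col row
  proof -
    have sub: "set col \<subseteq> {1..m}" using T by (auto simp: hook_tableau_in_tableaux)
    have inj: "inj_on \<epsilon> (set col)" by (rule inj_on_subset[OF FI_injD(2)[OF \<epsilon>] sub])
    \<comment> \<open>The column permutation is transported along the injection; the transported
      permutation acts on the image column and has the same sign.\<close>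
    have "map_permutation (set col) \<epsilon> \<sigma> permutes set (map \<epsilon> col)"
      using \<sigma> inj by (intro map_permutation_permutes) (auto simp: bij_betw_def)
    moreover have "sign (map_permutation (set col) \<epsilon> \<sigma>) = sign \<sigma>"
      using inj \<sigma> by (intro sign_map_permutation) auto
    moreover have "map (map_permutation (set col) \<epsilon> \<sigma>) (map \<epsilon> col) = map \<epsilon> (map \<sigma> col)"
      using inj by (auto simp: map_permutation_def restrict_id_def)
    ultimately show ?thesis
      using F_gen_permute[OF A map_tableaux[OF \<epsilon> T] _ dc] unfolding map_hook_tableau by metis
  qed
  show "F_gen A d i n (delta A (image_mset \<epsilon> v)) (map (map \<epsilon>) (hook_tableau col (x # row)))
      = (\<Oplus>\<^bsub>F_mod A d i n\<^esub>p\<in>{..<length col}. F_gen A d i n (delta A (image_mset \<epsilon> v)) (map (map \<epsilon>) (hook_tableau (col[p := x]) (col ! p # row))))"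
    if T: "hook_tableau col (x # row) \<in> tableaux (hook d i) m" for col x row
  proof -
    note T' = map_tableaux[OF \<epsilon> T, unfolded list.map]
    have "F_gen A d i n (delta A (image_mset \<epsilon> v)) (map (map \<epsilon>) (hook_tableau col (x # row)))
      = (\<Oplus>\<^bsub>F_mod A d i n\<^esub>p\<in>{..<length col}. F_gen A d i n (delta A (image_mset \<epsilon> v))
          (hook_tableau ((map \<epsilon> col)[p := \<epsilon> x]) (map \<epsilon> col ! p # map \<epsilon> row)))"
      using F_gen_shuffle[OF A T' dc] by (simp add: map_hook_tableau)
    also have "\<dots> = (\<Oplus>\<^bsub>F_mod A d i n\<^esub>p\<in>{..<length col}. F_gen A d i n (delta A (image_mset \<epsilon> v)) (map (map \<epsilon>) (hook_tableau (col[p := x]) (col ! p # row))))"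
      using F_gen_closed[OF A map_tableaux'[OF \<epsilon> hook_shuffle[OF T]] dc]
      by (intro F.finsum_cong') (auto simp: map_hook_tableau map_update)
    finally show ?thesis .
  qed
  show "F_gen A d i n (delta A (image_mset \<epsilon> v)) (map (map \<epsilon>) (hook_tableau col (P @ a # b # R)))
      = F_gen A d i n (delta A (image_mset \<epsilon> v)) (map (map \<epsilon>) (hook_tableau col (P @ b # a # R)))"
    if T: "hook_tableau col (P @ a # b # R) \<in> tableaux (hook d i) m" for col P a b R
    using F_gen_swap[OF A map_tableaux[OF \<epsilon> T, unfolded map_append list.map]] by (simp add: map_hook_tableau)
qed

lemma F_map_spec:
  assumes \<epsilon>: "\<epsilon> \<in> FI_inj m n"
  shows F_map_lin_hom: "fi_map (F_FI A d i) m n \<epsilon> \<in> lin_hom A (F_mod A d i m) (F_mod A d i n)"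
    and F_map_gen: "T \<in> tableaux (hook d i) m \<Longrightarrow> p \<in> carrier (mpol_ring A m) \<Longrightarrow>
      fi_map (F_FI A d i) m n \<epsilon> (F_gen A d i m p T) = F_gen A d i n (mpol_map A \<epsilon> p) (map (map \<epsilon>) T)"
proof -
  obtain h where h: "h \<in> lin_hom A (F_mod A d i m) (F_mod A d i n)"
    "\<And>T v. T \<in> tableaux (hook d i) m \<Longrightarrow> v \<in> monoms m \<Longrightarrow>
      h (F_gen A d i m (delta A v) T) = F_gen A d i n (delta A (image_mset \<epsilon> v)) (map (map \<epsilon>) T)"
    using F_map_ex[OF \<epsilon>, of d i] by blast
  \<comment> \<open>The map was built from monomials, whereas the definition of \<open>F_FI\<close>
    prescribes its values for all polynomials.\<close>
  have hg: "h (F_gen A d i m p T) = F_gen A d i n (mpol_map A \<epsilon> p) (map (map \<epsilon>) T)"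
    if T: "T \<in> tableaux (hook d i) m" and p: "p \<in> carrier (mpol_ring A m)" for T p
    by (rule mpol_lin_hom_eqI[OF A F.module_axioms lin_hom_comp[OF F_gen_lin_hom[OF A T] h(1)]
          lin_hom_comp[OF mpol_map_lin_hom[OF \<epsilon>] F_gen_lin_hom[OF A map_tableaux'[OF \<epsilon> T]]] _ p])
      (simp add: h(2)[OF T] mpol_map_delta[OF \<epsilon>])
  have eq: "fi_map (F_FI A d i) m n \<epsilon> x = h x" if x: "x \<in> carrier (F_mod A d i m)" for x
  proof -
    have "lin_ext A (F_mod A d i m) (F_mod A d i n) (tableaux (hook d i) m \<times> carrier (mpol_ring A m))
        (\<lambda>(T, p). F_gen A d i m p T) (\<lambda>(T, p). F_gen A d i n (mpol_map A \<epsilon> p) (map (map \<epsilon>) T)) x = h x"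
      by (rule lin_ext_eq_span[OF F.module_axioms F.module_axioms h(1) _ _ F_span_pure[OF A] x])
        (auto simp: hg intro!: F_gen_closed[OF A])
    then show ?thesis by (simp add: F_FI_def)
  qed
  show "fi_map (F_FI A d i) m n \<epsilon> \<in> lin_hom A (F_mod A d i m) (F_mod A d i n)"
    by (rule lin_hom_cong[OF h(1) _ F.module_axioms]) (simp add: eq)
  show "T \<in> tableaux (hook d i) m \<Longrightarrow> p \<in> carrier (mpol_ring A m) \<Longrightarrow>
      fi_map (F_FI A d i) m n \<epsilon> (F_gen A d i m p T) = F_gen A d i n (mpol_map A \<epsilon> p) (map (map \<epsilon>) T)"
    by (simp add: eq F_gen_closed[OF A] hg)
qed

section \<open>The augmentation\<close>

lemma augmentation_closed:
  assumes "x \<in> carrier (free_module A (cells n i q))"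
  shows "augmentation A x \<in> carrier (free_module A (sq_monoms q n))"
  unfolding augmentation_def
proof (rule lin_comb_in_submodule[OF Q.module_axioms free_module_submodule[OF A subset_UNIV] assms subset_UNIV])
  fix b assume b: "b \<in> cells n i q"
  obtain B C r where BC: "b = (B, C, r)" by (cases b)
  have fin: "finite C" using b unfolding BC by (rule cells_finite)
  have "card C \<le> card (set_mset r \<union> C)" using fin by (intro card_mono) auto
  then show "(case b of (B, C, r) \<Rightarrow> delta A (r + mset_set C)) \<in> carrier (free_module A (sq_monoms q n))"
    using b fin unfolding BC prod.case by (intro delta_closed[OF A]) (auto simp: sq_monoms_def cells_def)
qed

lemma sqfree_ideal_subset: "sqfree_ideal A d n \<subseteq> carrier (mpol_ring A n)"
  unfolding sqfree_ideal_eq[OF A] mpol_ring_simps by (rule free_module_mono[OF sq_monoms_subset])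

context
  fixes d :: nat
  assumes d: "1 \<le> d"
begin

lemma hook_aug_closed: "x \<in> carrier (F_mod A d 0 n) \<Longrightarrow> hook_aug A d n x \<in> sqfree_ideal A d n"
  unfolding hook_aug_def sqfree_ideal_eq[OF A] by (rule augmentation_closed[OF hook_embed_cells(1)[OF A d]])

lemma hook_aug_lin_hom_UNIV: "hook_aug A d n \<in> lin_hom A (F_mod A d 0 n) (free_module A UNIV)"
  using lin_hom_comp[OF E.lin_hom Aug.lin_hom] by (simp add: hook_aug_def[abs_def])

lemma hook_aug_lin_hom: "hook_aug A d n \<in> lin_hom A (F_mod A d 0 n) (mpol_ring A n)"
  unfolding mpol_lin_hom
  by (rule lin_hom_free_corestrict[OF hook_aug_lin_hom_UNIV])
    (use hook_aug_closed sqfree_ideal_subset[unfolded mpol_ring_simps] in blast)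

lemma hook_aug_gen:
  assumes T: "T \<in> tableaux (hook d 0) n" and p: "p \<in> carrier (mpol_ring A n)"
  shows "hook_aug A d n (F_gen A d 0 n p T) = p \<otimes>\<^bsub>mpol_ring A n\<^esub> delta A (mset (concat T))"
    and "mset (concat T) \<in> monoms n" "size (mset (concat T)) = d"
proof -
  obtain col row where Tcr: "T = hook_tableau col row" and len: "length col = Suc 0" "length row = d - 1"
    and dist: "distinct (col @ row)" and sub: "set (col @ row) \<subseteq> {1..n}"
    by (rule tableaux_hookE[OF T])
  obtain a where a: "col = [a]" using len(1) by (auto simp: length_Suc_conv)
  show Tm: "mset (concat T) \<in> monoms n" using sub unfolding Tcr hook_tableau_simps monoms_def by auto
  show "size (mset (concat T)) = d" using len d by (simp add: Tcr)
  show "hook_aug A d n (F_gen A d 0 n p T) = p \<otimes>\<^bsub>mpol_ring A n\<^esub> delta A (mset (concat T))"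
  proof (rule mpol_lin_hom_eqI[OF A SM.module_axioms lin_hom_comp[OF F_gen_lin_hom[OF A T] hook_aug_lin_hom]
        mpol_mult_lin1[OF A mpol_delta_closed[OF A Tm]] _ p])
    fix m assume m: "m \<in> monoms n"
    \<comment> \<open>A column of one box leaves no exterior part once its entry has moved to the
      row, so the embedded generator is a single basis vector.\<close>
    have "koszul A to_row (wedge A [a] (set row, m)) = wedge A [] (insert a (set row), m)"
      using koszul_wedge[OF A, of "[a]" to_row "(set row, m)"]
      by (simp add: lessThan_Suc P.finsum_insert wedge_closed[OF A UNIV_I] to_row_def)
    also have "\<dots> = delta A ({}, insert a (set row), m)"
      by (simp add: wedge_def delta_UNIV_closed[OF A])
    finally have "hook_aug A d n (F_gen A d 0 n (delta A m) T) = delta A (m + mset_set (insert a (set row)))"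
      using hook_embed_gen[OF A T[unfolded Tcr] m] by (simp add: hook_aug_def Tcr a augmentation_delta[OF A])
    moreover have "mset_set (insert a (set row)) = mset (concat T)"
      using dist mset_set_set[of "a # row"] by (simp add: Tcr a)
    ultimately show "hook_aug A d n (F_gen A d 0 n (delta A m) T)
      = delta A m \<otimes>\<^bsub>mpol_ring A n\<^esub> delta A (mset (concat T))"
      by (simp add: mpol_mult_delta[OF A])
  qed
qed

lemma hook_aug_R_lin_hom: "hook_aug A d n \<in> lin_hom (mpol_ring A n) (F_mod_R A d 0 n) (I_mod_R A d n)"
proof (rule lin_homI)
  fix x assume x': "x \<in> carrier (F_mod_R A d 0 n)"
  note x = x'[unfolded F_mod_R_simps]
  show "hook_aug A d n x \<in> carrier (I_mod_R A d n)"
    unfolding I_mod_R_simps by (rule hook_aug_closed[OF x])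
  show "hook_aug A d n (x \<oplus>\<^bsub>F_mod_R A d 0 n\<^esub> y) = hook_aug A d n x \<oplus>\<^bsub>I_mod_R A d n\<^esub> hook_aug A d n y"
    if "y \<in> carrier (F_mod_R A d 0 n)" for y
    unfolding F_mod_R_simps I_mod_R_simps
    by (rule lin_hom_add[OF hook_aug_lin_hom x]) (use that in \<open>simp add: F_mod_R_simps\<close>)
  fix q assume q: "q \<in> carrier (mpol_ring A n)"
  show "hook_aug A d n (q \<odot>\<^bsub>F_mod_R A d 0 n\<^esub> x) = q \<odot>\<^bsub>I_mod_R A d n\<^esub> hook_aug A d n x"
    unfolding I_mod_R_simps
  proof (rule F_hom_pure_eqI[OF A SM.module_axioms lin_hom_comp[OF F_mod_R_smult_lin_hom[OF A q] hook_aug_lin_hom]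
        lin_hom_comp[OF hook_aug_lin_hom mpol_mult_lin2[OF A q]] _ x])
    fix T p assume T: "T \<in> tableaux (hook d 0) n" and p: "p \<in> carrier (mpol_ring A n)"
    note Tm = mpol_delta_closed[OF A hook_aug_gen(2)[OF T p]]
    show "hook_aug A d n (q \<odot>\<^bsub>F_mod_R A d 0 n\<^esub> F_gen A d 0 n p T)
      = q \<otimes>\<^bsub>mpol_ring A n\<^esub> hook_aug A d n (F_gen A d 0 n p T)"
      using q p Tm by (simp add: F_mod_R_smult_gen[OF A q T p] hook_aug_gen(1)[OF T] S.m_assoc)
  qed
qed

lemma diff0_eq:
  assumes x: "x \<in> carrier (F_mod A d 0 n)"
  shows "diff0 A d n x = hook_aug A d n x"
  unfolding diff0_def
proof (rule lin_ext_eq_span[OF F_mod_R_module[OF A] I_mod_R_module[OF A] hook_aug_R_lin_hom _ _ F_mod_R_span[OF A]])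
  show "F_gen A d 0 n \<one>\<^bsub>mpol_ring A n\<^esub> \<in> tableaux (hook d 0) n \<rightarrow> carrier (F_mod_R A d 0 n)"
    unfolding F_mod_R_simps by (auto intro!: F_gen_closed[OF A])
  show "x \<in> carrier (F_mod_R A d 0 n)" using x by (simp add: F_mod_R_simps)
  fix T assume T: "T \<in> tableaux (hook d 0) n"
  note Tm = mpol_delta_closed[OF A hook_aug_gen(2)[OF T S.one_closed]]
  show "hook_aug A d n (F_gen A d 0 n \<one>\<^bsub>mpol_ring A n\<^esub> T) = delta A (mset (concat T))"
    using Tm by (simp add: hook_aug_gen(1)[OF T])
qed

section \<open>Exactness\<close>

text \<open>Given a monomial with at least \<open>d\<close> variables, take \<open>d\<close> of them
  as the row and the rest of the monomial as \<open>r\<close>. With empty exterior part this triple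
  is a row cycle, hence comes from \<open>F_mod\<close>, and its augmentation is the given
  monomial.\<close>

lemma diff0_surj: "diff0 A d n ` carrier (F_mod A d 0 n) = sqfree_ideal A d n"
proof -
  have eq: "diff0 A d n ` carrier (F_mod A d 0 n) = hook_aug A d n ` carrier (F_mod A d 0 n)"
    by (simp add: diff0_eq)
  interpret H: lin_map A "F_mod A d 0 n" "free_module A (sq_monoms d n)" "hook_aug A d n"
    by (intro lin_mapI F.module_axioms free_module_module A lin_hom_free_corestrict[OF hook_aug_lin_hom_UNIV])
      (use hook_aug_closed in \<open>simp add: sqfree_ideal_eq[OF A]\<close>)
  have "carrier (free_module A (sq_monoms d n)) \<subseteq> hook_aug A d n ` carrier (F_mod A d 0 n)"
    unfolding free_module_span_delta[OF A, symmetric]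
  proof (rule span_of_least[OF H.submodule_image[OF F.carrier_is_submodule]], clarify)
    fix u assume u: "u \<in> sq_monoms d n"
    obtain C where C: "C \<subseteq> set_mset u" "card C = d" "finite C"
      using u obtain_subset_with_card_n[of d "set_mset u"] by (auto simp: sq_monoms_def)
    have le: "mset_set C \<subseteq># u" using C(1,3) by (auto simp: subseteq_mset_def count_mset_set' Suc_le_eq)
    have "({}, C, u - mset_set C) \<in> cells n 0 d"
      using u C by (auto simp: cells_def sq_monoms_def dest: in_diffD)
    then have c: "delta A ({}, C, u - mset_set C) \<in> carrier (free_module A (cells n 0 d))"
      by (rule delta_closed[OF A])
    have "hook_aug A d n (hook_retract A d 0 n (delta A ({}, C, u - mset_set C))) = delta A u"
      unfolding hook_aug_def embed_retract[OF A d c koszul_cells_0[OF A c]]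
      using le by (simp add: augmentation_delta[OF A])
    then show "delta A u \<in> hook_aug A d n ` carrier (F_mod A d 0 n)"
      using R.map_closed[OF cells_UNIV[OF A c]] by (metis imageI)
  qed
  then show ?thesis unfolding eq sqfree_ideal_eq[OF A] using H.map_closed by auto
qed

text \<open>Translates a primitive on triples back to \<open>F_mod\<close>. The sign
  \<open>(-1)^i\<close> is put on \<open>y\<close> beforehand and squares to 1 against the sign in
  \<open>hook_embed_diff\<close>.\<close>

lemma retract_diff:
  assumes y: "y \<in> carrier (free_module A (cells n (Suc i) d))" and k: "koszul A to_row y = \<zero>\<^bsub>exterior_module A\<^esub>"
    and x: "x \<in> carrier (F_mod A d i n)" "koszul A to_mono y = hook_embed A d i n x"
  shows "x \<in> diff A d (Suc i) n ` carrier (F_mod A d (Suc i) n)"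
proof -
  let ?y = "[((- 1 :: int) ^ i)] \<cdot>\<^bsub>exterior_module A\<^esub> y"
  note yU = cells_UNIV[OF A y]
  have yc: "?y \<in> carrier (free_module A (cells n (Suc i) d))"
    by (rule submodule_int_pow[OF P.module_axioms free_module_submodule[OF A subset_UNIV] y])
  have yk: "koszul A to_row ?y = \<zero>\<^bsub>exterior_module A\<^esub>" by (simp add: K.map_int_pow yU k)
  define z where "z = hook_retract A d (Suc i) n ?y"
  have z: "z \<in> carrier (F_mod A d (Suc i) n)" unfolding z_def by (rule R.map_closed) (simp add: yU)
  have "hook_embed A d i n (hook_diff A d (Suc i) n z)
      = [((- 1 :: int) ^ i)] \<cdot>\<^bsub>exterior_module A\<^esub> ([((- 1 :: int) ^ i)] \<cdot>\<^bsub>exterior_module A\<^esub> hook_embed A d i n x)"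
    unfolding hook_embed_diff[OF A d z] unfolding z_def embed_retract[OF A d yc yk] by (simp add: K.map_int_pow yU x(2))
  also have "\<dots> = hook_embed A d i n x"
    using x(1) by (simp add: P.add.int_pow_pow flip: power_add mult_2)
  finally have "hook_diff A d (Suc i) n z = x"
    using lin_hom_closed[OF hook_diff_lin_hom[OF A, of d "Suc i" n] z] x(1) by (intro hook_embed_inj[OF A d]) auto
  then show ?thesis using diff_eq[OF A d z] z by (metis imageI)
qed

lemma kernel_diff0:
  "{x \<in> carrier (F_mod A d 0 n). diff0 A d n x = \<zero>\<^bsub>mpol_ring A n\<^esub>} = diff A d 1 n ` carrier (F_mod A d 1 n)"
proof (intro equalityI subsetI)
  fix x assume "x \<in> {x \<in> carrier (F_mod A d 0 n). diff0 A d n x = \<zero>\<^bsub>mpol_ring A n\<^esub>}"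
  then have x: "x \<in> carrier (F_mod A d 0 n)" and "augmentation A (hook_embed A d 0 n x) = \<zero>\<^bsub>free_module A UNIV\<^esub>"
    by (auto simp: diff0_eq hook_aug_def mpol_ring_simps free_module_simps)
  from exact_0[OF A hook_embed_cells(1)[OF A d x] this(2)]
  obtain y where "y \<in> carrier (free_module A (cells n (Suc 0) d))" "koszul A to_mono y = hook_embed A d 0 n x"
    "koszul A to_row y = \<zero>\<^bsub>exterior_module A\<^esub>" by blast
  then show "x \<in> diff A d 1 n ` carrier (F_mod A d 1 n)" using retract_diff[of y n 0 x] x by simp
next
  fix x assume "x \<in> diff A d 1 n ` carrier (F_mod A d 1 n)"
  then obtain z where z: "z \<in> carrier (F_mod A d (Suc 0) n)" "x = hook_diff A d (Suc 0) n z"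
    using diff_eq[OF A d] by auto
  have x: "x \<in> carrier (F_mod A d 0 n)" using lin_hom_closed[OF hook_diff_lin_hom[OF A, of d "Suc 0" n] z(1)] z(2) by simp
  note e = hook_embed_cells[OF A d z(1)]
  \<comment> \<open>On a row cycle the augmentation of the monomial differential equals that of the
    row differential, which is zero; the sign in \<open>hook_embed_diff\<close> is 1 here.\<close>
  have "hook_aug A d n x = \<zero>\<^bsub>free_module A UNIV\<^esub>"
    using hook_embed_diff[OF A d z(1)] augmentation_row_mono[OF A e(1)] e(2) z(1)
    by (simp add: hook_aug_def z(2) Aug.map_zero)
  then show "x \<in> {x \<in> carrier (F_mod A d 0 n). diff0 A d n x = \<zero>\<^bsub>mpol_ring A n\<^esub>}"
    using x by (simp add: diff0_eq mpol_ring_simps free_module_simps)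
qed

lemma kernel_diff:
  "{x \<in> carrier (F_mod A d (Suc i) n). diff A d (Suc i) n x = \<zero>\<^bsub>F_mod A d i n\<^esub>}
    = diff A d (Suc (Suc i)) n ` carrier (F_mod A d (Suc (Suc i)) n)"
proof (intro equalityI subsetI)
  fix x assume "x \<in> {x \<in> carrier (F_mod A d (Suc i) n). diff A d (Suc i) n x = \<zero>\<^bsub>F_mod A d i n\<^esub>}"
  then have x: "x \<in> carrier (F_mod A d (Suc i) n)" and "diff A d (Suc i) n x = \<zero>\<^bsub>F_mod A d i n\<^esub>"
    by simp_all
  then have x0: "hook_diff A d (Suc i) n x = \<zero>\<^bsub>F_mod A d i n\<^esub>" using diff_eq[OF A d x] by simp
  note e = hook_embed_cells[OF A d x]
  have "[((- 1 :: int) ^ i)] \<cdot>\<^bsub>exterior_module A\<^esub> koszul A to_mono (hook_embed A d (Suc i) n x) = \<zero>\<^bsub>exterior_module A\<^esub>"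
    using hook_embed_diff[OF A d x] by (simp add: x0 E.map_zero)
  \<comment> \<open>Multiplying by the same sign once more removes it.\<close>
  then have "[((- 1 :: int) ^ i)] \<cdot>\<^bsub>exterior_module A\<^esub> ([((- 1 :: int) ^ i)] \<cdot>\<^bsub>exterior_module A\<^esub>
      koszul A to_mono (hook_embed A d (Suc i) n x)) = \<zero>\<^bsub>exterior_module A\<^esub>" by simp
  then have "koszul A to_mono (hook_embed A d (Suc i) n x) = \<zero>\<^bsub>exterior_module A\<^esub>"
    using x by (simp add: P.add.int_pow_pow flip: power_add mult_2)
  from exact_Suc[OF A e this]
  obtain y where "y \<in> carrier (free_module A (cells n (Suc (Suc i)) d))"
    "koszul A to_mono y = hook_embed A d (Suc i) n x" "koszul A to_row y = \<zero>\<^bsub>exterior_module A\<^esub>" by blast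
  then show "x \<in> diff A d (Suc (Suc i)) n ` carrier (F_mod A d (Suc (Suc i)) n)"
    using retract_diff[of y n "Suc i" x] x by simp
next
  fix x assume "x \<in> diff A d (Suc (Suc i)) n ` carrier (F_mod A d (Suc (Suc i)) n)"
  then obtain z where z: "z \<in> carrier (F_mod A d (Suc (Suc i)) n)" "x = hook_diff A d (Suc (Suc i)) n z"
    using diff_eq[OF A d] by auto
  have x: "x \<in> carrier (F_mod A d (Suc i) n)"
    using lin_hom_closed[OF hook_diff_lin_hom[OF A, of d "Suc (Suc i)" n] z(1)] z(2) by simp
  \<comment> \<open>On triples this is the squared monomial differential, up to sign.\<close>
  have "hook_embed A d i n (hook_diff A d (Suc i) n x) = \<zero>\<^bsub>exterior_module A\<^esub>"
    unfolding hook_embed_diff[OF A d x] unfolding z(2) hook_embed_diff[OF A d z(1)]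
    using mono_mono[OF A hook_embed_cells(1)[OF A d z(1)]] z(1) by (simp add: K.map_int_pow)
  then have "hook_diff A d (Suc i) n x = \<zero>\<^bsub>F_mod A d i n\<^esub>"
    using lin_hom_closed[OF hook_diff_lin_hom[OF A, of d "Suc i" n] x] by (intro hook_embed_inj[OF A d]) (auto simp: E.map_zero)
  then show "x \<in> {x \<in> carrier (F_mod A d (Suc i) n). diff A d (Suc i) n x = \<zero>\<^bsub>F_mod A d i n\<^esub>}"
    using x by (simp add: diff_eq[OF A d])
qed

end

end

section \<open>Projections of the FI data; identities and composition of injections\<close>

lemma I_FI_simps:
  "carrier (fi_obj (I_FI A d) n) = sqfree_ideal A d n" "\<zero>\<^bsub>fi_obj (I_FI A d) n\<^esub> = \<zero>\<^bsub>mpol_ring A n\<^esub>"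
  "x \<oplus>\<^bsub>fi_obj (I_FI A d) n\<^esub> y = x \<oplus>\<^bsub>free_module A (sq_monoms d n)\<^esub> y"
  "a \<odot>\<^bsub>fi_obj (I_FI A d) n\<^esub> y = a \<odot>\<^bsub>free_module A (sq_monoms d n)\<^esub> y"
  "fi_gr (I_FI A d) n k = sqfree_ideal A d n \<inter> mpol_gr A n k" "fi_map (I_FI A d) m n \<epsilon> = mpol_map A \<epsilon>"
  by (simp_all add: I_FI_def mpol_ring_simps free_module_simps)

lemma F_FI_simps: "fi_obj (F_FI A d i) n = F_mod A d i n" "fi_gr (F_FI A d i) n = F_gr A d i n"
  by (simp_all add: F_FI_def)

lemma FI_inj_id: "restrict id {1..n} \<in> FI_inj n n"
  by (auto simp: FI_inj_def inj_on_def)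

lemma FI_inj_compose:
  assumes "\<epsilon> \<in> FI_inj l m" "\<eta> \<in> FI_inj m n" shows "compose {1..l} \<eta> \<epsilon> \<in> FI_inj l n"
proof -
  have "inj_on (compose {1..l} \<eta> \<epsilon>) {1..l}"
  proof (rule inj_onI)
    fix x y assume x: "x \<in> {1..l}" and y: "y \<in> {1..l}" and "compose {1..l} \<eta> \<epsilon> x = compose {1..l} \<eta> \<epsilon> y"
    then have "\<eta> (\<epsilon> x) = \<eta> (\<epsilon> y)" by (simp only: compose_eq)
    then have "\<epsilon> x = \<epsilon> y"
      by (rule inj_onD[OF FI_injD(2)[OF assms(2)] _ FI_injD(1)[OF assms(1) x] FI_injD(1)[OF assms(1) y]])
    then show "x = y" by (rule inj_onD[OF FI_injD(2)[OF assms(1)] _ x y])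
  qed
  moreover have "compose {1..l} \<eta> \<epsilon> \<in> {1..l} \<rightarrow>\<^sub>E {1..n}"
    by (rule PiE_I) (simp_all only: compose_eq FI_injD(1)[OF assms(2) FI_injD(1)[OF assms(1)]], simp only: compose_def restrict_apply if_False)
  ultimately show ?thesis by (simp only: FI_inj_def mem_Collect_eq)
qed

lemma image_mset_id: "v \<in> monoms n \<Longrightarrow> image_mset (restrict id {1..n}) v = v"
proof -
  assume v: "v \<in> monoms n"
  have "image_mset (restrict id {1..n}) v = image_mset id v"
    by (rule image_mset_cong) (use v in \<open>auto simp: monoms_def restrict_def\<close>)
  then show ?thesis by simp
qed

lemma image_mset_compose: "v \<in> monoms l \<Longrightarrow> image_mset (compose {1..l} \<eta> \<epsilon>) v = image_mset \<eta> (image_mset \<epsilon> v)"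
  unfolding image_mset.compositionality
  by (rule image_mset_cong) (auto simp: monoms_def compose_def subset_iff)

lemma map_tableau_id: "T \<in> tableaux cs n \<Longrightarrow> map (map (restrict id {1..n})) T = T"
  by (intro map_idI) (auto simp: tableaux_def subset_iff)

lemma map_tableau_compose: "T \<in> tableaux cs l \<Longrightarrow>
    map (map (compose {1..l} \<eta> \<epsilon>)) T = map (map \<eta>) (map (map \<epsilon>) T)"
  by (auto simp: tableaux_def compose_def subset_iff)

text \<open>An injection does not identify variables, so the number of distinct ones is kept and the
  ideals are mapped into each other.\<close>

lemma image_mset_sq_monoms:
  assumes \<epsilon>: "\<epsilon> \<in> FI_inj m n" and v: "v \<in> sq_monoms d m"
  shows "image_mset \<epsilon> v \<in> sq_monoms d n"
proof -
  have "set_mset v \<subseteq> {1..m}" using v by (simp add: sq_monoms_def)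
  then have "card (\<epsilon> ` set_mset v) = card (set_mset v)"
    by (intro card_image inj_on_subset[OF FI_injD(2)[OF \<epsilon>]])
  then show ?thesis
    using v image_mset_monoms[OF \<epsilon>, of v] by (simp add: sq_monoms_def monoms_def)
qed

context
  fixes A :: "('a, 'r) ring_scheme"
  assumes A: "cring A"
begin

interpretation P: module A "exterior_module A :: ('a, nat set \<times> 'z \<Rightarrow> 'a) module"
  by (rule free_module_module[OF A])

interpretation F: module A "F_mod A d i n" by (rule F_module[OF A])

interpretation E: lin_map A "F_mod A d i n" "exterior_module A" "hook_embed A d i n"
  by (intro lin_mapI F.module_axioms P.module_axioms hook_embed_lin_hom A)

interpretation SM: module A "mpol_ring A n" by (rule mpol_module[OF A])

section \<open>Graded pieces and their generators\<close>

lemma mpol_gr_eq: "mpol_gr A n k = carrier (free_module A {u \<in> monoms n. int (size u) = k})"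
  unfolding mpol_gr_def mpol_ring_simps by (auto simp: mem_free_module_iff)

text \<open>Linearity in each tensor factor replaces arbitrary classes by tableaux and homogeneous
  polynomials by monomials of the same degree.\<close>

lemma F_gr_eq: "F_gr A d i n k = span_of A (F_mod A d i n)
    {F_gen A d i n (delta A m) T | T m. T \<in> tableaux (hook d i) n \<and> m \<in> monoms n \<and> int (size m) = k - int d - int i}"
  (is "_ = span_of _ _ ?G")
proof -
  let ?U = "U_mod A d i n" and ?S = "mpol_ring A n"
  let ?B = "{u \<in> monoms n. int (size u) = k - int d - int i}"
  let ?H = "{pure_tensor A ?U ?S u p | u p. u \<in> carrier ?U \<and> p \<in> mpol_gr A n (k - int d - int i)}"
  have grS: "mpol_gr A n (k - int d - int i) \<subseteq> carrier ?S" by (auto simp: mpol_gr_def)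
  have G: "?G \<subseteq> carrier (F_mod A d i n)" by (auto intro!: F_gen_closed[OF A] mpol_delta_closed[OF A])
  have H: "?H \<subseteq> carrier (F_mod A d i n)"
    using pure_tensor_closed[OF U_module[OF A] mpol_module[OF A]] grS by (auto simp: F_mod_def)
  have GH: "?G \<subseteq> ?H"
  proof clarify
    fix T m assume T: "T \<in> tableaux (hook d i) n" and m: "m \<in> monoms n" "int (size m) = k - int d - int i"
    have "delta A m \<in> mpol_gr A n (k - int d - int i)"
      unfolding mpol_gr_eq using m by (intro delta_closed[OF A]) simp
    then show "\<exists>u p. F_gen A d i n (delta A m) T = pure_tensor A ?U ?S u p \<and> u \<in> carrier ?U \<and> p \<in> mpol_gr A n (k - int d - int i)"
      unfolding F_gen_def using tableau_class_closed[OF A T] by blast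
  qed
  have subG: "submodule (span_of A (F_mod A d i n) ?G) A (F_mod A d i n)"
    by (rule span_of_submodule[OF F.module_axioms G])
  have gen: "F_gen A d i n p T \<in> span_of A (F_mod A d i n) ?G"
    if T: "T \<in> tableaux (hook d i) n" and p: "p \<in> mpol_gr A n (k - int d - int i)" for T p
  proof (rule span_of_vimage[where f = "\<lambda>p. F_gen A d i n p T", OF free_module_module[OF A] F.module_axioms _ subG])
    show "(\<lambda>p. F_gen A d i n p T) \<in> lin_hom A (free_module A ?B) (F_mod A d i n)"
      by (rule lin_hom_free_restrict[OF _ F_gen_lin_hom[OF A T, unfolded mpol_lin_hom]]) auto
    show "delta A ` ?B \<subseteq> carrier (free_module A ?B)" by (auto intro: delta_closed[OF A])
    show "p \<in> span_of A (free_module A ?B) (delta A ` ?B)"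
      unfolding free_module_span_delta[OF A] using p by (simp add: mpol_gr_eq)
    show "F_gen A d i n s T \<in> span_of A (F_mod A d i n) ?G" if "s \<in> delta A ` ?B" for s
      using that T by (intro subsetD[OF span_of_superset]) auto
  qed
  have "?H \<subseteq> span_of A (F_mod A d i n) ?G"
  proof clarify
    fix u p assume u: "u \<in> carrier ?U" and p: "p \<in> mpol_gr A n (k - int d - int i)"
    have pS: "p \<in> carrier ?S" using p grS by blast
    show "pure_tensor A ?U ?S u p \<in> span_of A (F_mod A d i n) ?G"
    proof (rule span_of_vimage[where f = "\<lambda>u. pure_tensor A ?U ?S u p", OF U_module[OF A] F.module_axioms
          lin_map.lin_hom[OF F_gen_map[OF A pS]] subG])
      show "tableau_class A (hook d i) n ` tableaux (hook d i) n \<subseteq> carrier ?U"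
        using tableau_class_closed[OF A] by auto
      show "u \<in> span_of A ?U (tableau_class A (hook d i) n ` tableaux (hook d i) n)"
        unfolding U_span[OF A] by (rule u)
      show "pure_tensor A ?U ?S s p \<in> span_of A (F_mod A d i n) ?G"
        if "s \<in> tableau_class A (hook d i) n ` tableaux (hook d i) n" for s
        using that gen[OF _ p] by (auto simp: F_gen_def)
    qed
  qed
  then have "span_of A (F_mod A d i n) ?H \<subseteq> span_of A (F_mod A d i n) ?G"
    by (rule span_of_least[OF subG])
  moreover have "?G \<subseteq> span_of A (F_mod A d i n) ?H" using GH span_of_superset[of ?H A "F_mod A d i n"] by (rule order.trans)
  then have "span_of A (F_mod A d i n) ?G \<subseteq> span_of A (F_mod A d i n) ?H"
    by (rule span_of_least[OF span_of_submodule[OF F.module_axioms H]])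
  ultimately show ?thesis unfolding F_gr_def by (rule equalityI)
qed

lemma F_gr_gen_closed:
  "{F_gen A d i n (delta A m) T | T m. T \<in> tableaux (hook d i) n \<and> m \<in> monoms n \<and> int (size m) = k}
    \<subseteq> carrier (F_mod A d i n)"
  by (auto intro!: F_gen_closed[OF A] mpol_delta_closed[OF A])

lemma F_gr_submodule: "submodule (F_gr A d i n k) A (F_mod A d i n)"
  unfolding F_gr_eq by (rule span_of_submodule[OF F.module_axioms F_gr_gen_closed])

lemma F_gr_gen: "T \<in> tableaux (hook d i) n \<Longrightarrow> m \<in> monoms n \<Longrightarrow> int (size m) = k - int d - int i \<Longrightarrow>
    F_gen A d i n (delta A m) T \<in> F_gr A d i n k"
  unfolding F_gr_eq by (rule subsetD[OF span_of_superset]) blast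

text \<open>With \<open>F_gr_eq\<close>, compatibility with gradings has to be checked only on
  monomial multiples of tableaux of the right degree.\<close>

lemma F_gr_image:
  assumes "module A Q" "f \<in> lin_hom A (F_mod A d i n) Q" "submodule H A Q"
    and "\<And>T m. T \<in> tableaux (hook d i) n \<Longrightarrow> m \<in> monoms n \<Longrightarrow> int (size m) = k - int d - int i \<Longrightarrow>
      f (F_gen A d i n (delta A m) T) \<in> H"
  shows "f ` F_gr A d i n k \<subseteq> H"
proof
  fix y assume "y \<in> f ` F_gr A d i n k"
  then obtain x where x: "x \<in> F_gr A d i n k" "y = f x" by blast
  show "y \<in> H"
    unfolding x(2)
    by (rule span_of_vimage[OF F.module_axioms assms(1-3) F_gr_gen_closed _ x(1)[unfolded F_gr_eq]])
      (use assms(4) in blast)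
qed

section \<open>The graded FI-modules\<close>

lemma I_lin_hom:
  "lin_hom A (fi_obj (I_FI A d) n) N = lin_hom A (free_module A (sq_monoms d n)) N"
  "lin_hom A N (fi_obj (I_FI A d) n) = lin_hom A N (free_module A (sq_monoms d n))"
  by (auto simp: lin_hom_def hom_def I_FI_simps sqfree_ideal_eq[OF A])

lemma I_module: "module A (fi_obj (I_FI A d) n)"
proof -
  have "submodule (sqfree_ideal A d n) A (mpol_ring A n)"
  proof -
    have "submodule (sqfree_ideal A d n) A (free_module A (monoms n))"
      unfolding sqfree_ideal_eq[OF A] by (rule free_module_submodule[OF A sq_monoms_subset])
    moreover have "add_monoid (mpol_ring A n) = add_monoid (free_module A (monoms n))"
      by (simp add: mpol_ring_eq)
    ultimately show ?thesis by (simp add: submodule_def submodule_axioms_def mpol_ring_simps)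
  qed
  from submodule_module[OF mpol_module[OF A] this] show ?thesis by (simp add: I_FI_def)
qed

lemma I_gr_eq: "sqfree_ideal A d n \<inter> mpol_gr A n k
    = carrier (free_module A {u \<in> sq_monoms d n. int (size u) = k})"
proof -
  have "x \<in> carrier (free_module A (sq_monoms d n)) \<and> x \<in> carrier (free_module A {u \<in> monoms n. int (size u) = k})
    \<longleftrightarrow> x \<in> carrier (free_module A {u \<in> sq_monoms d n. int (size u) = k})" for x
  proof -
    have "(\<forall>b. x b \<noteq> \<zero>\<^bsub>A\<^esub> \<longrightarrow> b \<in> sq_monoms d n) \<and> (\<forall>b. x b \<noteq> \<zero>\<^bsub>A\<^esub> \<longrightarrow> b \<in> monoms n \<and> int (size b) = k)
      \<longleftrightarrow> (\<forall>b. x b \<noteq> \<zero>\<^bsub>A\<^esub> \<longrightarrow> b \<in> sq_monoms d n \<and> int (size b) = k)"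
      using sq_monoms_subset[of d n] by (metis subsetD)
    then show ?thesis unfolding mem_free_module_iff mem_Collect_eq by fast
  qed
  then show ?thesis unfolding sqfree_ideal_eq[OF A] mpol_gr_eq by (simp only: set_eq_iff Int_iff simp_thms)
qed

lemma I_gr_submodule: "submodule (fi_gr (I_FI A d) n k) A (fi_obj (I_FI A d) n)"
proof -
  interpret I: module A "fi_obj (I_FI A d) n" by (rule I_module)
  interpret Q: module A "free_module A (sq_monoms d n)" by (rule free_module_module[OF A])
  have "submodule (fi_gr (I_FI A d) n k) A (free_module A (sq_monoms d n))"
    unfolding I_FI_simps I_gr_eq by (rule free_module_submodule[OF A]) auto
  moreover have "(\<lambda>x. x) \<in> lin_hom A (fi_obj (I_FI A d) n) (free_module A (sq_monoms d n))"
    unfolding I_lin_hom by (rule Q.id_lin_hom)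
  ultimately have "submodule {x \<in> carrier (fi_obj (I_FI A d) n). x \<in> fi_gr (I_FI A d) n k} A (fi_obj (I_FI A d) n)"
    using lin_map.submodule_vimage[OF lin_mapI[OF I.module_axioms Q.module_axioms]] by blast
  moreover have "{x \<in> carrier (fi_obj (I_FI A d) n). x \<in> fi_gr (I_FI A d) n k} = fi_gr (I_FI A d) n k"
    by (auto simp: I_FI_simps)
  ultimately show ?thesis by simp
qed

text \<open>The ideal is itself free on monomials, so both maps of the transport are the
  identity.\<close>

lemma I_graded_module: "graded_module A (fi_obj (I_FI A d) n) (fi_gr (I_FI A d) n)"
proof -
  interpret Q: module A "free_module A (sq_monoms d n)" by (rule free_module_module[OF A])
  show ?thesis
  proof (rule graded_module_transport[where \<Phi> = "\<lambda>x. x" and \<Theta> = "\<lambda>x. x" and X = "sq_monoms d n" and deg = "\<lambda>u. int (size u)"])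
    show "module A (fi_obj (I_FI A d) n)" by (rule I_module)
    show "submodule (fi_gr (I_FI A d) n k) A (fi_obj (I_FI A d) n)" for k by (rule I_gr_submodule)
    show "(\<lambda>x. x) \<in> lin_hom A (fi_obj (I_FI A d) n) (free_module A (sq_monoms d n))"
      unfolding I_lin_hom by (rule Q.id_lin_hom)
    show "(\<lambda>x. x) \<in> lin_hom A (free_module A (sq_monoms d n)) (fi_obj (I_FI A d) n)"
      unfolding I_lin_hom by (rule Q.id_lin_hom)
    show "int (size b) = k" if "x \<in> fi_gr (I_FI A d) n k" "x b \<noteq> \<zero>\<^bsub>A\<^esub>" for k x b
      using that by (auto simp: I_FI_simps mpol_gr_def)
    show "delta A b \<in> fi_gr (I_FI A d) n (int (size b))" if "b \<in> sq_monoms d n" for b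
      unfolding I_FI_simps I_gr_eq using that by (intro delta_closed[OF A]) simp
  qed simp
qed

lemma I_map_graded_hom:
  assumes \<epsilon>: "\<epsilon> \<in> FI_inj m n"
  shows "graded_hom A (fi_obj (I_FI A d) m) (fi_gr (I_FI A d) m) (fi_obj (I_FI A d) n) (fi_gr (I_FI A d) n)
    (fi_map (I_FI A d) m n \<epsilon>)"
  unfolding graded_hom_def
proof (intro conjI allI)
  have "mpol_map A \<epsilon> \<in> lin_hom A (free_module A (sq_monoms d m)) (free_module A (monoms n))"
    using mpol_map_lin_hom[OF A \<epsilon>] unfolding mpol_lin_hom by (rule lin_hom_free_restrict[OF sq_monoms_subset])
  then show "fi_map (I_FI A d) m n \<epsilon> \<in> lin_hom A (fi_obj (I_FI A d) m) (fi_obj (I_FI A d) n)"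
    unfolding I_lin_hom I_FI_simps
    by (rule lin_hom_free_corestrict)
      (rule mpol_map_in[OF A \<epsilon> _ sq_monoms_subset image_mset_sq_monoms[OF \<epsilon>] sq_monoms_subset])
  show "fi_map (I_FI A d) m n \<epsilon> ` fi_gr (I_FI A d) m k \<subseteq> fi_gr (I_FI A d) n k" for k
    unfolding I_FI_simps I_gr_eq
  proof (intro image_subsetI)
    fix p assume "p \<in> carrier (free_module A {u \<in> sq_monoms d m. int (size u) = k})"
    then show "mpol_map A \<epsilon> p \<in> carrier (free_module A {u \<in> sq_monoms d n. int (size u) = k})"
      by (rule mpol_map_in[OF A \<epsilon>]) (use sq_monoms_subset image_mset_sq_monoms[OF \<epsilon>] in auto)
  qed
qed

lemma mpol_map_id: "p \<in> carrier (mpol_ring A n) \<Longrightarrow> mpol_map A (restrict id {1..n}) p = p"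
  by (rule mpol_lin_hom_eqI[OF A SM.module_axioms mpol_map_lin_hom[OF A FI_inj_id] SM.id_lin_hom])
    (simp_all del: One_nat_def add: mpol_map_delta[OF A FI_inj_id] image_mset_id)

lemma mpol_map_compose:
  assumes "\<epsilon> \<in> FI_inj l m" "\<eta> \<in> FI_inj m n" "p \<in> carrier (mpol_ring A l)"
  shows "mpol_map A (compose {1..l} \<eta> \<epsilon>) p = mpol_map A \<eta> (mpol_map A \<epsilon> p)"
  by (rule mpol_lin_hom_eqI[OF A SM.module_axioms mpol_map_lin_hom[OF A FI_inj_compose[OF assms(1,2)]]
        lin_hom_comp[OF mpol_map_lin_hom[OF A assms(1)] mpol_map_lin_hom[OF A assms(2)]] _ assms(3)])
    (simp del: One_nat_def add: mpol_map_delta[OF A FI_inj_compose[OF assms(1,2)]] mpol_map_delta[OF A assms(1)]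
      mpol_map_delta[OF A assms(2)] image_mset_monoms[OF assms(1)] image_mset_compose)

lemma I_FI_module: "graded_FI_module A (I_FI A d)"
  unfolding graded_FI_module_def
proof (intro conjI allI ballI I_graded_module I_map_graded_hom)
  show "fi_map (I_FI A d) n n (restrict id {1..n}) x = x" if "x \<in> carrier (fi_obj (I_FI A d) n)" for n x
    using that sqfree_ideal_subset[OF A, of d n] unfolding I_FI_simps by (intro mpol_map_id) blast
  show "fi_map (I_FI A d) l n (compose {1..l} \<eta> \<epsilon>) x = fi_map (I_FI A d) m n \<eta> (fi_map (I_FI A d) l m \<epsilon> x)"
    if "\<epsilon> \<in> FI_inj l m" "\<eta> \<in> FI_inj m n" "x \<in> carrier (fi_obj (I_FI A d) l)" for l m n \<epsilon> \<eta> x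
    using that(3) sqfree_ideal_subset[OF A, of d l] unfolding I_FI_simps
    by (intro mpol_map_compose[OF that(1,2)]) blast
qed

lemma F_map_delta:
  assumes "\<epsilon> \<in> FI_inj m n" "T \<in> tableaux (hook d i) m" "v \<in> monoms m"
  shows "fi_map (F_FI A d i) m n \<epsilon> (F_gen A d i m (delta A v) T)
    = F_gen A d i n (delta A (image_mset \<epsilon> v)) (map (map \<epsilon>) T)"
  using F_map_gen[OF A assms(1,2) mpol_delta_closed[OF A assms(3)]] mpol_map_delta[OF A assms(1,3)] by simp

lemma F_map_graded_hom:
  assumes \<epsilon>: "\<epsilon> \<in> FI_inj m n"
  shows "graded_hom A (fi_obj (F_FI A d i) m) (fi_gr (F_FI A d i) m) (fi_obj (F_FI A d i) n) (fi_gr (F_FI A d i) n)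
    (fi_map (F_FI A d i) m n \<epsilon>)"
  unfolding graded_hom_def F_FI_simps
proof (intro conjI allI)
  show "fi_map (F_FI A d i) m n \<epsilon> \<in> lin_hom A (F_mod A d i m) (F_mod A d i n)" by (rule F_map_lin_hom[OF A \<epsilon>])
  show "fi_map (F_FI A d i) m n \<epsilon> ` F_gr A d i m k \<subseteq> F_gr A d i n k" for k
  proof (rule F_gr_image[OF F.module_axioms F_map_lin_hom[OF A \<epsilon>] F_gr_submodule])
    fix T v assume T: "T \<in> tableaux (hook d i) m" and v: "v \<in> monoms m" "int (size v) = k - int d - int i"
    show "fi_map (F_FI A d i) m n \<epsilon> (F_gen A d i m (delta A v) T) \<in> F_gr A d i n k"
      unfolding F_map_delta[OF \<epsilon> T v(1)]
      by (rule F_gr_gen[OF map_tableaux'[OF \<epsilon> T] image_mset_monoms[OF \<epsilon> v(1)]]) (simp add: v(2))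
  qed
qed

lemma F_map_id:
  assumes "x \<in> carrier (F_mod A d i n)"
  shows "fi_map (F_FI A d i) n n (restrict id {1..n}) x = x"
proof (rule F_hom_eqI[OF A F.module_axioms F_map_lin_hom[OF A FI_inj_id] F.id_lin_hom _ assms])
  fix col row m assume T: "hook_tableau col row \<in> tableaux (hook d i) n" and m: "m \<in> monoms n"
  show "fi_map (F_FI A d i) n n (restrict id {1..n}) (F_gen A d i n (delta A m) (hook_tableau col row))
    = F_gen A d i n (delta A m) (hook_tableau col row)"
    unfolding F_map_delta[OF FI_inj_id T m] image_mset_id[OF m] map_tableau_id[OF T] ..
qed

lemma F_map_compose:
  assumes \<epsilon>: "\<epsilon> \<in> FI_inj l m" and \<eta>: "\<eta> \<in> FI_inj m n" and x: "x \<in> carrier (F_mod A d i l)"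
  shows "fi_map (F_FI A d i) l n (compose {1..l} \<eta> \<epsilon>) x = fi_map (F_FI A d i) m n \<eta> (fi_map (F_FI A d i) l m \<epsilon> x)"
proof (rule F_hom_eqI[OF A F.module_axioms F_map_lin_hom[OF A FI_inj_compose[OF \<epsilon> \<eta>]]
      lin_hom_comp[OF F_map_lin_hom[OF A \<epsilon>] F_map_lin_hom[OF A \<eta>]] _ x])
  fix col row v assume T: "hook_tableau col row \<in> tableaux (hook d i) l" and v: "v \<in> monoms l"
  show "fi_map (F_FI A d i) l n (compose {1..l} \<eta> \<epsilon>) (F_gen A d i l (delta A v) (hook_tableau col row))
    = fi_map (F_FI A d i) m n \<eta> (fi_map (F_FI A d i) l m \<epsilon> (F_gen A d i l (delta A v) (hook_tableau col row)))"
    unfolding F_map_delta[OF FI_inj_compose[OF \<epsilon> \<eta>] T v] F_map_delta[OF \<epsilon> T v]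
      F_map_delta[OF \<eta> map_tableaux'[OF \<epsilon> T] image_mset_monoms[OF \<epsilon> v]]
      image_mset_compose[OF v] map_tableau_compose[OF T] ..
qed

section \<open>Grading and naturality of the complex\<close>

context
  fixes d :: nat
  assumes d: "1 \<le> d"
begin

text \<open>The degree of a triple is that of its monomial plus the shift \<open>d + i\<close>. The
  row differential in the embedding leaves the monomial untouched, and the retraction sends a basis
  vector to a generator with the same monomial or to zero, so both respect degrees.\<close>

lemma F_graded_module: "graded_module A (F_mod A d i n) (F_gr A d i n)"
proof (rule graded_module_transport[where \<Phi> = "hook_embed A d i n" and \<Theta> = "hook_retract A d i n" and X = UNIV
      and deg = "\<lambda>(B, C, r). int (size r) + int d + int i", OF F.module_axioms E.lin_hom hook_retract_lin_hom[OF A]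
        retract_embed[OF A d] F_gr_submodule])
  fix k x b assume x: "x \<in> F_gr A d i n k" and b: "hook_embed A d i n x b \<noteq> \<zero>\<^bsub>A\<^esub>"
  let ?Y = "{(B, C, r). int (size r) + int d + int i = k} :: (nat set \<times> nat set \<times> nat multiset) set"
  have "hook_embed A d i n ` F_gr A d i n k \<subseteq> carrier (free_module A ?Y)"
  proof (rule F_gr_image[OF P.module_axioms E.lin_hom free_module_submodule[OF A subset_UNIV]])
    fix T m assume T: "T \<in> tableaux (hook d i) n" and m: "m \<in> monoms n" "int (size m) = k - int d - int i"
    obtain col row where Tcr: "T = hook_tableau col row" by (rule tableaux_hookE[OF T])
    have "wedge A col (set row, m) \<in> carrier (free_module A ?Y)"
      by (rule wedge_closed[OF A]) (use m in simp)
    then have "koszul A to_row (wedge A col (set row, m)) \<in> carrier (free_module A ?Y)"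
      by (rule koszul_closed[OF A, rotated]) (auto simp: to_row_def)
    then show "hook_embed A d i n (F_gen A d i n (delta A m) T) \<in> carrier (free_module A ?Y)"
      unfolding Tcr hook_embed_gen[OF A T[unfolded Tcr] m(1)] .
  qed
  then have "hook_embed A d i n x \<in> carrier (free_module A ?Y)" using x by blast
  then have "b \<in> ?Y" using b unfolding mem_free_module_iff by blast
  then show "(case b of (B, C, r) \<Rightarrow> int (size r) + int d + int i) = k" by auto
next
  fix b :: "nat set \<times> nat set \<times> nat multiset"
  obtain B C r where b: "b = (B, C, r)" by (cases b)
  show "hook_retract A d i n (delta A b) \<in> F_gr A d i n (case b of (B, C, r) \<Rightarrow> int (size r) + int d + int i)"
    using retract_tableau[of B C r n i d] submodule_zero[OF F_gr_submodule]
    by (auto simp: b hook_retract_delta[OF A] intro!: F_gr_gen)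
qed

lemma F_FI_module: "graded_FI_module A (F_FI A d i)"
  unfolding graded_FI_module_def
proof (intro conjI allI ballI F_map_graded_hom)
  show "graded_module A (fi_obj (F_FI A d i) n) (fi_gr (F_FI A d i) n)" for n
    unfolding F_FI_simps by (rule F_graded_module)
  show "fi_map (F_FI A d i) n n (restrict id {1..n}) x = x" if "x \<in> carrier (fi_obj (F_FI A d i) n)" for n x
    using that unfolding F_FI_simps by (rule F_map_id)
  show "fi_map (F_FI A d i) l n (compose {1..l} \<eta> \<epsilon>) x = fi_map (F_FI A d i) m n \<eta> (fi_map (F_FI A d i) l m \<epsilon> x)"
    if "\<epsilon> \<in> FI_inj l m" "\<eta> \<in> FI_inj m n" "x \<in> carrier (fi_obj (F_FI A d i) l)" for l m n \<epsilon> \<eta> x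
    using that unfolding F_FI_simps by (rule F_map_compose)
qed

text \<open>The shift by \<open>d\<close> in \<open>F_gr\<close> is the degree of the row monomial
  that the augmentation multiplies in. Naturality holds on generators because
  \<open>image_mset\<close> respects sums of multisets.\<close>

lemma diff0_FI_hom: "graded_FI_hom A (F_FI A d 0) (I_FI A d) (diff0 A d)"
  unfolding graded_FI_hom_def graded_hom_def
proof (intro conjI allI ballI)
  fix n
  have lin: "hook_aug A d n \<in> lin_hom A (F_mod A d 0 n) (fi_obj (I_FI A d) n)"
    unfolding I_lin_hom
    by (rule lin_hom_free_corestrict[OF hook_aug_lin_hom_UNIV[OF A d]])
      (use hook_aug_closed[OF A d] in \<open>simp add: sqfree_ideal_eq[OF A]\<close>)
  show "diff0 A d n \<in> lin_hom A (fi_obj (F_FI A d 0) n) (fi_obj (I_FI A d) n)"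
    unfolding F_FI_simps by (rule lin_hom_cong[OF lin _ F.module_axioms]) (simp add: diff0_eq[OF A d])
  show "diff0 A d n ` fi_gr (F_FI A d 0) n k \<subseteq> fi_gr (I_FI A d) n k" for k
  proof -
    have "diff0 A d n ` F_gr A d 0 n k = hook_aug A d n ` F_gr A d 0 n k"
      using submodule_subset[OF F_gr_submodule[of d 0 n k]] diff0_eq[OF A d]
      by (intro image_cong) auto
    also have "\<dots> \<subseteq> fi_gr (I_FI A d) n k"
    proof (rule F_gr_image[OF I_module lin I_gr_submodule])
      fix T m assume T: "T \<in> tableaux (hook d 0) n" and m: "m \<in> monoms n" "int (size m) = k - int d - int 0"
      note mc = mpol_delta_closed[OF A m(1)]
      note g = hook_aug_gen[OF A d T mc]
      have e: "hook_aug A d n (F_gen A d 0 n (delta A m) T) = delta A (m + mset (concat T))"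
        unfolding g(1) by (rule mpol_mult_delta[OF A])
      have "delta A (m + mset (concat T)) \<in> mpol_gr A n k"
        unfolding mpol_gr_eq using m g(2,3) by (intro delta_closed[OF A]) (simp add: monoms_def)
      moreover have "delta A (m + mset (concat T)) \<in> sqfree_ideal A d n"
        unfolding e[symmetric] by (rule hook_aug_closed[OF A d F_gen_closed[OF A T mc]])
      ultimately show "hook_aug A d n (F_gen A d 0 n (delta A m) T) \<in> fi_gr (I_FI A d) n k"
        unfolding e I_FI_simps by blast
    qed
    finally show ?thesis unfolding F_FI_simps .
  qed
next
  fix m n \<epsilon> x assume \<epsilon>: "\<epsilon> \<in> FI_inj m n" and "x \<in> carrier (fi_obj (F_FI A d 0) m)"
  then have x: "x \<in> carrier (F_mod A d 0 m)" by (simp add: F_FI_simps)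
  have "hook_aug A d n (fi_map (F_FI A d 0) m n \<epsilon> x) = mpol_map A \<epsilon> (hook_aug A d m x)"
  proof (rule F_hom_eqI[OF A SM.module_axioms lin_hom_comp[OF F_map_lin_hom[OF A \<epsilon>] hook_aug_lin_hom[OF A d]]
        lin_hom_comp[OF hook_aug_lin_hom[OF A d] mpol_map_lin_hom[OF A \<epsilon>]] _ x])
    fix col row v assume T: "hook_tableau col row \<in> tableaux (hook d 0) m" and v: "v \<in> monoms m"
    let ?T = "hook_tableau col row"
    note vc = mpol_delta_closed[OF A v] and vc' = mpol_delta_closed[OF A image_mset_monoms[OF \<epsilon> v]]
    note g = hook_aug_gen[OF A d T vc]
    have "v + mset (concat ?T) \<in> monoms m" using v g(2) by (simp add: monoms_def)
    then have "mpol_map A \<epsilon> (hook_aug A d m (F_gen A d 0 m (delta A v) ?T))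
        = delta A (image_mset \<epsilon> (v + mset (concat ?T)))"
      unfolding g(1) mpol_mult_delta[OF A] by (rule mpol_map_delta[OF A \<epsilon>])
    moreover have "hook_aug A d n (fi_map (F_FI A d 0) m n \<epsilon> (F_gen A d 0 m (delta A v) ?T))
        = delta A (image_mset \<epsilon> v + mset (concat (map (map \<epsilon>) ?T)))"
      unfolding F_map_delta[OF \<epsilon> T v] hook_aug_gen(1)[OF A d map_tableaux'[OF \<epsilon> T] vc'] by (rule mpol_mult_delta[OF A])
    ultimately show "hook_aug A d n (fi_map (F_FI A d 0) m n \<epsilon> (F_gen A d 0 m (delta A v) ?T))
        = mpol_map A \<epsilon> (hook_aug A d m (F_gen A d 0 m (delta A v) ?T))"
      by (simp add: map_hook_tableau)
  qed
  then show "diff0 A d n (fi_map (F_FI A d 0) m n \<epsilon> x) = fi_map (I_FI A d) m n \<epsilon> (diff0 A d m x)"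
    by (simp add: diff0_eq[OF A d] x lin_hom_closed[OF F_map_lin_hom[OF A \<epsilon>] x] I_FI_simps)
qed

text \<open>Each summand gains one variable while the shift drops from \<open>d + i + 1\<close> to
  \<open>d + i\<close>, so the degree is preserved. Naturality is verified on monomial generators
  with the formula of \<open>hook_diff_gen\<close>.\<close>

lemma diff_FI_hom: "graded_FI_hom A (F_FI A d (Suc i)) (F_FI A d i) (diff A d (Suc i))"
  unfolding graded_FI_hom_def graded_hom_def F_FI_simps
proof (intro conjI allI ballI)
  fix n
  note lin = hook_diff_lin_hom[OF A, of d "Suc i" n, unfolded diff_Suc_1]
  show "diff A d (Suc i) n \<in> lin_hom A (F_mod A d (Suc i) n) (F_mod A d i n)"
    by (rule lin_hom_cong[OF lin _ F.module_axioms]) (simp add: diff_eq[OF A d])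
  show "diff A d (Suc i) n ` F_gr A d (Suc i) n k \<subseteq> F_gr A d i n k" for k
  proof -
    have "diff A d (Suc i) n ` F_gr A d (Suc i) n k = hook_diff A d (Suc i) n ` F_gr A d (Suc i) n k"
      using submodule_subset[OF F_gr_submodule[of d "Suc i" n k]] diff_eq[OF A d]
      by (intro image_cong) auto
    also have "\<dots> \<subseteq> F_gr A d i n k"
    proof (rule F_gr_image[OF F.module_axioms lin F_gr_submodule])
      fix T m assume T: "T \<in> tableaux (hook d (Suc i)) n" and m: "m \<in> monoms n" "int (size m) = k - int d - int (Suc i)"
      obtain col row where Tcr: "T = hook_tableau col row" by (rule tableaux_hookE[OF T])
      show "hook_diff A d (Suc i) n (F_gen A d (Suc i) n (delta A m) T) \<in> F_gr A d i n k"
        unfolding hook_diff_gen[OF A d T mpol_delta_closed[OF A m(1)]]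
      proof (intro submodule_finsum[OF F.module_axioms F_gr_submodule] Pi_I submodule_int_pow[OF F.module_axioms F_gr_submodule])
        fix j assume "j \<in> {0..Suc i}"
        then have j: "j \<le> Suc i" by simp
        have "hd T ! j \<in> set (hd T)" "set (hd T) \<subseteq> {1..n}" using j T by (auto simp: Tcr hook_tableau_in_tableaux)
        then have mm: "{#hd T ! j#} + m \<in> monoms n" using m(1) by (auto simp: monoms_def)
        have Tj: "remove_box T j \<in> tableaux (hook d i) n"
          unfolding Tcr remove_box_hook by (rule remove_box_in_tableaux[OF T[unfolded Tcr] j])
        show "F_gen A d i n (delta A {#hd T ! j#} \<otimes>\<^bsub>mpol_ring A n\<^esub> delta A m) (remove_box T j) \<in> F_gr A d i n k"
          unfolding mpol_mult_delta[OF A] by (rule F_gr_gen[OF Tj mm]) (use m(2) in simp)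
      qed
    qed
    finally show ?thesis .
  qed
next
  fix m n \<epsilon> x assume \<epsilon>: "\<epsilon> \<in> FI_inj m n" and x: "x \<in> carrier (F_mod A d (Suc i) m)"
  note lin = hook_diff_lin_hom[OF A, of d "Suc i", unfolded diff_Suc_1]
  interpret h: lin_map A "F_mod A d i m" "F_mod A d i n" "fi_map (F_FI A d i) m n \<epsilon>"
    by (intro lin_mapI F.module_axioms F_map_lin_hom A \<epsilon>)
  have "hook_diff A d (Suc i) n (fi_map (F_FI A d (Suc i)) m n \<epsilon> x) = fi_map (F_FI A d i) m n \<epsilon> (hook_diff A d (Suc i) m x)"
  proof (rule F_hom_eqI[OF A F.module_axioms lin_hom_comp[OF F_map_lin_hom[OF A \<epsilon>] lin]
        lin_hom_comp[OF lin F_map_lin_hom[OF A \<epsilon>]] _ x])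
    fix col row v assume T: "hook_tableau col row \<in> tableaux (hook d (Suc i)) m" and v: "v \<in> monoms m"
    let ?T = "hook_tableau col row"
    note vc = mpol_delta_closed[OF A v] and vc' = mpol_delta_closed[OF A image_mset_monoms[OF \<epsilon> v]]
    have len: "length col = Suc (Suc i)" and sub: "set col \<subseteq> {1..m}" using T by (auto simp: hook_tableau_in_tableaux)
    have Tj: "remove_box ?T j \<in> tableaux (hook d i) m" if "j \<le> Suc i" for j
      unfolding remove_box_hook by (rule remove_box_in_tableaux[OF T that])
    have mm: "{#col ! j#} + v \<in> monoms m" if "j \<le> Suc i" for j
    proof -
      have "col ! j \<in> set col" using that len by simp
      then show ?thesis using sub v by (auto simp: monoms_def)
    qed
    have gc: "F_gen A d i m (delta A ({#col ! j#} + v)) (remove_box ?T j) \<in> carrier (F_mod A d i m)" if "j \<le> Suc i" for j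
      by (rule F_gen_closed[OF A Tj[OF that] mpol_delta_closed[OF A mm[OF that]]])
    have "fi_map (F_FI A d i) m n \<epsilon> (hook_diff A d (Suc i) m (F_gen A d (Suc i) m (delta A v) ?T))
      = (\<Oplus>\<^bsub>F_mod A d i n\<^esub>j\<in>{0..Suc i}. fi_map (F_FI A d i) m n \<epsilon> ([((- 1 :: int) ^ (Suc i - j))] \<cdot>\<^bsub>F_mod A d i m\<^esub>
        F_gen A d i m (delta A ({#col ! j#} + v)) (remove_box ?T j)))"
      unfolding hook_diff_gen[OF A d T vc] mpol_mult_delta[OF A] hook_tableau_simps
      by (rule h.map_finsum) (intro Pi_I F.add.int_pow_closed gc, simp)
    also have "\<dots> = (\<Oplus>\<^bsub>F_mod A d i n\<^esub>j\<in>{0..Suc i}. [((- 1 :: int) ^ (Suc i - j))] \<cdot>\<^bsub>F_mod A d i n\<^esub>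
        F_gen A d i n (delta A ({#hd (map (map \<epsilon>) ?T) ! j#} + image_mset \<epsilon> v)) (remove_box (map (map \<epsilon>) ?T) j))"
    proof (rule F.finsum_cong')
      fix j assume "j \<in> {0..Suc i}"
      then have j: "j \<le> Suc i" by simp
      \<comment> \<open>Box removal refers to positions and the injection to entries, so the two
        commute.\<close>
      have "map (map \<epsilon>) (remove_box ?T j) = remove_box (map (map \<epsilon>) ?T) j"
        by (simp add: remove_box_hook map_hook_tableau take_map drop_map)
      moreover have "image_mset \<epsilon> ({#col ! j#} + v) = {#hd (map (map \<epsilon>) ?T) ! j#} + image_mset \<epsilon> v"
        using j len by (simp add: map_hook_tableau)
      ultimately have e: "fi_map (F_FI A d i) m n \<epsilon> (F_gen A d i m (delta A ({#col ! j#} + v)) (remove_box ?T j))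
          = F_gen A d i n (delta A ({#hd (map (map \<epsilon>) ?T) ! j#} + image_mset \<epsilon> v)) (remove_box (map (map \<epsilon>) ?T) j)"
        using F_map_delta[OF \<epsilon> Tj[OF j] mm[OF j]] by simp
      show "fi_map (F_FI A d i) m n \<epsilon> ([((- 1 :: int) ^ (Suc i - j))] \<cdot>\<^bsub>F_mod A d i m\<^esub>
          F_gen A d i m (delta A ({#col ! j#} + v)) (remove_box ?T j))
        = [((- 1 :: int) ^ (Suc i - j))] \<cdot>\<^bsub>F_mod A d i n\<^esub>
          F_gen A d i n (delta A ({#hd (map (map \<epsilon>) ?T) ! j#} + image_mset \<epsilon> v)) (remove_box (map (map \<epsilon>) ?T) j)"
        unfolding h.map_int_pow[OF gc[OF j]] e ..
    next
      show "(\<lambda>j. [((- 1 :: int) ^ (Suc i - j))] \<cdot>\<^bsub>F_mod A d i n\<^esub>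
          F_gen A d i n (delta A ({#hd (map (map \<epsilon>) ?T) ! j#} + image_mset \<epsilon> v)) (remove_box (map (map \<epsilon>) ?T) j))
        \<in> {0..Suc i} \<rightarrow> carrier (F_mod A d i n)"
      proof (intro Pi_I F.add.int_pow_closed F_gen_closed[OF A] mpol_delta_closed[OF A])
        fix j assume "j \<in> {0..Suc i}"
        then have j: "j \<le> Suc i" by simp
        note T' = map_tableaux[OF \<epsilon> T]
        show "remove_box (map (map \<epsilon>) ?T) j \<in> tableaux (hook d i) n"
          unfolding map_hook_tableau remove_box_hook by (rule remove_box_in_tableaux[OF T' j])
        have "image_mset \<epsilon> ({#col ! j#} + v) \<in> monoms n" by (rule image_mset_monoms[OF \<epsilon> mm[OF j]])
        then show "{#hd (map (map \<epsilon>) ?T) ! j#} + image_mset \<epsilon> v \<in> monoms n"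
          using j len by (simp add: map_hook_tableau)
      qed
    qed simp
    also have "\<dots> = hook_diff A d (Suc i) n (fi_map (F_FI A d (Suc i)) m n \<epsilon> (F_gen A d (Suc i) m (delta A v) ?T))"
      unfolding F_map_delta[OF \<epsilon> T v] hook_diff_gen[OF A d map_tableaux'[OF \<epsilon> T] vc'] mpol_mult_delta[OF A] ..
    finally show "hook_diff A d (Suc i) n (fi_map (F_FI A d (Suc i)) m n \<epsilon> (F_gen A d (Suc i) m (delta A v) ?T))
      = fi_map (F_FI A d i) m n \<epsilon> (hook_diff A d (Suc i) m (F_gen A d (Suc i) m (delta A v) ?T))" ..
  qed
  then show "diff A d (Suc i) n (fi_map (F_FI A d (Suc i)) m n \<epsilon> x) = fi_map (F_FI A d i) m n \<epsilon> (diff A d (Suc i) m x)"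
    by (simp add: diff_eq[OF A d] x lin_hom_closed[OF F_map_lin_hom[OF A \<epsilon>] x])
qed

end

end

theorem theorem5p14:
  fixes A :: "('a, 'r) ring_scheme" and d :: nat
  assumes "cring A" and "d \<ge> 1"
  shows "graded_FI_module A (I_FI A d)
    \<and> (\<forall>i. graded_FI_module A (F_FI A d i))
    \<and> graded_FI_hom A (F_FI A d 0) (I_FI A d) (diff0 A d)
    \<and> (\<forall>i\<ge>1. graded_FI_hom A (F_FI A d i) (F_FI A d (i - 1)) (diff A d i))
    \<and> (\<forall>n. diff0 A d n ` carrier (fi_obj (F_FI A d 0) n) = carrier (fi_obj (I_FI A d) n)
         \<and> a_kernel (fi_obj (F_FI A d 0) n) (fi_obj (I_FI A d) n) (diff0 A d n)
             = diff A d 1 n ` carrier (fi_obj (F_FI A d 1) n)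
         \<and> (\<forall>i\<ge>1. a_kernel (fi_obj (F_FI A d i) n) (fi_obj (F_FI A d (i - 1)) n) (diff A d i n)
             = diff A d (Suc i) n ` carrier (fi_obj (F_FI A d (Suc i)) n)))"
proof (intro conjI allI impI)
  note A = assms(1) and d = assms(2)
  show "graded_FI_module A (I_FI A d)" by (rule I_FI_module[OF A])
  show "graded_FI_module A (F_FI A d i)" for i by (rule F_FI_module[OF A d])
  show "graded_FI_hom A (F_FI A d 0) (I_FI A d) (diff0 A d)" by (rule diff0_FI_hom[OF A d])
  show "graded_FI_hom A (F_FI A d i) (F_FI A d (i - 1)) (diff A d i)" if "1 \<le> i" for i
    using that diff_FI_hom[OF A d, of "i - 1"] by simp
  show "diff0 A d n ` carrier (fi_obj (F_FI A d 0) n) = carrier (fi_obj (I_FI A d) n)" for n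
    unfolding F_FI_simps I_FI_simps by (rule diff0_surj[OF A d])
  show "a_kernel (fi_obj (F_FI A d 0) n) (fi_obj (I_FI A d) n) (diff0 A d n)
      = diff A d 1 n ` carrier (fi_obj (F_FI A d 1) n)" for n
    unfolding a_kernel_def' F_FI_simps I_FI_simps by (rule kernel_diff0[OF A d])
  show "a_kernel (fi_obj (F_FI A d i) n) (fi_obj (F_FI A d (i - 1)) n) (diff A d i n)
      = diff A d (Suc i) n ` carrier (fi_obj (F_FI A d (Suc i)) n)" if i: "1 \<le> i" for i n
  proof -
    obtain j where j: "i = Suc j" using i by (cases i) auto
    show ?thesis unfolding a_kernel_def' F_FI_simps j diff_Suc_1 by (rule kernel_diff[OF A d])
  qed
qed

end
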